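(* Let $R$ be a finitely generated standard graded algebra over an Artinian local ring $R_0$ and let $M$ be a finitely generated graded $R$-module. Let $z\in R_1$ be an $M$-filter-regular linear form. Let $t\ge d(M)$ be an integer such that $M/zM$ is geometrically $t$-regular. Then $M$ is geometrically $(t+p_M(t)-h_{M/L}(t))$-regular, where $L=\Gamma_{R_+}(M)$.
   Context: Standard graded means $R=\bigoplus_{n\ge0}R_n$ is generated over $R_0$ by $R_1$; $R_+=\bigoplus_{n\ge1}R_n$. $\Gamma_{R_+}(M)=\{e\in M\mid R_te=0\text{ for } t\gg0\}$, and $H^i_{R_+}(M)$ is the $i$-th (graded) local cohomology module with respect to $R_+$. For an integer $m$, a finitely generated graded module $N$ is geometrically $m$-regular if $H^i_{R_+}(N)_{n-i+1}=0$ for all $n\ge m$ and all $i\ge1$. A homogeneous element $z$ is $M$-filter-regular if $(0_M:z)_n=0$ for $n\gg0$, where $0_M:z=\{e\in M\mid ze=0\}$. $d(M)$ is the maximal degree of the homogeneous minimal generators of $M$, i.e. $d(M)=\max\{n\mid (M/R_+M)_n\ne0\}$ ($-\infty$ if $M=0$). For a finitely generated graded $R$-module $N$, $h_N(n)=\ell_{R_0}(N_n)$ is its Hilbert function and $p_N$ its Hilbert polynomial, i.e. the polynomial with $p_N(n)=h_N(n)$ for $n\gg0$. *)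

theory Defs
  imports
    "HOL-Algebra.QuotRing"
    "HOL-Algebra.Module"
    "HOL-Algebra.Generated_Rings"
    "HOL-Computational_Algebra.Polynomial"
    "HOL-Library.Extended_Nat"
    "HOL-Library.Extended_Real"
begin

section \<open>Graded rings and graded modules\<close>

record 'a graded_ring = "'a ring" +
  rdeg :: "nat \<Rightarrow> 'a set"

text \<open>As in the library record for modules, the fields \<open>mult\<close> and \<open>one\<close> that are inherited
  from rings carry no meaning for a module.\<close>

record ('a, 'b) graded_module = "('a, 'b) module" +
  mdeg :: "int \<Rightarrow> 'b set"

definition direct_decomposition :: "('b, 'm) ring_scheme \<Rightarrow> ('i \<Rightarrow> 'b set) \<Rightarrow> bool" where
  "direct_decomposition G D \<longleftrightarrow>
     (\<forall>i. additive_subgroup (D i) G) \<and>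
     (\<forall>x\<in>carrier G. \<exists>!c. (\<forall>i. c i \<in> D i) \<and> finite {i. c i \<noteq> \<zero>\<^bsub>G\<^esub>} \<and>
        x = (\<Oplus>\<^bsub>G\<^esub> i \<in> {i. c i \<noteq> \<zero>\<^bsub>G\<^esub>}. c i))"

definition is_graded_ring :: "'a graded_ring \<Rightarrow> bool" where
  "is_graded_ring R \<longleftrightarrow> cring R \<and> direct_decomposition R (rdeg R) \<and>
     \<one>\<^bsub>R\<^esub> \<in> rdeg R 0 \<and>
     (\<forall>i j. \<forall>a\<in>rdeg R i. \<forall>b\<in>rdeg R j. a \<otimes>\<^bsub>R\<^esub> b \<in> rdeg R (i + j))"

definition is_graded_module :: "'a graded_ring \<Rightarrow> ('a, 'b) graded_module \<Rightarrow> bool" where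
  "is_graded_module R M \<longleftrightarrow> module R M \<and> direct_decomposition M (mdeg M) \<and>
     (\<forall>i j. \<forall>a\<in>rdeg R i. \<forall>x\<in>mdeg M j. a \<odot>\<^bsub>M\<^esub> x \<in> mdeg M (int i + j))"

definition degree_zero_ring :: "'a graded_ring \<Rightarrow> 'a graded_ring" where
  "degree_zero_ring R = R\<lparr>carrier := rdeg R 0\<rparr>"

definition standard_graded :: "'a graded_ring \<Rightarrow> bool" where
  "standard_graded R \<longleftrightarrow> is_graded_ring R \<and> generate_ring R (rdeg R 0 \<union> rdeg R 1) = carrier R"

definition finitely_generated_algebra :: "'a graded_ring \<Rightarrow> bool" where
  "finitely_generated_algebra R \<longleftrightarrow>
     (\<exists>S \<subseteq> carrier R. finite S \<and> generate_ring R (rdeg R 0 \<union> S) = carrier R)"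

definition artinian_ring :: "('a, 'm) ring_scheme \<Rightarrow> bool" where
  "artinian_ring R \<longleftrightarrow> cring R \<and>
     (\<forall>J :: nat \<Rightarrow> 'a set. (\<forall>n. ideal (J n) R \<and> J (Suc n) \<subseteq> J n) \<longrightarrow> (\<exists>n0. \<forall>n\<ge>n0. J n = J n0))"

definition local_ring :: "('a, 'm) ring_scheme \<Rightarrow> bool" where
  "local_ring R \<longleftrightarrow> cring R \<and> (\<exists>!J. maximalideal J R)"

definition submodule_span :: "'a graded_ring \<Rightarrow> ('a, 'b) graded_module \<Rightarrow> 'b set \<Rightarrow> 'b set" where
  "submodule_span R M S = \<Inter>{H. submodule H R M \<and> S \<subseteq> H}"

definition finitely_generated_module :: "'a graded_ring \<Rightarrow> ('a, 'b) graded_module \<Rightarrow> bool" where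
  "finitely_generated_module R M \<longleftrightarrow>
     (\<exists>S \<subseteq> carrier M. finite S \<and> submodule_span R M S = carrier M)"

definition graded_submodule :: "('a, 'b) graded_module \<Rightarrow> 'b set \<Rightarrow> ('a, 'b) graded_module" where
  "graded_submodule M H = M\<lparr>carrier := H, mdeg := (\<lambda>n. mdeg M n \<inter> H)\<rparr>"

text \<open>The quotient of \<open>M\<close> by a homogeneous submodule \<open>H\<close>; its component of degree \<open>n\<close> is the
  image of that of \<open>M\<close>.\<close>

definition graded_quotient ::
    "('a, 'b) graded_module \<Rightarrow> 'b set \<Rightarrow> ('a, 'b set) graded_module" where
  "graded_quotient M H =
     \<lparr>carrier = a_rcosets\<^bsub>M\<^esub> H, monoid.mult = rcoset_mult M H, one = H +>\<^bsub>M\<^esub> \<one>\<^bsub>M\<^esub>,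
      zero = H, add = set_add M,
      module.smult = (\<lambda>a X. \<Union>x\<in>X. H +>\<^bsub>M\<^esub> (a \<odot>\<^bsub>M\<^esub> x)),
      mdeg = (\<lambda>n. (\<lambda>x. H +>\<^bsub>M\<^esub> x) ` mdeg M n)\<rparr>"

section \<open>Generator degrees, Hilbert function and Hilbert polynomial\<close>

definition irrelevant_ideal :: "'a graded_ring \<Rightarrow> 'a set" where
  "irrelevant_ideal R =
     {\<Oplus>\<^bsub>R\<^esub> n\<in>F. c n | F c. finite F \<and> F \<subseteq> {1..} \<and> (\<forall>n\<in>F. c n \<in> rdeg R n)}"

definition ideal_smult :: "'a graded_ring \<Rightarrow> ('a, 'b) graded_module \<Rightarrow> 'a set \<Rightarrow> 'b set" where
  "ideal_smult R M J = submodule_span R M {a \<odot>\<^bsub>M\<^esub> x | a x. a \<in> J \<and> x \<in> carrier M}"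

text \<open>The supremum of the empty set in the extended reals is \<open>- \<infinity>\<close>, the convention for \<open>M = 0\<close>.\<close>

definition max_generator_degree :: "'a graded_ring \<Rightarrow> ('a, 'b) graded_module \<Rightarrow> ereal" where
  "max_generator_degree R M =
     (let Q = graded_quotient M (ideal_smult R M (irrelevant_ideal R))
      in Sup ((\<lambda>n. ereal (real_of_int n)) ` {n. mdeg Q n \<noteq> {\<zero>\<^bsub>Q\<^esub>}}))"

definition element_smult :: "('a, 'b) graded_module \<Rightarrow> 'a \<Rightarrow> 'b set" where
  "element_smult M z = {z \<odot>\<^bsub>M\<^esub> x | x. x \<in> carrier M}"

definition filter_regular :: "('a, 'b) graded_module \<Rightarrow> 'a \<Rightarrow> bool" where
  "filter_regular M z \<longleftrightarrow>
     (\<exists>n0. \<forall>n\<ge>n0. {e \<in> mdeg M n. z \<odot>\<^bsub>M\<^esub> e = \<zero>\<^bsub>M\<^esub>} = {\<zero>\<^bsub>M\<^esub>})"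

definition module_length :: "('a, 'm) ring_scheme \<Rightarrow> ('a, 'b) graded_module \<Rightarrow> enat" where
  "module_length R M =
     Sup {enat k | k. \<exists>N :: nat \<Rightarrow> 'b set.
        (\<forall>i\<le>k. submodule (N i) R M) \<and> (\<forall>i<k. N i \<subset> N (Suc i))}"

text \<open>For a finitely generated algebra over an Artinian ring and a finitely generated module all
  lengths below are finite, so that \<open>the_enat\<close> loses nothing.\<close>

definition hilbert_function :: "'a graded_ring \<Rightarrow> ('a, 'b) graded_module \<Rightarrow> int \<Rightarrow> nat" where
  "hilbert_function R N n =
     the_enat (module_length (degree_zero_ring R) (N\<lparr>carrier := mdeg N n\<rparr>))"

definition hilbert_polynomial :: "'a graded_ring \<Rightarrow> ('a, 'b) graded_module \<Rightarrow> rat poly" where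
  "hilbert_polynomial R N =
     (THE p. \<exists>n0. \<forall>n\<ge>n0. poly p (of_int n) = of_nat (hilbert_function R N n))"

section \<open>Local cohomology\<close>

definition torsion_part :: "'a graded_ring \<Rightarrow> ('a, 'b) graded_module \<Rightarrow> 'b set" where
  "torsion_part R M =
     {e \<in> carrier M. \<exists>t0. \<forall>t\<ge>t0. \<forall>a\<in>rdeg R t. a \<odot>\<^bsub>M\<^esub> e = \<zero>\<^bsub>M\<^esub>}"

definition graded_hom ::
    "'a graded_ring \<Rightarrow> ('a, 'b) graded_module \<Rightarrow> ('a, 'c) graded_module \<Rightarrow> ('b \<Rightarrow> 'c) set" where
  "graded_hom R M N =
     {f \<in> hom (add_monoid M) (add_monoid N).
        (\<forall>a\<in>carrier R. \<forall>x\<in>carrier M. f (a \<odot>\<^bsub>M\<^esub> x) = a \<odot>\<^bsub>N\<^esub> f x) \<and>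
        (\<forall>n. f ` mdeg M n \<subseteq> mdeg N n)}"

text \<open>Injective objects of the category of graded \<open>R\<close>-modules with carriers in the type \<open>'c\<close>.
  If \<open>'c\<close> contains a copy of the type of \<open>R\<close>, as in all uses below, this category contains
  copies of all shifts of \<open>R\<close> and their graded submodules; by the graded version of Baer's
  criterion the choice of \<open>'c\<close> is then immaterial.\<close>

definition graded_injective :: "'a graded_ring \<Rightarrow> ('a, 'c) graded_module \<Rightarrow> bool" where
  "graded_injective R E \<longleftrightarrow> is_graded_module R E \<and>
     (\<forall>(A :: ('a, 'c) graded_module) (B :: ('a, 'c) graded_module) u f.
        is_graded_module R A \<and> is_graded_module R B \<and>
        u \<in> graded_hom R A B \<and> inj_on u (carrier A) \<and> f \<in> graded_hom R A E \<longrightarrow>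
        (\<exists>g\<in>graded_hom R B E. \<forall>x\<in>carrier A. g (u x) = f x))"

definition graded_injective_resolution ::
    "'a graded_ring \<Rightarrow> ('a, 'b) graded_module \<Rightarrow>
     (nat \<Rightarrow> ('a, 'c) graded_module) \<Rightarrow> (nat \<Rightarrow> 'c \<Rightarrow> 'c) \<Rightarrow> bool" where
  "graded_injective_resolution R M E d \<longleftrightarrow>
     (\<forall>k. graded_injective R (E k) \<and> d k \<in> graded_hom R (E k) (E (Suc k))) \<and>
     (\<exists>\<epsilon>\<in>graded_hom R M (E 0). inj_on \<epsilon> (carrier M) \<and>
        \<epsilon> ` carrier M = a_kernel (E 0) (E 1) (d 0)) \<and>
     (\<forall>k. d k ` carrier (E k) = a_kernel (E (Suc k)) (E (Suc (Suc k))) (d (Suc k)))"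

text \<open>A type in which resolutions are formed. It is infinite and at least as large as the types of
  the ring and of the module. Over a Noetherian ring a graded module has a graded injective hull
  with no more elements than the maximum of the cardinalities of the ring, the module and the
  natural numbers, so every graded module with carrier in \<open>'b\<close> has a graded injective
  resolution in \<open>('a, 'b) univ\<close>.\<close>

type_synonym ('a, 'b) univ = "('a + 'b + nat) list"

definition chosen_resolution ::
    "'a graded_ring \<Rightarrow> ('a, 'b) graded_module \<Rightarrow>
     (nat \<Rightarrow> ('a, ('a, 'b) univ) graded_module) \<times>
     (nat \<Rightarrow> ('a, 'b) univ \<Rightarrow> ('a, 'b) univ)" where
  "chosen_resolution R M = (SOME (E, d). graded_injective_resolution R M E d)"

text \<open>The \<open>i\<close>-th right derived functor of the torsion functor: the cohomology in position \<open>i\<close> of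
  the complex of torsion parts of an injective resolution.\<close>

definition local_cohomology ::
    "'a graded_ring \<Rightarrow> ('a, 'b) graded_module \<Rightarrow> nat \<Rightarrow> ('a, ('a, 'b) univ set) graded_module" where
  "local_cohomology R M i =
     (let (E, d) = chosen_resolution R M;
          \<Gamma> = (\<lambda>k. graded_submodule (E k) (torsion_part R (E k)));
          Z = a_kernel (\<Gamma> i) (\<Gamma> (Suc i)) (d i);
          B = (case i of 0 \<Rightarrow> {\<zero>\<^bsub>E 0\<^esub>} | Suc j \<Rightarrow> d j ` carrier (\<Gamma> j))
      in graded_quotient (graded_submodule (\<Gamma> i) Z) B)"

definition geometrically_regular ::
    "'a graded_ring \<Rightarrow> ('a, 'b) graded_module \<Rightarrow> int \<Rightarrow> bool" where
  "geometrically_regular R N m \<longleftrightarrow>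
     (\<forall>n\<ge>m. \<forall>i\<ge>1. mdeg (local_cohomology R N i) (n - int i + 1) =
        {\<zero>\<^bsub>local_cohomology R N i\<^esub>})"

end

(*
  Let x_1, ..., x_r generate R_+ linearly. Geometric regularity of M/H is equivalent to a statement
  about Koszul cochains of M: with T the saturation of H, every cochain f in degree n > t whose
  differential lies in T agrees modulo T with a coboundary. This is read off an injective resolution,
  because injective modules have no Koszul cohomology modulo torsion.

  Put H = zM, L the torsion of M and W = zM + L, which is contained in T. Koszul exactness modulo T
  gives two things. First, the alternating sum of the lengths of (M/T)_{D+q} over the Koszul complex
  vanishes for D > t, so that the length of (M/T)_j is a polynomial in j for j > t. Since
  multiplication by z is injective on M/L, the difference h_{M/L}(j) - h_{M/L}(j - 1) is the sum of
  the lengths of (M/T)_j and (T/W)_j, and summing up shows that p_M(t) - h_{M/L}(t) is the sum of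
  the lengths tau_j of (T/W)_j over all j > t. Second, M being generated in degrees at most t,
  tau_j = 0 implies tau_{j+1} = 0 for j > t. Hence tau_j = 0 beyond m = t + p_M(t) - h_{M/L}(t).

  In degrees above m the cochain criterion for zM therefore turns into the one for 0: multiplication
  by z = c_1 x_1 + ... + c_r x_r is null-homotopic on the Koszul complex, so if the differential of f
  lies in L, then z f is a coboundary modulo L of a cochain that can be corrected to be divisible by
  z modulo L, and z can be cancelled modulo L.
*)
theory Submission
  imports Defs
begin

section \<open>Graded modules\<close>

text \<open>Regularity refers to a resolution picked by a choice operator in one fixed carrier type,
  so its existence in exactly that type has to be proved. This is why the construction of injective
  modules keeps track of the size of carriers and works with finite systems of equations only. The
  cohomologies of M and of M/zM live in resolutions over different types. No long exact sequence is
  used to compare them: both conditions are translated into statements about cochains with values in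
  M itself, modulo a saturated submodule. The torsion of M/zM becomes a submodule of M, and lengths
  of subquotients are read off from chains between two subgroups of M. That injective modules are
  Koszul exact modulo torsion rests on division: in an injective module every homogeneous element
  can be divided by a variable up to elements killed by a power of that variable. Treating the
  variables one after another leaves an error killed by powers of all of them, and such an error is
  torsion.\<close>

abbreviation add_sub ("_ \<oplus>\<^sub>_ _" [65, 1000, 66] 65) where "x \<oplus>\<^sub>G y \<equiv> x \<oplus>\<^bsub>G\<^esub> y"
abbreviation minus_sub ("_ \<ominus>\<^sub>_ _" [65, 1000, 66] 65) where "x \<ominus>\<^sub>G y \<equiv> x \<ominus>\<^bsub>G\<^esub> y"
abbreviation neg_sub ("\<ominus>\<^sub>_ _" [1000, 81] 80) where "\<ominus>\<^sub>G x \<equiv> \<ominus>\<^bsub>G\<^esub> x"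
abbreviation zero_sub ("\<zero>\<^sub>_" [1000] 1000) where "\<zero>\<^sub>G \<equiv> \<zero>\<^bsub>G\<^esub>"
abbreviation one_sub ("\<one>\<^sub>_" [1000] 1000) where "\<one>\<^sub>G \<equiv> \<one>\<^bsub>G\<^esub>"
abbreviation mult_sub ("_ \<otimes>\<^sub>_ _" [70, 1000, 71] 70) where "x \<otimes>\<^sub>G y \<equiv> x \<otimes>\<^bsub>G\<^esub> y"
abbreviation smult_sub ("_ \<odot>\<^sub>_ _" [70, 1000, 71] 70) where "a \<odot>\<^sub>G x \<equiv> a \<odot>\<^bsub>G\<^esub> x"

text \<open>An equational substitute for \<open>direct_decomposition\<close>, equivalent to it for
  additive subgroups by \<open>proj_family_exists\<close> and \<open>direct_decompositionI\<close>.
  Joint injectivity in the last clause replaces the expansion of an element as a finite sum, so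
  later gradings are verified by writing down their projections instead of proving unique
  existence.\<close>

definition proj_family :: "('b, 'm) ring_scheme \<Rightarrow> ('i \<Rightarrow> 'b set) \<Rightarrow> ('i \<Rightarrow> 'b \<Rightarrow> 'b) \<Rightarrow> bool" where
 "proj_family G D p \<longleftrightarrow>
   (\<forall>i. \<forall>x\<in>carrier G. p i x \<in> D i) \<and>
   (\<forall>i. \<forall>x\<in>carrier G. \<forall>y\<in>carrier G. p i (x \<oplus>\<^sub>G y) = p i x \<oplus>\<^sub>G p i y) \<and>
   (\<forall>x\<in>carrier G. finite {i. p i x \<noteq> \<zero>\<^sub>G}) \<and>
   (\<forall>i. \<forall>x\<in>D i. p i x = x) \<and>
   (\<forall>i j. i \<noteq> j \<longrightarrow> (\<forall>x\<in>D j. p i x = \<zero>\<^sub>G)) \<and>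
   (\<forall>x\<in>carrier G. (\<forall>i. p i x = \<zero>\<^sub>G) \<longrightarrow> x = \<zero>\<^sub>G)"

context abelian_group
begin

lemma finsum_support:
 assumes "finite U" "{i. c i \<noteq> \<zero>} \<subseteq> U" "\<And>i. c i \<in> carrier G"
 shows "(\<Oplus> i \<in> {i. c i \<noteq> \<zero>}. c i) = (\<Oplus> i \<in> U. c i)"
 by (rule add.finprod_mono_neutral_cong_left) (use assms in auto)

lemma add_subgroupI:
 assumes "H \<subseteq> carrier G" "\<zero> \<in> H" "\<And>x y. x \<in> H \<Longrightarrow> y \<in> H \<Longrightarrow> x \<oplus> y \<in> H"
  "\<And>x. x \<in> H \<Longrightarrow> \<ominus> x \<in> H"
 shows "additive_subgroup H G"
 unfolding additive_subgroup_def
 by (rule subgroup.intro) (use assms in \<open>auto simp: a_inv_def\<close>)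

lemma a_inv_zero: "\<ominus> \<zero> = \<zero>"
 by (rule minus_equality) simp_all

lemma plus_minus_r: "x \<in> carrier G \<Longrightarrow> y \<in> carrier G \<Longrightarrow> x \<oplus> y \<ominus> y = x"
 by (simp add: minus_eq a_assoc r_neg)

lemma plus_minus_l: "x \<in> carrier G \<Longrightarrow> y \<in> carrier G \<Longrightarrow> x \<oplus> y \<ominus> x = y"
 using plus_minus_r[of y x] by (simp add: a_comm)

lemma minus_plus: "x \<in> carrier G \<Longrightarrow> y \<in> carrier G \<Longrightarrow> x \<ominus> y \<oplus> y = x"
 by (simp add: minus_eq a_assoc l_neg)

lemma minus_zeroD: "x \<in> carrier G \<Longrightarrow> y \<in> carrier G \<Longrightarrow> x \<ominus> y = \<zero> \<Longrightarrow> x = y"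
 using minus_equality[of x "\<ominus> y"] by (simp add: minus_eq)

text \<open>Additivity of the components is the main point: the componentwise sum of two
  decompositions is a decomposition of the sum, and uniqueness identifies it with the chosen
  one.\<close>

lemma proj_family_exists:
 assumes "direct_decomposition G D"
 shows "\<exists>p. proj_family G D p"
proof -
 let ?P = "\<lambda>x c. (\<forall>i. c i \<in> D i) \<and> finite {i. c i \<noteq> \<zero>} \<and> x = (\<Oplus> i \<in> {i. c i \<noteq> \<zero>}. c i)"
 have sg: "additive_subgroup (D i) G" for i using assms by (simp add: direct_decomposition_def)
 have Dc: "x \<in> D i \<Longrightarrow> x \<in> carrier G" for i x using additive_subgroup.a_subset[OF sg] by blast
 have D0: "\<zero> \<in> D i" for i using additive_subgroup.zero_closed[OF sg] .
 have ex: "\<exists>!c. ?P x c" if "x \<in> carrier G" for x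
  using assms that unfolding direct_decomposition_def by blast
 define p where "p i x = (THE c. ?P x c) i" for i x
 have pP: "?P x (\<lambda>i. p i x)" if "x \<in> carrier G" for x
  using theI'[OF ex[OF that]] unfolding p_def by simp
 have pU: "p i x = c i" if "x \<in> carrier G" "?P x c" for x c i
  using the1_equality[of "?P x" c, OF ex[OF that(1)]] that(2) unfolding p_def by simp
 have "p i (x \<oplus> y) = p i x \<oplus> p i y" if x: "x \<in> carrier G" and y: "y \<in> carrier G" for i x y
 proof -
  let ?c = "\<lambda>i. p i x \<oplus> p i y"
  let ?U = "{i. p i x \<noteq> \<zero>} \<union> {i. p i y \<noteq> \<zero>}"
  have px: "p i x \<in> carrier G" "p i y \<in> carrier G" for i using pP[OF x] pP[OF y] Dc by auto
  have fin: "finite ?U" using pP[OF x] pP[OF y] by auto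
  have sub: "{i. ?c i \<noteq> \<zero>} \<subseteq> ?U" using px by auto
  have "(\<Oplus> i \<in> {i. ?c i \<noteq> \<zero>}. ?c i) = (\<Oplus> i \<in> ?U. ?c i)"
   by (rule finsum_support) (use fin sub px in auto)
  also have "\<dots> = (\<Oplus> i \<in> ?U. p i x) \<oplus> (\<Oplus> i \<in> ?U. p i y)"
   by (rule finsum_addf) (use px in auto)
  also have "(\<Oplus> i \<in> ?U. p i x) = (\<Oplus> i \<in> {i. p i x \<noteq> \<zero>}. p i x)"
   by (rule finsum_support[symmetric]) (use fin px in auto)
  also have "(\<Oplus> i \<in> ?U. p i y) = (\<Oplus> i \<in> {i. p i y \<noteq> \<zero>}. p i y)"
   by (rule finsum_support[symmetric]) (use fin px in auto)
  finally have "(\<Oplus> i \<in> {i. ?c i \<noteq> \<zero>}. ?c i) = x \<oplus> y" using pP[OF x] pP[OF y] by auto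
  moreover have "\<forall>i. ?c i \<in> D i"
   using pP[OF x] pP[OF y] additive_subgroup.a_closed[OF sg] by auto
  moreover have "finite {i. ?c i \<noteq> \<zero>}" using fin sub finite_subset by blast
  ultimately have "?P (x \<oplus> y) ?c" by simp
  then show ?thesis by (rule pU[OF a_closed[OF x y]])
 qed
 moreover have "p j x = (if j = i then x else \<zero>)" if "x \<in> D i" for i j x
 proof -
  let ?c = "\<lambda>j. if j = i then x else \<zero>"
  have xc: "x \<in> carrier G" using that Dc by auto
  have "(\<Oplus> j \<in> {j. ?c j \<noteq> \<zero>}. ?c j) = (\<Oplus> j \<in> {i}. ?c j)"
   by (rule finsum_support) (use xc in auto)
  also have "\<dots> = x" using xc by simp
  finally have "?P x ?c" using that D0 by auto
  then show ?thesis using pU[OF xc \<open>?P x ?c\<close>] by simp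
 qed
 moreover have "x = \<zero>" if "x \<in> carrier G" "\<forall>i. p i x = \<zero>" for x
  using pP[OF that(1)] that(2) by simp
 ultimately have "proj_family G D p" unfolding proj_family_def using pP by auto
 then show ?thesis using exI[of "proj_family G D" p] by simp
qed

lemma proj_sum:
 assumes "proj_family G D p" "\<And>i. additive_subgroup (D i) G"
 shows "finite A \<Longrightarrow> c \<in> A \<rightarrow> carrier G \<Longrightarrow> p j (\<Oplus> i \<in> A. c i) = (\<Oplus> i \<in> A. p j (c i))"
proof (induction A rule: finite_induct)
 case empty
 have "\<zero> \<in> D j" using assms(2) additive_subgroup.zero_closed by blast
 then show ?case using assms(1) by (simp add: proj_family_def)
next
 case (insert i A)
 have "p j x \<in> carrier G" if "x \<in> carrier G" for x
  using assms additive_subgroup.a_subset that unfolding proj_family_def by blast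
 with insert show ?case using assms(1) by (simp add: proj_family_def Pi_def)
qed

text \<open>An element and the sum of its projections have the same projections, so the difference
  is killed by all of them and vanishes by joint injectivity.\<close>

lemma proj_expand:
 assumes "proj_family G D p" "\<And>i. additive_subgroup (D i) G" "x \<in> carrier G"
 shows "x = (\<Oplus> i \<in> {i. p i x \<noteq> \<zero>}. p i x)"
proof -
 have pD: "p i y \<in> D i" if "y \<in> carrier G" for y i using assms(1) that by (auto simp: proj_family_def)
 have pc: "p i y \<in> carrier G" if "y \<in> carrier G" for y i
  using pD[OF that] assms(2) additive_subgroup.a_subset by blast
 define y where "y = (\<Oplus> i \<in> {i. p i x \<noteq> \<zero>}. p i x)"
 have fin: "finite {i. p i x \<noteq> \<zero>}" using assms by (auto simp: proj_family_def)
 have y: "y \<in> carrier G" unfolding y_def using pc assms(3) by auto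
 have pid: "p j (p i x) = (if i = j then p i x else \<zero>)" for i j
 proof (cases "i = j")
  case True then show ?thesis using pD[OF assms(3), of i] assms(1) by (simp add: proj_family_def)
 next
  case False
  then have "j \<noteq> i" by simp
  then have "\<forall>x\<in>D i. p j x = \<zero>" using assms(1) unfolding proj_family_def by blast
  then show ?thesis using pD[OF assms(3), of i] False by simp
 qed
 have py: "p j y = p j x" for j
 proof -
  have "p j y = (\<Oplus> i \<in> {i. p i x \<noteq> \<zero>}. p j (p i x))"
   unfolding y_def by (rule proj_sum[OF assms(1,2) fin]) (use pc assms in auto)
  also have "\<dots> = (\<Oplus> i \<in> {i. p i x \<noteq> \<zero>}. if j = i then p i x else \<zero>)"
   unfolding pid by (rule finsum_cong) (use pc assms in \<open>auto simp: simp_implies_def\<close>)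
  also have "\<dots> = p j x"
  proof (cases "p j x = \<zero>")
   case True
   then have "(\<Oplus> i \<in> {i. p i x \<noteq> \<zero>}. if j = i then p i x else \<zero>) = (\<Oplus> i \<in> {i. p i x \<noteq> \<zero>}. \<zero>)"
    by (intro finsum_cong) (auto simp: simp_implies_def)
   then show ?thesis using True by simp
  next
   case False
   then show ?thesis by (intro finsum_singleton) (use pc assms fin in auto)
  qed
  finally show ?thesis .
 qed
 have "p j (x \<ominus> y) = \<zero>" for j
 proof -
  have "p j x = p j (x \<ominus> y \<oplus> y)" using assms y by (simp add: minus_eq a_assoc l_neg)
  also have "\<dots> = p j (x \<ominus> y) \<oplus> p j y" using assms y by (simp add: proj_family_def)
  finally have "p j (x \<ominus> y) \<oplus> p j y = p j y" using py by simp
  then show ?thesis using pc assms(3) y by (simp add: add.r_cancel_one)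
 qed
 then have "x \<ominus> y = \<zero>" using assms(1,3) y by (simp add: proj_family_def)
 then show ?thesis unfolding y_def[symmetric] by (rule minus_zeroD[OF assms(3) y])
qed

lemma direct_decompositionI:
 assumes pf: "proj_family G D p" and sg: "\<And>i. additive_subgroup (D i) G"
 shows "direct_decomposition G D"
 unfolding direct_decomposition_def
proof (intro conjI allI ballI sg)
 fix x assume x: "x \<in> carrier G"
 have Dc: "x \<in> D i \<Longrightarrow> x \<in> carrier G" for i x using additive_subgroup.a_subset[OF sg] by blast
 show "\<exists>!c. (\<forall>i. c i \<in> D i) \<and> finite {i. c i \<noteq> \<zero>} \<and> x = (\<Oplus> i \<in> {i. c i \<noteq> \<zero>}. c i)"
 proof (rule ex1I[of _ "\<lambda>i. p i x"])
  show "(\<forall>i. p i x \<in> D i) \<and> finite {i. p i x \<noteq> \<zero>} \<and> x = (\<Oplus> i \<in> {i. p i x \<noteq> \<zero>}. p i x)"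
  proof (intro conjI)
   show "x = (\<Oplus> i \<in> {i. p i x \<noteq> \<zero>}. p i x)" by (rule proj_expand[OF pf sg x])
  qed (use pf x in \<open>simp_all add: proj_family_def\<close>)
 next
  fix c assume c: "(\<forall>i. c i \<in> D i) \<and> finite {i. c i \<noteq> \<zero>} \<and> x = (\<Oplus> i \<in> {i. c i \<noteq> \<zero>}. c i)"
  show "c = (\<lambda>i. p i x)"
  proof
   fix j
   have cc: "c i \<in> carrier G" for i using c Dc by auto
   have px: "p j x = (\<Oplus> i \<in> {i. c i \<noteq> \<zero>}. p j (c i))"
    unfolding conjunct2[OF conjunct2[OF c]] by (rule proj_sum[OF pf sg]) (use c cc in simp_all)
   have pc: "p j (c i) = (if j = i then c i else \<zero>)" for i
    using conjunct1[OF c] pf unfolding proj_family_def by (cases "j = i") simp_all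
   note px
   also have "(\<Oplus> i \<in> {i. c i \<noteq> \<zero>}. p j (c i)) = (\<Oplus> i \<in> {i. c i \<noteq> \<zero>}. if j = i then c i else \<zero>)"
    by (simp only: pc)
   also have "\<dots> = c j"
   proof (cases "c j = \<zero>")
    case True
    then have "(\<Oplus> i \<in> {i. c i \<noteq> \<zero>}. if j = i then c i else \<zero>) = (\<Oplus> i \<in> {i. c i \<noteq> \<zero>}. \<zero>)"
     by (intro finsum_cong) (auto simp: simp_implies_def)
    then show ?thesis using True by simp
   next
    case False
    then show ?thesis by (intro finsum_singleton) (use cc conjunct1[OF conjunct2[OF c]] in auto)
   qed
   finally show "c j = p j x" by simp
  qed
 qed
qed

end

definition hcomp :: "('b, 'm) ring_scheme \<Rightarrow> ('i \<Rightarrow> 'b set) \<Rightarrow> 'i \<Rightarrow> 'b \<Rightarrow> 'b" where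
 "hcomp G D = (SOME p. proj_family G D p)"

locale decomposed_group = abelian_group G for G (structure) and D +
 assumes dd: "direct_decomposition G D"
begin

lemma comp_family: "proj_family G D (hcomp G D)"
 unfolding hcomp_def using someI_ex[OF proj_family_exists[OF dd]] .

lemma piece_subgroup: "additive_subgroup (D i) G" using dd by (simp add: direct_decomposition_def)
lemma piece_carrier: "x \<in> D i \<Longrightarrow> x \<in> carrier G"
 using additive_subgroup.a_subset[OF piece_subgroup] by blast
lemma piece_zero: "\<zero> \<in> D i" using additive_subgroup.zero_closed[OF piece_subgroup] .
lemma piece_add: "x \<in> D i \<Longrightarrow> y \<in> D i \<Longrightarrow> x \<oplus> y \<in> D i"
 using additive_subgroup.a_closed[OF piece_subgroup] .
lemma piece_neg: "x \<in> D i \<Longrightarrow> \<ominus> x \<in> D i"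
 using additive_subgroup.a_inv_closed[OF piece_subgroup] .
lemma piece_minus: "x \<in> D i \<Longrightarrow> y \<in> D i \<Longrightarrow> x \<ominus> y \<in> D i"
 by (simp add: minus_eq piece_add piece_neg)

lemma comp_in: "x \<in> carrier G \<Longrightarrow> hcomp G D i x \<in> D i"
 using comp_family by (simp add: proj_family_def)
lemma comp_closed: "x \<in> carrier G \<Longrightarrow> hcomp G D i x \<in> carrier G"
 using comp_in piece_carrier by blast
lemma comp_add: "x \<in> carrier G \<Longrightarrow> y \<in> carrier G \<Longrightarrow> hcomp G D i (x \<oplus> y) = hcomp G D i x \<oplus> hcomp G D i y"
 using comp_family by (simp add: proj_family_def)
lemma comp_finite: "x \<in> carrier G \<Longrightarrow> finite {i. hcomp G D i x \<noteq> \<zero>}"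
 using comp_family by (simp add: proj_family_def)
lemma comp_id: "x \<in> D i \<Longrightarrow> hcomp G D i x = x"
 using comp_family by (simp add: proj_family_def)
lemma comp_other: "i \<noteq> j \<Longrightarrow> x \<in> D j \<Longrightarrow> hcomp G D i x = \<zero>"
 using comp_family by (simp add: proj_family_def)
lemma comp_all_zero: "x \<in> carrier G \<Longrightarrow> (\<And>i. hcomp G D i x = \<zero>) \<Longrightarrow> x = \<zero>"
 using comp_family by (simp add: proj_family_def)
lemma comp_expand: "x \<in> carrier G \<Longrightarrow> x = (\<Oplus> i \<in> {i. hcomp G D i x \<noteq> \<zero>}. hcomp G D i x)"
 using proj_expand[OF comp_family piece_subgroup] .
lemma comp_zero: "hcomp G D i \<zero> = \<zero>"
 using comp_id piece_zero by blast
lemma comp_neg: assumes "x \<in> carrier G" shows "hcomp G D i (\<ominus> x) = \<ominus> hcomp G D i x"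
proof -
 have "hcomp G D i (\<ominus> x) \<oplus> hcomp G D i x = \<zero>"
  using comp_add[of "\<ominus> x" x i] assms comp_zero by (simp add: l_neg)
 then show ?thesis using assms comp_closed by (simp add: minus_equality)
qed

text \<open>Only the components of the given \<open>x\<close> have to satisfy \<open>P\<close>, not
  all homogeneous elements. In this form it shows that \<open>x\<close> lies in a subgroup
  containing its components.\<close>

lemma homogeneous_sum_induct:
 assumes x: "x \<in> carrier G" and hom: "\<And>i. P (hcomp G D i x)"
  and zero: "P \<zero>" and add: "\<And>y z. y \<in> carrier G \<Longrightarrow> z \<in> carrier G \<Longrightarrow> P y \<Longrightarrow> P z \<Longrightarrow> P (y \<oplus> z)"
 shows "P x"
proof -
 have "P (\<Oplus> i \<in> A. hcomp G D i x)" if "finite A" for A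
  using that
 proof (induction A rule: finite_induct)
  case (insert i A)
  have "(\<lambda>i. hcomp G D i x) \<in> A \<rightarrow> carrier G" using comp_closed x by auto
  with insert show ?case using comp_closed[OF x] hom by (auto intro!: add finsum_closed)
 qed (simp add: zero)
 from this[OF comp_finite[OF x]] show ?thesis using comp_expand[OF x] by simp
qed

lemma homogeneous_induct:
 assumes "x \<in> carrier G" "\<And>i y. y \<in> D i \<Longrightarrow> P y"
  "\<And>y z. y \<in> carrier G \<Longrightarrow> z \<in> carrier G \<Longrightarrow> P y \<Longrightarrow> P z \<Longrightarrow> P (y \<oplus> z)"
 shows "P x"
 using homogeneous_sum_induct[OF assms(1), of P] assms comp_in piece_zero by blast

text \<open>Makes components computable although \<open>hcomp\<close> is chosen by
  \<open>SOME\<close>.\<close>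

lemma comp_unique:
 assumes x: "x \<in> carrier G" and pf: "proj_family G D p"
 shows "p i x = hcomp G D i x"
proof (rule homogeneous_induct[OF x])
 show "\<And>j y. y \<in> D j \<Longrightarrow> p i y = hcomp G D i y"
  subgoal for j y using pf comp_id[of y j] comp_other[of i j y] unfolding proj_family_def by (cases "i = j") simp_all
  done
 show "\<And>y z. y \<in> carrier G \<Longrightarrow> z \<in> carrier G \<Longrightarrow> p i y = hcomp G D i y \<Longrightarrow> p i z = hcomp G D i z
   \<Longrightarrow> p i (y \<oplus> z) = hcomp G D i (y \<oplus> z)"
  using pf comp_add by (simp add: proj_family_def)
qed

end

section \<open>The ring as a graded module over itself\<close>

definition rgr :: "'a graded_ring \<Rightarrow> int \<Rightarrow> 'a set" where
 "rgr R i = (if 0 \<le> i then rdeg R (nat i) else {\<zero>\<^sub>R})"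

text \<open>The free module on one generator of degree \<open>s\<close>, usually written R(-s). Its
  components come from \<open>rgr\<close>, which is zero in negative degrees, because rings are
  graded by natural numbers and modules by integers. With \<open>s = 0\<close> it lets results on
  modules speak of ideals.\<close>

definition shifted_ring :: "'a graded_ring \<Rightarrow> int \<Rightarrow> ('a, 'a) graded_module" where
 "shifted_ring R s = \<lparr>carrier = carrier R, monoid.mult = monoid.mult R, one = one R, zero = zero R,
   add = add R, module.smult = monoid.mult R, mdeg = (\<lambda>n. rgr R (n - s))\<rparr>"

lemma shifted_ring_simps [simp]:
 "carrier (shifted_ring R s) = carrier R" "zero (shifted_ring R s) = zero R"
 "add (shifted_ring R s) = add R" "module.smult (shifted_ring R s) = monoid.mult R"
 "mdeg (shifted_ring R s) n = rgr R (n - s)"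
 by (simp_all add: shifted_ring_def)

lemma abelian_group_cong:
 assumes "abelian_group G" "carrier G' = carrier G" "zero G' = zero G" "add G' = add G"
 shows "abelian_group G'"
proof -
 interpret abelian_group G by fact
 show ?thesis
  by (rule abelian_groupI) (use assms in \<open>auto simp: a_ac intro: l_neg\<close>)
qed

lemma a_inv_cong:
 assumes "carrier G' = carrier G" "zero G' = zero G" "add G' = add G"
 shows "a_inv G' = a_inv G"
 using assms unfolding a_inv_def m_inv_def by auto

lemma additive_subgroup_cong:
 assumes "carrier G' = carrier G" "zero G' = zero G" "add G' = add G"
 shows "additive_subgroup H G' = additive_subgroup H G"
proof -
 have "m_inv (add_monoid G') = m_inv (add_monoid G)"
  using a_inv_cong[OF assms] by (simp add: a_inv_def)
 then show ?thesis unfolding additive_subgroup_def subgroup_def using assms by simp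
qed

lemma proj_family_cong:
 assumes "carrier G' = carrier G" "zero G' = zero G" "add G' = add G"
 shows "proj_family G' = proj_family G"
 using assms unfolding proj_family_def by (intro ext) simp

locale graded_ring_loc = R?: cring R for R :: "'a graded_ring" (structure) +
 assumes graded: "is_graded_ring R"
begin

sublocale rd: decomposed_group R "rdeg R"
 by unfold_locales (use graded in \<open>simp add: is_graded_ring_def\<close>)

lemma one_deg: "\<one> \<in> rdeg R 0" using graded by (simp add: is_graded_ring_def)
lemma mult_deg: "a \<in> rdeg R i \<Longrightarrow> b \<in> rdeg R j \<Longrightarrow> a \<otimes> b \<in> rdeg R (i + j)"
 using graded by (simp add: is_graded_ring_def)

lemma rgr_of_nat [simp]: "rgr R (int i) = rdeg R i" by (simp add: rgr_def)

lemma rgr_subgroup: "additive_subgroup (rgr R i) R"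
 unfolding rgr_def using rd.piece_subgroup by (auto intro: add_subgroupI)

lemma mult_rgr: "a \<in> rgr R i \<Longrightarrow> b \<in> rgr R j \<Longrightarrow> a \<otimes> b \<in> rgr R (i + j)"
 using mult_deg[of a "nat i" b "nat j"] rd.piece_carrier rd.piece_zero
 by (auto simp: rgr_def nat_add_distrib split: if_splits)

lemma rgr_family: "proj_family R (\<lambda>n. rgr R (n - s)) (\<lambda>n x. if s \<le> n then hcomp R (rdeg R) (nat (n - s)) x else \<zero>)"
 unfolding proj_family_def
proof (intro conjI ballI allI impI)
 fix x assume x: "x \<in> carrier R"
 show "finite {i. (if s \<le> i then hcomp R (rdeg R) (nat (i - s)) x else \<zero>) \<noteq> \<zero>}"
 proof (rule finite_subset)
  show "{i. (if s \<le> i then hcomp R (rdeg R) (nat (i - s)) x else \<zero>) \<noteq> \<zero>}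
    \<subseteq> (\<lambda>i. int i + s) ` {i. hcomp R (rdeg R) i x \<noteq> \<zero>}"
  proof
   fix i assume i: "i \<in> {i. (if s \<le> i then hcomp R (rdeg R) (nat (i - s)) x else \<zero>) \<noteq> \<zero>}"
   then have "i = int (nat (i - s)) + s" "nat (i - s) \<in> {i. hcomp R (rdeg R) i x \<noteq> \<zero>}"
    by (auto split: if_splits)
   then show "i \<in> (\<lambda>i. int i + s) ` {i. hcomp R (rdeg R) i x \<noteq> \<zero>}" by (rule image_eqI)
  qed
 qed (simp add: rd.comp_finite x)
next
 fix x assume x: "x \<in> carrier R" "\<forall>i. (if s \<le> i then hcomp R (rdeg R) (nat (i - s)) x else \<zero>) = \<zero>"
 have "hcomp R (rdeg R) i x = \<zero>" for i using x(2)[rule_format, of "int i + s"] by simp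
 then show "x = \<zero>" using rd.comp_all_zero x(1) by blast
next
 fix i j x assume "i \<noteq> j" and x: "x \<in> rgr R (j - s)"
 then have "nat (i - s) \<noteq> nat (j - s)" if "s \<le> i" "s \<le> j" using that by auto
 then show "(if s \<le> i then hcomp R (rdeg R) (nat (i - s)) x else \<zero>) = \<zero>"
  using x rd.comp_other[of "nat (i - s)" "nat (j - s)" x] rd.comp_zero by (auto simp: rgr_def split: if_splits)
qed (simp_all add: rgr_def rd.comp_in rd.comp_add rd.comp_id rd.comp_zero split: if_splits)

lemma shifted_ring_module: "module R (shifted_ring R s)"
 by (rule moduleI) (simp_all add: is_cring l_distr r_distr m_assoc abelian_group_cong[OF is_abelian_group])

lemma shifted_ring_graded: "is_graded_module R (shifted_ring R s)"
proof -
 have ag: "abelian_group (shifted_ring R s)" by (rule abelian_group_cong[OF is_abelian_group]) simp_all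
 have md: "mdeg (shifted_ring R s) = (\<lambda>n. rgr R (n - s))" by auto
 have "direct_decomposition (shifted_ring R s) (mdeg (shifted_ring R s))"
  unfolding md
 proof (rule abelian_group.direct_decompositionI[OF ag])
  show "proj_family (shifted_ring R s) (\<lambda>n. rgr R (n - s))
   (\<lambda>n x. if s \<le> n then hcomp R (rdeg R) (nat (n - s)) x else \<zero>)"
   by (subst proj_family_cong[of _ R]) (simp_all add: rgr_family)
  show "additive_subgroup (rgr R (n - s)) (shifted_ring R s)" for n
   by (subst additive_subgroup_cong[of _ R]) (simp_all add: rgr_subgroup)
 qed
 moreover have "a \<otimes> x \<in> rgr R (int i + j - s)" if "a \<in> rdeg R i" "x \<in> rgr R (j - s)" for i j a x
  using mult_rgr[of a "int i" x "j - s"] that by (simp add: algebra_simps)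
 ultimately show ?thesis unfolding is_graded_module_def using shifted_ring_module by auto
qed

end

lemma graded_ring_locI: "is_graded_ring R \<Longrightarrow> graded_ring_loc R"
 by (simp add: graded_ring_loc_def graded_ring_loc_axioms_def is_graded_ring_def)

locale graded_module_loc = graded_ring_loc R + module R M
 for R :: "'a graded_ring" (structure) and M :: "('a, 'b) graded_module" (structure) +
 assumes gmod: "is_graded_module R M"
begin

sublocale md: decomposed_group M "mdeg M"
 by unfold_locales (use gmod in \<open>simp add: is_graded_module_def\<close>)

abbreviation mcomp :: "int \<Rightarrow> 'b \<Rightarrow> 'b" where "mcomp \<equiv> hcomp M (mdeg M)"

lemma smult_deg: "a \<in> rdeg R i \<Longrightarrow> x \<in> mdeg M j \<Longrightarrow> a \<odot>\<^sub>M x \<in> mdeg M (int i + j)"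
 using gmod by (simp add: is_graded_module_def)

lemma smult_rgr: "a \<in> rgr R i \<Longrightarrow> x \<in> mdeg M j \<Longrightarrow> a \<odot>\<^sub>M x \<in> mdeg M (i + j)"
 using smult_deg[of a "nat i" x j] md.piece_carrier md.piece_zero by (auto simp: rgr_def split: if_splits)

lemma comp_smult:
 assumes a: "a \<in> rgr R i" and x: "x \<in> carrier M"
 shows "mcomp n (a \<odot>\<^sub>M x) = a \<odot>\<^sub>M mcomp (n - i) x"
proof -
 have ac: "a \<in> carrier R" using a rgr_subgroup additive_subgroup.a_subset by blast
 show ?thesis
 proof (rule md.homogeneous_induct[OF x])
  fix j y assume y: "y \<in> mdeg M j"
  show "mcomp n (a \<odot>\<^sub>M y) = a \<odot>\<^sub>M mcomp (n - i) y"
  proof (cases "n = i + j")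
   case True then show ?thesis using smult_rgr[OF a y] y by (simp add: md.comp_id)
  next
   case False
   then have "n - i \<noteq> j" by auto
   with False show ?thesis using md.comp_other[OF _ smult_rgr[OF a y], of n] md.comp_other[OF _ y, of "n - i"] ac by simp
  qed
 next
  fix y z assume "y \<in> carrier M" "z \<in> carrier M"
   "mcomp n (a \<odot>\<^sub>M y) = a \<odot>\<^sub>M mcomp (n - i) y" "mcomp n (a \<odot>\<^sub>M z) = a \<odot>\<^sub>M mcomp (n - i) z"
  then show "mcomp n (a \<odot>\<^sub>M (y \<oplus>\<^sub>M z)) = a \<odot>\<^sub>M mcomp (n - i) (y \<oplus>\<^sub>M z)"
   using ac by (simp add: smult_r_distr md.comp_add md.comp_closed)
 qed
qed

end

lemma graded_module_locI: "is_graded_ring R \<Longrightarrow> is_graded_module R M \<Longrightarrow> graded_module_loc R M"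
 by (simp add: graded_module_loc_def graded_module_loc_axioms_def is_graded_module_def graded_ring_locI)

lemma graded_moduleI:
 assumes "module R M" "proj_family M (mdeg M) p" "\<And>n. additive_subgroup (mdeg M n) M"
  "\<And>i j a x. a \<in> rdeg R i \<Longrightarrow> x \<in> mdeg M j \<Longrightarrow> a \<odot>\<^sub>M x \<in> mdeg M (int i + j)"
 shows "is_graded_module R M"
proof -
 interpret module R M by fact
 show ?thesis unfolding is_graded_module_def using assms M.direct_decompositionI by blast
qed

section \<open>Homogeneous submodules, quotients and homomorphisms\<close>

definition hsub :: "'a graded_ring \<Rightarrow> ('a, 'b) graded_module \<Rightarrow> 'b set \<Rightarrow> bool" where
 "hsub R M H \<longleftrightarrow> submodule H R M \<and> (\<forall>x\<in>H. \<forall>n. hcomp M (mdeg M) n x \<in> H)"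

lemma graded_submodule_simps [simp]:
 "carrier (graded_submodule M H) = H" "zero (graded_submodule M H) = zero M"
 "add (graded_submodule M H) = add M" "module.smult (graded_submodule M H) = module.smult M"
 "mdeg (graded_submodule M H) n = mdeg M n \<inter> H"
 by (simp_all add: graded_submodule_def)

lemma (in abelian_group) add_subgroupD:
 assumes "additive_subgroup H G"
 shows "x \<in> H \<Longrightarrow> x \<in> carrier G" "\<zero> \<in> H" "x \<in> H \<Longrightarrow> y \<in> H \<Longrightarrow> x \<oplus> y \<in> H" "x \<in> H \<Longrightarrow> \<ominus> x \<in> H"
  "x \<in> H \<Longrightarrow> y \<in> H \<Longrightarrow> x \<ominus> y \<in> H"
proof -
 interpret additive_subgroup H G by fact
 show "x \<in> H \<Longrightarrow> x \<in> carrier G" "\<zero> \<in> H" "x \<in> H \<Longrightarrow> y \<in> H \<Longrightarrow> x \<oplus> y \<in> H" "x \<in> H \<Longrightarrow> \<ominus> x \<in> H"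
  "x \<in> H \<Longrightarrow> y \<in> H \<Longrightarrow> x \<ominus> y \<in> H"
  using a_subset by (auto simp: minus_eq)
qed

context graded_module_loc
begin

lemma submodule_subgroup: "submodule H R M \<Longrightarrow> additive_subgroup H M"
 by (simp add: submodule_def additive_subgroup_def)

lemma submoduleD:
 assumes "submodule H R M"
 shows "x \<in> H \<Longrightarrow> x \<in> carrier M" "\<zero>\<^sub>M \<in> H" "x \<in> H \<Longrightarrow> y \<in> H \<Longrightarrow> x \<oplus>\<^sub>M y \<in> H" "x \<in> H \<Longrightarrow> \<ominus>\<^sub>M x \<in> H"
  "x \<in> H \<Longrightarrow> y \<in> H \<Longrightarrow> x \<ominus>\<^sub>M y \<in> H" "a \<in> carrier R \<Longrightarrow> x \<in> H \<Longrightarrow> a \<odot>\<^sub>M x \<in> H"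
 using M.add_subgroupD[OF submodule_subgroup[OF assms]] submodule.smult_closed[OF assms] by simp_all

lemma hsub_submodule: "hsub R M H \<Longrightarrow> submodule H R M" by (simp add: hsub_def)
lemma hsub_comp: "hsub R M H \<Longrightarrow> x \<in> H \<Longrightarrow> mcomp n x \<in> H" by (simp add: hsub_def)
lemmas hsubD = submoduleD[OF hsub_submodule]

lemma hsubI:
 assumes "H \<subseteq> carrier M" "\<zero>\<^sub>M \<in> H" "\<And>x y. x \<in> H \<Longrightarrow> y \<in> H \<Longrightarrow> x \<oplus>\<^sub>M y \<in> H"
  "\<And>a x. a \<in> carrier R \<Longrightarrow> x \<in> H \<Longrightarrow> a \<odot>\<^sub>M x \<in> H" "\<And>x n. x \<in> H \<Longrightarrow> mcomp n x \<in> H"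
 shows "hsub R M H"
proof -
 have "\<ominus>\<^sub>M x \<in> H" if "x \<in> H" for x
 proof -
  have "\<ominus>\<^sub>M x = (\<ominus> \<one>) \<odot>\<^sub>M x" using that assms(1) by (subst smult_l_minus) auto
  then show ?thesis using assms(4) that by simp
 qed
 then show ?thesis unfolding hsub_def using assms by (auto intro!: submoduleI)
qed

lemma hsub_module:
 assumes "hsub R M H"
 shows "is_graded_module R (graded_submodule M H)"
proof (rule graded_moduleI[where p=mcomp])
 show m: "module R (graded_submodule M H)"
 proof (rule moduleI[OF R.is_cring])
  have "abelian_group (M\<lparr>carrier := H\<rparr>)"
   using submodule.submodule_is_module[OF hsub_submodule[OF assms]] module_axioms
   by (simp add: module_def)
  then show "abelian_group (graded_submodule M H)" by (rule abelian_group_cong) simp_all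
 qed (use hsubD[OF assms] in \<open>simp_all add: smult_l_distr smult_r_distr smult_assoc1\<close>)
 then interpret S: module R "graded_submodule M H" .
 show "proj_family (graded_submodule M H) (mdeg (graded_submodule M H)) mcomp"
  unfolding proj_family_def
 proof (intro conjI)
  show "\<forall>x\<in>carrier (graded_submodule M H). (\<forall>i. mcomp i x = \<zero>\<^bsub>graded_submodule M H\<^esub>) \<longrightarrow> x = \<zero>\<^bsub>graded_submodule M H\<^esub>"
   using md.comp_all_zero hsubD(1)[OF assms] by simp
 qed (simp_all add: hsubD(1)[OF assms] hsub_comp[OF assms] md.comp_in md.comp_add md.comp_finite md.comp_id md.comp_other)
 have neg: "\<ominus>\<^bsub>graded_submodule M H\<^esub> x = \<ominus>\<^sub>M x" if "x \<in> H" for x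
  by (rule S.minus_equality) (use that hsubD[OF assms] in \<open>simp_all add: M.l_neg\<close>)
 show "additive_subgroup (mdeg (graded_submodule M H) n) (graded_submodule M H)" for n
  by (rule S.add_subgroupI) (use hsubD[OF assms] md.piece_zero md.piece_add md.piece_neg neg in auto)
 show "a \<odot>\<^bsub>graded_submodule M H\<^esub> x \<in> mdeg (graded_submodule M H) (int i + j)"
  if "a \<in> rdeg R i" "x \<in> mdeg (graded_submodule M H) j" for a i x j
  using that hsubD[OF assms] smult_deg rd.piece_carrier by auto
qed

end

locale quot = graded_module_loc R M
 for R :: "'a graded_ring" (structure) and M :: "('a, 'b) graded_module" (structure) +
 fixes H assumes hs: "hsub R M H"
begin

abbreviation "Q \<equiv> graded_quotient M H"
abbreviation "cl x \<equiv> H +>\<^bsub>M\<^esub> x"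

lemma asH: "additive_subgroup H M" using hs by (simp add: hsub_submodule submodule_subgroup)
lemma sgH: "subgroup H (add_monoid M)" using asH by (simp add: additive_subgroup_def)
lemma abH: "abelian_subgroup H M" by (rule abelian_subgroupI3[OF asH M.abelian_group_axioms])

lemma cl_eq_iff: "x \<in> carrier M \<Longrightarrow> y \<in> carrier M \<Longrightarrow> cl x = cl y \<longleftrightarrow> x \<ominus>\<^sub>M y \<in> H"
proof -
 assume x: "x \<in> carrier M" and y: "y \<in> carrier M"
 have "cl x = cl y \<longleftrightarrow> x \<in> cl y"
  using M.a_repr_independence[OF _ y sgH, of x] abelian_subgroup.a_rcos_self[OF abH x] by auto
 also have "\<dots> \<longleftrightarrow> (\<exists>h\<in>H. x = h \<oplus>\<^sub>M y)" by (auto simp: a_r_coset_def')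
 also have "\<dots> \<longleftrightarrow> x \<ominus>\<^sub>M y \<in> H"
 proof
  assume "\<exists>h\<in>H. x = h \<oplus>\<^sub>M y"
  then show "x \<ominus>\<^sub>M y \<in> H" using y hsubD[OF hs] by (auto simp: M.minus_eq M.a_assoc M.r_neg)
 next
  assume "x \<ominus>\<^sub>M y \<in> H"
  moreover have "x = (x \<ominus>\<^sub>M y) \<oplus>\<^sub>M y" using x y by (simp add: M.minus_eq M.a_assoc M.l_neg)
  ultimately show "\<exists>h\<in>H. x = h \<oplus>\<^sub>M y" by blast
 qed
 finally show ?thesis .
qed

lemma Q_carrier: "carrier Q = cl ` carrier M"
 by (auto simp: graded_quotient_def A_RCOSETS_def')
lemma cl_zero: "cl \<zero>\<^sub>M = H" using hsubD[OF hs] by (intro M.a_coset_add_zero) auto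
lemma Q_zero: "\<zero>\<^sub>Q = cl \<zero>\<^sub>M" by (simp add: cl_zero) (simp add: graded_quotient_def)
lemma Q_add: "x \<in> carrier M \<Longrightarrow> y \<in> carrier M \<Longrightarrow> cl x \<oplus>\<^sub>Q cl y = cl (x \<oplus>\<^sub>M y)"
 by (simp add: graded_quotient_def abelian_subgroup.a_rcos_sum[OF abH])
lemma Q_deg: "mdeg Q n = cl ` mdeg M n" by (simp add: graded_quotient_def)
lemma cl_zero_iff: "x \<in> carrier M \<Longrightarrow> cl x = \<zero>\<^sub>Q \<longleftrightarrow> x \<in> H"
 using cl_eq_iff[of x "\<zero>\<^sub>M"] by (simp add: Q_zero M.minus_eq M.a_inv_zero)
lemma Q_smult: assumes a: "a \<in> carrier R" and x: "x \<in> carrier M" shows "a \<odot>\<^sub>Q cl x = cl (a \<odot>\<^sub>M x)"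
proof -
 have "cl (a \<odot>\<^sub>M y) = cl (a \<odot>\<^sub>M x)" if "y \<in> cl x" for y
 proof -
  have y: "y \<in> carrier M" using that M.a_r_coset_subset_G[of H x] hsubD(1)[OF hs] x by blast
  have "cl x = cl y" using M.a_repr_independence[OF that x sgH] .
  then have "y \<ominus>\<^sub>M x \<in> H" using cl_eq_iff x y by metis
  then have "a \<odot>\<^sub>M (y \<ominus>\<^sub>M x) \<in> H" using hsubD(6)[OF hs] a by blast
  then show ?thesis using a x y by (subst cl_eq_iff) (simp_all add: M.minus_eq smult_r_distr smult_r_minus)
 qed
 moreover have "x \<in> cl x" using abelian_subgroup.a_rcos_self[OF abH x] .
 ultimately have "(\<Union>y\<in>cl x. cl (a \<odot>\<^sub>M y)) = cl (a \<odot>\<^sub>M x)" by blast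
 then show ?thesis by (simp add: graded_quotient_def)
qed

lemma Q_abelian: "abelian_group Q"
proof (rule abelian_groupI)
 show "\<zero>\<^sub>Q \<in> carrier Q" by (auto simp: Q_zero Q_carrier)
next
 fix X assume "X \<in> carrier Q"
 then obtain x where x: "x \<in> carrier M" "X = cl x" by (auto simp: Q_carrier)
 then show "\<exists>Y\<in>carrier Q. Y \<oplus>\<^sub>Q X = \<zero>\<^sub>Q"
  by (auto simp: Q_carrier Q_zero Q_add M.l_neg intro!: bexI[of _ "\<ominus>\<^sub>M x"])
qed (auto simp: Q_carrier Q_add Q_zero M.a_ac)

lemma Q_module: "module R Q"
 by (rule moduleI[OF R.is_cring Q_abelian])
  (auto simp: Q_carrier Q_add Q_smult smult_l_distr smult_r_distr smult_assoc1)

lemma Q_graded: "is_graded_module R Q"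
proof (rule graded_moduleI[OF Q_module])
 \<comment> \<open>The projection of a coset is the class of the component of any representative;
   homogeneity of \<open>H\<close> makes the choice immaterial.\<close>
 define p where "p n X = cl (mcomp n (SOME x. x \<in> carrier M \<and> X = cl x))" for n X
 have p: "p n (cl x) = cl (mcomp n x)" if x: "x \<in> carrier M" for n x
 proof -
  define y where "y = (SOME y. y \<in> carrier M \<and> cl x = cl y)"
  have "y \<in> carrier M \<and> cl x = cl y" unfolding y_def by (rule someI[of _ x]) (use x in simp)
  then have y: "y \<in> carrier M" "cl y = cl x" by (blast, blast)
  then have "y \<ominus>\<^sub>M x \<in> H" using cl_eq_iff[OF y(1) x] by blast
  then have "mcomp n (y \<ominus>\<^sub>M x) \<in> H" using hsub_comp[OF hs] by blast
  then have "cl (mcomp n y) = cl (mcomp n x)"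
   using x y(1) by (subst cl_eq_iff) (simp_all add: md.comp_closed M.minus_eq md.comp_add md.comp_neg)
  then show ?thesis unfolding y_def p_def .
 qed
 have pd: "cl y = \<zero>\<^sub>Q" if "y = \<zero>\<^sub>M" for y by (simp only: that Q_zero)
 have D: "\<exists>y\<in>mdeg M n. X = cl y" if "X \<in> mdeg Q n" for X n using that by (auto simp: Q_deg)
 have C: "\<exists>y\<in>carrier M. X = cl y" if "X \<in> carrier Q" for X using that by (auto simp: Q_carrier)
 show "proj_family Q (mdeg Q) p"
  unfolding proj_family_def
 proof (intro conjI allI ballI impI)
  fix X assume "X \<in> carrier Q"
  then obtain x where x: "x \<in> carrier M" and X: "X = cl x" using C by blast
  show "p i X \<in> mdeg Q i" for i unfolding X p[OF x] Q_deg by (rule imageI[OF md.comp_in[OF x]])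
  show "p i (X \<oplus>\<^sub>Q Y) = p i X \<oplus>\<^sub>Q p i Y" if YQ: "Y \<in> carrier Q" for i Y
  proof -
   obtain y where y: "y \<in> carrier M" and Y: "Y = cl y" using C[OF YQ] by blast
   show ?thesis unfolding X Y Q_add[OF x y] p[OF x] p[OF y] p[OF M.a_closed[OF x y]]
     md.comp_add[OF x y] Q_add[OF md.comp_closed[OF x] md.comp_closed[OF y]] ..
  qed
  have "{i. p i X \<noteq> \<zero>\<^sub>Q} \<subseteq> {i. mcomp i x \<noteq> \<zero>\<^sub>M}" using pd unfolding X p[OF x] by blast
  then show "finite {i. p i X \<noteq> \<zero>\<^sub>Q}" using md.comp_finite[OF x] finite_subset by blast
  assume "\<forall>i. p i X = \<zero>\<^sub>Q"
  then have "mcomp i x \<in> H" for i using cl_zero_iff md.comp_closed[OF x] unfolding X p[OF x] by blast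
  then have "x \<in> H"
   by (rule md.homogeneous_sum_induct[OF x]) (use hsubD[OF hs] in simp_all)
  then show "X = \<zero>\<^sub>Q" using cl_zero_iff x unfolding X by blast
 next
  fix i X assume "X \<in> mdeg Q i"
  then obtain x where x: "x \<in> mdeg M i" and X: "X = cl x" using D by blast
  show "p i X = X" unfolding X p[OF md.piece_carrier[OF x]] md.comp_id[OF x] ..
 next
  fix i j X assume ij: "i \<noteq> j" and "X \<in> mdeg Q j"
  then obtain x where x: "x \<in> mdeg M j" and X: "X = cl x" using D by blast
  show "p i X = \<zero>\<^sub>Q" unfolding X p[OF md.piece_carrier[OF x]] md.comp_other[OF ij x] Q_zero ..
 qed
 have neg: "\<ominus>\<^sub>Q cl x = cl (\<ominus>\<^sub>M x)" if "x \<in> carrier M" for x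
  by (rule abelian_group.minus_equality[OF Q_abelian]) (use that in \<open>auto simp: Q_add Q_zero Q_carrier M.l_neg\<close>)
 show "additive_subgroup (mdeg Q n) Q" for n
 proof (rule abelian_group.add_subgroupI[OF Q_abelian])
  show "mdeg Q n \<subseteq> carrier Q" using md.piece_carrier by (auto simp: Q_deg Q_carrier)
  show "\<zero>\<^sub>Q \<in> mdeg Q n" using md.piece_zero by (auto simp: Q_deg Q_zero)
  show "X \<oplus>\<^sub>Q Y \<in> mdeg Q n" if XY: "X \<in> mdeg Q n" "Y \<in> mdeg Q n" for X Y
  proof -
   obtain x y where "X = cl x" "Y = cl y" "x \<in> mdeg M n" "y \<in> mdeg M n" using XY by (auto simp: Q_deg)
   then show ?thesis using md.piece_carrier md.piece_add by (auto simp: Q_deg Q_add)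
  qed
  show "\<ominus>\<^sub>Q X \<in> mdeg Q n" if "X \<in> mdeg Q n" for X
   using that md.piece_carrier md.piece_neg by (auto simp: Q_deg neg)
 qed
 fix i j a X assume "a \<in> rdeg R i" "X \<in> mdeg Q j"
 then show "a \<odot>\<^sub>Q X \<in> mdeg Q (int i + j)"
  using rd.piece_carrier md.piece_carrier smult_deg by (auto simp: Q_deg Q_smult)
qed

lemma cl_hom: "(\<lambda>x. cl x) \<in> graded_hom R M Q"
 unfolding graded_hom_def by (auto simp: hom_def Q_carrier Q_add Q_smult Q_deg)

end

lemma quotI: "is_graded_ring R \<Longrightarrow> is_graded_module R M \<Longrightarrow> hsub R M H \<Longrightarrow> quot R M H"
 by (simp add: quot_def quot_axioms_def graded_module_locI)

locale ghom = dom: graded_module_loc R M + cod: graded_module_loc R N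
 for R :: "'a graded_ring" and M :: "('a, 'b) graded_module" and N :: "('a, 'c) graded_module" +
 fixes f :: "'b \<Rightarrow> 'c"
 assumes ghom: "f \<in> graded_hom R M N"
begin

lemma closed [simp, intro]: "x \<in> carrier M \<Longrightarrow> f x \<in> carrier N"
 using ghom by (auto simp: graded_hom_def hom_def)
lemma add: "x \<in> carrier M \<Longrightarrow> y \<in> carrier M \<Longrightarrow> f (x \<oplus>\<^sub>M y) = f x \<oplus>\<^sub>N f y"
 using ghom by (simp add: graded_hom_def hom_def)
lemma smult: "a \<in> carrier R \<Longrightarrow> x \<in> carrier M \<Longrightarrow> f (a \<odot>\<^sub>M x) = a \<odot>\<^sub>N f x"
 using ghom by (simp add: graded_hom_def)
lemma deg: "x \<in> mdeg M n \<Longrightarrow> f x \<in> mdeg N n"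
 using ghom unfolding graded_hom_def by blast
lemma zero [simp]: "f \<zero>\<^sub>M = \<zero>\<^sub>N"
proof -
 have "f \<zero>\<^sub>M \<oplus>\<^sub>N f \<zero>\<^sub>M = f \<zero>\<^sub>M" using add[of "\<zero>\<^sub>M" "\<zero>\<^sub>M"] by simp
 then show ?thesis using cod.M.add.l_cancel_one[of "f \<zero>\<^sub>M" "f \<zero>\<^sub>M"] by simp
qed
lemma neg: assumes "x \<in> carrier M" shows "f (\<ominus>\<^sub>M x) = \<ominus>\<^sub>N f x"
proof -
 have "f (\<ominus>\<^sub>M x) \<oplus>\<^sub>N f x = \<zero>\<^sub>N"
  using add[of "\<ominus>\<^sub>M x" x] assms by (simp add: dom.M.l_neg)
 then show ?thesis using assms by (simp add: cod.M.minus_equality)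
qed
lemma minus: "x \<in> carrier M \<Longrightarrow> y \<in> carrier M \<Longrightarrow> f (x \<ominus>\<^sub>M y) = f x \<ominus>\<^sub>N f y"
 by (simp add: dom.M.minus_eq cod.M.minus_eq add neg)
lemma comp: assumes "x \<in> carrier M" shows "f (dom.mcomp n x) = cod.mcomp n (f x)"
proof (rule dom.md.homogeneous_induct[OF assms])
 fix i y assume y: "y \<in> mdeg M i"
 show "f (dom.mcomp n y) = cod.mcomp n (f y)"
 proof (cases "n = i")
  case True then show ?thesis using y deg dom.md.comp_id cod.md.comp_id by simp
 next
  case False then show ?thesis using y deg[OF y] dom.md.comp_other[OF False] cod.md.comp_other[OF False] by simp
 qed
qed (simp add: dom.md.comp_add cod.md.comp_add dom.md.comp_closed add)

lemma image_hsub: "hsub R N (f ` carrier M)"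
proof (rule cod.hsubI)
 show "\<zero>\<^sub>N \<in> f ` carrier M" using zero[symmetric] by blast
 fix x y a n assume "x \<in> f ` carrier M"
 then obtain u where u: "x = f u" "u \<in> carrier M" by auto
 show "a \<odot>\<^sub>N x \<in> f ` carrier M" if "a \<in> carrier R" using u that by (auto simp: smult[symmetric])
 show "cod.mcomp n x \<in> f ` carrier M" using u dom.md.comp_closed by (auto simp: comp[symmetric])
 assume "y \<in> f ` carrier M"
 then obtain v where v: "y = f v" "v \<in> carrier M" by auto
 show "x \<oplus>\<^sub>N y \<in> f ` carrier M" using u v by (auto simp: add[symmetric])
qed auto

lemma preimage_hsub: assumes "hsub R N H" shows "hsub R M {x \<in> carrier M. f x \<in> H}"
 by (rule dom.hsubI) (use cod.hsubD[OF assms] cod.hsub_comp[OF assms] in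
   \<open>auto simp: add smult comp dom.md.comp_closed\<close>)

text \<open>Degree-preserving maps commute with components, so a preimage of a homogeneous element
  can be replaced by its component of that degree.\<close>

lemma homogeneous_preimage:
 assumes "x \<in> carrier M" "f x \<in> mdeg N n"
 shows "f (dom.mcomp n x) = f x"
 using comp[OF assms(1)] cod.md.comp_id[OF assms(2)] by simp

end

lemma ghomI: "is_graded_ring R \<Longrightarrow> is_graded_module R M \<Longrightarrow> is_graded_module R N \<Longrightarrow> f \<in> graded_hom R M N \<Longrightarrow> ghom R M N f"
 by (simp add: ghom_def ghom_axioms_def graded_module_locI)

lemma graded_hom_comp:
 "f \<in> graded_hom R L M \<Longrightarrow> g \<in> graded_hom R M N \<Longrightarrow> (\<lambda>x. g (f x)) \<in> graded_hom R L N"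
 by (auto simp: graded_hom_def hom_def Pi_def) (metis image_subset_iff)

lemma (in graded_module_loc) zero_hsub: "hsub R M {\<zero>\<^sub>M}"
 by (rule hsubI) (auto simp: md.comp_zero)

text \<open>The copy of \<open>X\<close> on the image of an injection \<open>h\<close> into another
  type. Injectivity is tested only against modules with carriers in one fixed type, so modules built
  from functions, cosets or tagged pairs have to be carried back into it.\<close>

definition transport :: "('b \<Rightarrow> 'c) \<Rightarrow> ('a, 'b) graded_module \<Rightarrow> ('a, 'c) graded_module" where
 "transport h X = \<lparr>carrier = h ` carrier X, monoid.mult = undefined, one = undefined, zero = h \<zero>\<^sub>X,
   add = (\<lambda>u v. h (inv_into (carrier X) h u \<oplus>\<^sub>X inv_into (carrier X) h v)),
   module.smult = (\<lambda>a u. h (a \<odot>\<^sub>X inv_into (carrier X) h u)), mdeg = (\<lambda>n. h ` mdeg X n)\<rparr>"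

context graded_module_loc
begin

context
 fixes h :: "'b \<Rightarrow> 'c" assumes inj: "inj_on h (carrier M)"
begin

lemma transport_simps:
 "carrier (transport h M) = h ` carrier M" "zero (transport h M) = h \<zero>\<^sub>M"
 "x \<in> carrier M \<Longrightarrow> y \<in> carrier M \<Longrightarrow> h x \<oplus>\<^bsub>transport h M\<^esub> h y = h (x \<oplus>\<^sub>M y)"
 "x \<in> carrier M \<Longrightarrow> a \<odot>\<^bsub>transport h M\<^esub> h x = h (a \<odot>\<^sub>M x)"
 "mdeg (transport h M) n = h ` mdeg M n"
 using inj by (simp_all add: transport_def)

lemma transport_module: "module R (transport h M)"
proof (rule moduleI[OF R.is_cring abelian_groupI])
 fix u assume "u \<in> carrier (transport h M)"
 then obtain x where "x \<in> carrier M" "u = h x" by (auto simp: transport_simps)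
 then show "\<exists>v\<in>carrier (transport h M). v \<oplus>\<^bsub>transport h M\<^esub> u = \<zero>\<^bsub>transport h M\<^esub>"
  by (auto simp: transport_simps M.l_neg intro!: bexI[of _ "\<ominus>\<^sub>M x"])
qed (auto simp: transport_simps M.a_ac smult_l_distr smult_r_distr smult_assoc1)

lemma transport_graded: "is_graded_module R (transport h M)"
proof (rule graded_moduleI[OF transport_module])
 interpret T: module R "transport h M" by (rule transport_module)
 let ?p = "\<lambda>n u. h (mcomp n (inv_into (carrier M) h u))"
 have inj': "h x = h \<zero>\<^sub>M \<longleftrightarrow> x = \<zero>\<^sub>M" if "x \<in> carrier M" for x
  using inj that by (auto dest: inj_onD)
 show "proj_family (transport h M) (mdeg (transport h M)) ?p"
  unfolding proj_family_def transport_simps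
  by (auto simp: transport_simps inj md.comp_in md.comp_closed md.comp_add md.piece_carrier
    md.comp_id md.comp_other md.comp_finite inj' intro: md.comp_all_zero)
 have neg: "\<ominus>\<^bsub>transport h M\<^esub> h x = h (\<ominus>\<^sub>M x)" if "x \<in> carrier M" for x
  by (rule T.minus_equality) (use that in \<open>auto simp: transport_simps M.l_neg\<close>)
 show "additive_subgroup (mdeg (transport h M) n) (transport h M)" for n
  by (rule T.add_subgroupI)
   (auto simp: transport_simps neg md.piece_carrier md.piece_zero md.piece_add md.piece_neg)
 show "a \<odot>\<^bsub>transport h M\<^esub> x \<in> mdeg (transport h M) (int i + j)"
  if "a \<in> rdeg R i" "x \<in> mdeg (transport h M) j" for i j a x
  using that smult_deg by (auto simp: transport_simps md.piece_carrier)
qed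

lemma transport_hom: "h \<in> graded_hom R M (transport h M)"
 unfolding graded_hom_def by (auto simp: hom_def transport_simps)

lemma transport_inv_hom: "inv_into (carrier M) h \<in> graded_hom R (transport h M) M"
 unfolding graded_hom_def by (auto simp: hom_def transport_simps inj md.piece_carrier)

end
end

section \<open>Torsion\<close>

context graded_module_loc
begin

text \<open>The preimage in the module of the torsion of the quotient by \<open>H\<close>; for
  \<open>H = 0\<close> it is the torsion part. It lets the torsion of M/H be handled as a submodule
  of M.\<close>

definition sat :: "'b set \<Rightarrow> 'b set" where
 "sat H = {e \<in> carrier M. \<exists>t0. \<forall>t\<ge>t0. \<forall>a\<in>rdeg R t. a \<odot>\<^sub>M e \<in> H}"

lemma torsion_part_sat: "torsion_part R M = sat {\<zero>\<^sub>M}"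
 by (simp add: torsion_part_def sat_def)

lemma sat_hsub: assumes "hsub R M H" shows "hsub R M (sat H)"
proof (rule hsubI)
 note H = hsubD[OF assms] hsub_comp[OF assms]
 show "\<zero>\<^sub>M \<in> sat H" using H(2) rd.piece_carrier by (auto simp: sat_def)
 fix x y assume x: "x \<in> sat H" and y: "y \<in> sat H"
 then obtain s t where s: "\<forall>k\<ge>s. \<forall>a\<in>rdeg R k. a \<odot>\<^sub>M x \<in> H" and t: "\<forall>k\<ge>t. \<forall>a\<in>rdeg R k. a \<odot>\<^sub>M y \<in> H"
  by (auto simp: sat_def)
 have "\<forall>k\<ge>max s t. \<forall>a\<in>rdeg R k. a \<odot>\<^sub>M (x \<oplus>\<^sub>M y) \<in> H"
  using s t x y H(3) rd.piece_carrier by (auto simp: sat_def smult_r_distr)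
 then show "x \<oplus>\<^sub>M y \<in> sat H" using x y unfolding sat_def by blast
next
 note H = hsubD[OF assms] hsub_comp[OF assms]
 fix b x assume b: "b \<in> carrier R" and x: "x \<in> sat H"
 then obtain s where s: "\<forall>k\<ge>s. \<forall>a\<in>rdeg R k. a \<odot>\<^sub>M x \<in> H" by (auto simp: sat_def)
 have "a \<odot>\<^sub>M (b \<odot>\<^sub>M x) = b \<odot>\<^sub>M (a \<odot>\<^sub>M x)" if "a \<in> carrier R" for a
  using that b x by (simp add: sat_def smult_assoc1[symmetric] R.m_comm)
 then have "\<forall>k\<ge>s. \<forall>a\<in>rdeg R k. a \<odot>\<^sub>M (b \<odot>\<^sub>M x) \<in> H" using s b H(6) rd.piece_carrier by simp
 then show "b \<odot>\<^sub>M x \<in> sat H" using x b unfolding sat_def by blast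
next
 note H = hsubD[OF assms] hsub_comp[OF assms]
 fix x n assume x: "x \<in> sat H"
 then obtain s where s: "\<forall>k\<ge>s. \<forall>a\<in>rdeg R k. a \<odot>\<^sub>M x \<in> H" by (auto simp: sat_def)
 have "a \<odot>\<^sub>M mcomp n x = mcomp (n + int k) (a \<odot>\<^sub>M x)" if "a \<in> rdeg R k" for a k
  using comp_smult[of a "int k" x "n + int k"] that x by (simp add: sat_def)
 then have "\<forall>k\<ge>s. \<forall>a\<in>rdeg R k. a \<odot>\<^sub>M mcomp n x \<in> H" using s H by simp
 then show "mcomp n x \<in> sat H" using x md.comp_closed unfolding sat_def by blast
qed (auto simp: sat_def)

abbreviation "tors \<equiv> torsion_part R M"

lemma tors_hsub: "hsub R M tors" unfolding torsion_part_sat by (rule sat_hsub[OF zero_hsub])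

end

context ghom
begin

lemma tors_image: "x \<in> torsion_part R M \<Longrightarrow> f x \<in> torsion_part R N"
proof -
 assume x: "x \<in> torsion_part R M"
 then obtain s where s: "\<forall>k\<ge>s. \<forall>a\<in>rdeg R k. a \<odot>\<^sub>M x = \<zero>\<^sub>M" "x \<in> carrier M" by (auto simp: torsion_part_def)
 have "a \<odot>\<^sub>N f x = f (a \<odot>\<^sub>M x)" if "a \<in> rdeg R k" for a k
  using that s smult dom.rd.piece_carrier by simp
 with s have "\<forall>k\<ge>s. \<forall>a\<in>rdeg R k. a \<odot>\<^sub>N f x = \<zero>\<^sub>N" by simp
 then show ?thesis using s closed unfolding torsion_part_def by blast
qed

end

section \<open>Length and chain conditions\<close>

text \<open>The set of scalars need not be a subring. The whole ring gives submodules, degree zero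
  gives the subgroups that lengths count, and the list of variables or the empty set is enough for
  closure under Koszul operations.\<close>

definition asub :: "('a, 'b, 'm) module_scheme \<Rightarrow> 'a set \<Rightarrow> 'b set \<Rightarrow> bool" where
 "asub M A H \<longleftrightarrow> additive_subgroup H M \<and> (\<forall>a\<in>A. \<forall>h\<in>H. a \<odot>\<^sub>M h \<in> H)"

definition asub_chain :: "('a, 'b, 'm) module_scheme \<Rightarrow> 'a set \<Rightarrow> 'b set \<Rightarrow> 'b set \<Rightarrow> nat \<Rightarrow> (nat \<Rightarrow> 'b set) \<Rightarrow> bool" where
 "asub_chain M A X Y k N \<longleftrightarrow> (\<forall>i\<le>k. asub M A (N i) \<and> X \<subseteq> N i \<and> N i \<subseteq> Y) \<and> (\<forall>i<k. N i \<subset> N (Suc i))"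

text \<open>The length of Y/X, read off from chains between \<open>X\<close> and \<open>Y\<close>
  without forming the quotient.\<close>

definition len :: "('a, 'b, 'm) module_scheme \<Rightarrow> 'a set \<Rightarrow> 'b set \<Rightarrow> 'b set \<Rightarrow> enat" where
 "len M A X Y = Sup {enat k |k. \<exists>N. asub_chain M A X Y k N}"

definition acc :: "('a, 'b, 'm) module_scheme \<Rightarrow> 'a set \<Rightarrow> 'b set \<Rightarrow> bool" where
 "acc M A Y \<longleftrightarrow> (\<forall>N. (\<forall>i. asub M A (N i) \<and> N i \<subseteq> Y \<and> N i \<subseteq> N (Suc i)) \<longrightarrow> (\<exists>n0. \<forall>n\<ge>n0. N n = N n0))"

definition aspan :: "('a, 'b, 'm) module_scheme \<Rightarrow> 'a set \<Rightarrow> 'b set \<Rightarrow> 'b set" where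
 "aspan M A S = \<Inter>{H. asub M A H \<and> S \<subseteq> H}"

lemma len_ge: "asub_chain M A X Y k N \<Longrightarrow> enat k \<le> len M A X Y"
 unfolding len_def by (rule Sup_upper) blast

lemma len_le: "(\<And>k N. asub_chain M A X Y k N \<Longrightarrow> enat k \<le> c) \<Longrightarrow> len M A X Y \<le> c"
 unfolding len_def by (rule Sup_least) blast

text \<open>Turns a finite length into an actual longest chain: values below \<open>n\<close> are at
  most \<open>n - 1\<close>, so a supremum equal to \<open>n\<close> must be attained.\<close>

lemma enat_Sup_attained:
 assumes "S \<noteq> {}" "Sup S = enat n"
 shows "enat n \<in> S"
proof (rule ccontr)
 assume "enat n \<notin> S"
 then have less: "x < enat n" if "x \<in> S" for x
  using that assms(2) by (metis Sup_upper order_le_less)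
 show False
 proof (cases n)
  case 0
  then show False using less assms(1) by (auto simp: zero_enat_def[symmetric])
 next
  case (Suc m)
  have "x \<le> enat m" if "x \<in> S" for x using less[OF that] Suc by (cases x) auto
  then have "Sup S \<le> enat m" by (rule Sup_least)
  then show False using assms(2) Suc by simp
 qed
qed

context module
begin

lemma asubD:
 assumes "asub M A H"
 shows "x \<in> H \<Longrightarrow> x \<in> carrier M" "\<zero>\<^sub>M \<in> H" "x \<in> H \<Longrightarrow> y \<in> H \<Longrightarrow> x \<oplus>\<^sub>M y \<in> H" "x \<in> H \<Longrightarrow> \<ominus>\<^sub>M x \<in> H"
  "x \<in> H \<Longrightarrow> y \<in> H \<Longrightarrow> x \<ominus>\<^sub>M y \<in> H" "a \<in> A \<Longrightarrow> x \<in> H \<Longrightarrow> a \<odot>\<^sub>M x \<in> H"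
proof -
 have s: "additive_subgroup H M" using assms by (simp add: asub_def)
 show "x \<in> H \<Longrightarrow> x \<in> carrier M" "\<zero>\<^sub>M \<in> H" "x \<in> H \<Longrightarrow> y \<in> H \<Longrightarrow> x \<oplus>\<^sub>M y \<in> H" "x \<in> H \<Longrightarrow> \<ominus>\<^sub>M x \<in> H"
  "x \<in> H \<Longrightarrow> y \<in> H \<Longrightarrow> x \<ominus>\<^sub>M y \<in> H" by (rule M.add_subgroupD[OF s]; assumption)+
 show "a \<in> A \<Longrightarrow> x \<in> H \<Longrightarrow> a \<odot>\<^sub>M x \<in> H" using assms by (simp add: asub_def)
qed

lemma asubI:
 assumes "H \<subseteq> carrier M" "\<zero>\<^sub>M \<in> H" "\<And>x y. x \<in> H \<Longrightarrow> y \<in> H \<Longrightarrow> x \<oplus>\<^sub>M y \<in> H"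
  "\<And>x. x \<in> H \<Longrightarrow> \<ominus>\<^sub>M x \<in> H" "\<And>a x. a \<in> A \<Longrightarrow> x \<in> H \<Longrightarrow> a \<odot>\<^sub>M x \<in> H"
 shows "asub M A H"
 unfolding asub_def using assms by (auto intro!: M.add_subgroupI)

lemma asub_inter: "asub M A H \<Longrightarrow> asub M A K \<Longrightarrow> asub M A (H \<inter> K)"
 by (rule asubI) (use asubD in auto)

definition msum :: "'c set \<Rightarrow> 'c set \<Rightarrow> 'c set" where "msum H K = {h \<oplus>\<^sub>M k | h k. h \<in> H \<and> k \<in> K}"

lemma msumI: "h \<in> H \<Longrightarrow> k \<in> K \<Longrightarrow> h \<oplus>\<^sub>M k \<in> msum H K" unfolding msum_def by blast
lemma msumE: assumes "x \<in> msum H K" obtains h k where "h \<in> H" "k \<in> K" "x = h \<oplus>\<^sub>M k"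
 using assms unfolding msum_def by blast

lemma swap4: "a \<in> carrier M \<Longrightarrow> b \<in> carrier M \<Longrightarrow> c \<in> carrier M \<Longrightarrow> d \<in> carrier M \<Longrightarrow>
  (a \<oplus>\<^sub>M b) \<oplus>\<^sub>M (c \<oplus>\<^sub>M d) = (a \<oplus>\<^sub>M c) \<oplus>\<^sub>M (b \<oplus>\<^sub>M d)"
 by (simp add: M.a_ac)

lemma asub_msum:
 assumes A: "A \<subseteq> carrier R" and H: "asub M A H" and K: "asub M A K"
 shows "asub M A (msum H K)"
proof (rule asubI)
 show "msum H K \<subseteq> carrier M" unfolding msum_def using asubD(1)[OF H] asubD(1)[OF K] by auto
 show "\<zero>\<^sub>M \<in> msum H K" using msumI[OF asubD(2)[OF H] asubD(2)[OF K]] by simp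
next
 fix x y assume "x \<in> msum H K" "y \<in> msum H K"
 then obtain h k h' k' where e: "h \<in> H" "k \<in> K" "x = h \<oplus>\<^sub>M k" "h' \<in> H" "k' \<in> K" "y = h' \<oplus>\<^sub>M k'"
  by (elim msumE) blast
 have "x \<oplus>\<^sub>M y = (h \<oplus>\<^sub>M h') \<oplus>\<^sub>M (k \<oplus>\<^sub>M k')"
  unfolding e using e asubD(1)[OF H] asubD(1)[OF K] by (intro swap4) auto
 then show "x \<oplus>\<^sub>M y \<in> msum H K" using e asubD(3)[OF H] asubD(3)[OF K] msumI by metis
next
 fix x assume "x \<in> msum H K"
 then obtain h k where e: "h \<in> H" "k \<in> K" "x = h \<oplus>\<^sub>M k" by (elim msumE) blast
 then have c: "h \<in> carrier M" "k \<in> carrier M" using asubD(1)[OF H] asubD(1)[OF K] by auto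
 have "\<ominus>\<^sub>M x = \<ominus>\<^sub>M h \<oplus>\<^sub>M \<ominus>\<^sub>M k" unfolding e using c by (rule M.minus_add)
 then show "\<ominus>\<^sub>M x \<in> msum H K" using e asubD(4)[OF H] asubD(4)[OF K] msumI by metis
 fix a assume a: "a \<in> A"
 then have "a \<odot>\<^sub>M x = a \<odot>\<^sub>M h \<oplus>\<^sub>M a \<odot>\<^sub>M k" unfolding e using A c by (intro smult_r_distr) auto
 then show "a \<odot>\<^sub>M x \<in> msum H K" using e a asubD(6)[OF H] asubD(6)[OF K] msumI by metis
qed

lemma msum_left: assumes "asub M A K" "H \<subseteq> carrier M" shows "H \<subseteq> msum H K"
proof
 fix h assume h: "h \<in> H"
 have "h \<oplus>\<^sub>M \<zero>\<^sub>M \<in> msum H K" by (rule msumI[OF h asubD(2)[OF assms(1)]])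
 then show "h \<in> msum H K" using h assms(2) by auto
qed
lemma msum_right: assumes "asub M A H" "K \<subseteq> carrier M" shows "K \<subseteq> msum H K"
proof
 fix k assume k: "k \<in> K"
 have "\<zero>\<^sub>M \<oplus>\<^sub>M k \<in> msum H K" by (rule msumI[OF asubD(2)[OF assms(1)] k])
 then show "k \<in> msum H K" using k assms(2) by auto
qed
lemma msum_least: assumes "asub M A L" "H \<subseteq> L" "K \<subseteq> L" shows "msum H K \<subseteq> L"
 unfolding msum_def using asubD(3)[OF assms(1)] assms(2,3) by auto
lemma msum_mono: "H \<subseteq> H' \<Longrightarrow> K \<subseteq> K' \<Longrightarrow> msum H K \<subseteq> msum H' K'" unfolding msum_def by blast

text \<open>The modular law: if n' = n + y with y in \<open>Y\<close>, then y = n' - n lies in the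
  intersection of \<open>N'\<close> and \<open>Y\<close>. In \<open>len_add\<close> it detects which
  half of a chain grows.\<close>

lemma asub_modular:
 assumes "asub M A N" "asub M A N'" "asub M A Y" "N \<subseteq> N'" "N' \<inter> Y \<subseteq> N" "N' \<subseteq> msum N Y"
 shows "N' = N"
proof
 show "N' \<subseteq> N"
 proof
  fix n' assume n': "n' \<in> N'"
  then obtain n y where ny: "n \<in> N" "y \<in> Y" "n' = n \<oplus>\<^sub>M y" using assms(6) msumE by blast
  have c: "n \<in> carrier M" "y \<in> carrier M" using ny assms(1,3) asubD(1) by auto
  have "y = n' \<ominus>\<^sub>M n" unfolding ny using M.plus_minus_l[OF c] by simp
  have "n' \<ominus>\<^sub>M n \<in> N'" using asubD(5)[OF assms(2) n'] ny(1) assms(4) by blast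
  then have "y \<in> N'" using ssubst[OF \<open>y = n' \<ominus>\<^sub>M n\<close>, of "\<lambda>u. u \<in> N'"] by blast
  then show "n' \<in> N" using ny assms(5) asubD(3)[OF assms(1)] by auto
 qed
qed fact

text \<open>Chains are concatenated at \<open>Y\<close>. If the total length is finite, both partial
  lengths are attained by chains; otherwise there is nothing to show.\<close>

lemma len_superadd:
 assumes Y: "X \<subseteq> Y" "Y \<subseteq> Z" and XY: "asub M A X" "asub M A Y"
 shows "len M A X Y + len M A Y Z \<le> len M A X Z"
proof -
 have conc: "enat (k + l) \<le> len M A X Z" if N: "asub_chain M A X Y k N" and N': "asub_chain M A Y Z l N'" for k l N N'
 proof (rule len_ge)
  have N1: "asub M A (N i)" "X \<subseteq> N i" "N i \<subseteq> Y" if "i \<le> k" for i using N that by (simp_all add: asub_chain_def)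
  have N2: "N i \<subset> N (Suc i)" if "i < k" for i using N that by (simp add: asub_chain_def)
  have N1': "asub M A (N' i)" "Y \<subseteq> N' i" "N' i \<subseteq> Z" if "i \<le> l" for i using N' that by (simp_all add: asub_chain_def)
  have N2': "N' i \<subset> N' (Suc i)" if "i < l" for i using N' that by (simp add: asub_chain_def)
  let ?N = "\<lambda>i. if i < k then N i else N' (i - k)"
  show "asub_chain M A X Z (k + l) ?N"
   unfolding asub_chain_def
  proof (rule conjI; intro allI impI)
   fix i assume i: "i \<le> k + l"
   show "asub M A (?N i) \<and> X \<subseteq> ?N i \<and> ?N i \<subseteq> Z"
   proof (cases "i < k")
    case True
    then have "i \<le> k" by simp
    note c = N1[OF this]
    have "N i \<subseteq> Z" using c(3) Y(2) by (rule subset_trans)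
    then show ?thesis using c True by simp
   next
    case False
    with i have "i - k \<le> l" by simp
    note c = N1'[OF this]
    have "X \<subseteq> N' (i - k)" using Y(1) c(2) by (rule subset_trans)
    then show ?thesis using c False by simp
   qed
  next
   fix i assume i: "i < k + l"
   consider "Suc i < k" | "Suc i = k" | "k \<le> i" by linarith
   then show "?N i \<subset> ?N (Suc i)"
   proof cases
    case 1 then show ?thesis using N2[of i] by simp
   next
    case 2
    have "N i \<subset> N k" using 2 N2[of i] by simp
    moreover have "N k \<subseteq> Y" "Y \<subseteq> N' 0" using N1(3)[of k] N1'(2)[of 0] by simp_all
    ultimately have "N i \<subset> N' 0" by (meson psubset_subset_trans subset_trans)
    moreover have "?N i = N i" "?N (Suc i) = N' 0" using 2 by simp_all
    ultimately show ?thesis by (simp only:)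
   next
    case 3
    then show ?thesis using N2'[of "i - k"] i by (simp add: Suc_diff_le)
   qed
  qed
 qed
 show ?thesis
 proof (cases "len M A X Z")
  case infinity then show ?thesis by simp
 next
  case (enat z)
  let ?S = "{enat k |k. \<exists>N. asub_chain M A X Y k N}" and ?T = "{enat k |k. \<exists>N. asub_chain M A Y Z k N}"
  have 0: "asub_chain M A X Y 0 (\<lambda>_. X)" "asub_chain M A Y Z 0 (\<lambda>_. Y)"
   using XY Y by (simp_all add: asub_chain_def)
  have "len M A X Y \<le> enat z"
   by (rule len_le) (use conc[OF _ 0(2)] enat in simp)
  moreover have "len M A Y Z \<le> enat z"
   by (rule len_le) (use conc[OF 0(1)] enat in simp)
  ultimately obtain a b where ab: "len M A X Y = enat a" "len M A Y Z = enat b"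
   by (metis enat_ile)
  have "enat a \<in> ?S" by (rule enat_Sup_attained) (use 0 ab in \<open>auto simp: len_def\<close>)
  moreover have "enat b \<in> ?T" by (rule enat_Sup_attained) (use 0 ab in \<open>auto simp: len_def\<close>)
  ultimately obtain N N' where "asub_chain M A X Y a N" "asub_chain M A Y Z b N'" by auto
  then show ?thesis using conc ab by simp
 qed
qed

lemma len_one: assumes "asub M A X" "asub M A Y" "X \<subset> Y" shows "1 \<le> len M A X Y"
proof -
 have "asub_chain M A X Y 1 (\<lambda>i. if i = 0 then X else Y)" using assms by (auto simp: asub_chain_def)
 from len_ge[OF this] show ?thesis by (simp add: one_enat_def)
qed

lemma len_step: assumes "asub M A X" "asub M A B" "X \<subseteq> B" "asub M A B'" "B \<subset> B'"
 shows "len M A X B + 1 \<le> len M A X B'"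
proof -
 have "len M A X B + 1 \<le> len M A X B + len M A B B'" using len_one assms by (intro add_left_mono) auto
 also have "\<dots> \<le> len M A X B'" using len_superadd[of X B B'] assms by auto
 finally show ?thesis .
qed

lemma len_mono: assumes "Y \<subseteq> Y'" shows "len M A X Y \<le> len M A X Y'"
proof (rule len_le)
 fix k N assume "asub_chain M A X Y k N"
 then have "asub_chain M A X Y' k N" using assms unfolding asub_chain_def by blast
 then show "enat k \<le> len M A X Y'" by (rule len_ge)
qed

lemma len_anti: assumes "X' \<subseteq> X" shows "len M A X Y \<le> len M A X' Y"
proof (rule len_le)
 fix k N assume "asub_chain M A X Y k N"
 then have "asub_chain M A X' Y k N" using assms unfolding asub_chain_def by blast
 then show "enat k \<le> len M A X' Y" by (rule len_ge)
qed

text \<open>For the inequality opposite to \<open>len_superadd\<close>, a chain N_i from X to Z is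
  cut into the intersections with Y and the sums with Y. By the modular law each strict step is
  strict in at least one of the two, so the index is bounded by the sum of the two lengths.\<close>

lemma len_add:
 assumes A: "A \<subseteq> carrier R" and Y: "X \<subseteq> Y" "Y \<subseteq> Z" and s: "asub M A X" "asub M A Y" "asub M A Z"
 shows "len M A X Z = len M A X Y + len M A Y Z"
proof (rule antisym)
 show "len M A X Z \<le> len M A X Y + len M A Y Z"
 proof (rule len_le)
  fix k N assume ch: "asub_chain M A X Z k N"
  have N: "asub M A (N i)" "X \<subseteq> N i" "N i \<subseteq> Z" if "i \<le> k" for i using ch that by (auto simp: asub_chain_def)
  have "enat j \<le> len M A X (N j \<inter> Y) + len M A Y (msum (N j) Y)" if "j \<le> k" for j
   using that
  proof (induction j)
   case 0 then show ?case by (simp add: zero_enat_def[symmetric])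
  next
   case (Suc j)
   have st: "N j \<subset> N (Suc j)" using ch Suc by (auto simp: asub_chain_def)
   have N1: "asub M A (N j)" "X \<subseteq> N j" and N2: "asub M A (N (Suc j))" "X \<subseteq> N (Suc j)" using N Suc by auto
   let ?a = "N j \<inter> Y" and ?a' = "N (Suc j) \<inter> Y" and ?b = "msum (N j) Y" and ?b' = "msum (N (Suc j)) Y"
   have aa: "?a \<subseteq> ?a'" "?b \<subseteq> ?b'" using st msum_mono by blast+
   have sa: "asub M A ?a" "asub M A ?a'" using asub_inter N1 N2 s by auto
   have sb: "asub M A ?b" "asub M A ?b'" using asub_msum A N1 N2 s by auto
   have Yb: "Y \<subseteq> ?b" using msum_right[OF N1(1)] asubD(1)[OF s(2)] by blast
   have Xa: "X \<subseteq> ?a" using N1 Y by auto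
   have "?a \<noteq> ?a' \<or> ?b \<noteq> ?b'"
   proof (rule ccontr)
    assume "\<not> ?thesis"
    then have "N (Suc j) \<inter> Y \<subseteq> N j" "N (Suc j) \<subseteq> msum (N j) Y"
     using msum_left[OF s(2), of "N (Suc j)"] asubD(1)[OF N2(1)] by auto
    then have "N (Suc j) = N j" using asub_modular[OF N1(1) N2(1) s(2)] st by blast
    then show False using st by simp
   qed
   then consider "?a \<subset> ?a'" | "?b \<subset> ?b'" using aa by blast
   then show ?case
   proof cases
    case 1
    have "enat (Suc j) \<le> (len M A X ?a + len M A Y ?b) + 1"
     using Suc by (simp add: eSuc_enat[symmetric] eSuc_plus_1)
    also have "\<dots> = (len M A X ?a + 1) + len M A Y ?b" by (simp add: ac_simps)
    also have "\<dots> \<le> len M A X ?a' + len M A Y ?b'"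
     using len_step[OF s(1) sa(1) Xa sa(2) 1] len_mono[OF aa(2)] by (intro add_mono)
    finally show ?thesis .
   next
    case 2
    have "enat (Suc j) \<le> (len M A X ?a + len M A Y ?b) + 1"
     using Suc by (simp add: eSuc_enat[symmetric] eSuc_plus_1)
    also have "\<dots> = len M A X ?a + (len M A Y ?b + 1)" by (simp add: ac_simps)
    also have "\<dots> \<le> len M A X ?a' + len M A Y ?b'"
     using len_step[OF s(2) sb(1) Yb sb(2) 2] len_mono[OF aa(1)] by (intro add_mono)
    finally show ?thesis .
   qed
  qed
  from this[of k] have "enat k \<le> len M A X (N k \<inter> Y) + len M A Y (msum (N k) Y)" by simp
  also have "\<dots> \<le> len M A X Y + len M A Y Z"
   using N[of k] Y by (intro add_mono len_mono msum_least[OF s(3)]) auto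
  finally show "enat k \<le> len M A X Y + len M A Y Z" .
 qed
qed (use len_superadd Y s in blast)

lemma len_zero_iff: assumes "asub M A X" "asub M A Y" "X \<subseteq> Y" shows "len M A X Y = 0 \<longleftrightarrow> X = Y"
proof
 assume "len M A X Y = 0" then show "X = Y" using len_one[OF assms(1,2)] assms(3) by (metis not_one_le_zero psubsetI)
next
 assume XY: "X = Y"
 have "len M A X Y \<le> 0"
 proof (rule len_le)
  fix k N assume ch: "asub_chain M A X Y k N"
  show "enat k \<le> 0"
  proof (cases k)
   case (Suc j)
   then have "N 0 \<subset> N 1" "X \<subseteq> N 0" "N 1 \<subseteq> Y" using ch by (auto simp: asub_chain_def)
   then show ?thesis using XY by auto
  qed (simp add: zero_enat_def)
 qed
 then show "len M A X Y = 0" by simp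
qed

text \<open>The lengths of the members of a chain are bounded, so a maximal one is attained; by
  additivity every later member has length zero over it.\<close>

lemma acc_if_finite_len:
 assumes A: "A \<subseteq> carrier R" and fin: "len M A {\<zero>\<^sub>M} Y \<noteq> \<infinity>"
 shows "acc M A Y"
 unfolding acc_def
proof (intro allI impI)
 fix N assume N: "\<forall>i. asub M A (N i) \<and> N i \<subseteq> Y \<and> N i \<subseteq> N (Suc i)"
 let ?l = "\<lambda>i. the_enat (len M A {\<zero>\<^sub>M} (N i))"
 obtain y where y: "len M A {\<zero>\<^sub>M} Y = enat y" using fin by auto
 have le: "len M A {\<zero>\<^sub>M} (N i) \<le> enat y" for i using N len_mono y by metis
 then have l: "len M A {\<zero>\<^sub>M} (N i) = enat (?l i)" "?l i \<le> y" for i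
 proof -
  obtain q where q: "len M A {\<zero>\<^sub>M} (N i) = enat q" using enat_ile[OF le[of i]] by blast
  then show "len M A {\<zero>\<^sub>M} (N i) = enat (?l i)" "?l i \<le> y" using le[of i] by simp_all
 qed
 have mono: "N i \<subseteq> N j" if "i \<le> j" for i j using lift_Suc_mono_le[of N i j] that N by auto
 define m where "m = Max (range ?l)"
 have "finite (range ?l)" by (rule finite_subset[of _ "{..y}"]) (use l in auto)
 then have "m \<in> range ?l" "\<And>i. ?l i \<le> m" unfolding m_def by (auto intro: Max_in)
 then obtain n0 where n0: "?l n0 = m" "\<And>i. ?l i \<le> ?l n0" by auto
 have "N n = N n0" if "n \<ge> n0" for n
 proof -
  have z: "asub M A {\<zero>\<^sub>M}" by (rule asubI) (use A M.a_inv_zero in auto)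
  have "len M A {\<zero>\<^sub>M} (N n) = len M A {\<zero>\<^sub>M} (N n0) + len M A (N n0) (N n)"
  proof (rule len_add[OF A _ mono[OF that] z])
   show "{\<zero>\<^sub>M} \<subseteq> N n0" using asubD(2) N by blast
  qed (use N in blast)+
  then have "enat (?l n) = enat (?l n0) + len M A (N n0) (N n)" using l by metis
  then have "len M A (N n0) (N n) = 0" using n0(2)[of n] by (cases "len M A (N n0) (N n)") (auto simp: zero_enat_def)
  then show ?thesis using len_zero_iff N mono[OF that] by metis
 qed
 then show "\<exists>n0. \<forall>n\<ge>n0. N n = N n0" by blast
qed

lemma acc_maximal:
 assumes acc: "acc M A Y" and F: "F \<noteq> {}" "\<And>H. H \<in> F \<Longrightarrow> asub M A H \<and> H \<subseteq> Y"
 obtains H where "H \<in> F" "\<And>K. K \<in> F \<Longrightarrow> H \<subseteq> K \<Longrightarrow> K = H"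
proof -
 have "\<exists>H\<in>F. \<forall>K\<in>F. H \<subseteq> K \<longrightarrow> K = H"
 proof (rule ccontr)
  assume "\<not> ?thesis"
  then have step: "\<forall>H\<in>F. \<exists>K\<in>F. H \<subset> K" by blast
  obtain H0 where "H0 \<in> F" using F by blast
  have "\<exists>f. \<forall>n::nat. f n \<in> F \<and> f n \<subset> f (Suc n)"
   by (rule dependent_nat_choice[where P="\<lambda>_ H. H \<in> F" and Q="\<lambda>_ H K. H \<subset> K"])
    (use \<open>H0 \<in> F\<close> step in blast)+
  then obtain f where f: "\<And>n::nat. f n \<in> F \<and> f n \<subset> f (Suc n)" by blast
  then have "\<exists>n0. \<forall>n\<ge>n0. f n = f n0" using acc F(2) unfolding acc_def by blast
  then show False using f by (metis le_SucI order_refl psubset_eq)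
 qed
 then show ?thesis using that by blast
qed

lemma aspan_asub: assumes "S \<subseteq> carrier M" "A \<subseteq> carrier R" shows "asub M A (aspan M A S)"
proof -
 have c: "asub M A (carrier M)" by (rule asubI) (use assms in auto)
 show ?thesis unfolding aspan_def
  by (rule asubI) (use c assms asubD in auto)
qed
lemma aspan_incl: "S \<subseteq> aspan M A S" unfolding aspan_def by blast
lemma aspan_least: "asub M A H \<Longrightarrow> S \<subseteq> H \<Longrightarrow> aspan M A S \<subseteq> H" unfolding aspan_def by blast
lemma aspan_mono: "S \<subseteq> T \<Longrightarrow> aspan M A S \<subseteq> aspan M A T" unfolding aspan_def by blast

text \<open>A maximal finitely generated subobject of \<open>H\<close> absorbs each element of
  \<open>H\<close>.\<close>

lemma acc_fin_gen:
 assumes acc: "acc M A Y" and Y: "asub M A H" "H \<subseteq> Y" and A: "A \<subseteq> carrier R"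
 obtains S where "finite S" "S \<subseteq> H" "aspan M A S = H"
proof -
 let ?F = "{aspan M A S | S. finite S \<and> S \<subseteq> H}"
 have Hc: "H \<subseteq> carrier M" using asubD(1)[OF Y(1)] by blast
 obtain K where K: "K \<in> ?F" "\<And>L. L \<in> ?F \<Longrightarrow> K \<subseteq> L \<Longrightarrow> L = K"
 proof (rule acc_maximal[OF acc, of ?F])
  show "asub M A L \<and> L \<subseteq> Y" if L: "L \<in> ?F" for L
  proof -
   obtain S where S: "L = aspan M A S" "S \<subseteq> H" using L by blast
   then show ?thesis using aspan_asub[of S A] aspan_least[OF Y(1), of S] A Hc Y(2) by auto
  qed
 qed auto
 then obtain S where S: "K = aspan M A S" "finite S" "S \<subseteq> H" by blast
 have "H \<subseteq> K"
 proof
  fix h assume h: "h \<in> H"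
  have "aspan M A (insert h S) = K"
   by (rule K(2)) (use S h aspan_mono[of S "insert h S"] in auto)
  then show "h \<in> K" using aspan_incl[of "insert h S" A] by auto
 qed
 then show ?thesis using that S aspan_least[OF Y(1) S(3)] by blast
qed

end

text \<open>The isomorphism of Y/X with Y'/X' induced by \<open>f\<close>: \<open>X\<close> is the
  full preimage of \<open>X'\<close>, and \<open>Y'\<close> is the image enlarged by
  \<open>X'\<close>. On intermediate subgroups, taking preimages and taking images plus
  \<open>X'\<close> are inverse to each other. Linearity of \<open>f\<close> is asked on
  \<open>Y\<close> only.\<close>

lemma len_iso:
 assumes MM: "module R M" and NN: "module R N" and A: "A \<subseteq> carrier R"
  and Y: "asub M A Y" and X': "asub N A X'"
  and fc: "\<And>y. y \<in> Y \<Longrightarrow> f y \<in> carrier N"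
  and fa: "\<And>y z. y \<in> Y \<Longrightarrow> z \<in> Y \<Longrightarrow> f (y \<oplus>\<^sub>M z) = f y \<oplus>\<^sub>N f z"
  and fs: "\<And>a y. a \<in> A \<Longrightarrow> y \<in> Y \<Longrightarrow> f (a \<odot>\<^sub>M y) = a \<odot>\<^sub>N f y"
  and X: "X = {y \<in> Y. f y \<in> X'}" and Y': "Y' = {f y \<oplus>\<^sub>N x | y x. y \<in> Y \<and> x \<in> X'}"
 shows "len M A X Y = len N A X' Y'"
proof -
 interpret M: module R M by fact
 interpret N: module R N by fact
 note Yd = M.asubD[OF Y] and Xd = N.asubD[OF X']
 have f0: "f \<zero>\<^sub>M = \<zero>\<^sub>N"
  using fa[OF Yd(2) Yd(2)] fc[OF Yd(2)] by (metis M.M.l_zero M.M.zero_closed N.M.add.l_cancel_one')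
 have fn: "f (\<ominus>\<^sub>M y) = \<ominus>\<^sub>N f y" if "y \<in> Y" for y
 proof -
  have "f (\<ominus>\<^sub>M y) \<oplus>\<^sub>N f y = \<zero>\<^sub>N"
   using fa[OF Yd(4)[OF that] that] f0 Yd(1)[OF that] by (simp add: M.M.l_neg)
  then show ?thesis using fc[OF that] fc[OF Yd(4)[OF that]] by (simp add: N.M.minus_equality)
 qed
 let ?up = "\<lambda>H. N.msum (f ` H) X'"
 have img: "asub N A (f ` H)" if H: "asub M A H" "H \<subseteq> Y" for H
 proof (rule N.asubI)
  show "f ` H \<subseteq> carrier N" using fc H by auto
  show "\<zero>\<^sub>N \<in> f ` H" using f0 M.asubD(2)[OF H(1)] by (metis imageI)
  fix x a assume "x \<in> f ` H"
  then obtain u where u: "u \<in> H" "x = f u" "u \<in> Y" using H by auto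
  show "\<ominus>\<^sub>N x \<in> f ` H" unfolding u using fn[OF u(3)] M.asubD(4)[OF H(1) u(1)] by (metis imageI)
  show "a \<odot>\<^sub>N x \<in> f ` H" if "a \<in> A"
   unfolding u using fs[OF that u(3)] M.asubD(6)[OF H(1) that u(1)] by (metis imageI)
  fix y assume "y \<in> f ` H"
  then obtain v where v: "v \<in> H" "y = f v" "v \<in> Y" using H by auto
  show "x \<oplus>\<^sub>N y \<in> f ` H" unfolding u v using fa[OF u(3) v(3)] M.asubD(3)[OF H(1) u(1) v(1)] by (metis imageI)
 qed
 have pre: "asub M A {y \<in> Y. f y \<in> H}" if H: "asub N A H" for H
  by (rule M.asubI) (use Yd N.asubD[OF H] fa fs fn f0 in auto)
 have Y'm: "Y' = ?up Y" unfolding Y' N.msum_def by auto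
 \<comment> \<open>Elements of \<open>Y\<close> with the same image modulo \<open>X'\<close> differ
   by an element of \<open>X\<close>, so going up and down again loses nothing above
   \<open>X\<close>.\<close>
 have up_rec: "{y \<in> Y. f y \<in> ?up H} = H" if H: "asub M A H" "H \<subseteq> Y" "X \<subseteq> H" for H
 proof
  show "H \<subseteq> {y \<in> Y. f y \<in> ?up H}" using N.msum_left[OF X', of "f ` H"] fc H(2) by auto
  show "{y \<in> Y. f y \<in> ?up H} \<subseteq> H"
  proof safe
   fix y assume y: "y \<in> Y" "f y \<in> ?up H"
   then obtain h x where hx: "h \<in> H" "x \<in> X'" "f y = f h \<oplus>\<^sub>N x" by (auto elim: N.msumE)
   have hY: "h \<in> Y" using hx H by auto
   have "f (y \<ominus>\<^sub>M h) = x"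
    unfolding M.M.minus_eq fa[OF y(1) Yd(4)[OF hY]] fn[OF hY] hx(3)
    using N.M.plus_minus_l[OF fc[OF hY] Xd(1)[OF hx(2)]] by (simp add: N.M.minus_eq)
   then have "y \<ominus>\<^sub>M h \<in> H" using H(3) Yd(5)[OF y(1) hY] hx(2) unfolding X by auto
   then have "(y \<ominus>\<^sub>M h) \<oplus>\<^sub>M h \<in> H" using M.asubD(3)[OF H(1)] hx by blast
   then show "y \<in> H" using Yd(1)[OF y(1)] Yd(1)[OF hY] by (simp add: M.M.minus_eq M.M.a_assoc M.M.l_neg)
  qed
 qed
 show ?thesis
 proof (rule antisym)
  show "len M A X Y \<le> len N A X' Y'"
  proof (rule len_le)
   fix k C assume ch: "asub_chain M A X Y k C"
   have C: "asub M A (C i)" "X \<subseteq> C i" "C i \<subseteq> Y" if "i \<le> k" for i using ch that by (auto simp: asub_chain_def)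
   have "asub_chain N A X' Y' k (\<lambda>i. ?up (C i))"
    unfolding asub_chain_def
   proof (intro conjI allI impI)
    fix i assume i: "i \<le> k"
    show "asub N A (?up (C i))" using N.asub_msum[OF A img X'] C[OF i] by blast
    show "X' \<subseteq> ?up (C i)" using N.msum_right[OF img[OF C(1,3)[OF i]]] Xd(1) by blast
    show "?up (C i) \<subseteq> Y'" unfolding Y'm using C(3)[OF i] by (intro N.msum_mono) auto
   next
    fix i assume i: "i < k"
    have s: "C i \<subset> C (Suc i)" using ch i by (auto simp: asub_chain_def)
    then have "?up (C i) \<subseteq> ?up (C (Suc i))" by (intro N.msum_mono) auto
    moreover have "?up (C i) \<noteq> ?up (C (Suc i))"
    proof
     assume e: "?up (C i) = ?up (C (Suc i))"
     have "i \<le> k" "Suc i \<le> k" using i by simp_all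
     note r = up_rec[OF C(1)[OF this(1)] C(3)[OF this(1)] C(2)[OF this(1)]]
      up_rec[OF C(1)[OF this(2)] C(3)[OF this(2)] C(2)[OF this(2)]]
     have "C i = C (Suc i)" by (rule trans[OF r(1)[symmetric] trans[OF _ r(2)]]) (simp only: e)
     then show False using s by simp
    qed
    ultimately show "?up (C i) \<subset> ?up (C (Suc i))" by blast
   qed
   then show "enat k \<le> len N A X' Y'" by (rule len_ge)
  qed
  show "len N A X' Y' \<le> len M A X Y"
  proof (rule len_le)
   fix k C assume ch: "asub_chain N A X' Y' k C"
   have C: "asub N A (C i)" "X' \<subseteq> C i" "C i \<subseteq> Y'" if "i \<le> k" for i using ch that by (auto simp: asub_chain_def)
   let ?dn = "\<lambda>H. {y \<in> Y. f y \<in> H}"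
   have rec: "C i = ?up (?dn (C i))" if i: "i \<le> k" for i
   proof
    show "C i \<subseteq> ?up (?dn (C i))"
    proof
     fix c assume c: "c \<in> C i"
     then obtain y x where yx: "y \<in> Y" "x \<in> X'" "c = f y \<oplus>\<^sub>N x" using C(3)[OF i] unfolding Y' by blast
     have "c \<ominus>\<^sub>N x = f y" unfolding yx(3) using fc[OF yx(1)] Xd(1)[OF yx(2)] by (rule N.M.plus_minus_r)
     moreover have "c \<ominus>\<^sub>N x \<in> C i" using N.asubD(5)[OF C(1)[OF i] c] C(2)[OF i] yx(2) by blast
     ultimately have "f y \<in> C i" by simp
     then show "c \<in> ?up (?dn (C i))" unfolding yx(3) using yx by (intro N.msumI) auto
    qed
    show "?up (?dn (C i)) \<subseteq> C i" by (rule N.msum_least[OF C(1)[OF i]]) (use C[OF i] in auto)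
   qed
   have "asub_chain M A X Y k (\<lambda>i. ?dn (C i))"
    unfolding asub_chain_def
   proof (intro conjI allI impI)
    fix i assume i: "i \<le> k"
    show "asub M A (?dn (C i))" using pre C[OF i] by blast
    show "X \<subseteq> ?dn (C i)" unfolding X using C(2)[OF i] by blast
    show "?dn (C i) \<subseteq> Y" by blast
   next
    fix i assume i: "i < k"
    have s: "C i \<subset> C (Suc i)" using ch i by (auto simp: asub_chain_def)
    have "?dn (C i) \<noteq> ?dn (C (Suc i))"
    proof
     assume e: "?dn (C i) = ?dn (C (Suc i))"
     have r: "C i = ?up (?dn (C i))" "C (Suc i) = ?up (?dn (C (Suc i)))" using i by (intro rec; simp)+
     have "C i = C (Suc i)" by (rule trans[OF r(1) trans[OF _ r(2)[symmetric]]]) (simp only: e)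
     then show False using s by simp
    qed
    then show "?dn (C i) \<subset> ?dn (C (Suc i))" using s by blast
   qed
   then show "enat k \<le> len M A X Y" by (rule len_ge)
  qed
 qed
qed

section \<open>Finiteness\<close>

context module
begin

lemma pow_shift: "x \<in> carrier R \<Longrightarrow> y \<in> carrier M \<Longrightarrow> x \<odot>\<^sub>M (x [^]\<^bsub>R\<^esub> (k::nat) \<odot>\<^sub>M y) = x [^]\<^bsub>R\<^esub> Suc k \<odot>\<^sub>M y"
 by (simp add: smult_assoc1[symmetric] R.m_comm)

lemma smult_swap: "a \<in> carrier R \<Longrightarrow> b \<in> carrier R \<Longrightarrow> y \<in> carrier M \<Longrightarrow> a \<odot>\<^sub>M (b \<odot>\<^sub>M y) = b \<odot>\<^sub>M (a \<odot>\<^sub>M y)"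
 by (simp add: smult_assoc1[symmetric] R.m_comm)

lemma asub_image_smult:
 assumes A: "A \<subseteq> carrier R" and x: "x \<in> carrier R" and G: "asub M A G"
 shows "asub M A ((\<lambda>g. x \<odot>\<^sub>M g) ` G)"
proof (rule asubI)
 note Gd = asubD[OF G]
 show "(\<lambda>g. x \<odot>\<^sub>M g) ` G \<subseteq> carrier M" using x Gd(1) by auto
 show "\<zero>\<^sub>M \<in> (\<lambda>g. x \<odot>\<^sub>M g) ` G" by (rule image_eqI[OF _ Gd(2)]) (simp add: x)
 fix u a assume "u \<in> (\<lambda>g. x \<odot>\<^sub>M g) ` G"
 then obtain g where g: "g \<in> G" "u = x \<odot>\<^sub>M g" by auto
 note gc = Gd(1)[OF g(1)]
 show "\<ominus>\<^sub>M u \<in> (\<lambda>g. x \<odot>\<^sub>M g) ` G"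
  by (rule image_eqI[OF _ Gd(4)[OF g(1)]]) (simp add: g(2) smult_r_minus x gc)
 show "a \<odot>\<^sub>M u \<in> (\<lambda>g. x \<odot>\<^sub>M g) ` G" if "a \<in> A"
  by (rule image_eqI[OF _ Gd(6)[OF that g(1)]]) (use smult_swap[of a x g] A that x gc g(2) in auto)
 fix v assume "v \<in> (\<lambda>g. x \<odot>\<^sub>M g) ` G"
 then obtain h where h: "h \<in> G" "v = x \<odot>\<^sub>M h" by auto
 show "u \<oplus>\<^sub>M v \<in> (\<lambda>g. x \<odot>\<^sub>M g) ` G"
  by (rule image_eqI[OF _ Gd(3)[OF g(1) h(1)]]) (simp add: g(2) h(2) smult_r_distr x gc Gd(1)[OF h(1)])
qed

text \<open>Polynomials in \<open>x\<close> of degree less than \<open>k\<close> with coefficients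
  in \<open>G\<close>, that is, G + xG + ... + x^(k-1) G; the sum need not be direct.\<close>

primrec pow_layers :: "'a \<Rightarrow> 'c set \<Rightarrow> nat \<Rightarrow> 'c set" where
 "pow_layers x G 0 = {\<zero>\<^sub>M}"
| "pow_layers x G (Suc k) = msum ((\<lambda>g. x [^]\<^bsub>R\<^esub> k \<odot>\<^sub>M g) ` G) (pow_layers x G k)"

lemma asub_zero: "A \<subseteq> carrier R \<Longrightarrow> asub M A {\<zero>\<^sub>M}"
 by (rule asubI) (auto simp: M.a_inv_zero)

lemma pow_layers_asub:
 assumes "A \<subseteq> carrier R" "x \<in> carrier R" "asub M A G"
 shows "asub M A (pow_layers x G k)"
proof (induction k)
 case (Suc k)
 then show ?case using asub_msum[OF assms(1) asub_image_smult[OF assms(1) _ assms(3)] Suc.IH] assms(2) by simp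
qed (simp add: asub_zero assms(1))

lemma pow_layers_Suc_subset:
 assumes "A \<subseteq> carrier R" "x \<in> carrier R" "asub M A G"
 shows "pow_layers x G k \<subseteq> pow_layers x G (Suc k)"
 using msum_right[OF asub_image_smult[OF assms(1) _ assms(3)], of "x [^]\<^bsub>R\<^esub> k" "pow_layers x G k"]
  asubD(1)[OF pow_layers_asub[OF assms]] assms(2) by auto

lemma pow_layers_smult:
 assumes A: "A \<subseteq> carrier R" and x: "x \<in> carrier R" and G: "asub M A G" and u: "u \<in> pow_layers x G k"
 shows "x \<odot>\<^sub>M u \<in> pow_layers x G (Suc k)"
 using u
proof (induction k arbitrary: u)
 case 0
 then have "x \<odot>\<^sub>M u = \<zero>\<^sub>M" using x by simp
 then show ?case using asubD(2)[OF pow_layers_asub[OF A x G, of "Suc 0"]] by simp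
next
 case (Suc k)
 then obtain g v where gv: "g \<in> G" "v \<in> pow_layers x G k" "u = x [^]\<^bsub>R\<^esub> k \<odot>\<^sub>M g \<oplus>\<^sub>M v"
  by (auto elim!: msumE)
 have c: "g \<in> carrier M" "v \<in> carrier M" using asubD(1)[OF G] asubD(1)[OF pow_layers_asub[OF A x G]] gv by auto
 have e: "x \<odot>\<^sub>M u = x [^]\<^bsub>R\<^esub> Suc k \<odot>\<^sub>M g \<oplus>\<^sub>M x \<odot>\<^sub>M v"
  unfolding gv(3) using pow_shift[OF x c(1), of k] c x by (simp add: smult_r_distr)
 show ?case unfolding e pow_layers.simps(2)[of x G "Suc k"]
  by (rule msumI) (use gv(1) Suc.IH[OF gv(2)] in simp_all)
qed

lemma pow_layers_mono:
 assumes "A \<subseteq> carrier R" "x \<in> carrier R" "asub M A G" "k \<le> l"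
 shows "pow_layers x G k \<subseteq> pow_layers x G l"
 using lift_Suc_mono_le[of "pow_layers x G" k l] pow_layers_Suc_subset[OF assms(1-3)] assms(4) by blast

lemma pow_layers_union_asub:
 assumes A: "A \<subseteq> carrier R" and x: "x \<in> carrier R" and G: "asub M A G"
 shows "asub M (insert x A) (\<Union>k. pow_layers x G k)"
proof (rule asubI)
 note pa = pow_layers_asub[OF A x G]
 show "(\<Union>k. pow_layers x G k) \<subseteq> carrier M" using asubD(1)[OF pa] by blast
 show "\<zero>\<^sub>M \<in> (\<Union>k. pow_layers x G k)" using asubD(2)[OF pa] by blast
 fix u a assume "u \<in> (\<Union>k. pow_layers x G k)"
 then obtain k where k: "u \<in> pow_layers x G k" by blast
 show "\<ominus>\<^sub>M u \<in> (\<Union>k. pow_layers x G k)" using asubD(4)[OF pa k] by blast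
 show "a \<odot>\<^sub>M u \<in> (\<Union>k. pow_layers x G k)" if "a \<in> insert x A"
  using that asubD(6)[OF pa _ k] pow_layers_smult[OF A x G k] by blast
 fix v assume "v \<in> (\<Union>k. pow_layers x G k)"
 then obtain l where l: "v \<in> pow_layers x G l" by blast
 have "u \<in> pow_layers x G (max k l)" "v \<in> pow_layers x G (max k l)"
  using pow_layers_mono[OF A x G, of k "max k l"] pow_layers_mono[OF A x G, of l "max k l"] k l by auto
 then show "u \<oplus>\<^sub>M v \<in> (\<Union>k. pow_layers x G k)" using asubD(3)[OF pa] by blast
qed

text \<open>The leading coefficient argument. Representations by powers of \<open>x\<close> are not
  unique, so a leading coefficient in degree \<open>k\<close> means any \<open>g\<close> for which
  x^k g plus lower terms lies in the submodule. These still form \<open>A\<close>-stable subgroups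
  of \<open>G\<close> that increase with \<open>k\<close>.\<close>

lemma acc_adjoin:
 assumes A: "A \<subseteq> carrier R" and x: "x \<in> carrier R" and G: "asub M A G" and acc: "acc M A G"
 shows "acc M (insert x A) (\<Union>k. pow_layers x G k)"
 unfolding acc_def
proof (intro allI impI)
 let ?U = "pow_layers x G"
 note pa = pow_layers_asub[OF A x G]
 note Gd = asubD[OF G]
 fix N assume N: "\<forall>i. asub M (insert x A) (N i) \<and> N i \<subseteq> (\<Union>k. ?U k) \<and> N i \<subseteq> N (Suc i)"
 have Na: "asub M (insert x A) (N i)" and NA: "asub M A (N i)" for i using N unfolding asub_def by blast+
 have Nmono: "N i \<subseteq> N j" if "i \<le> j" for i j using lift_Suc_mono_le[of N i j] that N by auto
 define I where "I k i = {g \<in> G. \<exists>u\<in>?U k. x [^]\<^bsub>R\<^esub> k \<odot>\<^sub>M g \<oplus>\<^sub>M u \<in> N i}" for k i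
 have xk: "x [^]\<^bsub>R\<^esub> (k::nat) \<in> carrier R" for k using x by simp
 have I_asub: "asub M A (I k i)" for k i
 proof (rule asubI)
  show "I k i \<subseteq> carrier M" using Gd(1) by (auto simp: I_def)
  have "x [^]\<^bsub>R\<^esub> k \<odot>\<^sub>M \<zero>\<^sub>M \<oplus>\<^sub>M \<zero>\<^sub>M \<in> N i" using xk asubD(2)[OF Na] by simp
  then show "\<zero>\<^sub>M \<in> I k i" using Gd(2) asubD(2)[OF pa] unfolding I_def by blast
  fix g a assume "g \<in> I k i"
  then obtain u where g: "g \<in> G" "u \<in> ?U k" "x [^]\<^bsub>R\<^esub> k \<odot>\<^sub>M g \<oplus>\<^sub>M u \<in> N i" unfolding I_def by blast
  have c: "g \<in> carrier M" "u \<in> carrier M" using g Gd(1) asubD(1)[OF pa] by auto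
  have "\<ominus>\<^sub>M (x [^]\<^bsub>R\<^esub> k \<odot>\<^sub>M g \<oplus>\<^sub>M u) = x [^]\<^bsub>R\<^esub> k \<odot>\<^sub>M (\<ominus>\<^sub>M g) \<oplus>\<^sub>M \<ominus>\<^sub>M u"
   using c xk by (simp add: smult_r_minus M.minus_add)
  then have "x [^]\<^bsub>R\<^esub> k \<odot>\<^sub>M (\<ominus>\<^sub>M g) \<oplus>\<^sub>M \<ominus>\<^sub>M u \<in> N i" using asubD(4)[OF Na g(3)] by simp
  then show "\<ominus>\<^sub>M g \<in> I k i" using Gd(4)[OF g(1)] asubD(4)[OF pa g(2)] unfolding I_def by blast
  show "a \<odot>\<^sub>M g \<in> I k i" if a: "a \<in> A"
  proof -
   have "a \<odot>\<^sub>M (x [^]\<^bsub>R\<^esub> k \<odot>\<^sub>M g \<oplus>\<^sub>M u) = x [^]\<^bsub>R\<^esub> k \<odot>\<^sub>M (a \<odot>\<^sub>M g) \<oplus>\<^sub>M a \<odot>\<^sub>M u"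
    using c xk a A smult_swap[of a "x [^]\<^bsub>R\<^esub> k" g] by (auto simp: smult_r_distr)
   then have "x [^]\<^bsub>R\<^esub> k \<odot>\<^sub>M (a \<odot>\<^sub>M g) \<oplus>\<^sub>M a \<odot>\<^sub>M u \<in> N i" using asubD(6)[OF NA a g(3)] by simp
   then show ?thesis using Gd(6)[OF a g(1)] asubD(6)[OF pa a g(2)] unfolding I_def by blast
  qed
  fix h assume "h \<in> I k i"
  then obtain v where h: "h \<in> G" "v \<in> ?U k" "x [^]\<^bsub>R\<^esub> k \<odot>\<^sub>M h \<oplus>\<^sub>M v \<in> N i" unfolding I_def by blast
  have d: "h \<in> carrier M" "v \<in> carrier M" using h Gd(1) asubD(1)[OF pa] by auto
  have "(x [^]\<^bsub>R\<^esub> k \<odot>\<^sub>M g \<oplus>\<^sub>M u) \<oplus>\<^sub>M (x [^]\<^bsub>R\<^esub> k \<odot>\<^sub>M h \<oplus>\<^sub>M v) = x [^]\<^bsub>R\<^esub> k \<odot>\<^sub>M (g \<oplus>\<^sub>M h) \<oplus>\<^sub>M (u \<oplus>\<^sub>M v)"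
   using c d xk swap4[of "x [^]\<^bsub>R\<^esub> k \<odot>\<^sub>M g" u "x [^]\<^bsub>R\<^esub> k \<odot>\<^sub>M h" v] by (simp add: smult_r_distr)
  then have "x [^]\<^bsub>R\<^esub> k \<odot>\<^sub>M (g \<oplus>\<^sub>M h) \<oplus>\<^sub>M (u \<oplus>\<^sub>M v) \<in> N i" using asubD(3)[OF Na g(3) h(3)] by simp
  then show "g \<oplus>\<^sub>M h \<in> I k i" using Gd(3)[OF g(1) h(1)] asubD(3)[OF pa g(2) h(2)] unfolding I_def by blast
 qed
 have I_G: "I k i \<subseteq> G" for k i unfolding I_def by blast
 have I_i: "I k i \<subseteq> I k j" if "i \<le> j" for k i j using Nmono[OF that] unfolding I_def by blast
 have I_Suc: "I k i \<subseteq> I (Suc k) i" for k i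
 proof
  fix g assume "g \<in> I k i"
  then obtain u where g: "g \<in> G" "u \<in> ?U k" "x [^]\<^bsub>R\<^esub> k \<odot>\<^sub>M g \<oplus>\<^sub>M u \<in> N i" unfolding I_def by blast
  have c: "g \<in> carrier M" "u \<in> carrier M" using g Gd(1) asubD(1)[OF pa] by auto
  have "x \<odot>\<^sub>M (x [^]\<^bsub>R\<^esub> k \<odot>\<^sub>M g \<oplus>\<^sub>M u) = x [^]\<^bsub>R\<^esub> Suc k \<odot>\<^sub>M g \<oplus>\<^sub>M x \<odot>\<^sub>M u"
   using pow_shift[OF x c(1), of k] c x by (simp add: smult_r_distr)
  then have "x [^]\<^bsub>R\<^esub> Suc k \<odot>\<^sub>M g \<oplus>\<^sub>M x \<odot>\<^sub>M u \<in> N i" using asubD(6)[OF Na insertI1 g(3)] by simp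
  then show "g \<in> I (Suc k) i" using g(1) pow_layers_smult[OF A x G g(2)] unfolding I_def by blast
 qed
 have I_k: "I k i \<subseteq> I l i" if "k \<le> l" for k l i using lift_Suc_mono_le[of "\<lambda>k. I k i" k l] that I_Suc by blast
 have stab: "\<exists>n0. \<forall>n\<ge>n0. J n = J n0" if "\<And>i. asub M A (J i)" "\<And>i. J i \<subseteq> G" "\<And>i. J i \<subseteq> J (Suc i)" for J :: "nat \<Rightarrow> 'c set"
  using acc that unfolding acc_def by blast
 \<comment> \<open>Stability is needed for all degrees \<open>k\<close> at once: the diagonal takes
   care of all \<open>k\<close> beyond \<open>s\<close>, and the finitely many remaining rows are
   stabilised one by one.\<close>
 have "I i i \<subseteq> I (Suc i) (Suc i)" for i using I_i[of i "Suc i" i] I_Suc[of i "Suc i"] by auto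
 then obtain s where s: "\<forall>n\<ge>s. I n n = I s s" using stab[of "\<lambda>i. I i i", OF I_asub I_G] by blast
 have "\<forall>k. \<exists>n0. \<forall>n\<ge>n0. I k n = I k n0"
  by (intro allI stab I_asub I_G I_i) simp
 then obtain m where m: "\<And>k n. n \<ge> m k \<Longrightarrow> I k n = I k (m k)" by metis
 define n0 where "n0 = Max (insert s (m ` {..s}))"
 have n0: "s \<le> n0" "\<And>k. k \<le> s \<Longrightarrow> m k \<le> n0" unfolding n0_def by (rule Max_ge; simp)+
 have Ieq: "I k n = I k n0" if n: "n \<ge> n0" for k n
 proof (cases "k \<le> s")
  case True then show ?thesis using m[of k n] m[of k n0] n0 n by (metis le_trans)
 next
  case False
  have "I k l = I s s" if l: "l \<ge> s" for l
  proof
   let ?p = "max k l"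
   have "I k l \<subseteq> I ?p ?p" using I_k[of k ?p l] I_i[of l ?p ?p] by auto
   then show "I k l \<subseteq> I s s" using s False by (metis max.coboundedI1 nat_le_linear)
   show "I s s \<subseteq> I k l" using I_k[of s k s] I_i[of s l k] False l by auto
  qed
  then show ?thesis using n0 n by (metis le_trans)
 qed
 have "N n = N n0" if n: "n \<ge> n0" for n
 proof
  show "N n0 \<subseteq> N n" by (rule Nmono[OF n])
  \<comment> \<open>Subtracting an element of \<open>N n0\<close> with the same leading coefficient
    leaves an element of smaller degree.\<close>
  have "y \<in> N n0" if "y \<in> N n" "y \<in> ?U k" for y k
   using that
  proof (induction k arbitrary: y)
   case 0 then show ?case using asubD(2)[OF Na] by simp
  next
   case (Suc k)
   then obtain g v where gv: "g \<in> G" "v \<in> ?U k" "y = x [^]\<^bsub>R\<^esub> k \<odot>\<^sub>M g \<oplus>\<^sub>M v"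
    by (auto elim!: msumE)
   then have "g \<in> I k n" using Suc.prems(1) unfolding I_def by blast
   then have "g \<in> I k n0" using Ieq[OF n] by simp
   then obtain w where w: "w \<in> ?U k" "x [^]\<^bsub>R\<^esub> k \<odot>\<^sub>M g \<oplus>\<^sub>M w \<in> N n0" unfolding I_def by blast
   let ?y = "x [^]\<^bsub>R\<^esub> k \<odot>\<^sub>M g \<oplus>\<^sub>M w"
   have c: "x [^]\<^bsub>R\<^esub> k \<odot>\<^sub>M g \<in> carrier M" "v \<in> carrier M" "w \<in> carrier M"
    using gv w Gd(1) asubD(1)[OF pa] xk by auto
   have e: "y \<ominus>\<^sub>M ?y = v \<ominus>\<^sub>M w"
   proof -
    have "y \<ominus>\<^sub>M ?y = (x [^]\<^bsub>R\<^esub> k \<odot>\<^sub>M g \<oplus>\<^sub>M v) \<oplus>\<^sub>M (\<ominus>\<^sub>M (x [^]\<^bsub>R\<^esub> k \<odot>\<^sub>M g) \<oplus>\<^sub>M \<ominus>\<^sub>M w)"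
     using c by (simp add: gv(3) M.minus_eq M.minus_add)
    also have "\<dots> = v \<ominus>\<^sub>M w" using c by (subst swap4) (simp_all add: M.r_neg M.minus_eq)
    finally show ?thesis .
   qed
   have "?y \<in> N n" using w(2) Nmono[OF n] by blast
   then have "v \<ominus>\<^sub>M w \<in> N n" using asubD(5)[OF Na Suc.prems(1)] e by metis
   moreover have "v \<ominus>\<^sub>M w \<in> ?U k" using asubD(5)[OF pa gv(2) w(1)] .
   ultimately have "v \<ominus>\<^sub>M w \<in> N n0" by (rule Suc.IH)
   then have "(y \<ominus>\<^sub>M ?y) \<oplus>\<^sub>M ?y \<in> N n0" using asubD(3)[OF Na _ w(2)] e by simp
   moreover have "(y \<ominus>\<^sub>M ?y) \<oplus>\<^sub>M ?y = y" using c gv(3) by (intro M.minus_plus) auto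
   ultimately show ?case by simp
  qed
  then show "N n \<subseteq> N n0" using N by blast
 qed
 then show "\<exists>n0. \<forall>n\<ge>n0. N n = N n0" by blast
qed

lemma acc_subset: "acc M A Y \<Longrightarrow> Z \<subseteq> Y \<Longrightarrow> acc M A Z"
 unfolding acc_def by (meson subset_trans)

lemma acc_aspan_adjoin:
 assumes A: "A \<subseteq> carrier R" and x: "x \<in> carrier R" and S: "S \<subseteq> carrier M" and acc: "acc M A (aspan M A S)"
 shows "acc M (insert x A) (aspan M (insert x A) S)"
proof (rule acc_subset[OF acc_adjoin[OF A x aspan_asub[OF S A] acc]])
 have "aspan M A S \<subseteq> pow_layers x (aspan M A S) (Suc 0)"
 proof
  fix y assume y: "y \<in> aspan M A S"
  then have "y \<in> carrier M" using asubD(1)[OF aspan_asub[OF S A]] by blast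
  then have "x [^]\<^bsub>R\<^esub> (0::nat) \<odot>\<^sub>M y \<oplus>\<^sub>M \<zero>\<^sub>M = y" by simp
  moreover have "x [^]\<^bsub>R\<^esub> (0::nat) \<odot>\<^sub>M y \<oplus>\<^sub>M \<zero>\<^sub>M \<in> pow_layers x (aspan M A S) (Suc 0)"
   unfolding pow_layers.simps using y by (intro msumI) auto
  ultimately show "y \<in> pow_layers x (aspan M A S) (Suc 0)" by simp
 qed
 then have "S \<subseteq> (\<Union>k. pow_layers x (aspan M A S) k)" using aspan_incl[of S A] by blast
 then show "aspan M (insert x A) S \<subseteq> (\<Union>k. pow_layers x (aspan M A S) k)"
  by (rule aspan_least[OF pow_layers_union_asub[OF A x aspan_asub[OF S A]]])
qed

lemma acc_aspan_finite_adjoin: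
 assumes A: "A \<subseteq> carrier R" and S: "S \<subseteq> carrier M" and acc: "acc M A (aspan M A S)"
 shows "finite X \<Longrightarrow> X \<subseteq> carrier R \<Longrightarrow> acc M (X \<union> A) (aspan M (X \<union> A) S)"
proof (induction X rule: finite_induct)
 case (insert x X)
 then show ?case using acc_aspan_adjoin[of "X \<union> A" x S] A S by auto
qed (simp add: acc)

text \<open>The scalars that map \<open>H\<close> into itself are closed under the operations
  generating the ring.\<close>

lemma asub_generate_ring:
 assumes B: "B \<subseteq> carrier R" and gen: "generate_ring R B = carrier R" and H: "asub M B H"
 shows "asub M (carrier R) H"
proof -
 note Hd = asubD[OF H]
 have "\<forall>h\<in>H. a \<odot>\<^sub>M h \<in> H" if "a \<in> generate_ring R B" for a
  using that
 proof (induction rule: generate_ring.induct)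
  case one then show ?case using Hd(1) by simp
 next
  case (incl a) then show ?case using Hd(6) by blast
 next
  case (a_inv a)
  then have "a \<in> carrier R" using gen by simp
  then show ?case using a_inv Hd(1,4) by (simp add: smult_l_minus)
 next
  case (eng_add a b)
  then have "a \<in> carrier R" "b \<in> carrier R" using gen by simp_all
  then show ?case using eng_add Hd(1,3) by (simp add: smult_l_distr)
 next
  case (eng_mult a b)
  then have "a \<in> carrier R" "b \<in> carrier R" using gen by simp_all
  then show ?case using eng_mult Hd(1) by (simp add: smult_assoc1)
 qed
 then show ?thesis using gen H unfolding asub_def by blast
qed

lemma asub_mono_ops: "B \<subseteq> A \<Longrightarrow> asub M A H \<Longrightarrow> asub M B H" unfolding asub_def by blast

text \<open>The chain condition is assumed only for the span of the generators over
  \<open>A\<close>, later the degree zero part; the finitely many ring generators are then adjoined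
  one at a time.\<close>

lemma noetherian_module:
 assumes A: "A \<subseteq> carrier R" and X: "finite X" "X \<subseteq> carrier R" and gen: "generate_ring R (A \<union> X) = carrier R"
  and S: "S \<subseteq> carrier M" "aspan M (carrier R) S = carrier M" and acc: "acc M A (aspan M A S)"
 shows "acc M (carrier R) (carrier M)"
proof -
 have AX: "X \<union> A \<subseteq> carrier R" "generate_ring R (X \<union> A) = carrier R" using A X gen by (auto simp: Un_commute)
 have eq: "asub M (X \<union> A) H \<longleftrightarrow> asub M (carrier R) H" for H
  using asub_generate_ring[OF AX] asub_mono_ops[OF AX(1)] by blast
 have "aspan M (X \<union> A) S = carrier M" using S(2) unfolding aspan_def eq .
 then have "acc M (X \<union> A) (carrier M)" using acc_aspan_finite_adjoin[OF A S(1) acc X] by simp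
 then show ?thesis unfolding acc_def eq .
qed

lemma submodule_asub: "submodule H R M \<longleftrightarrow> asub M (carrier R) H"
 unfolding submodule_def submodule_axioms_def asub_def additive_subgroup_def by auto

end

lemma enat_le_finite: "a \<le> b \<Longrightarrow> b \<noteq> \<infinity> \<Longrightarrow> a \<noteq> (\<infinity>::enat)"
 by (auto dest: enat_ile)

section \<open>Artinian rings have finite length\<close>

context graded_ring_loc
begin

abbreviation "R0 \<equiv> rdeg R 0"
abbreviation "Rmod \<equiv> shifted_ring R 0"

lemma R0_carrier: "R0 \<subseteq> carrier R" using rd.piece_carrier by blast
lemma R0_mult: "a \<in> R0 \<Longrightarrow> b \<in> R0 \<Longrightarrow> a \<otimes> b \<in> R0" using mult_deg[of a 0 b 0] by simp
lemma R0_pow: "a \<in> R0 \<Longrightarrow> a [^] (n::nat) \<in> R0" by (induction n) (auto simp: one_deg R0_mult)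

lemma Rmod_neg: "\<ominus>\<^sub>Rmod x = \<ominus> x"
 using a_inv_cong[of Rmod R] by simp

lemma degree_zero_ideal:
 assumes cr: "cring (degree_zero_ring R)" and J: "asub Rmod R0 J" "J \<subseteq> R0"
 shows "ideal J (degree_zero_ring R)"
proof -
 interpret Z: cring "degree_zero_ring R" by fact
 interpret S: module R Rmod by (rule shifted_ring_module)
 have simps: "carrier (degree_zero_ring R) = R0" "add (degree_zero_ring R) = add R" "zero (degree_zero_ring R) = zero R"
  "monoid.mult (degree_zero_ring R) = monoid.mult R" by (simp_all add: degree_zero_ring_def)
 note Jd = S.asubD[OF J(1), simplified Rmod_neg shifted_ring_simps]
 have neg: "\<ominus>\<^bsub>degree_zero_ring R\<^esub> x = \<ominus> x" if "x \<in> J" for x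
  by (rule Z.minus_equality) (use that J(2) Jd in \<open>auto simp: simps R.l_neg\<close>)
 have "additive_subgroup J (degree_zero_ring R)"
  by (rule Z.add_subgroupI) (use J(2) Jd neg in \<open>simp_all add: simps\<close>)
 then have sg: "subgroup J (add_monoid (degree_zero_ring R))" by (simp add: additive_subgroup_def)
 have l: "x \<otimes> a \<in> J" if "a \<in> J" "x \<in> R0" for a x using Jd(6)[OF that(2,1)] .
 have r: "a \<otimes> x \<in> J" if "a \<in> J" "x \<in> R0" for a x
  using l[OF that] m_comm[of a x] Jd(1)[OF that(1)] that(2) R0_carrier by auto
 show ?thesis by (rule idealI[OF Z.ring_axioms sg]) (unfold simps, fact l, fact r)
qed

lemma artinian_minimal:
 assumes art: "artinian_ring (degree_zero_ring R)"
  and F: "I0 \<in> F" "\<And>J. J \<in> F \<Longrightarrow> asub Rmod R0 J \<and> J \<subseteq> R0"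
 obtains I where "I \<in> F" "\<And>J. J \<in> F \<Longrightarrow> \<not> J \<subset> I"
proof -
 have "\<exists>I\<in>F. \<forall>J\<in>F. \<not> J \<subset> I"
 proof (rule ccontr)
  assume "\<not> ?thesis"
  then have step: "\<forall>I\<in>F. \<exists>J\<in>F. J \<subset> I" by blast
  have "\<exists>f. \<forall>n::nat. f n \<in> F \<and> f (Suc n) \<subset> f n"
   by (rule dependent_nat_choice[where P="\<lambda>_ H. H \<in> F" and Q="\<lambda>_ H K. K \<subset> H"])
    (use F(1) step in blast)+
  then obtain f where f: "\<And>n::nat. f n \<in> F \<and> f (Suc n) \<subset> f n" by blast
  have cr: "cring (degree_zero_ring R)" using art by (simp add: artinian_ring_def)
  have "\<forall>n. ideal (f n) (degree_zero_ring R) \<and> f (Suc n) \<subseteq> f n"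
  proof (intro allI conjI)
   fix n
   have "f n \<in> F" using f by blast
   then have "asub Rmod R0 (f n)" "f n \<subseteq> R0" using F(2) by simp_all
   then show "ideal (f n) (degree_zero_ring R)" by (rule degree_zero_ideal[OF cr])
   show "f (Suc n) \<subseteq> f n" using f by (simp add: psubset_imp_subset)
  qed
  moreover have "(\<forall>n. ideal (f n) (degree_zero_ring R) \<and> f (Suc n) \<subseteq> f n) \<longrightarrow> (\<exists>n0. \<forall>n\<ge>n0. f n = f n0)"
   by (rule spec[OF conjunct2[OF art[unfolded artinian_ring_def]], of f])
  ultimately obtain n0 where n0: "\<forall>n\<ge>n0. f n = f n0" by (elim impE exE) assumption
  have "f (Suc n0) = f n0" using spec[OF n0, of "Suc n0"] by simp
  then show False using f[of n0] by simp
 qed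
 then show ?thesis using that by blast
qed

text \<open>Akizuki's argument: an ideal \<open>I\<close> that is minimal among those of infinite length satisfies
 \<open>aI = I\<close> or \<open>aI = 0\<close> for every \<open>a\<close>, so it is a vector space over a field all of whose proper
 subspaces have finite length, which is absurd.\<close>

lemma artinian_finite_length:
 assumes art: "artinian_ring (degree_zero_ring R)"
 shows "len Rmod R0 {\<zero>} R0 \<noteq> \<infinity>"
proof
 assume inf: "len Rmod R0 {\<zero>} R0 = \<infinity>"
 interpret S: module R Rmod by (rule shifted_ring_module)
 note Sd = S.asubD[simplified Rmod_neg shifted_ring_simps]
 have R0s: "asub Rmod R0 R0"
  by (rule S.asubI) (use rd.piece_carrier rd.piece_zero rd.piece_add rd.piece_neg R0_mult in \<open>auto simp: Rmod_neg\<close>)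
 have zs: "asub Rmod R0 {\<zero>}" using S.asub_zero[OF R0_carrier] by simp
 \<comment> \<open>Ideals of infinite length; the descending chain condition provides a minimal one,
   whose proper subideals all have finite length.\<close>
 let ?F = "{I. asub Rmod R0 I \<and> I \<subseteq> R0 \<and> len Rmod R0 {\<zero>} I = \<infinity>}"
 obtain I where "I \<in> ?F" and min: "\<And>J. J \<in> ?F \<Longrightarrow> \<not> J \<subset> I"
  by (rule artinian_minimal[OF art, of R0 ?F]) (use R0s inf in auto)
 then have I: "asub Rmod R0 I" "I \<subseteq> R0" "len Rmod R0 {\<zero>} I = \<infinity>" by auto
 note Id = Sd[OF I(1)]
 have z_sub: "{\<zero>} \<subseteq> J" if "asub Rmod R0 J" for J using Sd(2)[OF that] by simp
 have proper: "len Rmod R0 {\<zero>} J \<noteq> \<infinity>" if J: "asub Rmod R0 J" "J \<subset> I" for J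
 proof
  assume "len Rmod R0 {\<zero>} J = \<infinity>"
  moreover have "J \<subseteq> R0" using J(2) I(2) by blast
  ultimately have "J \<in> ?F" using J(1) by simp
  then show False using min J(2) by blast
 qed
 \<comment> \<open>If multiplication by \<open>a\<close> is not zero on \<open>I\<close>, its kernel
   is proper and hence of finite length; the image then has infinite length and equals
   \<open>I\<close> by minimality.\<close>
 have dich: "(\<lambda>y. a \<otimes> y) ` I = I \<or> (\<forall>y\<in>I. a \<otimes> y = \<zero>)" if a: "a \<in> R0" for a
 proof (rule disjCI)
  assume nz: "\<not> (\<forall>y\<in>I. a \<otimes> y = \<zero>)"
  have ac: "a \<in> carrier R" using a R0_carrier by blast
  let ?J = "(\<lambda>y. a \<otimes> y) ` I" and ?K = "{y \<in> I. a \<otimes> y \<in> {\<zero>}}"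
  have J: "asub Rmod R0 ?J" using S.asub_image_smult[OF R0_carrier ac I(1)] by simp
  have JI: "?J \<subseteq> I" using Id(6) a by auto
  have K: "asub Rmod R0 ?K"
   by (rule S.asubI) (use Id ac R0_carrier R.m_lcomm[of a] in \<open>auto simp: Rmod_neg r_distr r_minus subset_iff\<close>)
  have lenK: "len Rmod R0 ?K I = len Rmod R0 {\<zero>} ?J"
  proof (rule len_iso[OF shifted_ring_module shifted_ring_module R0_carrier I(1) zs, of "\<lambda>y. a \<otimes> y"])
   show "?J = {a \<otimes> y \<oplus>\<^sub>Rmod x |y x. y \<in> I \<and> x \<in> {\<zero>}}"
    unfolding image_def using Id(1) ac by (intro Collect_cong) (metis R.m_closed R.r_zero shifted_ring_simps(3) singleton_iff)
  qed (use ac Id(1) R0_carrier in \<open>auto simp: r_distr m_lcomm subset_iff\<close>)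
  have "len Rmod R0 {\<zero>} I = len Rmod R0 {\<zero>} ?K + len Rmod R0 ?K I"
   using S.len_add[OF R0_carrier _ _ zs K I(1)] z_sub[OF K] by auto
  moreover have "?K \<subset> I" using nz by auto
  ultimately have "len Rmod R0 {\<zero>} ?J = \<infinity>" using proper[OF K] I(3) lenK by auto
  then show "?J = I" using proper[OF J] JI by blast
 qed
 have "I \<noteq> {\<zero>}" using I(3) S.len_zero_iff[OF zs zs] by auto
 then obtain v where v: "v \<in> I" "v \<noteq> \<zero>" using Id(2) by auto
 \<comment> \<open>Zorn's lemma gives a submodule maximal among those missing \<open>v\<close>. At
   this point \<open>I\<close> is not known to be finitely generated, so a maximal proper submodule
   has to be obtained in this indirect way.\<close>
 let ?G = "{H. asub Rmod R0 H \<and> H \<subseteq> I \<and> v \<notin> H}"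
 have "\<exists>H\<in>?G. \<forall>K\<in>?G. H \<subseteq> K \<longrightarrow> K = H"
 proof (rule subset_Zorn_nonempty)
  show "?G \<noteq> {}" using zs v Id(2) by auto
  fix C assume C: "C \<noteq> {}" "subset.chain ?G C"
  then have CG: "\<And>K. K \<in> C \<Longrightarrow> K \<in> ?G" and lin: "\<And>K L. K \<in> C \<Longrightarrow> L \<in> C \<Longrightarrow> K \<subseteq> L \<or> L \<subseteq> K"
   unfolding subset_chain_def by auto
  have Cs: "asub Rmod R0 K" if "K \<in> C" for K using CG[OF that] by simp
  have "asub Rmod R0 (\<Union>C)"
  proof (rule S.asubI)
   show "\<Union>C \<subseteq> carrier Rmod" using S.asubD(1)[OF Cs] by blast
   show "\<zero>\<^sub>Rmod \<in> \<Union>C" using S.asubD(2)[OF Cs] C(1) by blast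
   show "\<ominus>\<^sub>Rmod x \<in> \<Union>C" if "x \<in> \<Union>C" for x using that S.asubD(4)[OF Cs] by blast
   show "a \<odot>\<^sub>Rmod x \<in> \<Union>C" if "a \<in> R0" "x \<in> \<Union>C" for a x using that S.asubD(6)[OF Cs] by blast
   show "x \<oplus>\<^sub>Rmod y \<in> \<Union>C" if xy: "x \<in> \<Union>C" "y \<in> \<Union>C" for x y
   proof -
    obtain K L where "K \<in> C" "L \<in> C" "x \<in> K" "y \<in> L" using xy by blast
    then show ?thesis using lin[of K L] S.asubD(3)[OF Cs] by blast
   qed
  qed
  then show "\<Union>C \<in> ?G" using CG by blast
 qed
 then obtain H where "H \<in> ?G" and maxH': "\<forall>K\<in>?G. H \<subseteq> K \<longrightarrow> K = H" by (rule bexE)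
 have maxH: "K = H" if "K \<in> ?G" "H \<subseteq> K" for K using bspec[OF maxH' that(1)] that(2) by (rule mp)
 from \<open>H \<in> ?G\<close> have H: "asub Rmod R0 H" "H \<subseteq> I" "v \<notin> H" by simp_all
 note Hd = Sd[OF H(1)]
 \<comment> \<open>Everything strictly above \<open>H\<close> contains \<open>v\<close>; showing
   that it then contains an arbitrary \<open>u\<close> of \<open>I\<close> leaves no room between
   \<open>H\<close> and \<open>I\<close>.\<close>
 have full: "N = I" if N: "asub Rmod R0 N" "H \<subset> N" "N \<subseteq> I" for N
 proof
  note Nd = Sd[OF N(1)]
  have vN: "v \<in> N" using maxH[of N] N by auto
  show "I \<subseteq> N"
  proof
   fix u assume u: "u \<in> I"
   show "u \<in> N"
   proof (cases "u \<in> H")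
    case True then show ?thesis using N(2) by auto
   next
    case False
    have uc: "u \<in> carrier R" using Id(1) u by blast
    let ?K = "S.msum H ((\<lambda>a. u \<odot>\<^sub>Rmod a) ` R0)"
    have Ru: "asub Rmod R0 ((\<lambda>a. u \<odot>\<^sub>Rmod a) ` R0)" using S.asub_image_smult[OF R0_carrier uc R0s] .
    have K: "asub Rmod R0 ?K" by (rule S.asub_msum[OF R0_carrier H(1) Ru])
    have "u \<otimes> \<one> \<in> (\<lambda>a. u \<odot>\<^sub>Rmod a) ` R0" using one_deg by simp
    then have "u \<in> ?K" using S.msum_right[OF H(1)] S.asubD(1)[OF Ru] uc by auto
    moreover have "(\<lambda>a. u \<odot>\<^sub>Rmod a) ` R0 \<subseteq> I" using Id(6) u R0_carrier uc by (auto simp: m_comm subset_iff)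
    then have "?K \<subseteq> I" by (rule S.msum_least[OF I(1) H(2)])
    moreover have "H \<subseteq> ?K" using S.msum_left[OF Ru] S.asubD(1)[OF H(1)] by blast
    ultimately have "v \<in> ?K" using maxH[of ?K] K False by blast
    then obtain h a where ha: "h \<in> H" "a \<in> R0" "v = h \<oplus> u \<otimes> a" by (auto elim!: S.msumE)
    have ac: "a \<in> carrier R" using ha(2) R0_carrier by blast
    have hc: "h \<in> carrier R" using ha(1) Hd(1) by blast
    have au: "a \<otimes> u \<in> N"
    proof -
     have "v \<ominus> h = u \<otimes> a" unfolding ha(3) using hc uc ac by (intro R.plus_minus_l) auto
     moreover have "v \<oplus> \<ominus> h \<in> N" using Nd(3)[OF vN Nd(4)] ha(1) N(2) by blast
     ultimately show ?thesis using uc ac by (simp add: R.minus_eq m_comm)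
    qed
    \<comment> \<open>If \<open>au\<close> were zero, \<open>v = h + ua\<close> would lie in
      \<open>H\<close>. So \<open>a\<close> does not annihilate \<open>I\<close> and multiplication
      by \<open>a\<close> maps \<open>I\<close> onto itself.\<close>
    have aI: "(\<lambda>y. a \<otimes> y) ` I = I"
    proof (rule ccontr)
     assume "\<not> ?thesis"
     then have "a \<otimes> u = \<zero>" using dich[OF ha(2)] u by blast
     then show False using ha hc uc ac H(3) by (simp add: m_comm)
    qed
    have powI: "\<exists>y\<in>I. u' = a [^] n \<otimes> y" if "u' \<in> I" for u' and n :: nat
     using that
    proof (induction n arbitrary: u')
     case 0 then show ?case using Id(1) by auto
    next
     case (Suc n)
     obtain w where w: "w \<in> I" "u' = a [^] n \<otimes> w" using Suc by blast
     obtain y where y: "y \<in> I" "w = a \<otimes> y" using aI w(1) by blast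
     show ?case using w y Id(1)[OF y(1)] ac by (auto simp: m_assoc intro!: bexI[of _ y])
    qed
    \<comment> \<open>The ideals generated by the powers of \<open>a\<close> become stationary, so
      a^n = a^(n+1) b for some n and b. As \<open>u\<close> is a^n times an element of
      \<open>I\<close>, this gives u = b(au), and \<open>au\<close> is already in
      \<open>N\<close>.\<close>
    define P where "P n = (\<lambda>y. (a [^] n) \<odot>\<^sub>Rmod y) ` R0" for n :: nat
    have P_in: "y \<in> P n \<longleftrightarrow> (\<exists>c\<in>R0. y = a [^] n \<otimes> c)" for y n unfolding P_def by auto
    have Pa: "asub Rmod R0 (P n)" "P n \<subseteq> R0" for n
     unfolding P_def
     using S.asub_image_smult[OF R0_carrier _ R0s, of "a [^] n"] ac R0_mult R0_pow[OF ha(2)] by simp_all blast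
    have Pr: "asub Rmod R0 J \<and> J \<subseteq> R0" if J: "J \<in> range P" for J
    proof -
     from J obtain n where "J = P n" by (rule imageE)
     then show ?thesis using Pa[of n] by simp
    qed
    obtain J where J: "J \<in> range P" and Jm: "\<And>J'. J' \<in> range P \<Longrightarrow> \<not> J' \<subset> J"
     using artinian_minimal[OF art rangeI[of P 0] Pr] by metis
    from J(1) obtain n where "J = P n" by (rule imageE)
    then have n: "\<not> P l \<subset> P n" for l using Jm[OF rangeI[of P l]] by simp
    have "P (Suc n) \<subseteq> P n"
    proof
     fix y assume "y \<in> P (Suc n)"
     then obtain c where c: "c \<in> R0" "y = a [^] Suc n \<otimes> c" unfolding P_in by (rule bexE)
     then have "y = a [^] n \<otimes> (a \<otimes> c)" using ac R0_carrier by (simp add: m_assoc subset_iff)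
     then show "y \<in> P n" unfolding P_in using R0_mult[OF ha(2) c(1)] by (intro bexI)
    qed
    then have "P (Suc n) = P n" using n[of "Suc n"] by blast
    moreover have "a [^] n \<otimes> \<one> \<in> P n" unfolding P_in using one_deg by (intro bexI[of _ \<one>]) simp_all
    ultimately have "a [^] n \<otimes> \<one> \<in> P (Suc n)" by simp
    then obtain b where b: "b \<in> R0" "a [^] n = a [^] Suc n \<otimes> b" unfolding P_in using ac by auto
    have bc: "b \<in> carrier R" using b R0_carrier by blast
    obtain y where y: "y \<in> I" "u = a [^] n \<otimes> y" using powI[OF u] by blast
    have yc: "y \<in> carrier R" using y Id(1) by blast
    have "b \<otimes> (a \<otimes> u) = (a [^] Suc n \<otimes> b) \<otimes> y" unfolding y(2) using ac bc yc by (simp add: m_ac)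
    also have "\<dots> = u" using b(2) y(2) by simp
    finally show "u \<in> N" using Nd(6)[OF b(1) au] by simp
   qed
  qed
 qed fact
 \<comment> \<open>\<open>I\<close> has length at most one over \<open>H\<close>, and
   \<open>H\<close> has finite length, which contradicts the choice of \<open>I\<close>.\<close>
 have "len Rmod R0 H I \<le> 1"
 proof (rule len_le)
  fix k N assume ch: "asub_chain Rmod R0 H I k N"
  show "enat k \<le> 1"
  proof (rule ccontr)
   assume "\<not> ?thesis"
   then have k: "2 \<le> k" by (simp add: one_enat_def)
   have s: "N 0 \<subset> N (Suc 0)" "N (Suc 0) \<subset> N (Suc (Suc 0))" using ch k unfolding asub_chain_def by auto
   have N1: "asub Rmod R0 (N (Suc 0))" "N (Suc 0) \<subseteq> I" "H \<subseteq> N 0" "N (Suc (Suc 0)) \<subseteq> I"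
    using ch k unfolding asub_chain_def by auto
   have "H \<subset> N (Suc 0)" using N1(3) s(1) by blast
   then have "N (Suc 0) = I" using full N1 by blast
   then show False using s(2) N1(4) by blast
  qed
 qed
 then obtain l where l: "len Rmod R0 H I = enat l" by (cases "len Rmod R0 H I") (auto simp: one_enat_def)
 moreover have "len Rmod R0 {\<zero>} I = len Rmod R0 {\<zero>} H + len Rmod R0 H I"
  using S.len_add[OF R0_carrier z_sub[OF H(1)] H(2) zs H(1) I(1)] .
 moreover have "len Rmod R0 {\<zero>} H \<noteq> \<infinity>" using proper[OF H(1)] H(2,3) v(1) by blast
 ultimately show False using I(3) by auto
qed

end

section \<open>Finiteness of homogeneous components and of torsion\<close>

context graded_module_loc
begin

text \<open>One more generator \<open>u\<close> enlarges the span by a quotient of the degree zero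
  part, namely modulo the scalars that send \<open>u\<close> into the previous span.\<close>

lemma finite_length_span:
 assumes fl: "len Rmod R0 {\<zero>} R0 \<noteq> \<infinity>" and S: "finite S" "S \<subseteq> carrier M"
 shows "len M R0 {\<zero>\<^sub>M} (aspan M R0 S) \<noteq> \<infinity>"
 using S
proof (induction S rule: finite_induct)
 case empty
 have z: "asub M R0 {\<zero>\<^sub>M}" by (rule asub_zero[OF R0_carrier])
 have "aspan M R0 {} = {\<zero>\<^sub>M}"
  using aspan_least[OF z, of "{}"] asubD(2)[OF aspan_asub[of "{}" R0]] R0_carrier by auto
 then show ?case using len_zero_iff[OF z z] by simp
next
 case (insert u S)
 have uc: "u \<in> carrier M" and Sc: "S \<subseteq> carrier M" using insert by auto
 interpret S: module R Rmod by (rule shifted_ring_module)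
 have R0s: "asub Rmod R0 R0"
  by (rule S.asubI) (use rd.piece_carrier rd.piece_zero rd.piece_add rd.piece_neg R0_mult in \<open>auto simp: Rmod_neg\<close>)
 have z: "asub M R0 {\<zero>\<^sub>M}" by (rule asub_zero[OF R0_carrier])
 let ?X = "aspan M R0 S" and ?Y = "{a \<odot>\<^sub>M u \<oplus>\<^sub>M x |a x. a \<in> R0 \<and> x \<in> aspan M R0 S}"
 let ?K = "{a \<in> R0. a \<odot>\<^sub>M u \<in> ?X}"
 have X: "asub M R0 ?X" by (rule aspan_asub[OF Sc R0_carrier])
 have "len Rmod R0 ?K R0 = len M R0 ?X ?Y"
  by (rule len_iso[OF shifted_ring_module module_axioms R0_carrier R0s X, of "\<lambda>a. a \<odot>\<^sub>M u"])
   (use uc R0_carrier in \<open>auto simp: smult_l_distr smult_assoc1 subset_iff\<close>)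
 moreover have "len Rmod R0 ?K R0 \<le> len Rmod R0 {\<zero>} R0"
  by (rule S.len_anti) (use rd.piece_zero uc asubD(2)[OF X] in auto)
 ultimately have XY: "len M R0 ?X ?Y \<noteq> \<infinity>" using enat_le_finite[OF _ fl] by simp
 have Ru: "asub M R0 ((\<lambda>a. a \<odot>\<^sub>M u) ` R0)"
 proof (rule asubI)
  have im: "a \<odot>\<^sub>M u \<in> (\<lambda>a. a \<odot>\<^sub>M u) ` R0" if "a \<in> R0" for a using that by blast
  show "(\<lambda>a. a \<odot>\<^sub>M u) ` R0 \<subseteq> carrier M" using uc R0_carrier by auto
  show "\<zero>\<^sub>M \<in> (\<lambda>a. a \<odot>\<^sub>M u) ` R0" using im[OF rd.piece_zero] uc by simp
  fix x y assume "x \<in> (\<lambda>a. a \<odot>\<^sub>M u) ` R0"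
  then obtain a where a: "a \<in> R0" "a \<in> carrier R" "x = a \<odot>\<^sub>M u" using R0_carrier by blast
  show "\<ominus>\<^sub>M x \<in> (\<lambda>a. a \<odot>\<^sub>M u) ` R0" using im[OF rd.piece_neg[OF a(1)]] uc a by (simp add: smult_l_minus)
  show "b \<odot>\<^sub>M x \<in> (\<lambda>a. a \<odot>\<^sub>M u) ` R0" if b: "b \<in> R0" for b
   using im[OF R0_mult[OF b a(1)]] uc a b R0_carrier by (simp add: smult_assoc1 subset_iff)
  assume "y \<in> (\<lambda>a. a \<odot>\<^sub>M u) ` R0"
  then obtain b where b: "b \<in> R0" "b \<in> carrier R" "y = b \<odot>\<^sub>M u" using R0_carrier by blast
  show "x \<oplus>\<^sub>M y \<in> (\<lambda>a. a \<odot>\<^sub>M u) ` R0" using im[OF rd.piece_add[OF a(1) b(1)]] uc a b by (simp add: smult_l_distr)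
 qed
 have Ye: "?Y = msum ((\<lambda>a. a \<odot>\<^sub>M u) ` R0) ?X" unfolding msum_def by blast
 have Y: "asub M R0 ?Y" unfolding Ye by (rule asub_msum[OF R0_carrier Ru X])
 have XsY: "?X \<subseteq> ?Y" unfolding Ye using msum_right[OF Ru] asubD(1)[OF X] by blast
 have "\<one> \<odot>\<^sub>M u \<in> (\<lambda>a. a \<odot>\<^sub>M u) ` R0" using one_deg by blast
 then have "u \<in> ?Y" unfolding Ye using msum_left[OF X, of "(\<lambda>a. a \<odot>\<^sub>M u) ` R0"] asubD(1)[OF Ru] uc by auto
 then have "insert u S \<subseteq> ?Y" using XsY aspan_incl[of S R0] by blast
 then have "aspan M R0 (insert u S) \<subseteq> ?Y" by (rule aspan_least[OF Y])
 then have "len M R0 {\<zero>\<^sub>M} (aspan M R0 (insert u S)) \<le> len M R0 {\<zero>\<^sub>M} ?Y" by (rule len_mono)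
 also have "\<dots> = len M R0 {\<zero>\<^sub>M} ?X + len M R0 ?X ?Y"
  by (rule len_add[OF R0_carrier _ XsY z X Y]) (use asubD(2)[OF X] in simp)
 finally have le: "len M R0 {\<zero>\<^sub>M} (aspan M R0 (insert u S)) \<le> len M R0 {\<zero>\<^sub>M} ?X + len M R0 ?X ?Y" .
 have "len M R0 {\<zero>\<^sub>M} ?X + len M R0 ?X ?Y \<noteq> \<infinity>" using XY insert.IH[OF Sc] by (simp add: plus_eq_infty_iff_enat)
 then show ?case by (rule enat_le_finite[OF le])
qed

lemma piece_asub: "asub M R0 (mdeg M n)"
proof (rule asubI)
 show "mdeg M n \<subseteq> carrier M" using md.piece_carrier by blast
 show "a \<odot>\<^sub>M x \<in> mdeg M n" if "a \<in> R0" "x \<in> mdeg M n" for a x using smult_deg[OF that] by simp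
qed (fact md.piece_zero md.piece_add md.piece_neg)+

lemma hsub_asub: "hsub R M H \<Longrightarrow> asub M (carrier R) H"
 by (simp add: hsub_submodule submodule_asub[symmetric])

lemma comp_smult_piece:
 assumes a: "a \<in> carrier R" and x: "x \<in> mdeg M j"
 shows "mcomp n (a \<odot>\<^sub>M x) = (if j \<le> n then hcomp R (rdeg R) (nat (n - j)) a else \<zero>) \<odot>\<^sub>M x"
proof (rule rd.homogeneous_induct[OF a])
 fix i b assume b: "b \<in> rdeg R i"
 have bx: "b \<odot>\<^sub>M x \<in> mdeg M (int i + j)" by (rule smult_deg[OF b x])
 show "mcomp n (b \<odot>\<^sub>M x) = (if j \<le> n then hcomp R (rdeg R) (nat (n - j)) b else \<zero>) \<odot>\<^sub>M x"
 proof (cases "n = int i + j")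
  case True then show ?thesis using b bx by (simp add: md.comp_id rd.comp_id)
 next
  case False
  then have "nat (n - j) \<noteq> i" if "j \<le> n" using that by auto
  then show ?thesis using md.comp_other[OF False bx] rd.comp_other[of "nat (n - j)" i b] b md.piece_carrier[OF x] by auto
 qed
next
 fix b c assume "b \<in> carrier R" "c \<in> carrier R"
  "mcomp n (b \<odot>\<^sub>M x) = (if j \<le> n then hcomp R (rdeg R) (nat (n - j)) b else \<zero>) \<odot>\<^sub>M x"
  "mcomp n (c \<odot>\<^sub>M x) = (if j \<le> n then hcomp R (rdeg R) (nat (n - j)) c else \<zero>) \<odot>\<^sub>M x"
 then show "mcomp n ((b \<oplus> c) \<odot>\<^sub>M x) = (if j \<le> n then hcomp R (rdeg R) (nat (n - j)) (b \<oplus> c) else \<zero>) \<odot>\<^sub>M x"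
  using md.piece_carrier[OF x] by (simp add: smult_l_distr md.comp_add rd.comp_add rd.comp_closed)
qed

text \<open>Finitely many elements of degree \<open>n\<close> generate the submodule spanned by the
  whole component. The ring has no negative degrees, so only scalars of degree zero contribute to
  degree \<open>n\<close>.\<close>

lemma piece_finite_gen:
 assumes acc: "acc M (carrier R) (carrier M)"
 obtains S where "finite S" "S \<subseteq> mdeg M n" "aspan M R0 S = mdeg M n"
proof -
 have Mc: "mdeg M n \<subseteq> carrier M" using md.piece_carrier by blast
 let ?H = "aspan M (carrier R) (mdeg M n)"
 let ?F = "{aspan M (carrier R) S |S. finite S \<and> S \<subseteq> mdeg M n}"
 have as: "asub M (carrier R) (aspan M (carrier R) S)" if "S \<subseteq> mdeg M n" for S
  by (rule aspan_asub) (use that Mc in auto)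
 obtain K where K: "K \<in> ?F" "\<And>L. L \<in> ?F \<Longrightarrow> K \<subseteq> L \<Longrightarrow> L = K"
 proof (rule acc_maximal[OF acc, of ?F])
  show "asub M (carrier R) L \<and> L \<subseteq> carrier M" if L: "L \<in> ?F" for L
  proof -
   obtain S where S: "L = aspan M (carrier R) S" "S \<subseteq> mdeg M n" using L by blast
   then show ?thesis using as[of S] asubD(1)[OF as[of S]] by auto
  qed
 qed auto
 then obtain S where S: "K = aspan M (carrier R) S" "finite S" "S \<subseteq> mdeg M n" by blast
 \<comment> \<open>A submodule over the whole ring that contains \<open>S\<close> and whose elements
   of degree \<open>n\<close> lie in the degree zero span of \<open>S\<close>.\<close>
 let ?V = "{y \<in> carrier M. (\<forall>m<n. mcomp m y = \<zero>\<^sub>M) \<and> mcomp n y \<in> aspan M R0 S}"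
 have Sp: "asub M R0 (aspan M R0 S)" by (rule aspan_asub[OF _ R0_carrier]) (use S(3) Mc in blast)
 note Spd = asubD[OF Sp]
 have "asub M (carrier R) ?V"
 proof (rule asubI)
  show "\<zero>\<^sub>M \<in> ?V" using Spd(2) by (simp add: md.comp_zero)
  fix x assume x: "x \<in> ?V"
  then show "\<ominus>\<^sub>M x \<in> ?V" using Spd(4) by (simp add: md.comp_neg M.a_inv_zero)
  fix a assume a: "a \<in> carrier R"
  show "a \<odot>\<^sub>M x \<in> ?V"
  proof (rule rd.homogeneous_induct[OF a])
   fix i b assume b: "b \<in> rdeg R i"
   have c: "mcomp m (b \<odot>\<^sub>M x) = b \<odot>\<^sub>M mcomp (m - int i) x" for m
    using comp_smult[of b "int i" x m] b x by simp
   have bc: "b \<in> carrier R" using b rd.piece_carrier by blast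
   show "b \<odot>\<^sub>M x \<in> ?V"
   proof (cases "i = 0")
    case True then show ?thesis using c x bc b Spd(6) by auto
   next
    case False
    then have "mcomp n (b \<odot>\<^sub>M x) = \<zero>\<^sub>M" using c x bc by simp
    then show ?thesis using c x bc Spd(2) by auto
   qed
  next
   fix b c assume "b \<in> carrier R" "c \<in> carrier R" "b \<odot>\<^sub>M x \<in> ?V" "c \<odot>\<^sub>M x \<in> ?V"
   then show "(b \<oplus> c) \<odot>\<^sub>M x \<in> ?V" using x Spd(3) by (simp add: smult_l_distr md.comp_add)
  qed
 qed (use Spd(3) in \<open>auto simp: md.comp_add\<close>)
 moreover have "S \<subseteq> ?V" 
 proof
  fix y assume y: "y \<in> S"
  then have yn: "y \<in> mdeg M n" using S(3) by blast
  have "mcomp m y = \<zero>\<^sub>M" if "m < n" for m by (rule md.comp_other[OF _ yn]) (use that in simp)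
  then show "y \<in> ?V" using y aspan_incl[of S R0] md.comp_id[OF yn] md.piece_carrier[OF yn] by auto
 qed
 ultimately have KV: "K \<subseteq> ?V" unfolding S(1) by (rule aspan_least)
 have "mdeg M n \<subseteq> aspan M R0 S"
 proof
  fix h assume h: "h \<in> mdeg M n"
  have "aspan M (carrier R) (insert h S) = K"
   by (rule K(2)) (use S h aspan_mono[of S "insert h S"] in auto)
  then have "h \<in> ?V" using aspan_incl[of "insert h S" "carrier R"] KV by blast
  then show "h \<in> aspan M R0 S" using md.comp_id[OF h] by simp
 qed
 then show ?thesis using that S(2,3) aspan_least[OF piece_asub S(3)] by blast
qed

text \<open>The chain condition is used twice: a single exponent works for all elements of the
  saturation, and the saturation is generated in degrees bounded above. In degrees at least the sum
  of the two bounds, the coefficients of the generators have degree at least the exponent.\<close>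

lemma sat_bounded:
 assumes acc: "acc M (carrier R) (carrier M)" and H: "hsub R M H"
 shows "\<exists>n0. \<forall>n\<ge>n0. sat H \<inter> mdeg M n \<subseteq> H"
proof -
 let ?T = "sat H"
 note Hd = hsubD[OF H]
 have T: "hsub R M ?T" by (rule sat_hsub[OF H])
 note Td = hsubD[OF T]
 let ?N = "\<lambda>k::nat. {y \<in> ?T. \<forall>t\<ge>k. \<forall>a\<in>rdeg R t. a \<odot>\<^sub>M y \<in> H}"
 have "asub M (carrier R) (?N k) \<and> ?N k \<subseteq> carrier M \<and> ?N k \<subseteq> ?N (Suc k)" for k
 proof (intro conjI asubI)
  show "?N k \<subseteq> carrier M" using Td(1) by blast
  show "?N k \<subseteq> ?N (Suc k)" by (rule Collect_mono) (meson Suc_leD)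
  show "?N k \<subseteq> carrier M" using Td(1) by blast
  show "\<zero>\<^sub>M \<in> ?N k" using Td(2) Hd(2) rd.piece_carrier by simp
  show "x \<oplus>\<^sub>M y \<in> ?N k" if "x \<in> ?N k" "y \<in> ?N k" for x y
   using that Td(1,3) Hd(3) rd.piece_carrier by (simp add: smult_r_distr)
  show "\<ominus>\<^sub>M x \<in> ?N k" if "x \<in> ?N k" for x
   using that Td(1,4) Hd(4) rd.piece_carrier by (simp add: smult_r_minus)
  show "b \<odot>\<^sub>M x \<in> ?N k" if "x \<in> ?N k" "b \<in> carrier R" for x b
   using that Td(1,6) Hd(6) rd.piece_carrier smult_swap[of _ b x] by simp
 qed
 then obtain k0 where k0: "\<forall>n\<ge>k0. ?N n = ?N k0" using acc[unfolded acc_def, rule_format, of ?N] by blast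
 have Tk: "a \<odot>\<^sub>M y \<in> H" if y: "y \<in> ?T" and t: "t \<ge> k0" and a: "a \<in> rdeg R t" for y t a
 proof -
  obtain t0 where t0: "\<forall>t\<ge>t0. \<forall>a\<in>rdeg R t. a \<odot>\<^sub>M y \<in> H" using y by (auto simp: sat_def)
  then have "y \<in> ?N (max k0 t0)" using y by auto
  moreover have "?N (max k0 t0) = ?N k0" by (rule k0[rule_format]) simp
  ultimately have "y \<in> ?N k0" by (simp only:)
  then show ?thesis using t a by blast
 qed
 let ?G = "\<lambda>k::nat. {s. \<exists>i\<le>int k. s \<in> ?T \<inter> mdeg M i}"
 let ?V = "\<lambda>k. aspan M (carrier R) (?G k)"
 have Gc: "?G k \<subseteq> carrier M" for k using Td(1) by blast
 have "asub M (carrier R) (?V k) \<and> ?V k \<subseteq> carrier M \<and> ?V k \<subseteq> ?V (Suc k)" for k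
 proof -
  have a: "asub M (carrier R) (?V k)" by (rule aspan_asub[OF Gc]) simp
  have "?V k \<subseteq> ?V (Suc k)" 
  proof (rule aspan_mono, rule subsetI)
   fix s assume "s \<in> ?G k"
   then obtain i where "i \<le> int k" "s \<in> ?T \<inter> mdeg M i" by blast
   then show "s \<in> ?G (Suc k)" by (intro CollectI exI[of _ i]) simp
  qed
  then show ?thesis using a asubD(1)[OF a] by blast
 qed
 then obtain d where d: "\<forall>n\<ge>d. ?V n = ?V d" using acc[unfolded acc_def, rule_format, of ?V] by blast
 let ?B = "{y \<in> carrier M. \<forall>n\<ge>int d + int k0. mcomp n y \<in> H}"
 \<comment> \<open>\<open>?B\<close> need not be stable under scalars, since they raise degrees; its
   largest stable subset is taken instead.\<close>
 let ?B' = "{y \<in> carrier M. \<forall>a\<in>carrier R. a \<odot>\<^sub>M y \<in> ?B}"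
 have B': "asub M (carrier R) ?B'"
 proof (rule asubI)
  show "\<zero>\<^sub>M \<in> ?B'" using Hd(2) by (simp add: md.comp_zero)
  show "x \<oplus>\<^sub>M y \<in> ?B'" if "x \<in> ?B'" "y \<in> ?B'" for x y
   using that Hd(3) by (simp add: smult_r_distr md.comp_add)
  show "\<ominus>\<^sub>M x \<in> ?B'" if "x \<in> ?B'" for x
   using that Hd(4) by (simp add: smult_r_minus md.comp_neg)
  show "b \<odot>\<^sub>M x \<in> ?B'" if "x \<in> ?B'" "b \<in> carrier R" for x b
   using that by (simp add: smult_assoc1[symmetric])
 qed auto
 have "?G d \<subseteq> ?B'"
 proof
  fix s assume "s \<in> ?G d"
  then obtain i where i: "i \<le> int d" "s \<in> ?T" "s \<in> mdeg M i" by blast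
  have "mcomp n (a \<odot>\<^sub>M s) \<in> H" if a: "a \<in> carrier R" and n: "n \<ge> int d + int k0" for a n
  proof -
   have e: "mcomp n (a \<odot>\<^sub>M s) = hcomp R (rdeg R) (nat (n - i)) a \<odot>\<^sub>M s"
    using comp_smult_piece[OF a i(3), of n] i(1) n by simp
   show ?thesis unfolding e using Tk[OF i(2), of "nat (n - i)"] rd.comp_in[OF a] i(1) n by auto
  qed
  then show "s \<in> ?B'" using i(3) md.piece_carrier by auto
 qed
 then have VB: "?V d \<subseteq> ?B'" by (rule aspan_least[OF B'])
 have "y \<in> H" if n: "n \<ge> int d + int k0" and y: "y \<in> ?T" "y \<in> mdeg M n" for n y
 proof -
  have "y \<in> ?G (nat n)" using y n by auto
  then have "y \<in> ?V (nat n)" by (rule subsetD[OF aspan_incl])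
  moreover have "?V (nat n) = ?V d" by (rule d[rule_format]) (use n in linarith)
  ultimately have "y \<in> ?B'" using subsetD[OF VB] by simp
  then have "\<one> \<odot>\<^sub>M y \<in> ?B" using one_closed by blast
  then have "mcomp n y \<in> H" using n md.piece_carrier[OF y(2)] by simp
  then show ?thesis using md.comp_id[OF y(2)] by simp
 qed
 then show ?thesis by blast
qed

end

section \<open>Linear generators and the Koszul complex\<close>

text \<open>The set x_1 P + ... + x_r P, by a recursion that runs in parallel with those of
  \<open>kd\<close> and \<open>dot\<close>.\<close>

primrec combo :: "('a, 'b, 'm) module_scheme \<Rightarrow> 'a list \<Rightarrow> 'b set \<Rightarrow> 'b set" where
 "combo M [] P = {\<zero>\<^sub>M}"
| "combo M (x # xs) P = {x \<odot>\<^sub>M b \<oplus>\<^sub>M y | b y. b \<in> P \<and> y \<in> combo M xs P}"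

text \<open>A Koszul cochain assigns an element to every subset of the variables; the subset is encoded by
 its characteristic list. Recursion over the list of variables replaces the usual signs.\<close>

primrec kd :: "('a, 'b, 'm) module_scheme \<Rightarrow> 'a list \<Rightarrow> (bool list \<Rightarrow> 'b) \<Rightarrow> bool list \<Rightarrow> 'b" where
 "kd M [] f l = \<zero>\<^sub>M"
| "kd M (x # xs) f l = (case l of [] \<Rightarrow> \<zero>\<^sub>M | b # m \<Rightarrow>
   (if b then x \<odot>\<^sub>M f (False # m) \<ominus>\<^sub>M kd M xs (\<lambda>k. f (True # k)) m else kd M xs (\<lambda>k. f (False # k)) m))"

text \<open>Contraction with the functional whose coefficients are the list \<open>c # cs\<close>.
  The minus sign on subsets containing the first variable makes it a homotopy for multiplication by
  the sum of the c_i x_i.\<close>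

primrec kw :: "('a, 'b, 'm) module_scheme \<Rightarrow> 'a list \<Rightarrow> (bool list \<Rightarrow> 'b) \<Rightarrow> bool list \<Rightarrow> 'b" where
 "kw M [] f l = \<zero>\<^sub>M"
| "kw M (c # cs) f l = (case l of [] \<Rightarrow> \<zero>\<^sub>M | b # m \<Rightarrow>
   (if b then \<ominus>\<^sub>M kw M cs (\<lambda>k. f (True # k)) m else c \<odot>\<^sub>M f (True # m) \<oplus>\<^sub>M kw M cs (\<lambda>k. f (False # k)) m))"

primrec dot :: "('a, 'm) ring_scheme \<Rightarrow> 'a list \<Rightarrow> 'a list \<Rightarrow> 'a" where
 "dot R [] xs = \<zero>\<^sub>R"
| "dot R (c # cs) xs = (c \<otimes>\<^sub>R hd xs) \<oplus>\<^sub>R dot R cs (tl xs)"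

text \<open>The exterior degree of a subset. It is an integer, so that cochains of degree -1, which
  vanish, need no separate treatment.\<close>

primrec ntrue :: "bool list \<Rightarrow> int" where
 "ntrue [] = 0"
| "ntrue (b # l) = (if b then 1 else 0) + ntrue l"

lemma ntrue_nonneg: "0 \<le> ntrue l" by (induction l) auto
lemma ntrue_le: "ntrue l \<le> int (length l)" by (induction l) auto
lemma ntrue_max: "ntrue l = int (length l) \<Longrightarrow> l = replicate (length l) True"
proof (induction l)
 case (Cons b l) then show ?case using ntrue_le[of l] by (auto split: if_splits)
qed simp
lemma ntrue_replicate: "ntrue (replicate r True) = int r" by (induction r) auto

definition kin :: "nat \<Rightarrow> (bool list \<Rightarrow> 'b) \<Rightarrow> 'b set \<Rightarrow> bool" where
 "kin r f S \<longleftrightarrow> (\<forall>l. length l = r \<longrightarrow> f l \<in> S)"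

text \<open>Cochains of internal degree \<open>n\<close> and exterior degree \<open>q\<close>,
  extended by zero to subsets of other sizes. The differential raises both degrees by one, so
  \<open>n - q\<close> is constant along a strand of the complex.\<close>

definition coch :: "('b, 'm) ring_scheme \<Rightarrow> nat \<Rightarrow> (int \<Rightarrow> 'b set) \<Rightarrow> int \<Rightarrow> int \<Rightarrow> (bool list \<Rightarrow> 'b) \<Rightarrow> bool" where
 "coch M r G n q f \<longleftrightarrow> (\<forall>l. length l = r \<longrightarrow> f l \<in> (if ntrue l = q then G n else {\<zero>\<^sub>M}))"

lemma kinI: "(\<And>l. length l = r \<Longrightarrow> f l \<in> S) \<Longrightarrow> kin r f S" by (simp add: kin_def)
lemma kinD: "kin r f S \<Longrightarrow> length l = r \<Longrightarrow> f l \<in> S" by (simp add: kin_def)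
lemma kin_Cons: "kin (Suc r) f S \<Longrightarrow> kin r (\<lambda>k. f (b # k)) S" by (simp add: kin_def)
lemma kin_mono: "kin r f S \<Longrightarrow> S \<subseteq> T \<Longrightarrow> kin r f T" unfolding kin_def by blast
lemma cochD: "coch M r G n q f \<Longrightarrow> length l = r \<Longrightarrow> f l \<in> (if ntrue l = q then G n else {\<zero>\<^sub>M})" by (simp add: coch_def)
lemma coch_Cons:
 assumes "coch M (Suc r) G n q f"
 shows "coch M r G n (q - 1) (\<lambda>k. f (True # k))" "coch M r G n q (\<lambda>k. f (False # k))"
 using assms[unfolded coch_def, rule_format, of "True # _"] assms[unfolded coch_def, rule_format, of "False # _"]
 unfolding coch_def by (auto simp: algebra_simps split: if_splits)

lemma kd_cong:
 "(\<And>l. length l = length xs \<Longrightarrow> f l = g l) \<Longrightarrow> length l = length xs \<Longrightarrow> kd M xs f l = kd M xs g l"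
proof (induction xs arbitrary: f g l)
 case (Cons x xs)
 obtain b m where l: "l = b # m" "length m = length xs" using Cons.prems(2) by (cases l) auto
 have "kd M xs (\<lambda>k. f (b # k)) m = kd M xs (\<lambda>k. g (b # k)) m" for b
  by (rule Cons.IH[OF _ l(2)]) (simp add: Cons.prems(1))
 then show ?case using Cons.prems(1)[of "False # m"] l by simp
qed simp

context module
begin

lemma minus_swap4: "a \<in> carrier M \<Longrightarrow> b \<in> carrier M \<Longrightarrow> c \<in> carrier M \<Longrightarrow> d \<in> carrier M \<Longrightarrow>
  (a \<oplus>\<^sub>M b) \<ominus>\<^sub>M (c \<oplus>\<^sub>M d) = (a \<ominus>\<^sub>M c) \<oplus>\<^sub>M (b \<ominus>\<^sub>M d)"
 by (simp add: M.minus_eq M.minus_add M.a_ac)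

lemma kd_closed:
 "set xs \<subseteq> carrier R \<Longrightarrow> asub M (set xs) S \<Longrightarrow> kin (length xs) f S \<Longrightarrow> kin (length xs) (kd M xs f) S"
proof (induction xs arbitrary: f)
 case Nil then show ?case using asubD(2) by (simp add: kin_def)
next
 case (Cons x xs)
 have S: "asub M (set xs) S" using Cons.prems(2) by (rule asub_mono_ops[rotated]) auto
 have k: "kin (length xs) (kd M xs (\<lambda>k. f (b # k))) S" for b
  using Cons.IH[OF _ S] Cons.prems(1,3) by (simp add: kin_Cons)
 show ?case
 proof (rule kinI)
  fix l :: "bool list" assume "length l = length (x # xs)"
  then obtain b m where l: "l = b # m" "length m = length xs" by (cases l) auto
  have "x \<odot>\<^sub>M f (False # m) \<in> S" using asubD(6)[OF Cons.prems(2)] kinD[OF Cons.prems(3)] l by simp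
  then show "kd M (x # xs) f l \<in> S" using l kinD[OF k l(2)] asubD(5)[OF S] by simp
 qed
qed

lemma carrier_asub: "A \<subseteq> carrier R \<Longrightarrow> asub M A (carrier M)"
 by (rule asubI) auto

lemma kd_carrier: "set xs \<subseteq> carrier R \<Longrightarrow> kin (length xs) f (carrier M) \<Longrightarrow> kin (length xs) (kd M xs f) (carrier M)"
 by (rule kd_closed[OF _ carrier_asub])

lemma kd_carrierD: "set xs \<subseteq> carrier R \<Longrightarrow> kin (length xs) f (carrier M) \<Longrightarrow> length l = length xs \<Longrightarrow> kd M xs f l \<in> carrier M"
 using kd_carrier kinD by blast

lemma kw_closed:
 "set cs \<subseteq> carrier R \<Longrightarrow> asub M (set cs) S \<Longrightarrow> kin (length cs) f S \<Longrightarrow> kin (length cs) (kw M cs f) S"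
proof (induction cs arbitrary: f)
 case Nil then show ?case using asubD(2) by (simp add: kin_def)
next
 case (Cons x xs)
 have S: "asub M (set xs) S" using Cons.prems(2) by (rule asub_mono_ops[rotated]) auto
 have k: "kin (length xs) (kw M xs (\<lambda>k. f (b # k))) S" for b
  using Cons.IH[OF _ S] Cons.prems(1,3) by (simp add: kin_Cons)
 show ?case
 proof (rule kinI)
  fix l :: "bool list" assume "length l = length (x # xs)"
  then obtain b m where l: "l = b # m" "length m = length xs" by (cases l) auto
  have "x \<odot>\<^sub>M f (True # m) \<in> S" using asubD(6)[OF Cons.prems(2)] kinD[OF Cons.prems(3)] l by simp
  then show "kw M (x # xs) f l \<in> S" using l kinD[OF k l(2)] asubD(3,4)[OF S] by simp
 qed
qed

lemma kw_carrierD: "set xs \<subseteq> carrier R \<Longrightarrow> kin (length xs) f (carrier M) \<Longrightarrow> length l = length xs \<Longrightarrow> kw M xs f l \<in> carrier M"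
 using kw_closed[OF _ carrier_asub] kinD by blast

lemma kd_add:
 "set xs \<subseteq> carrier R \<Longrightarrow> kin (length xs) f (carrier M) \<Longrightarrow> kin (length xs) g (carrier M) \<Longrightarrow> length l = length xs \<Longrightarrow>
  kd M xs (\<lambda>k. f k \<oplus>\<^sub>M g k) l = kd M xs f l \<oplus>\<^sub>M kd M xs g l"
proof (induction xs arbitrary: f g l)
 case (Cons x xs)
 obtain b m where l: "l = b # m" "length m = length xs" using Cons.prems(4) by (cases l) auto
 have IH: "kd M xs (\<lambda>k. f (b # k) \<oplus>\<^sub>M g (b # k)) m = kd M xs (\<lambda>k. f (b # k)) m \<oplus>\<^sub>M kd M xs (\<lambda>k. g (b # k)) m" for b
  using Cons.IH[OF _ _ _ l(2)] Cons.prems by (simp add: kin_Cons)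
 have c: "f (False # m) \<in> carrier M" "g (False # m) \<in> carrier M" using Cons.prems l by (simp_all add: kin_def)
 have d: "kd M xs (\<lambda>k. f (b # k)) m \<in> carrier M" "kd M xs (\<lambda>k. g (b # k)) m \<in> carrier M" for b
  using kd_carrierD[OF _ _ l(2)] Cons.prems by (simp_all add: kin_Cons)
 show ?case using l IH c d Cons.prems(1) minus_swap4 by (simp add: smult_r_distr)
qed simp

lemma kd_neg:
 "set xs \<subseteq> carrier R \<Longrightarrow> kin (length xs) f (carrier M) \<Longrightarrow> length l = length xs \<Longrightarrow>
  kd M xs (\<lambda>k. \<ominus>\<^sub>M f k) l = \<ominus>\<^sub>M kd M xs f l"
proof (induction xs arbitrary: f l)
 case Nil then show ?case by (simp add: M.a_inv_zero)
next
 case (Cons x xs)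
 obtain b m where l: "l = b # m" "length m = length xs" using Cons.prems(3) by (cases l) auto
 have IH: "kd M xs (\<lambda>k. \<ominus>\<^sub>M f (b # k)) m = \<ominus>\<^sub>M kd M xs (\<lambda>k. f (b # k)) m" for b
  using Cons.IH[OF _ _ l(2)] Cons.prems by (simp add: kin_Cons)
 have c: "f (False # m) \<in> carrier M" using Cons.prems l by (simp_all add: kin_def)
 have d: "kd M xs (\<lambda>k. f (b # k)) m \<in> carrier M" for b
  using kd_carrierD[OF _ _ l(2)] Cons.prems by (simp_all add: kin_Cons)
 show ?case using l IH c d Cons.prems(1) by (simp add: smult_r_minus M.minus_eq M.minus_add)
qed

lemma kin_neg: "kin r f (carrier M) \<Longrightarrow> kin r (\<lambda>k. \<ominus>\<^sub>M f k) (carrier M)"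
 by (simp add: kin_def)

lemma kd_minus:
 "set xs \<subseteq> carrier R \<Longrightarrow> kin (length xs) f (carrier M) \<Longrightarrow> kin (length xs) g (carrier M) \<Longrightarrow> length l = length xs \<Longrightarrow>
  kd M xs (\<lambda>k. f k \<ominus>\<^sub>M g k) l = kd M xs f l \<ominus>\<^sub>M kd M xs g l"
 unfolding M.minus_eq using kd_add[of xs f "\<lambda>k. \<ominus>\<^sub>M g k" l] kd_neg[of xs g l] kin_neg by simp

lemma kd_smult:
 "set xs \<subseteq> carrier R \<Longrightarrow> a \<in> carrier R \<Longrightarrow> kin (length xs) f (carrier M) \<Longrightarrow> length l = length xs \<Longrightarrow>
  kd M xs (\<lambda>k. a \<odot>\<^sub>M f k) l = a \<odot>\<^sub>M kd M xs f l"
proof (induction xs arbitrary: f l)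
 case (Cons x xs)
 obtain b m where l: "l = b # m" "length m = length xs" using Cons.prems(4) by (cases l) auto
 have IH: "kd M xs (\<lambda>k. a \<odot>\<^sub>M f (b # k)) m = a \<odot>\<^sub>M kd M xs (\<lambda>k. f (b # k)) m" for b
  using Cons.IH[OF _ _ _ l(2)] Cons.prems by (simp add: kin_Cons)
 have c: "f (False # m) \<in> carrier M" using Cons.prems l by (simp_all add: kin_def)
 have d: "kd M xs (\<lambda>k. f (b # k)) m \<in> carrier M" for b
  using kd_carrierD[OF _ _ l(2)] Cons.prems by (simp_all add: kin_Cons)
 show ?case using l IH c d Cons.prems(1,2) smult_swap[of x a "f (False # m)"]
  by (simp add: M.minus_eq smult_r_distr smult_r_minus)
qed simp

lemma kd_zero: "set xs \<subseteq> carrier R \<Longrightarrow> length l = length xs \<Longrightarrow> kd M xs (\<lambda>k. \<zero>\<^sub>M) l = \<zero>\<^sub>M"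
 using kd_smult[of xs \<zero> "\<lambda>k. \<zero>\<^sub>M" l] kd_carrierD[of xs "\<lambda>k. \<zero>\<^sub>M" l] by (simp add: kin_def)

lemma kd_kd:
 "set xs \<subseteq> carrier R \<Longrightarrow> kin (length xs) f (carrier M) \<Longrightarrow> length l = length xs \<Longrightarrow> kd M xs (kd M xs f) l = \<zero>\<^sub>M"
proof (induction xs arbitrary: f l)
 case (Cons x xs)
 obtain b m where l: "l = b # m" "length m = length xs" using Cons.prems(3) by (cases l) auto
 have xs: "set xs \<subseteq> carrier R" "x \<in> carrier R" using Cons.prems by auto
 have k: "kin (length xs) (\<lambda>k. f (b # k)) (carrier M)" for b using Cons.prems(2) by (simp add: kin_Cons)
 have IH: "kd M xs (kd M xs (\<lambda>k. f (b # k))) m = \<zero>\<^sub>M" for b using Cons.IH[OF xs(1) k l(2)] .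
 have c: "kin (length xs) (\<lambda>k. x \<odot>\<^sub>M f (False # k)) (carrier M)" using k xs by (simp add: kin_def)
 have d: "kd M xs (\<lambda>k. f (b # k)) m \<in> carrier M" for b by (rule kd_carrierD[OF xs(1) k l(2)])
 have "kd M xs (\<lambda>k. x \<odot>\<^sub>M f (False # k) \<ominus>\<^sub>M kd M xs (\<lambda>j. f (True # j)) k) m
   = x \<odot>\<^sub>M kd M xs (\<lambda>k. f (False # k)) m"
  using kd_minus[OF xs(1) c kd_carrier[OF xs(1) k] l(2), of True] kd_smult[OF xs k l(2)] IH d xs
  by (simp add: M.minus_eq M.a_inv_zero)
 moreover have "kd M xs (\<lambda>k. kd M xs (\<lambda>j. f (False # j)) k) m = \<zero>\<^sub>M" using IH[of False] .
 ultimately show ?case using l d xs IH by (cases b) (simp_all add: M.minus_eq M.r_neg)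
qed simp

lemma kw_add:
 "set xs \<subseteq> carrier R \<Longrightarrow> kin (length xs) f (carrier M) \<Longrightarrow> kin (length xs) g (carrier M) \<Longrightarrow> length l = length xs \<Longrightarrow>
  kw M xs (\<lambda>k. f k \<oplus>\<^sub>M g k) l = kw M xs f l \<oplus>\<^sub>M kw M xs g l"
proof (induction xs arbitrary: f g l)
 case (Cons x xs)
 obtain b m where l: "l = b # m" "length m = length xs" using Cons.prems(4) by (cases l) auto
 have IH: "kw M xs (\<lambda>k. f (b # k) \<oplus>\<^sub>M g (b # k)) m = kw M xs (\<lambda>k. f (b # k)) m \<oplus>\<^sub>M kw M xs (\<lambda>k. g (b # k)) m" for b
  using Cons.IH[OF _ _ _ l(2)] Cons.prems by (simp add: kin_Cons)
 have c: "f (True # m) \<in> carrier M" "g (True # m) \<in> carrier M" using Cons.prems l by (simp_all add: kin_def)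
 have d: "kw M xs (\<lambda>k. f (b # k)) m \<in> carrier M" "kw M xs (\<lambda>k. g (b # k)) m \<in> carrier M" for b
  using kw_carrierD[OF _ _ l(2)] Cons.prems by (simp_all add: kin_Cons)
 show ?case using l IH c d Cons.prems(1) swap4 by (simp add: smult_r_distr M.minus_add)
qed simp

lemma kw_neg:
 "set xs \<subseteq> carrier R \<Longrightarrow> kin (length xs) f (carrier M) \<Longrightarrow> length l = length xs \<Longrightarrow>
  kw M xs (\<lambda>k. \<ominus>\<^sub>M f k) l = \<ominus>\<^sub>M kw M xs f l"
proof (induction xs arbitrary: f l)
 case Nil then show ?case by (simp add: M.a_inv_zero)
next
 case (Cons x xs)
 obtain b m where l: "l = b # m" "length m = length xs" using Cons.prems(3) by (cases l) auto
 have IH: "kw M xs (\<lambda>k. \<ominus>\<^sub>M f (b # k)) m = \<ominus>\<^sub>M kw M xs (\<lambda>k. f (b # k)) m" for b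
  using Cons.IH[OF _ _ l(2)] Cons.prems by (simp add: kin_Cons)
 have c: "f (True # m) \<in> carrier M" using Cons.prems l by (simp_all add: kin_def)
 have d: "kw M xs (\<lambda>k. f (b # k)) m \<in> carrier M" for b
  using kw_carrierD[OF _ _ l(2)] Cons.prems by (simp_all add: kin_Cons)
 show ?case using l IH c d Cons.prems(1) by (simp add: smult_r_minus M.minus_add)
qed

lemma kw_smult:
 "set xs \<subseteq> carrier R \<Longrightarrow> a \<in> carrier R \<Longrightarrow> kin (length xs) f (carrier M) \<Longrightarrow> length l = length xs \<Longrightarrow>
  kw M xs (\<lambda>k. a \<odot>\<^sub>M f k) l = a \<odot>\<^sub>M kw M xs f l"
proof (induction xs arbitrary: f l)
 case (Cons x xs)
 obtain b m where l: "l = b # m" "length m = length xs" using Cons.prems(4) by (cases l) auto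
 have IH: "kw M xs (\<lambda>k. a \<odot>\<^sub>M f (b # k)) m = a \<odot>\<^sub>M kw M xs (\<lambda>k. f (b # k)) m" for b
  using Cons.IH[OF _ _ _ l(2)] Cons.prems by (simp add: kin_Cons)
 have c: "f (True # m) \<in> carrier M" using Cons.prems l by (simp_all add: kin_def)
 have d: "kw M xs (\<lambda>k. f (b # k)) m \<in> carrier M" for b
  using kw_carrierD[OF _ _ l(2)] Cons.prems by (simp_all add: kin_Cons)
 show ?case using l IH c d Cons.prems(1,2) smult_swap[of x a "f (True # m)"]
  by (simp add: smult_r_distr smult_r_minus)
qed simp

lemma dot_closed: "set cs \<subseteq> carrier R \<Longrightarrow> set xs \<subseteq> carrier R \<Longrightarrow> length cs = length xs \<Longrightarrow> dot R cs xs \<in> carrier R"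
proof (induction cs arbitrary: xs)
 case (Cons c cs) then show ?case by (cases xs) auto
qed simp

text \<open>After splitting off the first variable, the terms combining \<open>c\<close> with the
  differential of the tail cancel on subsets without this variable, and those combining
  \<open>x\<close> with the contraction of the tail cancel on the others. What remains is
  \<open>c \<otimes> x\<close> and the homotopy for the tail.\<close>

lemma k_homotopy:
 "set xs \<subseteq> carrier R \<Longrightarrow> set cs \<subseteq> carrier R \<Longrightarrow> length cs = length xs \<Longrightarrow> kin (length xs) f (carrier M) \<Longrightarrow> length l = length xs \<Longrightarrow>
  kd M xs (kw M cs f) l \<oplus>\<^sub>M kw M cs (kd M xs f) l = dot R cs xs \<odot>\<^sub>M f l"
proof (induction xs arbitrary: f l cs)
 case Nil then show ?case by (simp add: kin_def)
next
 case (Cons x xs)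
 obtain b m where l: "l = b # m" "length m = length xs" using Cons.prems(5) by (cases l) auto
 obtain c ds where cs: "cs = c # ds" "length ds = length xs" using Cons.prems(3) by (cases cs) auto
 have xs: "set xs \<subseteq> carrier R" "x \<in> carrier R" and ds: "set ds \<subseteq> carrier R" "c \<in> carrier R"
  using Cons.prems cs by auto
 have k: "kin (length xs) (\<lambda>k. f (b # k)) (carrier M)" for b using Cons.prems(4) by (simp add: kin_Cons)
 have kds: "kin (length ds) (\<lambda>k. f (b # k)) (carrier M)" for b using k cs(2) by simp
 have l2: "length m = length ds" using l cs by simp
 let ?F = "\<lambda>k. f (False # k)" and ?T = "\<lambda>k. f (True # k)"
 note IH = Cons.IH[OF xs(1) ds(1) cs(2) k l(2)]
 have dc: "dot R ds xs \<in> carrier R" using dot_closed[OF ds(1) xs(1) cs(2)] .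
 have kW: "kin (length xs) (kw M ds (\<lambda>k. f (b # k))) (carrier M)" for b
  using kw_closed[OF ds(1) carrier_asub[OF ds(1)] kds] cs(2) by simp
 have kD: "kin (length ds) (kd M xs (\<lambda>k. f (b # k))) (carrier M)" for b
  using kd_carrier[OF xs(1) k] cs(2) by simp
 have mc: "f (b # m) \<in> carrier M" for b using k l(2) by (simp add: kin_def)
 have c1: "kd M xs (\<lambda>k. f (b # k)) m \<in> carrier M" "kw M ds (\<lambda>k. f (b # k)) m \<in> carrier M"
  "kd M xs (kw M ds (\<lambda>k. f (b # k))) m \<in> carrier M" "kw M ds (kd M xs (\<lambda>k. f (b # k))) m \<in> carrier M" for b
  using kd_carrierD[OF xs(1) k l(2)] kw_carrierD[OF ds(1) kds l2] kd_carrierD[OF xs(1) kW l(2)] kw_carrierD[OF ds(1) kD l2] by auto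
 have dotS: "dot R cs (x # xs) = c \<otimes> x \<oplus> dot R ds xs" using cs by simp
 show ?case
 proof (cases b)
  case False
  have e1: "kd M xs (\<lambda>k. c \<odot>\<^sub>M ?T k \<oplus>\<^sub>M kw M ds ?F k) m = c \<odot>\<^sub>M kd M xs ?T m \<oplus>\<^sub>M kd M xs (kw M ds ?F) m"
  proof -
   have "kin (length xs) (\<lambda>k. c \<odot>\<^sub>M ?T k) (carrier M)" using k[of True] ds by (simp add: kin_def)
   then show ?thesis using kd_add[OF xs(1) _ kW l(2), of _ False] kd_smult[OF xs(1) ds(2) k l(2), of True] by simp
  qed
  have "kd M (x # xs) (kw M cs f) l = c \<odot>\<^sub>M kd M xs ?T m \<oplus>\<^sub>M kd M xs (kw M ds ?F) m"
   using e1 by (simp add: l cs False)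
  moreover have "kw M cs (kd M (x # xs) f) l = c \<odot>\<^sub>M (x \<odot>\<^sub>M ?F m \<ominus>\<^sub>M kd M xs ?T m) \<oplus>\<^sub>M kw M ds (kd M xs ?F) m"
   by (simp add: l cs False)
  moreover have "c \<odot>\<^sub>M (x \<odot>\<^sub>M ?F m \<ominus>\<^sub>M kd M xs ?T m) = (c \<otimes> x) \<odot>\<^sub>M ?F m \<ominus>\<^sub>M c \<odot>\<^sub>M kd M xs ?T m"
   using ds xs mc c1 by (simp add: M.minus_eq smult_r_distr smult_r_minus smult_assoc1)
  moreover have "(p \<oplus>\<^sub>M q) \<oplus>\<^sub>M ((u \<ominus>\<^sub>M p) \<oplus>\<^sub>M v) = u \<oplus>\<^sub>M (q \<oplus>\<^sub>M v)"
   if "p \<in> carrier M" "q \<in> carrier M" "u \<in> carrier M" "v \<in> carrier M" for p q u v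
  proof -
   have "(p \<oplus>\<^sub>M q) \<oplus>\<^sub>M ((u \<ominus>\<^sub>M p) \<oplus>\<^sub>M v) = ((u \<ominus>\<^sub>M p) \<oplus>\<^sub>M p) \<oplus>\<^sub>M (q \<oplus>\<^sub>M v)"
    using that by (simp add: M.a_ac)
   then show ?thesis using M.minus_plus[OF that(3,1)] by simp
  qed
  ultimately have "kd M (x # xs) (kw M cs f) l \<oplus>\<^sub>M kw M cs (kd M (x # xs) f) l
    = (c \<otimes> x) \<odot>\<^sub>M ?F m \<oplus>\<^sub>M (kd M xs (kw M ds ?F) m \<oplus>\<^sub>M kw M ds (kd M xs ?F) m)"
   using ds xs mc c1 by simp
  also have "\<dots> = dot R cs (x # xs) \<odot>\<^sub>M ?F m"
   unfolding dotS IH using ds xs mc dc by (simp add: smult_l_distr)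
  finally show ?thesis by (simp add: l False del: kd.simps kw.simps dot.simps)
 next
  case True
  have e1: "kd M xs (\<lambda>k. \<ominus>\<^sub>M kw M ds ?T k) m = \<ominus>\<^sub>M kd M xs (kw M ds ?T) m"
   by (rule kd_neg[OF xs(1) kW l(2)])
  have e2: "kw M ds (\<lambda>k. x \<odot>\<^sub>M ?F k \<ominus>\<^sub>M kd M xs ?T k) m = x \<odot>\<^sub>M kw M ds ?F m \<ominus>\<^sub>M kw M ds (kd M xs ?T) m"
  proof -
   have "kin (length ds) (\<lambda>k. x \<odot>\<^sub>M ?F k) (carrier M)" using kds[of False] xs by (simp add: kin_def)
   then show ?thesis
    using kw_add[OF ds(1) _ kin_neg[OF kD] l2, of "\<lambda>k. x \<odot>\<^sub>M ?F k" True] kw_smult[OF ds(1) xs(2) kds l2, of False]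
     kw_neg[OF ds(1) kD l2, of True] by (simp add: M.minus_eq)
  qed
  have "kd M (x # xs) (kw M cs f) l = x \<odot>\<^sub>M (c \<odot>\<^sub>M ?T m \<oplus>\<^sub>M kw M ds ?F m) \<ominus>\<^sub>M \<ominus>\<^sub>M kd M xs (kw M ds ?T) m"
   using e1 by (simp add: l cs True)
  also have "\<dots> = (c \<otimes> x) \<odot>\<^sub>M ?T m \<oplus>\<^sub>M x \<odot>\<^sub>M kw M ds ?F m \<oplus>\<^sub>M kd M xs (kw M ds ?T) m"
   using ds xs mc c1 by (simp add: M.minus_eq smult_r_distr smult_assoc1[symmetric] m_comm)
  finally have "kd M (x # xs) (kw M cs f) l = (c \<otimes> x) \<odot>\<^sub>M ?T m \<oplus>\<^sub>M x \<odot>\<^sub>M kw M ds ?F m \<oplus>\<^sub>M kd M xs (kw M ds ?T) m" .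
  moreover have "kw M cs (kd M (x # xs) f) l = \<ominus>\<^sub>M (x \<odot>\<^sub>M kw M ds ?F m \<ominus>\<^sub>M kw M ds (kd M xs ?T) m)"
   using e2 by (simp add: l cs True)
  moreover have "((u \<oplus>\<^sub>M p) \<oplus>\<^sub>M q) \<oplus>\<^sub>M \<ominus>\<^sub>M (p \<ominus>\<^sub>M v) = u \<oplus>\<^sub>M (q \<oplus>\<^sub>M v)"
   if "p \<in> carrier M" "q \<in> carrier M" "u \<in> carrier M" "v \<in> carrier M" for p q u v
  proof -
   have "((u \<oplus>\<^sub>M p) \<oplus>\<^sub>M q) \<oplus>\<^sub>M \<ominus>\<^sub>M (p \<ominus>\<^sub>M v) = ((u \<ominus>\<^sub>M p) \<oplus>\<^sub>M p) \<oplus>\<^sub>M (q \<oplus>\<^sub>M v)"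
    using that by (simp add: M.a_ac M.minus_eq M.minus_add)
   then show ?thesis using M.minus_plus[OF that(3,1)] by simp
  qed
  ultimately have "kd M (x # xs) (kw M cs f) l \<oplus>\<^sub>M kw M cs (kd M (x # xs) f) l
    = (c \<otimes> x) \<odot>\<^sub>M ?T m \<oplus>\<^sub>M (kd M xs (kw M ds ?T) m \<oplus>\<^sub>M kw M ds (kd M xs ?T) m)"
   using ds xs mc c1 by simp
  also have "\<dots> = dot R cs (x # xs) \<odot>\<^sub>M ?T m"
   unfolding dotS IH using ds xs mc dc by (simp add: smult_l_distr)
  finally show ?thesis by (simp add: l True del: kd.simps kw.simps dot.simps)
 qed
qed

lemma combo_asub:
 assumes A: "A \<subseteq> carrier R" and P: "asub M A P"
 shows "set xs \<subseteq> carrier R \<Longrightarrow> asub M A (combo M xs P)"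
proof (induction xs)
 case (Cons x xs)
 have "combo M (x # xs) P = msum ((\<lambda>g. x \<odot>\<^sub>M g) ` P) (combo M xs P)" unfolding msum_def by auto
 then show ?case using asub_msum[OF A asub_image_smult[OF A _ P] Cons.IH, of x] Cons.prems by simp
qed (simp add: asub_zero A)

lemma combo_incl:
 assumes P: "asub M {} P"
 shows "set xs \<subseteq> carrier R \<Longrightarrow> x \<in> set xs \<Longrightarrow> b \<in> P \<Longrightarrow> x \<odot>\<^sub>M b \<in> combo M xs P"
proof (induction xs)
 case (Cons y xs)
 have C: "asub M {} (combo M xs P)" by (rule combo_asub[OF _ P]) (use Cons in auto)
 have bc: "b \<in> carrier M" using asubD(1)[OF P] Cons by blast
 have yc: "y \<in> carrier R" "x \<in> carrier R" using Cons by auto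
 show ?case
 proof (cases "x = y")
  case True
  have "y \<odot>\<^sub>M b \<oplus>\<^sub>M \<zero>\<^sub>M \<in> combo M (y # xs) P" using asubD(2)[OF C] Cons.prems(3) by auto
  then show ?thesis using True yc bc by (simp del: combo.simps)
 next
  case False
  then have "x \<odot>\<^sub>M b \<in> combo M xs P" using Cons by auto
  then have "y \<odot>\<^sub>M \<zero>\<^sub>M \<oplus>\<^sub>M x \<odot>\<^sub>M b \<in> combo M (y # xs) P" using asubD(2)[OF P] by auto
  then show ?thesis using yc bc by (simp del: combo.simps)
 qed
qed simp

lemma combo_smult:
 assumes a: "a \<in> carrier R" and P: "P \<subseteq> carrier M" "\<And>b. b \<in> P \<Longrightarrow> a \<odot>\<^sub>M b \<in> P'"
 shows "set xs \<subseteq> carrier R \<Longrightarrow> y \<in> combo M xs P \<Longrightarrow> y \<in> carrier M \<and> a \<odot>\<^sub>M y \<in> combo M xs P'"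
proof (induction xs arbitrary: y)
 case (Cons x xs)
 obtain b u where bu: "b \<in> P" "u \<in> combo M xs P" "y = x \<odot>\<^sub>M b \<oplus>\<^sub>M u" using Cons.prems by auto
 have IH: "u \<in> carrier M" "a \<odot>\<^sub>M u \<in> combo M xs P'" using Cons.IH[OF _ bu(2)] Cons.prems by auto
 have bc: "b \<in> carrier M" "x \<in> carrier R" using bu P Cons.prems by auto
 have "a \<odot>\<^sub>M y = x \<odot>\<^sub>M (a \<odot>\<^sub>M b) \<oplus>\<^sub>M a \<odot>\<^sub>M u"
  unfolding bu(3) using a bc IH(1) smult_swap[of a x b] by (simp add: smult_r_distr)
 then show ?case using IH P(2)[OF bu(1)] bu bc by auto
qed (use a in simp)

text \<open>A cochain in the degree below the top has one value for each omitted variable, and its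
  differential is, up to signs, the combination of the variables with these values. This turns
  generation in lower degree into a statement about cochains.\<close>

lemma combo_kd:
 assumes P: "asub M {} P"
 shows "set xs \<subseteq> carrier R \<Longrightarrow> e \<in> combo M xs P \<Longrightarrow>
  \<exists>f. (\<forall>l. length l = length xs \<longrightarrow> f l \<in> (if ntrue l = int (length xs) - 1 then P else {\<zero>\<^sub>M})) \<and>
    kd M xs f (replicate (length xs) True) = e"
proof (induction xs arbitrary: e)
 case Nil then show ?case by (intro exI[of _ "\<lambda>_. \<zero>\<^sub>M"]) simp
next
 case (Cons x xs)
 obtain b u where bu: "b \<in> P" "u \<in> combo M xs P" "e = x \<odot>\<^sub>M b \<oplus>\<^sub>M u" using Cons.prems by auto
 have xs: "set xs \<subseteq> carrier R" "x \<in> carrier R" using Cons.prems by auto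
 have C: "asub M {} (combo M xs P)" by (rule combo_asub[OF _ P]) (use xs in auto)
 have "\<ominus>\<^sub>M u \<in> combo M xs P" using asubD(4)[OF C bu(2)] .
 then obtain g where g: "\<And>l. length l = length xs \<Longrightarrow> g l \<in> (if ntrue l = int (length xs) - 1 then P else {\<zero>\<^sub>M})"
  "kd M xs g (replicate (length xs) True) = \<ominus>\<^sub>M u" using Cons.IH[OF xs(1)] by blast
 \<comment> \<open>\<open>b\<close> sits on the subset missing exactly the first variable. The tail
   was solved for \<open>-u\<close> because the differential subtracts the contribution of subsets
   containing that variable.\<close>
 define f where "f l = (if hd l then g (tl l) else if tl l = replicate (length xs) True then b else \<zero>\<^sub>M)" for l
 have "f l \<in> (if ntrue l = int (length (x # xs)) - 1 then P else {\<zero>\<^sub>M})" if l: "length l = length (x # xs)" for l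
 proof -
  obtain c m where m: "l = c # m" "length m = length xs" using l by (cases l) auto
  show ?thesis
  proof (cases c)
   case True then show ?thesis using g(1)[OF m(2)] by (auto simp: m f_def split: if_splits)
  next
   case False
   have "ntrue m = int (length xs) \<longleftrightarrow> m = replicate (length xs) True"
    using ntrue_max[of m] m(2) ntrue_replicate by metis
   then show ?thesis using False bu(1) by (simp add: m(1) f_def)
  qed
 qed
 moreover have "kd M (x # xs) f (replicate (length (x # xs)) True) = e"
 proof -
  have "(\<lambda>k. f (True # k)) = g" by (simp add: f_def)
  moreover have "b \<in> carrier M" "u \<in> carrier M" using asubD(1)[OF P] asubD(1)[OF C] bu by auto
  ultimately show ?thesis using g(2) xs by (simp add: f_def bu(3) M.minus_eq)
 qed
 ultimately show ?case by blast
qed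

end

lemma (in ghom) kd_hom:
 "set xs \<subseteq> carrier R \<Longrightarrow> kin (length xs) g (carrier M) \<Longrightarrow> length l = length xs \<Longrightarrow> kd N xs (\<lambda>k. f (g k)) l = f (kd M xs g l)"
proof (induction xs arbitrary: g l)
 case (Cons x xs)
 obtain b m where l: "l = b # m" "length m = length xs" using Cons.prems(3) by (cases l) auto
 have IH: "kd N xs (\<lambda>k. f (g (b # k))) m = f (kd M xs (\<lambda>k. g (b # k)) m)" for b
  using Cons.IH[OF _ _ l(2)] Cons.prems by (simp add: kin_Cons)
 have c: "g (False # m) \<in> carrier M" using Cons.prems l by (simp_all add: kin_def)
 have d: "kd M xs (\<lambda>k. g (b # k)) m \<in> carrier M" for b
  using dom.kd_carrierD[OF _ _ l(2)] Cons.prems by (simp_all add: kin_Cons)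
 show ?case using l IH c d Cons.prems(1) by (simp add: minus smult)
qed simp

context graded_module_loc
begin

lemma kd_coch:
 "set xs \<subseteq> rdeg R 1 \<Longrightarrow> coch M (length xs) (mdeg M) n q f \<Longrightarrow> coch M (length xs) (mdeg M) (n + 1) (q + 1) (kd M xs f)"
proof (induction xs arbitrary: f q)
 case Nil then show ?case by (simp add: coch_def md.piece_zero)
next
 case (Cons x xs)
 have cr: "set xs \<subseteq> carrier R" "x \<in> carrier R" using Cons.prems rd.piece_carrier by auto
 have IH: "coch M (length xs) (mdeg M) (n + 1) q (kd M xs (\<lambda>k. f (True # k)))"
  "coch M (length xs) (mdeg M) (n + 1) (q + 1) (kd M xs (\<lambda>k. f (False # k)))"
  using Cons.IH[OF _ coch_Cons(1)] Cons.IH[OF _ coch_Cons(2)] Cons.prems by fastforce+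
 show ?case unfolding coch_def
 proof (intro allI impI)
  fix l :: "bool list" assume ll: "length l = length (x # xs)"
  then obtain b m where l: "l = b # m" "length m = length xs" by (cases l) auto
  have F: "f (False # m) \<in> (if ntrue m = q then mdeg M n else {\<zero>\<^sub>M})" using cochD[OF Cons.prems(2), of "False # m"] l by simp
  have "x \<odot>\<^sub>M f (False # m) \<in> (if ntrue m = q then mdeg M (n + 1) else {\<zero>\<^sub>M})"
   using F smult_deg[of x 1 "f (False # m)" n] Cons.prems(1) cr by (auto simp: add.commute split: if_splits)
  then show "kd M (x # xs) f l \<in> (if ntrue l = q + 1 then mdeg M (n + 1) else {\<zero>\<^sub>M})"
   using cochD[OF IH(1) l(2)] cochD[OF IH(2) l(2)] md.piece_minus
   by (cases b) (auto simp: l M.minus_eq M.a_inv_zero split: if_splits)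
 qed
qed

lemma kw_coch:
 "set cs \<subseteq> R0 \<Longrightarrow> coch M (length cs) (mdeg M) n q f \<Longrightarrow> coch M (length cs) (mdeg M) n (q - 1) (kw M cs f)"
proof (induction cs arbitrary: f q)
 case Nil then show ?case by (simp add: coch_def md.piece_zero)
next
 case (Cons x xs)
 have cr: "set xs \<subseteq> carrier R" "x \<in> carrier R" using Cons.prems rd.piece_carrier by auto
 have IH: "coch M (length xs) (mdeg M) n (q - 1 - 1) (kw M xs (\<lambda>k. f (True # k)))"
  "coch M (length xs) (mdeg M) n (q - 1) (kw M xs (\<lambda>k. f (False # k)))"
  using Cons.IH[OF _ coch_Cons(1)] Cons.IH[OF _ coch_Cons(2)] Cons.prems by fastforce+
 show ?case unfolding coch_def
 proof (intro allI impI)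
  fix l :: "bool list" assume ll: "length l = length (x # xs)"
  then obtain b m where l: "l = b # m" "length m = length xs" by (cases l) auto
  have F: "f (True # m) \<in> (if 1 + ntrue m = q then mdeg M n else {\<zero>\<^sub>M})" using cochD[OF Cons.prems(2), of "True # m"] l by simp
  have "x \<odot>\<^sub>M f (True # m) \<in> (if 1 + ntrue m = q then mdeg M n else {\<zero>\<^sub>M})"
   using F smult_deg[of x 0 "f (True # m)" n] Cons.prems(1) cr by (auto split: if_splits)
  then show "kw M (x # xs) f l \<in> (if ntrue l = q - 1 then mdeg M n else {\<zero>\<^sub>M})"
   using cochD[OF IH(1) l(2)] cochD[OF IH(2) l(2)] md.piece_add md.piece_neg
   by (cases b) (auto simp: l M.a_inv_zero split: if_splits)
 qed
qed

lemma coch_kin: "coch M r (mdeg M) n q f \<Longrightarrow> kin r f (carrier M)"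
 unfolding coch_def kin_def using md.piece_carrier M.zero_closed by (metis singletonD)

end

section \<open>Graded injective modules\<close>

definition rcomp :: "'a graded_ring \<Rightarrow> int \<Rightarrow> int \<Rightarrow> 'a \<Rightarrow> 'a" where
 "rcomp R s n a = (if s \<le> n then hcomp R (rdeg R) (nat (n - s)) a else \<zero>\<^sub>R)"

text \<open>Graphs of graded homomorphisms from an ideal, shifted by \<open>s\<close>, to \<open>N\<close>.\<close>

definition graph_ok :: "'a graded_ring \<Rightarrow> ('a, 'g) graded_module \<Rightarrow> int \<Rightarrow> ('a \<times> 'g) set \<Rightarrow> bool" where
 "graph_ok R N s H \<longleftrightarrow> H \<subseteq> carrier R \<times> carrier N \<and> (\<zero>\<^sub>R, \<zero>\<^sub>N) \<in> H \<and>
   (\<forall>a y b w. (a, y) \<in> H \<longrightarrow> (b, w) \<in> H \<longrightarrow> (a \<oplus>\<^sub>R b, y \<oplus>\<^sub>N w) \<in> H) \<and>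
   (\<forall>r a y. r \<in> carrier R \<longrightarrow> (a, y) \<in> H \<longrightarrow> (r \<otimes>\<^sub>R a, r \<odot>\<^sub>N y) \<in> H) \<and>
   (\<forall>n a y. (a, y) \<in> H \<longrightarrow> (rcomp R s n a, hcomp N (mdeg N) n y) \<in> H) \<and>
   (\<forall>y. (\<zero>\<^sub>R, y) \<in> H \<longrightarrow> y = \<zero>\<^sub>N)"

lemma graph_okD:
 assumes "graph_ok R N s H"
 shows "(a, y) \<in> H \<Longrightarrow> a \<in> carrier R" "(a, y) \<in> H \<Longrightarrow> y \<in> carrier N" "(\<zero>\<^sub>R, \<zero>\<^sub>N) \<in> H"
  "(a, y) \<in> H \<Longrightarrow> (b, w) \<in> H \<Longrightarrow> (a \<oplus>\<^sub>R b, y \<oplus>\<^sub>N w) \<in> H"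
  "r \<in> carrier R \<Longrightarrow> (a, y) \<in> H \<Longrightarrow> (r \<otimes>\<^sub>R a, r \<odot>\<^sub>N y) \<in> H"
  "(a, y) \<in> H \<Longrightarrow> (rcomp R s n a, hcomp N (mdeg N) n y) \<in> H"
  "(\<zero>\<^sub>R, y) \<in> H \<Longrightarrow> y = \<zero>\<^sub>N"
 using assms unfolding graph_ok_def by (blast, blast, blast, blast, blast, blast, blast)

context graded_ring_loc
begin

lemma rcomp_family: "proj_family R (\<lambda>n. rgr R (n - s)) (rcomp R s)"
proof -
 have "rcomp R s = (\<lambda>n x. if s \<le> n then hcomp R (rdeg R) (nat (n - s)) x else \<zero>)"
  by (intro ext) (simp add: rcomp_def)
 then show ?thesis using rgr_family[of s] by simp
qed

lemma rgr_carrier: "a \<in> rgr R n \<Longrightarrow> a \<in> carrier R"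
 using rgr_subgroup additive_subgroup.a_subset by blast

lemma rcomp_facts:
 shows "x \<in> carrier R \<Longrightarrow> rcomp R s n x \<in> rgr R (n - s)"
  "x \<in> carrier R \<Longrightarrow> y \<in> carrier R \<Longrightarrow> rcomp R s n (x \<oplus> y) = rcomp R s n x \<oplus> rcomp R s n y"
  "x \<in> carrier R \<Longrightarrow> finite {n. rcomp R s n x \<noteq> \<zero>}"
  "x \<in> rgr R (n - s) \<Longrightarrow> rcomp R s n x = x"
  "n \<noteq> m \<Longrightarrow> x \<in> rgr R (m - s) \<Longrightarrow> rcomp R s n x = \<zero>"
  "x \<in> carrier R \<Longrightarrow> (\<And>n. rcomp R s n x = \<zero>) \<Longrightarrow> x = \<zero>"
  "rcomp R s n \<zero> = \<zero>"
  "x \<in> carrier R \<Longrightarrow> rcomp R s n x \<in> carrier R"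
proof -
 note f = rcomp_family[of s, unfolded proj_family_def]
 show "x \<in> carrier R \<Longrightarrow> rcomp R s n x \<in> rgr R (n - s)" using f by blast
 then show "x \<in> carrier R \<Longrightarrow> rcomp R s n x \<in> carrier R" using rgr_carrier by blast
 show "x \<in> carrier R \<Longrightarrow> y \<in> carrier R \<Longrightarrow> rcomp R s n (x \<oplus> y) = rcomp R s n x \<oplus> rcomp R s n y" using f by blast
 show "x \<in> carrier R \<Longrightarrow> finite {n. rcomp R s n x \<noteq> \<zero>}" using f by blast
 show "x \<in> rgr R (n - s) \<Longrightarrow> rcomp R s n x = x" using f by blast
 show "n \<noteq> m \<Longrightarrow> x \<in> rgr R (m - s) \<Longrightarrow> rcomp R s n x = \<zero>" using f by blast
 show "x \<in> carrier R \<Longrightarrow> (\<And>n. rcomp R s n x = \<zero>) \<Longrightarrow> x = \<zero>" using f by blast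
 show "rcomp R s n \<zero> = \<zero>" by (simp add: rcomp_def rd.comp_zero)
qed

lemmas rcomp_simps = rcomp_facts(1,2,7,8)

end

lemma (in graded_module_loc) comp_smult_rcomp:
 "a \<in> carrier R \<Longrightarrow> x \<in> mdeg M s \<Longrightarrow> mcomp n (a \<odot>\<^sub>M x) = rcomp R s n a \<odot>\<^sub>M x"
 unfolding rcomp_def by (rule comp_smult_piece)

text \<open>Adjoins to \<open>N\<close> one element e_i of degree \<open>s i\<close> for each index,
  subject to a e_i = y for (a, y) in \<open>P i\<close>. Concretely, \<open>F\<close> is the direct
  sum of \<open>N\<close> and the free modules R(-s i), and \<open>K\<close> is spanned by the
  differences of the two sides of the relations. The quotient solves all the systems at
  once.\<close>

locale pushout = graded_module_loc R N
 for R :: "'a graded_ring" (structure) and N :: "('a, 'g) graded_module" (structure) +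
 fixes s :: "'i \<Rightarrow> int" and P :: "'i \<Rightarrow> ('a \<times> 'g) set"
 assumes gok: "\<And>i. graph_ok R N (s i) (P i)"
begin

definition F :: "('a, 'g \<times> ('i \<Rightarrow> 'a)) graded_module" where
 "F = \<lparr>carrier = {(n, f). n \<in> carrier N \<and> (\<forall>i. f i \<in> carrier R) \<and> finite {i. f i \<noteq> \<zero>}},
   monoid.mult = undefined, one = undefined, zero = (\<zero>\<^sub>N, \<lambda>_. \<zero>),
   add = (\<lambda>u v. (fst u \<oplus>\<^sub>N fst v, \<lambda>i. snd u i \<oplus> snd v i)),
   module.smult = (\<lambda>a u. (a \<odot>\<^sub>N fst u, \<lambda>i. a \<otimes> snd u i)),
   mdeg = (\<lambda>k. {(n, f). n \<in> mdeg N k \<and> (\<forall>i. f i \<in> rgr R (k - s i)) \<and> finite {i. f i \<noteq> \<zero>}})\<rparr>"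

lemma F_carrier: "u \<in> carrier F \<longleftrightarrow> fst u \<in> carrier N \<and> (\<forall>i. snd u i \<in> carrier R) \<and> finite {i. snd u i \<noteq> \<zero>}"
 by (cases u) (simp add: F_def)
lemma F_zero: "\<zero>\<^sub>F = (\<zero>\<^sub>N, \<lambda>_. \<zero>)" by (simp add: F_def)
lemma F_add: "u \<oplus>\<^sub>F v = (fst u \<oplus>\<^sub>N fst v, \<lambda>i. snd u i \<oplus> snd v i)" by (simp add: F_def)
lemma F_smult: "a \<odot>\<^sub>F u = (a \<odot>\<^sub>N fst u, \<lambda>i. a \<otimes> snd u i)" by (simp add: F_def)
lemma F_deg: "u \<in> mdeg F k \<longleftrightarrow> fst u \<in> mdeg N k \<and> (\<forall>i. snd u i \<in> rgr R (k - s i)) \<and> finite {i. snd u i \<noteq> \<zero>}"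
 by (cases u) (simp add: F_def)

lemma fin_add:
 assumes "finite {i. f i \<noteq> \<zero>}" "finite {i. g i \<noteq> \<zero>}" "\<And>i. f i = \<zero> \<Longrightarrow> g i = \<zero> \<Longrightarrow> h i = (z::'z)"
 shows "finite {i. h i \<noteq> z}"
 by (rule finite_subset[OF _ finite_UnI[OF assms(1,2)]]) (use assms(3) in blast)

lemma F_closed:
 "u \<in> carrier F \<Longrightarrow> v \<in> carrier F \<Longrightarrow> u \<oplus>\<^sub>F v \<in> carrier F"
 "a \<in> carrier R \<Longrightarrow> u \<in> carrier F \<Longrightarrow> a \<odot>\<^sub>F u \<in> carrier F" "\<zero>\<^sub>F \<in> carrier F"
proof -
 show "u \<oplus>\<^sub>F v \<in> carrier F" if "u \<in> carrier F" "v \<in> carrier F"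
  using that fin_add[of "snd u" "snd v" "\<lambda>i. snd u i \<oplus> snd v i" \<zero>] by (simp add: F_carrier F_add)
 show "a \<odot>\<^sub>F u \<in> carrier F" if "a \<in> carrier R" "u \<in> carrier F"
  using that fin_add[of "snd u" "snd u" "\<lambda>i. a \<otimes> snd u i" \<zero>] by (simp add: F_carrier F_smult)
 show "\<zero>\<^sub>F \<in> carrier F" by (simp add: F_carrier F_zero)
qed

definition Fneg :: "'g \<times> ('i \<Rightarrow> 'a) \<Rightarrow> 'g \<times> ('i \<Rightarrow> 'a)" where
 "Fneg u = (\<ominus>\<^sub>N fst u, \<lambda>i. \<ominus> snd u i)"

lemma Fneg: "u \<in> carrier F \<Longrightarrow> Fneg u \<in> carrier F" "u \<in> carrier F \<Longrightarrow> Fneg u \<oplus>\<^sub>F u = \<zero>\<^sub>F"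
proof -
 assume u: "u \<in> carrier F"
 show "Fneg u \<in> carrier F"
  using u fin_add[of "snd u" "snd u" "\<lambda>i. \<ominus> snd u i" \<zero>] by (simp add: F_carrier Fneg_def)
 show "Fneg u \<oplus>\<^sub>F u = \<zero>\<^sub>F" using u by (simp add: F_carrier Fneg_def F_add F_zero M.l_neg R.l_neg)
qed

lemma F_abelian: "abelian_group F"
proof (rule abelian_groupI)
 show "\<exists>v\<in>carrier F. v \<oplus>\<^sub>F u = \<zero>\<^sub>F" if "u \<in> carrier F" for u
  using Fneg that by (intro bexI[of _ "Fneg u"]) auto
qed (auto simp: F_closed, simp_all add: F_carrier F_add F_zero M.a_ac R.a_ac)

lemma F_module: "module R F"
 by (rule moduleI[OF R.is_cring F_abelian F_closed(2)])
  (simp_all add: F_carrier F_add F_smult smult_l_distr smult_r_distr smult_assoc1 l_distr r_distr m_assoc)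

lemma F_graded: "is_graded_module R F"
proof (rule graded_moduleI[OF F_module])
 let ?p = "\<lambda>k u. (mcomp k (fst u), \<lambda>i. rcomp R (s i) k (snd u i))"
 show "proj_family F (mdeg F) ?p"
  unfolding proj_family_def
 proof (intro conjI allI ballI impI)
  fix k u assume u: "u \<in> carrier F"
  then have u': "fst u \<in> carrier N" "\<And>i. snd u i \<in> carrier R" "finite {i. snd u i \<noteq> \<zero>}" by (simp_all add: F_carrier)
  have fin: "finite {i. rcomp R (s i) k (snd u i) \<noteq> \<zero>}"
   by (rule fin_add[OF u'(3) u'(3)]) (simp add: rcomp_simps)
  show "?p k u \<in> mdeg F k" using u' fin by (simp add: F_deg md.comp_in rcomp_simps)
  show "?p k (u \<oplus>\<^sub>F v) = ?p k u \<oplus>\<^sub>F ?p k v" if "v \<in> carrier F" for v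
   using u' that by (simp add: F_add F_carrier md.comp_add rcomp_simps)
 next
  fix u assume u: "u \<in> carrier F"
  then have u': "fst u \<in> carrier N" "\<And>i. snd u i \<in> carrier R" "finite {i. snd u i \<noteq> \<zero>}" by (simp_all add: F_carrier)
  have "{k. ?p k u \<noteq> \<zero>\<^sub>F} \<subseteq> {k. mcomp k (fst u) \<noteq> \<zero>\<^sub>N} \<union> (\<Union>i\<in>{i. snd u i \<noteq> \<zero>}. {k. rcomp R (s i) k (snd u i) \<noteq> \<zero>})"
  proof
   fix k assume "k \<in> {k. ?p k u \<noteq> \<zero>\<^sub>F}"
   then have "mcomp k (fst u) \<noteq> \<zero>\<^sub>N \<or> (\<exists>i. rcomp R (s i) k (snd u i) \<noteq> \<zero>)" by (auto simp: F_zero)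
   then show "k \<in> {k. mcomp k (fst u) \<noteq> \<zero>\<^sub>N} \<union> (\<Union>i\<in>{i. snd u i \<noteq> \<zero>}. {k. rcomp R (s i) k (snd u i) \<noteq> \<zero>})"
    using rcomp_facts(7) by force
  qed
  moreover have "finite \<dots>" using u' md.comp_finite rcomp_facts(3) by auto
  ultimately show "finite {k. ?p k u \<noteq> \<zero>\<^sub>F}" by (rule finite_subset)
  assume z: "\<forall>k. ?p k u = \<zero>\<^sub>F"
  have "fst u = \<zero>\<^sub>N" by (rule md.comp_all_zero[OF u'(1)]) (use z in \<open>simp add: F_zero\<close>)
  moreover have "snd u i = \<zero>" for i
  proof (rule rcomp_facts(6)[OF u'(2)])
   show "rcomp R (s i) k (snd u i) = \<zero>" for k using spec[OF z, of k] unfolding F_zero by (auto dest: fun_cong)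
  qed
  ultimately show "u = \<zero>\<^sub>F" by (cases u) (auto simp: F_zero)
 next
  fix k u assume "u \<in> mdeg F k"
  then show "?p k u = u" by (cases u) (simp add: F_deg md.comp_id rcomp_facts(4))
 next
  fix k l u assume kl: "k \<noteq> l" and "u \<in> mdeg F l"
  then show "?p k u = \<zero>\<^sub>F" using md.comp_other[OF kl] rcomp_facts(5)[OF kl] by (simp add: F_deg F_zero)
 qed
 fix k
 have rz: "\<zero> \<in> rgr R j" "x \<in> rgr R j \<Longrightarrow> y \<in> rgr R j \<Longrightarrow> x \<oplus> y \<in> rgr R j" "x \<in> rgr R j \<Longrightarrow> \<ominus> x \<in> rgr R j" for x y j
  using R.add_subgroupD[OF rgr_subgroup] by blast+
 have degc: "u \<in> mdeg F k \<Longrightarrow> u \<in> carrier F" for u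
  unfolding F_deg F_carrier using md.piece_carrier rgr_carrier by blast
 have neg: "\<ominus>\<^sub>F u = Fneg u" if "u \<in> carrier F" for u
  using abelian_group.minus_equality[OF F_abelian Fneg(2)[OF that] that Fneg(1)[OF that]] .
 show "additive_subgroup (mdeg F k) F"
 proof (rule abelian_group.add_subgroupI[OF F_abelian])
  show "mdeg F k \<subseteq> carrier F" using degc by blast
  show "\<zero>\<^sub>F \<in> mdeg F k" by (simp add: F_deg F_zero md.piece_zero rz)
  show "u \<oplus>\<^sub>F v \<in> mdeg F k" if "u \<in> mdeg F k" "v \<in> mdeg F k" for u v
   using that fin_add[of "snd u" "snd v" "\<lambda>i. snd u i \<oplus> snd v i" \<zero>] by (simp add: F_deg F_add md.piece_add rz)
  show "\<ominus>\<^sub>F u \<in> mdeg F k" if "u \<in> mdeg F k" for u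
   using that fin_add[of "snd u" "snd u" "\<lambda>i. \<ominus> snd u i" \<zero>] neg[OF degc[OF that]]
   by (simp add: F_deg Fneg_def md.piece_neg rz)
 qed
 fix i j a u assume a: "a \<in> rdeg R i" and u: "u \<in> mdeg F j"
 have "a \<otimes> snd u t \<in> rgr R (int i + j - s t)" for t
  using mult_rgr[of a "int i" "snd u t" "j - s t"] a u by (simp add: F_deg algebra_simps)
 moreover have "finite {t. a \<otimes> snd u t \<noteq> \<zero>}"
  by (rule fin_add[of "snd u" "snd u"]) (use u a rd.piece_carrier in \<open>auto simp: F_deg\<close>)
 ultimately show "a \<odot>\<^sub>F u \<in> mdeg F (int i + j)"
  using u smult_deg[OF a] by (simp add: F_deg F_smult)
qed

sublocale Fm: graded_module_loc R F
 by (rule graded_module_locI[OF graded F_graded])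

lemma F_comp: "u \<in> carrier F \<Longrightarrow> hcomp F (mdeg F) k u = (mcomp k (fst u), \<lambda>i. rcomp R (s i) k (snd u i))"
proof (rule Fm.md.homogeneous_induct[where P="\<lambda>u. hcomp F (mdeg F) k u = (mcomp k (fst u), \<lambda>i. rcomp R (s i) k (snd u i))"])
 fix l u assume u: "u \<in> mdeg F l"
 show "hcomp F (mdeg F) k u = (mcomp k (fst u), \<lambda>i. rcomp R (s i) k (snd u i))"
 proof (cases "k = l")
  case True then show ?thesis using u Fm.md.comp_id[OF u] by (cases u) (simp add: F_deg md.comp_id rcomp_facts(4))
 next
  case False
  then show ?thesis using u Fm.md.comp_other[OF False u] md.comp_other[OF False] rcomp_facts(5)[OF False]
   by (simp add: F_deg F_zero)
 qed
next
 fix u v assume uv: "u \<in> carrier F" "v \<in> carrier F"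
  "hcomp F (mdeg F) k u = (mcomp k (fst u), \<lambda>i. rcomp R (s i) k (snd u i))"
  "hcomp F (mdeg F) k v = (mcomp k (fst v), \<lambda>i. rcomp R (s i) k (snd v i))"
 show "hcomp F (mdeg F) k (u \<oplus>\<^sub>F v) = (mcomp k (fst (u \<oplus>\<^sub>F v)), \<lambda>i. rcomp R (s i) k (snd (u \<oplus>\<^sub>F v) i))"
  unfolding Fm.md.comp_add[OF uv(1,2)] uv(3,4) using uv(1,2) by (simp add: F_add F_carrier md.comp_add rcomp_simps)
qed assumption

definition S :: "('i \<Rightarrow> 'g) \<Rightarrow> 'g" where "S w = (\<Oplus>\<^bsub>N\<^esub> i \<in> {i. w i \<noteq> \<zero>\<^sub>N}. w i)"

lemma S_superset: "finite U \<Longrightarrow> {i. w i \<noteq> \<zero>\<^sub>N} \<subseteq> U \<Longrightarrow> (\<And>i. w i \<in> carrier N) \<Longrightarrow> S w = (\<Oplus>\<^bsub>N\<^esub> i \<in> U. w i)"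
 unfolding S_def by (rule M.finsum_support)

lemma S_closed: "(\<And>i. w i \<in> carrier N) \<Longrightarrow> S w \<in> carrier N"
 unfolding S_def by (rule M.finsum_closed) simp

lemma S_add:
 assumes "\<And>i. v i \<in> carrier N" "\<And>i. w i \<in> carrier N" "finite {i. v i \<noteq> \<zero>\<^sub>N}" "finite {i. w i \<noteq> \<zero>\<^sub>N}"
 shows "S (\<lambda>i. v i \<oplus>\<^sub>N w i) = S v \<oplus>\<^sub>N S w"
proof -
 let ?U = "{i. v i \<noteq> \<zero>\<^sub>N} \<union> {i. w i \<noteq> \<zero>\<^sub>N}"
 have U: "finite ?U" using assms(3,4) by (rule finite_UnI)
 have "S (\<lambda>i. v i \<oplus>\<^sub>N w i) = (\<Oplus>\<^bsub>N\<^esub> i \<in> ?U. v i \<oplus>\<^sub>N w i)"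
  by (rule S_superset[OF U]) (use assms(1,2) in auto)
 also have "\<dots> = (\<Oplus>\<^bsub>N\<^esub> i \<in> ?U. v i) \<oplus>\<^sub>N (\<Oplus>\<^bsub>N\<^esub> i \<in> ?U. w i)"
  by (rule M.finsum_addf) (use assms in auto)
 also have "(\<Oplus>\<^bsub>N\<^esub> i \<in> ?U. v i) = S v" by (rule S_superset[OF U, symmetric]) (use assms(1) in auto)
 also have "(\<Oplus>\<^bsub>N\<^esub> i \<in> ?U. w i) = S w" by (rule S_superset[OF U, symmetric]) (use assms(2) in auto)
 finally show ?thesis .
qed

lemma S_additive:
 assumes h: "\<And>x. x \<in> carrier N \<Longrightarrow> h x \<in> carrier N" "h \<zero>\<^sub>N = \<zero>\<^sub>N"
  "\<And>x y. x \<in> carrier N \<Longrightarrow> y \<in> carrier N \<Longrightarrow> h (x \<oplus>\<^sub>N y) = h x \<oplus>\<^sub>N h y"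
  and w: "\<And>i. w i \<in> carrier N" "finite {i. w i \<noteq> \<zero>\<^sub>N}"
 shows "S (\<lambda>i. h (w i)) = h (S w)"
proof -
 have "(\<Oplus>\<^bsub>N\<^esub> i \<in> U. h (w i)) = h (\<Oplus>\<^bsub>N\<^esub> i \<in> U. w i)" if "finite U" for U
  using that
 proof (induction U rule: finite_induct)
  case (insert i U)
  have c: "w \<in> U \<rightarrow> carrier N" "(\<lambda>i. h (w i)) \<in> U \<rightarrow> carrier N" using w h by auto
  then show ?case using insert w h M.finsum_closed[OF c(1)] by simp
 qed (simp add: h)
 moreover have "S (\<lambda>i. h (w i)) = (\<Oplus>\<^bsub>N\<^esub> i \<in> {i. w i \<noteq> \<zero>\<^sub>N}. h (w i))"
  by (rule S_superset[OF w(2)]) (use h w in auto)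
 ultimately show ?thesis using w(2) by (simp add: S_def)
qed

lemma S_single: "y \<in> carrier N \<Longrightarrow> S (\<lambda>i. if i = j then y else \<zero>\<^sub>N) = y"
 by (subst S_superset[of "{j}"]) auto

lemma S_zero: "S (\<lambda>i. \<zero>\<^sub>N) = \<zero>\<^sub>N" by (simp add: S_def)

text \<open>Finite sums of relations. Each \<open>P i\<close> is closed under addition, so one pair
  \<open>(snd u i, w i)\<close> per index is enough.\<close>

definition K :: "('g \<times> ('i \<Rightarrow> 'a)) set" where
 "K = {u \<in> carrier F. \<exists>w. (\<forall>i. (snd u i, w i) \<in> P i) \<and> finite {i. w i \<noteq> \<zero>\<^sub>N} \<and> fst u \<oplus>\<^sub>N S w = \<zero>\<^sub>N}"

lemma KI: "u \<in> carrier F \<Longrightarrow> (\<And>i. (snd u i, w i) \<in> P i) \<Longrightarrow> finite {i. w i \<noteq> \<zero>\<^sub>N} \<Longrightarrow> fst u \<oplus>\<^sub>N S w = \<zero>\<^sub>N \<Longrightarrow> u \<in> K"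
 unfolding K_def by blast

lemma KE:
 assumes "u \<in> K"
 obtains w where "u \<in> carrier F" "\<And>i. (snd u i, w i) \<in> P i" "\<And>i. w i \<in> carrier N" "finite {i. w i \<noteq> \<zero>\<^sub>N}"
  "fst u \<oplus>\<^sub>N S w = \<zero>\<^sub>N" "fst u \<in> carrier N" "S w \<in> carrier N"
proof -
 from assms obtain w where w: "u \<in> carrier F" "\<And>i. (snd u i, w i) \<in> P i" "finite {i. w i \<noteq> \<zero>\<^sub>N}" "fst u \<oplus>\<^sub>N S w = \<zero>\<^sub>N"
  unfolding K_def by blast
 have c: "w i \<in> carrier N" for i using graph_okD(2)[OF gok w(2)] .
 show ?thesis by (rule that[OF w(1,2) c w(3,4) _ S_closed[OF c]]) (use w(1) in \<open>simp add: F_carrier\<close>)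
qed

lemma K_hsub: "hsub R F K"
proof (rule Fm.hsubI)
 show "K \<subseteq> carrier F" unfolding K_def by blast
 show "\<zero>\<^sub>F \<in> K"
  by (rule KI[of _ "\<lambda>_. \<zero>\<^sub>N"]) (simp_all add: F_zero F_carrier S_zero graph_okD(3)[OF gok])
next
 fix u v assume "u \<in> K" "v \<in> K"
 then obtain w x where w: "u \<in> carrier F" "\<And>i. (snd u i, w i) \<in> P i" "\<And>i. w i \<in> carrier N" "finite {i. w i \<noteq> \<zero>\<^sub>N}"
  "fst u \<oplus>\<^sub>N S w = \<zero>\<^sub>N" "fst u \<in> carrier N" "S w \<in> carrier N"
  and x: "v \<in> carrier F" "\<And>i. (snd v i, x i) \<in> P i" "\<And>i. x i \<in> carrier N" "finite {i. x i \<noteq> \<zero>\<^sub>N}"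
  "fst v \<oplus>\<^sub>N S x = \<zero>\<^sub>N" "fst v \<in> carrier N" "S x \<in> carrier N" by (elim KE) blast
 show "u \<oplus>\<^sub>F v \<in> K"
 proof (rule KI[of _ "\<lambda>i. w i \<oplus>\<^sub>N x i"])
  show "u \<oplus>\<^sub>F v \<in> carrier F" using w x by simp
  show "(snd (u \<oplus>\<^sub>F v) i, w i \<oplus>\<^sub>N x i) \<in> P i" for i using graph_okD(4)[OF gok w(2) x(2)] by (simp add: F_add)
  show "finite {i. w i \<oplus>\<^sub>N x i \<noteq> \<zero>\<^sub>N}"
   by (rule finite_subset[OF _ finite_UnI[OF w(4) x(4)]]) auto
  have "fst (u \<oplus>\<^sub>F v) \<oplus>\<^sub>N S (\<lambda>i. w i \<oplus>\<^sub>N x i) = (fst u \<oplus>\<^sub>N fst v) \<oplus>\<^sub>N (S w \<oplus>\<^sub>N S x)"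
   using S_add[OF w(3) x(3) w(4) x(4)] by (simp add: F_add)
  also have "\<dots> = (fst u \<oplus>\<^sub>N S w) \<oplus>\<^sub>N (fst v \<oplus>\<^sub>N S x)" using w x by (intro swap4) auto
  finally show "fst (u \<oplus>\<^sub>F v) \<oplus>\<^sub>N S (\<lambda>i. w i \<oplus>\<^sub>N x i) = \<zero>\<^sub>N" using w x by simp
 qed
next
 fix a u assume a: "a \<in> carrier R" and "u \<in> K"
 from this(2) obtain w where w: "u \<in> carrier F" "\<And>i. (snd u i, w i) \<in> P i" "\<And>i. w i \<in> carrier N" "finite {i. w i \<noteq> \<zero>\<^sub>N}"
  "fst u \<oplus>\<^sub>N S w = \<zero>\<^sub>N" "fst u \<in> carrier N" "S w \<in> carrier N" by (elim KE) blast
 show "a \<odot>\<^sub>F u \<in> K"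
 proof (rule KI[of _ "\<lambda>i. a \<odot>\<^sub>N w i"])
  show "a \<odot>\<^sub>F u \<in> carrier F" using w a by simp
  show "(snd (a \<odot>\<^sub>F u) i, a \<odot>\<^sub>N w i) \<in> P i" for i using graph_okD(5)[OF gok a w(2)] by (simp add: F_smult)
  show "finite {i. a \<odot>\<^sub>N w i \<noteq> \<zero>\<^sub>N}" by (rule finite_subset[OF _ w(4)]) (use a in auto)
  have "S (\<lambda>i. a \<odot>\<^sub>N w i) = a \<odot>\<^sub>N S w"
   by (rule S_additive) (use a w(3,4) in \<open>simp_all add: smult_r_distr\<close>)
  then show "fst (a \<odot>\<^sub>F u) \<oplus>\<^sub>N S (\<lambda>i. a \<odot>\<^sub>N w i) = \<zero>\<^sub>N"
   using a w smult_r_distr[OF a w(6,7)] by (simp add: F_smult)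
 qed
next
 fix u k assume "u \<in> K"
 then obtain w where w: "u \<in> carrier F" "\<And>i. (snd u i, w i) \<in> P i" "\<And>i. w i \<in> carrier N" "finite {i. w i \<noteq> \<zero>\<^sub>N}"
  "fst u \<oplus>\<^sub>N S w = \<zero>\<^sub>N" "fst u \<in> carrier N" "S w \<in> carrier N" by (elim KE) blast
 show "hcomp F (mdeg F) k u \<in> K"
 proof (rule KI[of _ "\<lambda>i. mcomp k (w i)"])
  show "hcomp F (mdeg F) k u \<in> carrier F" using w Fm.md.comp_closed by simp
  show "(snd (hcomp F (mdeg F) k u) i, mcomp k (w i)) \<in> P i" for i
   using graph_okD(6)[OF gok w(2)] by (simp add: F_comp[OF w(1)])
  show "finite {i. mcomp k (w i) \<noteq> \<zero>\<^sub>N}" by (rule finite_subset[OF _ w(4)]) (auto simp: md.comp_zero)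
  have "S (\<lambda>i. mcomp k (w i)) = mcomp k (S w)"
   by (rule S_additive) (use w(3,4) in \<open>simp_all add: md.comp_add md.comp_closed md.comp_zero\<close>)
  then show "fst (hcomp F (mdeg F) k u) \<oplus>\<^sub>N S (\<lambda>i. mcomp k (w i)) = \<zero>\<^sub>N"
   using w md.comp_add[OF w(6,7), of k] md.comp_zero by (simp add: F_comp[OF w(1)])
 qed
qed

sublocale Fq: quot R F K
 by (rule quotI[OF graded F_graded K_hsub])

definition emb :: "'g \<Rightarrow> ('g \<times> ('i \<Rightarrow> 'a)) set" where "emb n = Fq.cl (n, \<lambda>_. \<zero>)"

lemma emb_hom: "emb \<in> graded_hom R N (graded_quotient F K)"
proof -
 have "(\<lambda>n. (n, \<lambda>_. \<zero>)) \<in> graded_hom R N F"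
  unfolding graded_hom_def by (auto simp: hom_def F_carrier F_add F_smult F_deg R.add_subgroupD(2)[OF rgr_subgroup])
 from graded_hom_comp[OF this Fq.cl_hom] show ?thesis by (simp add: emb_def[abs_def])
qed

text \<open>If all ring coordinates of an element of \<open>K\<close> are zero, single-valuedness of
  the graphs makes all the values zero, so no relation is imposed on \<open>N\<close>
  itself.\<close>

lemma emb_inj: "inj_on emb (carrier N)"
proof (rule inj_onI)
 fix x y assume x: "x \<in> carrier N" and y: "y \<in> carrier N" and e: "emb x = emb y"
 have c: "(x, \<lambda>_. \<zero>) \<in> carrier F" "(y, \<lambda>_. \<zero>) \<in> carrier F" using x y by (simp_all add: F_carrier)
 then have "(x, \<lambda>_. \<zero>) \<ominus>\<^sub>F (y, \<lambda>_. \<zero>) \<in> K" using e Fq.cl_eq_iff[OF c] by (simp add: emb_def)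
 moreover have "(x, \<lambda>_. \<zero>) \<ominus>\<^sub>F (y, \<lambda>_. \<zero>) = (x \<ominus>\<^sub>N y, \<lambda>_. \<zero>)"
 proof -
  have "(x, \<lambda>_. \<zero>) = (x \<ominus>\<^sub>N y, \<lambda>_. \<zero>) \<oplus>\<^sub>F (y, \<lambda>_. \<zero>)" using M.minus_plus[OF x y] by (simp add: F_add)
  then show ?thesis using Fm.M.plus_minus_r[of "(x \<ominus>\<^sub>N y, \<lambda>_. \<zero>)" "(y, \<lambda>_. \<zero>)"] c(2) x y by (simp add: F_carrier)
 qed
 ultimately have "(x \<ominus>\<^sub>N y, \<lambda>_. \<zero>) \<in> K" by simp
 then obtain w where w: "\<And>i. (\<zero>, w i) \<in> P i" "x \<ominus>\<^sub>N y \<oplus>\<^sub>N S w = \<zero>\<^sub>N" by (elim KE) auto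
 have "w = (\<lambda>_. \<zero>\<^sub>N)" using graph_okD(7)[OF gok w(1)] by (intro ext)
 then have "x \<ominus>\<^sub>N y = \<zero>\<^sub>N" using w(2) x y by (simp add: S_zero)
 then show "x = y" by (rule M.minus_zeroD[OF x y])
qed

lemma emb_solution:
 "\<exists>e\<in>mdeg (graded_quotient F K) (s j). \<forall>a y. (a, y) \<in> P j \<longrightarrow> a \<odot>\<^bsub>graded_quotient F K\<^esub> e = emb y"
proof (intro bexI allI impI)
 let ?e = "(\<zero>\<^sub>N, \<lambda>i. if i = j then \<one> else \<zero>)"
 have eF: "?e \<in> carrier F" by (simp add: F_carrier)
 have "?e \<in> mdeg F (s j)"
  using rgr_of_nat[of 0] one_deg R.add_subgroupD(2)[OF rgr_subgroup] by (simp add: F_deg md.piece_zero)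
 then show "Fq.cl ?e \<in> mdeg (graded_quotient F K) (s j)" by (simp add: Fq.Q_deg)
 fix a y assume ay: "(a, y) \<in> P j"
 have ac: "a \<in> carrier R" and yc: "y \<in> carrier N" using graph_okD(1,2)[OF gok ay] .
 have yF: "(y, \<lambda>_. \<zero>) \<in> carrier F" using yc by (simp add: F_carrier)
 let ?d = "(\<ominus>\<^sub>N y, \<lambda>i. if i = j then a else \<zero>)"
 have dF: "?d \<in> carrier F" using ac yc by (simp add: F_carrier)
 have "a \<odot>\<^sub>F ?e = ?d \<oplus>\<^sub>F (y, \<lambda>_. \<zero>)" using ac yc by (auto simp: F_smult F_add M.l_neg)
 then have "a \<odot>\<^sub>F ?e \<ominus>\<^sub>F (y, \<lambda>_. \<zero>) = ?d" using Fm.M.plus_minus_r[OF dF yF] by simp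
 moreover have "?d \<in> K"
 proof (rule KI[OF dF, of "\<lambda>i. if i = j then y else \<zero>\<^sub>N"])
  show "(snd ?d i, if i = j then y else \<zero>\<^sub>N) \<in> P i" for i using ay graph_okD(3)[OF gok, of i] by simp
  show "fst ?d \<oplus>\<^sub>N S (\<lambda>i. if i = j then y else \<zero>\<^sub>N) = \<zero>\<^sub>N" using yc by (simp add: S_single M.l_neg)
 qed simp
 ultimately have "Fq.cl (a \<odot>\<^sub>F ?e) = Fq.cl (y, \<lambda>_. \<zero>)"
  using Fq.cl_eq_iff[of "a \<odot>\<^sub>F ?e" "(y, \<lambda>_. \<zero>)"] ac eF yF Fm.smult_closed[OF ac eF] by simp
 then show "a \<odot>\<^bsub>graded_quotient F K\<^esub> Fq.cl ?e = emb y" using Fq.Q_smult[OF ac eF] by (simp add: emb_def)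
qed

end

text \<open>Baer's criterion: only finite systems of equations need to be solvable, because the ring is Noetherian.\<close>

definition solves :: "'a graded_ring \<Rightarrow> ('a, 'g) graded_module \<Rightarrow> ('a, 'g) graded_module \<Rightarrow> bool" where
 "solves R N N' \<longleftrightarrow> (\<forall>s ps H. graph_ok R N s H \<longrightarrow> set ps \<subseteq> H \<longrightarrow>
   (\<exists>e\<in>mdeg N' s. \<forall>(a, y)\<in>set ps. a \<odot>\<^sub>N' e = y))"

text \<open>A maximal partial extension, viewed as a graph, is defined everywhere: for homogeneous
  \<open>b\<close> the scalars that send \<open>b\<close> into its domain form an ideal with a
  partial map to \<open>E\<close>. The ideal is finitely generated, so this map is multiplication by
  some \<open>e\<close>, and \<open>b\<close> may be sent to \<open>e\<close>. The carrier types of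
  \<open>A\<close> and \<open>B\<close> are arbitrary, in contrast to
  \<open>graded_injective\<close>.\<close>

lemma baer:
 fixes R :: "'a graded_ring" and E :: "('a, 'e) graded_module" and A :: "('a, 'x) graded_module" and B :: "('a, 'y) graded_module"
 assumes gr: "is_graded_ring R" and acc: "acc (shifted_ring R 0) (carrier R) (carrier R)"
  and gE: "is_graded_module R E" and sol: "solves R E E"
  and gA: "is_graded_module R A" and gB: "is_graded_module R B"
  and u: "u \<in> graded_hom R A B" "inj_on u (carrier A)" and f: "f \<in> graded_hom R A E"
 shows "\<exists>g\<in>graded_hom R B E. \<forall>x\<in>carrier A. g (u x) = f x"
proof -
 interpret R: graded_ring_loc R by (rule graded_ring_locI[OF gr])
 interpret E: graded_module_loc R E by (rule graded_module_locI[OF gr gE])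
 interpret B: graded_module_loc R B by (rule graded_module_locI[OF gr gB])
 interpret u: ghom R A B u by (rule ghomI[OF gr gA gB u(1)])
 interpret f: ghom R A E f by (rule ghomI[OF gr gA gE f])
 define ok where "ok P \<longleftrightarrow> P \<subseteq> carrier B \<times> carrier E \<and>
   (\<forall>x v y w. (x, v) \<in> P \<longrightarrow> (y, w) \<in> P \<longrightarrow> (x \<oplus>\<^sub>B y, v \<oplus>\<^sub>E w) \<in> P) \<and>
   (\<forall>r x v. r \<in> carrier R \<longrightarrow> (x, v) \<in> P \<longrightarrow> (r \<odot>\<^sub>B x, r \<odot>\<^sub>E v) \<in> P) \<and>
   (\<forall>n x v. (x, v) \<in> P \<longrightarrow> (B.mcomp n x, E.mcomp n v) \<in> P) \<and>
   (\<forall>v. (\<zero>\<^sub>B, v) \<in> P \<longrightarrow> v = \<zero>\<^sub>E)" for P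
 have okI: "ok P" if "P \<subseteq> carrier B \<times> carrier E"
   "\<And>x v y w. (x, v) \<in> P \<Longrightarrow> (y, w) \<in> P \<Longrightarrow> (x \<oplus>\<^sub>B y, v \<oplus>\<^sub>E w) \<in> P"
   "\<And>r x v. r \<in> carrier R \<Longrightarrow> (x, v) \<in> P \<Longrightarrow> (r \<odot>\<^sub>B x, r \<odot>\<^sub>E v) \<in> P"
   "\<And>n x v. (x, v) \<in> P \<Longrightarrow> (B.mcomp n x, E.mcomp n v) \<in> P"
   "\<And>v. (\<zero>\<^sub>B, v) \<in> P \<Longrightarrow> v = \<zero>\<^sub>E" for P
  unfolding ok_def using that by blast
 have okD: "(x, v) \<in> P \<Longrightarrow> x \<in> carrier B" "(x, v) \<in> P \<Longrightarrow> v \<in> carrier E"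
   "(x, v) \<in> P \<Longrightarrow> (y, w) \<in> P \<Longrightarrow> (x \<oplus>\<^sub>B y, v \<oplus>\<^sub>E w) \<in> P"
   "r \<in> carrier R \<Longrightarrow> (x, v) \<in> P \<Longrightarrow> (r \<odot>\<^sub>B x, r \<odot>\<^sub>E v) \<in> P"
   "(x, v) \<in> P \<Longrightarrow> (B.mcomp n x, E.mcomp n v) \<in> P"
   "(\<zero>\<^sub>B, v) \<in> P \<Longrightarrow> v = \<zero>\<^sub>E" if "ok P" for P x v y w r n
  using that unfolding ok_def by (blast, blast, blast, blast, blast, blast)
 let ?P0 = "(\<lambda>x. (u x, f x)) ` carrier A"
 have P0: "ok ?P0"
 proof (rule okI)
  fix x v y w assume "(x, v) \<in> ?P0" "(y, w) \<in> ?P0"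
  then obtain p q where "p \<in> carrier A" "q \<in> carrier A" "x = u p" "v = f p" "y = u q" "w = f q" by auto
  then show "(x \<oplus>\<^sub>B y, v \<oplus>\<^sub>E w) \<in> ?P0" by (intro image_eqI[of _ _ "p \<oplus>\<^sub>A q"]) (simp_all add: u.add f.add)
 next
  fix r x v assume "r \<in> carrier R" "(x, v) \<in> ?P0"
  then obtain p where "p \<in> carrier A" "x = u p" "v = f p" "r \<in> carrier R" by auto
  then show "(r \<odot>\<^sub>B x, r \<odot>\<^sub>E v) \<in> ?P0" by (intro image_eqI[of _ _ "r \<odot>\<^sub>A p"]) (simp_all add: u.smult f.smult)
 next
  fix n x v assume "(x, v) \<in> ?P0"
  then obtain p where "p \<in> carrier A" "x = u p" "v = f p" by auto
  then show "(B.mcomp n x, E.mcomp n v) \<in> ?P0"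
   by (intro image_eqI[of _ _ "u.dom.mcomp n p"]) (simp_all add: u.comp f.comp u.dom.md.comp_closed)
 next
  fix v assume "(\<zero>\<^sub>B, v) \<in> ?P0"
  then obtain p where p: "p \<in> carrier A" "u p = \<zero>\<^sub>B" "v = f p" by auto
  have "p = \<zero>\<^sub>A" by (rule inj_onD[OF u(2)]) (use p in simp_all)
  then show "v = \<zero>\<^sub>E" using p by simp
 qed auto
 let ?F = "{P. ok P \<and> ?P0 \<subseteq> P}"
 have "\<exists>P\<in>?F. \<forall>Q\<in>?F. P \<subseteq> Q \<longrightarrow> Q = P"
 proof (rule subset_Zorn_nonempty)
  show "?F \<noteq> {}" using P0 by blast
  fix C assume C: "C \<noteq> {}" "subset.chain ?F C"
  have Cok: "ok P" "?P0 \<subseteq> P" if "P \<in> C" for P using C(2) that unfolding subset_chain_def by auto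
  have lin: "P \<subseteq> Q \<or> Q \<subseteq> P" if "P \<in> C" "Q \<in> C" for P Q using C(2) that unfolding subset_chain_def by blast
  have "ok (\<Union>C)"
  proof (rule okI)
   show "\<Union>C \<subseteq> carrier B \<times> carrier E" using okD(1,2)[OF Cok(1)] by auto
   show "(x \<oplus>\<^sub>B y, v \<oplus>\<^sub>E w) \<in> \<Union>C" if xy: "(x, v) \<in> \<Union>C" "(y, w) \<in> \<Union>C" for x v y w
   proof -
    obtain P Q where PQ: "P \<in> C" "Q \<in> C" "(x, v) \<in> P" "(y, w) \<in> Q" using xy by blast
    from lin[OF PQ(1,2)] show ?thesis
    proof
     assume "P \<subseteq> Q" then show ?thesis using okD(3)[OF Cok(1)[OF PQ(2)], of x v y w] PQ by blast
    next
     assume "Q \<subseteq> P" then show ?thesis using okD(3)[OF Cok(1)[OF PQ(1)], of x v y w] PQ by blast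
    qed
   qed
   show "(r \<odot>\<^sub>B x, r \<odot>\<^sub>E v) \<in> \<Union>C" if xr: "r \<in> carrier R" "(x, v) \<in> \<Union>C" for r x v
    using xr(2) okD(4)[OF Cok(1) xr(1)] by blast
   show "(B.mcomp n x, E.mcomp n v) \<in> \<Union>C" if x: "(x, v) \<in> \<Union>C" for n x v
    using x okD(5)[OF Cok(1)] by blast
   show "v = \<zero>\<^sub>E" if x: "(\<zero>\<^sub>B, v) \<in> \<Union>C" for v using x okD(6)[OF Cok(1)] by blast
  qed
  then show "\<Union>C \<in> ?F" using C(1) Cok(2) by blast
 qed
 then obtain P where PF: "P \<in> ?F" and max': "\<forall>Q\<in>?F. P \<subseteq> Q \<longrightarrow> Q = P" by (rule bexE)
 have P: "ok P" "?P0 \<subseteq> P" using PF by simp_all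
 have max: "Q = P" if "ok Q" "P \<subseteq> Q" for Q using bspec[OF max', of Q] that P(2) by simp
 note Pd = okD[OF P(1)]
 have Pz: "(\<zero>\<^sub>B, \<zero>\<^sub>E) \<in> P" using P(2) u.zero f.zero u.dom.M.zero_closed by force
 have hom: "\<exists>v. (b, v) \<in> P" if b: "b \<in> mdeg B s" for b s
 proof -
  have bc: "b \<in> carrier B" using B.md.piece_carrier[OF b] .
  \<comment> \<open>The constraints a e = y that an image \<open>e\<close> of \<open>b\<close> has
    to satisfy.\<close>
  define H where "H = {(a, y). a \<in> carrier R \<and> (a \<odot>\<^sub>B b, y) \<in> P}"
  have Hin: "(a, y) \<in> H \<longleftrightarrow> a \<in> carrier R \<and> (a \<odot>\<^sub>B b, y) \<in> P" for a y by (simp add: H_def)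
  have H: "graph_ok R E s H"
   unfolding graph_ok_def
  proof (intro conjI allI impI)
   show "H \<subseteq> carrier R \<times> carrier E" using Pd(2) by (auto simp: H_def)
   show "(\<zero>\<^sub>R, \<zero>\<^sub>E) \<in> H" using Pz bc by (simp add: Hin)
   show "(a \<oplus>\<^sub>R a', y \<oplus>\<^sub>E w) \<in> H" if "(a, y) \<in> H" "(a', w) \<in> H" for a y a' w
    using that bc Pd(3) by (simp add: Hin B.smult_l_distr)
   show "(r \<otimes>\<^sub>R a, r \<odot>\<^sub>E y) \<in> H" if "r \<in> carrier R" "(a, y) \<in> H" for r a y
    using that bc Pd(4) by (simp add: Hin B.smult_assoc1)
   show "(rcomp R s n a, E.mcomp n y) \<in> H" if ay: "(a, y) \<in> H" for n a y
    using ay Pd(5)[of "a \<odot>\<^sub>B b" y n] B.comp_smult_rcomp[OF _ b, of a n] R.rcomp_facts(8)[of a s n] by (simp add: Hin)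
   show "y = \<zero>\<^sub>E" if "(\<zero>\<^sub>R, y) \<in> H" for y using that bc Pd(6) by (simp add: Hin)
  qed
  interpret Rm: module R "shifted_ring R 0" by (rule R.shifted_ring_module)
  note Hd = graph_okD[OF H]
  let ?I = "fst ` H"
  have HI: "a \<in> ?I" if "(a, y) \<in> H" for a y using imageI[OF that, of fst] by simp
  have I: "asub (shifted_ring R 0) (carrier R) ?I"
  proof (rule Rm.asubI)
   show "?I \<subseteq> carrier (shifted_ring R 0)" using Hd(1) by auto
   show "\<zero>\<^bsub>shifted_ring R 0\<^esub> \<in> ?I" using HI[OF Hd(3)] by simp
   fix x assume "x \<in> ?I"
   then obtain v where v: "(x, v) \<in> H" by auto
   have "\<ominus>\<^sub>R \<one>\<^sub>R \<otimes>\<^sub>R x \<in> ?I" by (rule HI[OF Hd(5)[OF _ v]]) simp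
   then show "\<ominus>\<^bsub>shifted_ring R 0\<^esub> x \<in> ?I" using Hd(1)[OF v] by (simp add: R.Rmod_neg R.l_minus)
   show "a \<odot>\<^bsub>shifted_ring R 0\<^esub> x \<in> ?I" if a: "a \<in> carrier R" for a using HI[OF Hd(5)[OF a v]] by simp
   fix y assume "y \<in> ?I"
   then obtain w where w: "(y, w) \<in> H" by auto
   show "x \<oplus>\<^bsub>shifted_ring R 0\<^esub> y \<in> ?I" using HI[OF Hd(4)[OF v w]] by simp
  qed
  have Ic: "?I \<subseteq> carrier R" using Hd(1) by auto
  obtain S where S: "finite S" "S \<subseteq> ?I" "aspan (shifted_ring R 0) (carrier R) S = ?I"
   using Rm.acc_fin_gen[OF acc I Ic subset_refl] by blast
  have "\<forall>a\<in>S. \<exists>y. (a, y) \<in> H"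
  proof
   fix a assume "a \<in> S"
   then have "a \<in> fst ` H" using S(2) by blast
   then obtain p where "p \<in> H" "a = fst p" by (elim imageE) simp
   then have "(a, snd p) \<in> H" by simp
   then show "\<exists>y. (a, y) \<in> H" by (rule exI)
  qed
  then obtain yy where yy: "\<And>a. a \<in> S \<Longrightarrow> (a, yy a) \<in> H" by metis
  obtain as where as: "set as = S" using finite_list[OF S(1)] by blast
  have "set (map (\<lambda>a. (a, yy a)) as) \<subseteq> H" using yy as by auto
  then obtain e where e: "e \<in> mdeg E s" "\<forall>(a, y)\<in>set (map (\<lambda>a. (a, yy a)) as). a \<odot>\<^sub>E e = y"
   using sol H unfolding solves_def by meson
  have ec: "e \<in> carrier E" using E.md.piece_carrier[OF e(1)] .
  have eS: "(a, a \<odot>\<^sub>E e) \<in> H" if "a \<in> S" for a using e(2) as yy[OF that] that by auto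
  \<comment> \<open>A solution for the generators is a solution on the whole ideal, because the
    scalars \<open>a\<close> with (a, a e) in the graph form an ideal themselves.\<close>
  let ?J = "{a \<in> carrier R. (a, a \<odot>\<^sub>E e) \<in> H}"
  have J: "asub (shifted_ring R 0) (carrier R) ?J"
  proof (rule Rm.asubI)
   show "\<zero>\<^bsub>shifted_ring R 0\<^esub> \<in> ?J" using Hd(3) ec by simp
   fix x assume x: "x \<in> ?J"
   show "\<ominus>\<^bsub>shifted_ring R 0\<^esub> x \<in> ?J"
    using x Hd(5)[of "\<ominus>\<^sub>R \<one>\<^sub>R" x "x \<odot>\<^sub>E e"] ec by (simp add: R.Rmod_neg R.l_minus E.smult_l_minus)
   show "a \<odot>\<^bsub>shifted_ring R 0\<^esub> x \<in> ?J" if "a \<in> carrier R" for a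
    using x Hd(5)[OF that, of x "x \<odot>\<^sub>E e"] ec that by (simp add: E.smult_assoc1)
   fix y assume "y \<in> ?J"
   then show "x \<oplus>\<^bsub>shifted_ring R 0\<^esub> y \<in> ?J"
    using x Hd(4)[of x "x \<odot>\<^sub>E e" y "y \<odot>\<^sub>E e"] ec by (simp add: E.smult_l_distr)
  qed auto
  have "S \<subseteq> ?J" using eS S(2) Ic by blast
  from Rm.aspan_least[OF J this] have IJ: "?I \<subseteq> ?J" unfolding S(3) .
  have key: "a \<odot>\<^sub>E e = y" if ay: "(a, y) \<in> H" for a y
  proof -
   have "a \<in> ?J" using subsetD[OF IJ HI[OF ay]] .
   then have ae: "(a, a \<odot>\<^sub>E e) \<in> H" by simp
   have c: "a \<in> carrier R" "y \<in> carrier E" using Hd(1,2)[OF ay] by auto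
   have "(a \<oplus>\<^sub>R \<ominus>\<^sub>R \<one>\<^sub>R \<otimes>\<^sub>R a, a \<odot>\<^sub>E e \<oplus>\<^sub>E (\<ominus>\<^sub>R \<one>\<^sub>R) \<odot>\<^sub>E y) \<in> H"
    by (rule Hd(4)[OF ae Hd(5)[OF _ ay]]) simp
   moreover have "a \<oplus>\<^sub>R \<ominus>\<^sub>R \<one>\<^sub>R \<otimes>\<^sub>R a = \<zero>\<^sub>R" using c by (simp add: R.l_minus R.r_neg)
   ultimately have "a \<odot>\<^sub>E e \<oplus>\<^sub>E (\<ominus>\<^sub>R \<one>\<^sub>R) \<odot>\<^sub>E y = \<zero>\<^sub>E" using Hd(7) by simp
   then have "a \<odot>\<^sub>E e \<ominus>\<^sub>E y = \<zero>\<^sub>E" using c by (simp add: E.smult_l_minus E.M.minus_eq)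
   then show ?thesis by (rule E.M.minus_zeroD[OF E.smult_closed[OF c(1) ec] c(2)])
  qed
  \<comment> \<open>The extension by \<open>b \<mapsto> e\<close>, written without deciding which
    multiples of \<open>b\<close> already lie in the old domain.\<close>
  define P' where "P' = {(x \<oplus>\<^sub>B a \<odot>\<^sub>B b, v \<oplus>\<^sub>E a \<odot>\<^sub>E e) | x v a. (x, v) \<in> P \<and> a \<in> carrier R}"
  have P'I: "(x \<oplus>\<^sub>B a \<odot>\<^sub>B b, v \<oplus>\<^sub>E a \<odot>\<^sub>E e) \<in> P'" if "(x, v) \<in> P" "a \<in> carrier R" for x v a
   unfolding P'_def using that by blast
  have P'E: "\<exists>x v a. p = x \<oplus>\<^sub>B a \<odot>\<^sub>B b \<and> q = v \<oplus>\<^sub>E a \<odot>\<^sub>E e \<and> (x, v) \<in> P \<and> a \<in> carrier R \<and> x \<in> carrier B \<and> v \<in> carrier E"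
   if "(p, q) \<in> P'" for p q using that Pd(1,2) unfolding P'_def by blast
  \<comment> \<open>From x + ab = 0 the multiple ab = -x is in the old domain with value -v, so ae =
    -v by \<open>key\<close>.\<close>
  have P'0: "q = \<zero>\<^sub>E" if pq: "(\<zero>\<^sub>B, q) \<in> P'" for q
   proof -
    obtain x v a where x: "\<zero>\<^sub>B = x \<oplus>\<^sub>B a \<odot>\<^sub>B b" "q = v \<oplus>\<^sub>E a \<odot>\<^sub>E e" "(x, v) \<in> P" "a \<in> carrier R" "x \<in> carrier B" "v \<in> carrier E"
     using P'E[OF pq] by blast
    have ab: "a \<odot>\<^sub>B b = \<ominus>\<^sub>B x"
     using x(1)[symmetric] x(4,5) bc B.M.minus_equality[of "a \<odot>\<^sub>B b" x] by (simp add: B.M.a_comm)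
    have "((\<ominus>\<^sub>R \<one>\<^sub>R) \<odot>\<^sub>B x, (\<ominus>\<^sub>R \<one>\<^sub>R) \<odot>\<^sub>E v) \<in> P" by (rule Pd(4)[OF _ x(3)]) simp
    then have "(\<ominus>\<^sub>B x, \<ominus>\<^sub>E v) \<in> P" using x(5,6) by (simp add: B.smult_l_minus E.smult_l_minus)
    then have "(a, \<ominus>\<^sub>E v) \<in> H" using x(4) ab by (simp add: Hin)
    then have "a \<odot>\<^sub>E e = \<ominus>\<^sub>E v" by (rule key)
    then show ?thesis using x(2,6) by (simp add: E.M.r_neg)
   qed
  have "ok P'"
  proof (rule okI)
   show "q = \<zero>\<^sub>E" if "(\<zero>\<^sub>B, q) \<in> P'" for q by (rule P'0[OF that])
  next
   show "P' \<subseteq> carrier B \<times> carrier E" using P'E bc ec by fastforce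
  next
   fix p q assume "(p, q) \<in> P'"
   then obtain x v a where x: "p = x \<oplus>\<^sub>B a \<odot>\<^sub>B b" "q = v \<oplus>\<^sub>E a \<odot>\<^sub>E e" "(x, v) \<in> P" "a \<in> carrier R" "x \<in> carrier B" "v \<in> carrier E"
    using P'E by blast
   show "(r \<odot>\<^sub>B p, r \<odot>\<^sub>E q) \<in> P'" if r: "r \<in> carrier R" for r
   proof -
    have "r \<odot>\<^sub>B p = r \<odot>\<^sub>B x \<oplus>\<^sub>B (r \<otimes>\<^sub>R a) \<odot>\<^sub>B b" "r \<odot>\<^sub>E q = r \<odot>\<^sub>E v \<oplus>\<^sub>E (r \<otimes>\<^sub>R a) \<odot>\<^sub>E e"
     using x r bc ec by (simp_all add: B.smult_r_distr B.smult_assoc1 E.smult_r_distr E.smult_assoc1)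
    then show ?thesis using P'I[OF Pd(4)[OF r x(3)], of "r \<otimes>\<^sub>R a"] r x(4) by simp
   qed
   show "(B.mcomp n p, E.mcomp n q) \<in> P'" for n
   proof -
    have "B.mcomp n p = B.mcomp n x \<oplus>\<^sub>B rcomp R s n a \<odot>\<^sub>B b" "E.mcomp n q = E.mcomp n v \<oplus>\<^sub>E rcomp R s n a \<odot>\<^sub>E e"
     using x bc ec B.comp_smult_rcomp[OF x(4) b] E.comp_smult_rcomp[OF x(4) e(1)]
     by (simp_all add: B.md.comp_add E.md.comp_add)
    then show ?thesis using P'I[OF Pd(5)[OF x(3)] R.rcomp_facts(8)[OF x(4)]] by simp
   qed
   fix p' q' assume "(p', q') \<in> P'"
   then obtain x' v' a' where y: "p' = x' \<oplus>\<^sub>B a' \<odot>\<^sub>B b" "q' = v' \<oplus>\<^sub>E a' \<odot>\<^sub>E e" "(x', v') \<in> P" "a' \<in> carrier R" "x' \<in> carrier B" "v' \<in> carrier E"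
    using P'E by blast
   have "p \<oplus>\<^sub>B p' = (x \<oplus>\<^sub>B x') \<oplus>\<^sub>B (a \<oplus>\<^sub>R a') \<odot>\<^sub>B b" "q \<oplus>\<^sub>E q' = (v \<oplus>\<^sub>E v') \<oplus>\<^sub>E (a \<oplus>\<^sub>R a') \<odot>\<^sub>E e"
    using x y bc ec B.swap4[of x "a \<odot>\<^sub>B b" x' "a' \<odot>\<^sub>B b"] E.swap4[of v "a \<odot>\<^sub>E e" v' "a' \<odot>\<^sub>E e"]
    by (simp_all add: B.smult_l_distr E.smult_l_distr)
   then show "(p \<oplus>\<^sub>B p', q \<oplus>\<^sub>E q') \<in> P'" using P'I[OF Pd(3)[OF x(3) y(3)], of "a \<oplus>\<^sub>R a'"] x(4) y(4) by simp
  qed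
  moreover have "P \<subseteq> P'"
  proof
   fix p assume p: "p \<in> P"
   obtain x v where xv: "p = (x, v)" by (cases p)
   have "(x \<oplus>\<^sub>B \<zero>\<^sub>R \<odot>\<^sub>B b, v \<oplus>\<^sub>E \<zero>\<^sub>R \<odot>\<^sub>E e) \<in> P'" by (rule P'I) (use p xv in simp_all)
   then show "p \<in> P'" using xv p Pd(1,2)[of x v] bc ec by simp
  qed
  ultimately have "P' = P" by (rule max)
  moreover have "(\<zero>\<^sub>B \<oplus>\<^sub>B \<one>\<^sub>R \<odot>\<^sub>B b, \<zero>\<^sub>E \<oplus>\<^sub>E \<one>\<^sub>R \<odot>\<^sub>E e) \<in> P'" by (rule P'I[OF Pz]) simp
  ultimately have "(b, e) \<in> P" using bc ec by simp
  then show ?thesis by blast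
 qed
 have dom: "\<exists>v. (b, v) \<in> P" if "b \<in> carrier B" for b
  by (rule B.md.homogeneous_induct[OF that hom]) (use Pd(3) in blast)+
 have uniq: "v = w" if vw: "(b, v) \<in> P" "(b, w) \<in> P" for b v w
 proof -
  have c: "b \<in> carrier B" "v \<in> carrier E" "w \<in> carrier E" using Pd(1,2) vw by blast+
  have "(b \<oplus>\<^sub>B (\<ominus>\<^sub>R \<one>\<^sub>R) \<odot>\<^sub>B b, v \<oplus>\<^sub>E (\<ominus>\<^sub>R \<one>\<^sub>R) \<odot>\<^sub>E w) \<in> P"
   by (rule Pd(3)[OF vw(1) Pd(4)[OF _ vw(2)]]) simp
  then have "(\<zero>\<^sub>B, v \<ominus>\<^sub>E w) \<in> P" using c by (simp add: B.smult_l_minus E.smult_l_minus B.M.r_neg E.M.minus_eq)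
  then show "v = w" using E.M.minus_zeroD[OF c(2,3) Pd(6)] by blast
 qed
 define g where "g b = (SOME v. (b, v) \<in> P)" for b
 have g: "(b, g b) \<in> P" if "b \<in> carrier B" for b unfolding g_def using dom[OF that] by (rule someI_ex)
 have geq: "g b = v" if "(b, v) \<in> P" for b v using uniq[OF g[OF Pd(1)[OF that]] that] .
 have "g \<in> graded_hom R B E"
  unfolding graded_hom_def hom_def
 proof (intro CollectI conjI ballI allI Pi_I subsetI)
  show "g x \<in> carrier (add_monoid E)" if "x \<in> carrier (add_monoid B)" for x using Pd(2)[OF g] that by simp
  show "g (x \<otimes>\<^bsub>add_monoid B\<^esub> y) = g x \<otimes>\<^bsub>add_monoid E\<^esub> g y" if "x \<in> carrier (add_monoid B)" "y \<in> carrier (add_monoid B)" for x y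
   using geq[OF Pd(3)[OF g g]] that by simp
  show "g (a \<odot>\<^sub>B x) = a \<odot>\<^sub>E g x" if "a \<in> carrier R" "x \<in> carrier B" for a x
   using geq[OF Pd(4)[OF that(1) g[OF that(2)]]] .
  show "y \<in> mdeg E n" if yg: "y \<in> g ` mdeg B n" for n y
  proof -
   obtain x where x: "x \<in> mdeg B n" "y = g x" using yg by blast
   have "(x, E.mcomp n (g x)) \<in> P"
    using Pd(5)[OF g[OF B.md.piece_carrier[OF x(1)]], of n] B.md.comp_id[OF x(1)] by simp
   then have "g x = E.mcomp n (g x)" by (rule geq)
   moreover have "E.mcomp n (g x) \<in> mdeg E n"
    using E.md.comp_in[OF Pd(2)[OF g[OF B.md.piece_carrier[OF x(1)]]]] .
   ultimately show ?thesis using x(2) by simp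
  qed
 qed
 moreover have "g (u x) = f x" if "x \<in> carrier A" for x
  by (rule geq) (use P(2) that in blast)
 ultimately show ?thesis by blast
qed

section \<open>Sizes of carriers\<close>

definition small :: "'c itself \<Rightarrow> 'x set \<Rightarrow> bool" where
 "small c X \<longleftrightarrow> (\<exists>f :: 'x \<Rightarrow> 'c. inj_on f X)"

lemma small_subset: "small c X \<Longrightarrow> Y \<subseteq> X \<Longrightarrow> small c Y"
 unfolding small_def using inj_on_subset by blast

lemma small_image:
 assumes "small (c :: 'c itself) X" shows "small c (h ` X)"
proof -
 obtain f :: "'a \<Rightarrow> 'c" where f: "inj_on f X" using assms by (auto simp: small_def)
 have "inj_on (\<lambda>y. f (inv_into X h y)) (h ` X)"
 proof (rule inj_onI)
  fix y z assume yz: "y \<in> h ` X" "z \<in> h ` X" "f (inv_into X h y) = f (inv_into X h z)"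
  then have "inv_into X h y = inv_into X h z" by (intro inj_onD[OF f]) (simp_all add: inv_into_into)
  then show "y = z" using yz(1,2) f_inv_into_f by metis
 qed
 then show ?thesis unfolding small_def by blast
qed

lemma small_UNIV: "small TYPE('c) (X :: 'c set)"
 unfolding small_def by (intro exI[of _ "\<lambda>x. x"]) simp

text \<open>A type into which its own finite lists, the ring and the natural numbers embed. Closure
  under finite lists replaces cardinal arithmetic: everything adjoined in the construction of
  injective modules is coded by finite data.\<close>

locale coding =
 fixes pr :: "'c list \<Rightarrow> 'c" and ia :: "'a \<Rightarrow> 'c" and q :: "nat \<Rightarrow> 'c"
 assumes inj_pr: "inj pr" and inj_ia: "inj ia" and inj_q: "inj q"
begin

lemma small_Times:
 assumes "small TYPE('c) X" "small TYPE('c) Y" shows "small TYPE('c) (X \<times> Y)"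
proof -
 obtain f g where f: "inj_on (f :: _ \<Rightarrow> 'c) X" and g: "inj_on (g :: _ \<Rightarrow> 'c) Y" using assms by (auto simp: small_def)
 have "inj_on (\<lambda>u. pr [f (fst u), g (snd u)]) (X \<times> Y)"
  by (rule inj_onI) (use f g in \<open>auto dest!: injD[OF inj_pr] dest: inj_onD\<close>)
 then show ?thesis unfolding small_def by blast
qed

lemma small_lists:
 assumes "small TYPE('c) X" shows "small TYPE('c) {l. set l \<subseteq> X}"
proof -
 obtain f where f: "inj_on (f :: _ \<Rightarrow> 'c) X" using assms by (auto simp: small_def)
 have "inj_on (\<lambda>l. pr (map f l)) {l. set l \<subseteq> X}"
 proof (rule inj_onI)
  fix l m assume lm: "l \<in> {l. set l \<subseteq> X}" "m \<in> {l. set l \<subseteq> X}" "pr (map f l) = pr (map f m)"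
  have "map f l = map f m" using injD[OF inj_pr lm(3)] .
  then show "l = m" using lm by (intro map_inj_on[of f]) (auto intro: inj_on_subset[OF f])
 qed
 then show ?thesis unfolding small_def by blast
qed

lemma small_nat: "small TYPE('c) (X :: nat set)"
 unfolding small_def using inj_q inj_on_subset by blast

lemma small_ring: "small TYPE('c) (X :: 'a set)"
 unfolding small_def using inj_ia inj_on_subset by blast

lemma small_int: "small TYPE('c) (X :: int set)"
proof -
 have "inj_on (\<lambda>i::int. pr [q (nat i), q (nat (- i))]) X"
  by (rule inj_onI) (auto dest!: injD[OF inj_pr] injD[OF inj_q])
 then show ?thesis unfolding small_def by blast
qed

end

lemma (in graded_module_loc) graded_hom_cong:
 assumes f: "f \<in> graded_hom R M N" and e: "\<And>x. x \<in> carrier M \<Longrightarrow> f x = g x"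
 shows "g \<in> graded_hom R M N"
 unfolding graded_hom_def hom_def
proof (intro CollectI conjI ballI allI Pi_I)
 have fc: "f x \<in> carrier N" "y \<in> carrier M \<Longrightarrow> f (x \<oplus>\<^sub>M y) = f x \<oplus>\<^sub>N f y" if "x \<in> carrier M" for x y
  using f that by (auto simp: graded_hom_def hom_def)
 have fs: "f (a \<odot>\<^sub>M x) = a \<odot>\<^sub>N f x" if "a \<in> carrier R" "x \<in> carrier M" for a x using f that by (simp add: graded_hom_def)
 have fd: "f ` mdeg M n \<subseteq> mdeg N n" for n using f by (simp add: graded_hom_def)
 show "g x \<in> carrier (add_monoid N)" if "x \<in> carrier (add_monoid M)" for x
  using fc(1)[of x] e[of x] that by simp
 show "g (x \<otimes>\<^bsub>add_monoid M\<^esub> y) = g x \<otimes>\<^bsub>add_monoid N\<^esub> g y"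
  if "x \<in> carrier (add_monoid M)" "y \<in> carrier (add_monoid M)" for x y
  using fc(2)[of x y] e[of x] e[of y] e[of "x \<oplus>\<^sub>M y"] that by simp
 show "g (a \<odot>\<^sub>M x) = a \<odot>\<^sub>N g x" if "a \<in> carrier R" "x \<in> carrier M" for a x
  using fs[OF that] e[OF that(2)] e[OF smult_closed[OF that]] by simp
 show "g ` mdeg M n \<subseteq> mdeg N n" for n
 proof (rule image_subsetI)
  fix x assume x: "x \<in> mdeg M n"
  then have "f x \<in> mdeg N n" using fd by blast
  then show "g x \<in> mdeg N n" using e[OF md.piece_carrier[OF x]] by simp
 qed
qed

lemma (in graded_module_loc) graph_ok_zero: "graph_ok R M s {(\<zero>, \<zero>\<^sub>M)}"
 unfolding graph_ok_def by (simp add: rcomp_facts(7) md.comp_zero)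

text \<open>Systems are indexed by a degree and a finite list of equations, not by graphs, of which
  there may be too many for the carrier type. The first coordinate of an element records the stage
  at which it appears; old elements keep their names, and the inclusion is the identity.\<close>

lemma (in coding) solution_step:
 fixes R :: "'a graded_ring" and N :: "('a, nat \<times> 'c) graded_module"
 assumes gr: "is_graded_ring R" and gN: "is_graded_module R N" and lev: "carrier N \<subseteq> {..<k} \<times> UNIV"
 shows "\<exists>N' :: ('a, nat \<times> 'c) graded_module. is_graded_module R N' \<and> carrier N' \<subseteq> {..<Suc k} \<times> UNIV \<and>
  (\<lambda>x. x) \<in> graded_hom R N N' \<and> solves R N N'"
proof -
 interpret N: graded_module_loc R N by (rule graded_module_locI[OF gr gN])
 \<comment> \<open>One graph through the given equations is enough. An inconsistent list gets the
   zero graph, which merely adds a free summand.\<close>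
 define P :: "int \<times> ('a \<times> (nat \<times> 'c)) list \<Rightarrow> ('a \<times> (nat \<times> 'c)) set" where
  "P i = (if \<exists>H. graph_ok R N (fst i) H \<and> set (snd i) \<subseteq> H
      then SOME H. graph_ok R N (fst i) H \<and> set (snd i) \<subseteq> H else {(\<zero>\<^sub>R, \<zero>\<^sub>N)})" for i
 have Psome: "graph_ok R N (fst i) (P i) \<and> set (snd i) \<subseteq> P i" if "\<exists>H. graph_ok R N (fst i) H \<and> set (snd i) \<subseteq> H" for i
  using someI_ex[OF that] that by (simp add: P_def)
 have "graph_ok R N (fst i) (P i)" for i
 proof (cases "\<exists>H. graph_ok R N (fst i) H \<and> set (snd i) \<subseteq> H")
  case True then show ?thesis using Psome by blast
 next
  case False show ?thesis unfolding P_def if_not_P[OF False] by (rule N.graph_ok_zero)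
 qed
 then interpret po: pushout R N fst P by unfold_locales
 let ?X = "graded_quotient po.F po.K"
 interpret X: graded_module_loc R ?X by (rule graded_module_locI[OF gr po.Fq.Q_graded])
 \<comment> \<open>An element of the sum is coded by its coordinate in \<open>N\<close> and a finite
   association list for the ring coordinates.\<close>
 let ?h = "\<lambda>u :: (nat \<times> 'c) \<times> ((int \<times> ('a \<times> (nat \<times> 'c)) list) \<times> 'a) list.
   (fst u, \<lambda>i. case map_of (snd u) i of None \<Rightarrow> \<zero>\<^sub>R | Some a \<Rightarrow> a)"
 have "carrier po.F \<subseteq> range ?h"
 proof
  fix u assume "u \<in> carrier po.F"
  then have "finite {i. snd u i \<noteq> \<zero>\<^sub>R}" by (simp add: po.F_carrier)
  then obtain l where l: "set l = {i. snd u i \<noteq> \<zero>\<^sub>R}" using finite_list by blast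
  have "u = ?h (fst u, map (\<lambda>i. (i, snd u i)) l)"
  proof (rule prod_eqI)
   show "snd u = snd (?h (fst u, map (\<lambda>i. (i, snd u i)) l))"
    by (rule ext) (use l in \<open>auto simp: map_of_map_restrict restrict_map_def\<close>)
  qed simp
  then show "u \<in> range ?h" by (rule range_eqI)
 qed
 moreover have sl: "small TYPE('c) (UNIV :: 'z list set)" if "small TYPE('c) (UNIV :: 'z set)" for dummy :: 'z
  using small_lists[OF that] by simp
 have st: "small TYPE('c) (UNIV :: ('z \<times> 'y) set)" if "small TYPE('c) (UNIV :: 'z set)" "small TYPE('c) (UNIV :: 'y set)" for d :: 'z and e :: 'y
  using small_Times[OF that] by simp
 have T: "small TYPE('c) (UNIV :: (nat \<times> 'c) set)"
  using small_Times[OF small_nat[of UNIV] small_UNIV[of UNIV]] by simp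
 have aT: "small TYPE('c) (UNIV :: ('a \<times> (nat \<times> 'c)) set)" using small_Times[OF small_ring[of UNIV] T] by simp
 have laT: "small TYPE('c) (UNIV :: ('a \<times> (nat \<times> 'c)) list set)" using small_lists[OF aT] by simp
 have I: "small TYPE('c) (UNIV :: (int \<times> ('a \<times> (nat \<times> 'c)) list) set)" using small_Times[OF small_int[of UNIV] laT] by simp
 have Ia: "small TYPE('c) (UNIV :: ((int \<times> ('a \<times> (nat \<times> 'c)) list) \<times> 'a) set)" using small_Times[OF I small_ring[of UNIV]] by simp
 have lIa: "small TYPE('c) (UNIV :: ((int \<times> ('a \<times> (nat \<times> 'c)) list) \<times> 'a) list set)" using small_lists[OF Ia] by simp
 have "small TYPE('c) (UNIV :: ((nat \<times> 'c) \<times> ((int \<times> ('a \<times> (nat \<times> 'c)) list) \<times> 'a) list) set)"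
  using small_Times[OF T lIa] by simp
 from small_image[OF this, of ?h] have "small TYPE('c) (carrier po.F)"
  using \<open>carrier po.F \<subseteq> range ?h\<close> by (rule small_subset)
 from small_image[OF this] have "small TYPE('c) (carrier ?X)" unfolding po.Fq.Q_carrier .
 then obtain j :: "_ \<Rightarrow> 'c" where j: "inj_on j (carrier ?X)" by (auto simp: small_def)
 define h where "h x = (if x \<in> po.emb ` carrier N then inv_into (carrier N) po.emb x else (k, j x))" for x
 have h_emb: "h (po.emb x) = x" if "x \<in> carrier N" for x
  using that inv_into_f_f[OF po.emb_inj that] by (simp add: h_def)
 have h_lev: "fst (h x) < k" if "x \<in> po.emb ` carrier N" for x using that h_emb lev by auto
 have h_new: "h x = (k, j x)" if "x \<notin> po.emb ` carrier N" for x using that by (simp add: h_def)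
 have inj: "inj_on h (carrier ?X)"
 proof (rule inj_onI)
  fix x y assume xy: "x \<in> carrier ?X" "y \<in> carrier ?X" "h x = h y"
  show "x = y"
  proof (cases "x \<in> po.emb ` carrier N")
   case True
   have "y \<in> po.emb ` carrier N"
   proof (rule ccontr)
    assume "y \<notin> po.emb ` carrier N"
    then have "fst (h y) = k" using h_new by simp
    then show False using h_lev[OF True] xy(3) by simp
   qed
   then show ?thesis using True xy(3) h_emb by auto
  next
   case False
   have "y \<notin> po.emb ` carrier N"
   proof
    assume "y \<in> po.emb ` carrier N"
    then have "fst (h y) < k" by (rule h_lev)
    then show False using h_new[OF False] xy(3) by simp
   qed
   then show ?thesis using False xy h_new inj_onD[OF j] by auto
  qed
 qed
 let ?N' = "transport h ?X"
 have "carrier ?N' \<subseteq> {..<Suc k} \<times> UNIV"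
 proof
  fix y assume "y \<in> carrier ?N'"
  then obtain x where x: "y = h x" unfolding X.transport_simps(1)[OF inj] by blast
  have "fst (h x) < Suc k" using h_lev[of x] h_new[of x] by (cases "x \<in> po.emb ` carrier N") auto
  then show "y \<in> {..<Suc k} \<times> UNIV" unfolding x by (cases "h x") simp
 qed
 moreover have "(\<lambda>x. x) \<in> graded_hom R N ?N'"
  by (rule N.graded_hom_cong[OF graded_hom_comp[OF po.emb_hom X.transport_hom[OF inj]] h_emb])
 moreover have "solves R N ?N'"
  unfolding solves_def
 proof (intro allI impI)
  fix s ps H assume H: "graph_ok R N s H" "set ps \<subseteq> H"
  then have "\<exists>H. graph_ok R N (fst (s, ps)) H \<and> set (snd (s, ps)) \<subseteq> H" by auto
  from Psome[OF this] have ps: "set ps \<subseteq> P (s, ps)" "graph_ok R N s (P (s, ps))" by simp_all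
  obtain e where e: "e \<in> mdeg ?X s" "\<And>a y. (a, y) \<in> P (s, ps) \<Longrightarrow> a \<odot>\<^sub>?X e = po.emb y"
   using po.emb_solution[of "(s, ps)"] by auto
  show "\<exists>e\<in>mdeg ?N' s. \<forall>(a, y)\<in>set ps. a \<odot>\<^sub>?N' e = y"
  proof (intro bexI ballI)
   show "h e \<in> mdeg ?N' s" using e(1) by (simp add: X.transport_simps[OF inj])
   fix p assume p: "p \<in> set ps"
   obtain a y where ay: "p = (a, y)" by (cases p)
   have "(a, y) \<in> P (s, ps)" using p ps(1) ay by blast
   then have "a \<odot>\<^sub>?N' h e = h (po.emb y)"
    using X.transport_simps(4)[OF inj X.md.piece_carrier[OF e(1)]] e(2) by simp
   also have "\<dots> = y" by (rule h_emb[OF graph_okD(2)[OF ps(2) \<open>(a, y) \<in> P (s, ps)\<close>]])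
   finally show "case p of (a, y) \<Rightarrow> a \<odot>\<^sub>?N' h e = y" by (simp add: ay)
  qed
 qed
 ultimately show ?thesis using X.transport_graded[OF inj] by blast
qed

section \<open>Unions of increasing chains of graded modules\<close>

locale module_chain =
 fixes R :: "'a graded_ring" and G :: "nat \<Rightarrow> ('a, 'g) graded_module"
 assumes gr: "is_graded_ring R" and gG: "\<And>k. is_graded_module R (G k)"
  and inc: "\<And>k. (\<lambda>x. x) \<in> graded_hom R (G k) (G (Suc k))"
begin

lemma inc_le: "k \<le> l \<Longrightarrow> (\<lambda>x. x) \<in> graded_hom R (G k) (G l)"
proof (induction l)
 case 0 then show ?case by (auto simp: graded_hom_def hom_def)
next
 case (Suc l)
 show ?case
 proof (cases "k = Suc l")
  case True then show ?thesis by (auto simp: graded_hom_def hom_def)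
 next
  case False then show ?thesis using graded_hom_comp[OF Suc.IH inc] Suc.prems by simp
 qed
qed

lemma inc_ghom: "k \<le> l \<Longrightarrow> ghom R (G k) (G l) (\<lambda>x. x)"
 by (rule ghomI[OF gr gG gG inc_le])

lemma Gloc: "graded_module_loc R (G k)" by (rule graded_module_locI[OF gr gG])

definition lev :: "'g \<Rightarrow> nat" where "lev x = (LEAST k. x \<in> carrier (G k))"

text \<open>The inclusions are identities on elements, so the direct limit is a plain union.
  Operations are evaluated at the first stage containing the arguments; every later stage gives the
  same result.\<close>

definition U :: "('a, 'g) graded_module" where
 "U = \<lparr>carrier = (\<Union>k. carrier (G k)), monoid.mult = undefined, one = undefined, zero = \<zero>\<^bsub>G 0\<^esub>,
   add = (\<lambda>x y. x \<oplus>\<^bsub>G (max (lev x) (lev y))\<^esub> y),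
   module.smult = (\<lambda>a x. a \<odot>\<^bsub>G (lev x)\<^esub> x), mdeg = (\<lambda>n. \<Union>k. mdeg (G k) n)\<rparr>"

lemma lev: "x \<in> carrier (G k) \<Longrightarrow> x \<in> carrier (G (lev x))" "x \<in> carrier (G k) \<Longrightarrow> lev x \<le> k"
 unfolding lev_def by (rule LeastI) (auto intro: Least_le)

lemma carrier_mono: "k \<le> l \<Longrightarrow> x \<in> carrier (G k) \<Longrightarrow> x \<in> carrier (G l)"
 using ghom.closed[OF inc_ghom] .
lemma deg_mono: "k \<le> l \<Longrightarrow> x \<in> mdeg (G k) n \<Longrightarrow> x \<in> mdeg (G l) n"
 using ghom.deg[OF inc_ghom] .

lemma U_carrier: "x \<in> carrier U \<longleftrightarrow> (\<exists>k. x \<in> carrier (G k))" by (simp add: U_def)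
lemma U_zero: "\<zero>\<^sub>U = \<zero>\<^bsub>G k\<^esub>" using ghom.zero[OF inc_ghom, of 0 k] by (simp add: U_def)
lemma U_add: assumes "x \<in> carrier (G k)" "y \<in> carrier (G k)" shows "x \<oplus>\<^sub>U y = x \<oplus>\<^bsub>G k\<^esub> y"
proof -
 let ?m = "max (lev x) (lev y)"
 have "x \<in> carrier (G ?m)" "y \<in> carrier (G ?m)"
  using carrier_mono[of "lev x" ?m x] carrier_mono[of "lev y" ?m y] lev(1)[OF assms(1)] lev(1)[OF assms(2)] by simp_all
 moreover have "?m \<le> k" using lev(2)[OF assms(1)] lev(2)[OF assms(2)] by simp
 ultimately show ?thesis using ghom.add[OF inc_ghom, of ?m k x y] by (simp add: U_def)
qed
lemma U_smult: assumes "x \<in> carrier (G k)" "a \<in> carrier R" shows "a \<odot>\<^sub>U x = a \<odot>\<^bsub>G k\<^esub> x"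
 using ghom.smult[OF inc_ghom[OF lev(2)[OF assms(1)]] assms(2) lev(1)[OF assms(1)]] by (simp add: U_def)
lemma U_deg: "x \<in> mdeg U n \<longleftrightarrow> (\<exists>k. x \<in> mdeg (G k) n)" by (simp add: U_def)

lemma common2: assumes "x \<in> carrier U" "y \<in> carrier U" obtains k where "x \<in> carrier (G k)" "y \<in> carrier (G k)"
proof -
 obtain k l where "x \<in> carrier (G k)" "y \<in> carrier (G l)" using assms by (auto simp: U_carrier)
 then show ?thesis using that[of "max k l"] carrier_mono[of k "max k l" x] carrier_mono[of l "max k l" y] by simp
qed

lemma common3: assumes "x \<in> carrier U" "y \<in> carrier U" "z \<in> carrier U"
 obtains k where "x \<in> carrier (G k)" "y \<in> carrier (G k)" "z \<in> carrier (G k)"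
proof -
 obtain k where k: "x \<in> carrier (G k)" "y \<in> carrier (G k)" using common2[OF assms(1,2)] .
 obtain l where l: "z \<in> carrier (G l)" using assms by (auto simp: U_carrier)
 show ?thesis using that[of "max k l"] carrier_mono[of k "max k l"] carrier_mono[of l "max k l" z] k l by simp
qed

lemma G_closed: "x \<in> carrier (G k) \<Longrightarrow> y \<in> carrier (G k) \<Longrightarrow> x \<oplus>\<^bsub>G k\<^esub> y \<in> carrier (G k)"
 "a \<in> carrier R \<Longrightarrow> x \<in> carrier (G k) \<Longrightarrow> a \<odot>\<^bsub>G k\<^esub> x \<in> carrier (G k)" "\<zero>\<^bsub>G k\<^esub> \<in> carrier (G k)"
proof -
 interpret g: graded_module_loc R "G k" by (rule Gloc)
 show "x \<in> carrier (G k) \<Longrightarrow> y \<in> carrier (G k) \<Longrightarrow> x \<oplus>\<^bsub>G k\<^esub> y \<in> carrier (G k)"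
  "a \<in> carrier R \<Longrightarrow> x \<in> carrier (G k) \<Longrightarrow> a \<odot>\<^bsub>G k\<^esub> x \<in> carrier (G k)" "\<zero>\<^bsub>G k\<^esub> \<in> carrier (G k)" by simp_all
qed

lemma U_abelian: "abelian_group U"
proof (rule abelian_groupI)
 show "\<zero>\<^sub>U \<in> carrier U" using G_closed(3)[of 0] by (auto simp: U_carrier U_zero[of 0])
next
 fix x y assume "x \<in> carrier U" "y \<in> carrier U"
 then obtain k where k: "x \<in> carrier (G k)" "y \<in> carrier (G k)" by (rule common2)
 interpret g: graded_module_loc R "G k" by (rule Gloc)
 show "x \<oplus>\<^sub>U y \<in> carrier U" unfolding U_add[OF k] U_carrier using G_closed(1)[OF k] by blast
 show "x \<oplus>\<^sub>U y = y \<oplus>\<^sub>U x" unfolding U_add[OF k] U_add[OF k(2,1)] by (rule g.M.a_comm[OF k])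
next
 fix x y z assume "x \<in> carrier U" "y \<in> carrier U" "z \<in> carrier U"
 then obtain k where k: "x \<in> carrier (G k)" "y \<in> carrier (G k)" "z \<in> carrier (G k)" by (rule common3)
 interpret g: graded_module_loc R "G k" by (rule Gloc)
 show "x \<oplus>\<^sub>U y \<oplus>\<^sub>U z = x \<oplus>\<^sub>U (y \<oplus>\<^sub>U z)"
  using k G_closed(1)[of _ k] by (simp add: U_add[of _ k] g.M.a_assoc)
next
 fix x assume "x \<in> carrier U"
 then obtain k where k: "x \<in> carrier (G k)" by (auto simp: U_carrier)
 interpret g: graded_module_loc R "G k" by (rule Gloc)
 show "\<zero>\<^sub>U \<oplus>\<^sub>U x = x" using k G_closed(3)[of k] by (simp add: U_add[of _ k] U_zero[of k])
 show "\<exists>y\<in>carrier U. y \<oplus>\<^sub>U x = \<zero>\<^sub>U"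
  using k by (intro bexI[of _ "\<ominus>\<^bsub>G k\<^esub> x"]) (auto simp: U_add[of _ k] U_zero[of k] g.M.l_neg U_carrier)
qed

lemma U_module: "module R U"
proof (rule moduleI[OF _ U_abelian])
 show "cring R" using gr by (simp add: is_graded_ring_def)
next
 fix a x assume a: "a \<in> carrier R" and "x \<in> carrier U"
 then obtain k where k: "x \<in> carrier (G k)" by (auto simp: U_carrier)
 show "a \<odot>\<^sub>U x \<in> carrier U" unfolding U_smult[OF k a] U_carrier using G_closed(2)[OF a k] by blast
next
 fix a b x assume ab: "a \<in> carrier R" "b \<in> carrier R" and "x \<in> carrier U"
 then obtain k where k: "x \<in> carrier (G k)" by (auto simp: U_carrier)
 interpret g: graded_module_loc R "G k" by (rule Gloc)
 show "(a \<oplus>\<^sub>R b) \<odot>\<^sub>U x = a \<odot>\<^sub>U x \<oplus>\<^sub>U b \<odot>\<^sub>U x"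
  using ab k by (simp add: U_smult[of _ k] U_add[of _ k] g.smult_l_distr)
 show "(a \<otimes>\<^sub>R b) \<odot>\<^sub>U x = a \<odot>\<^sub>U (b \<odot>\<^sub>U x)"
  using ab k by (simp add: U_smult[of _ k] g.smult_assoc1)
next
 fix a x y assume a: "a \<in> carrier R" and "x \<in> carrier U" "y \<in> carrier U"
 from this(2,3) obtain k where k: "x \<in> carrier (G k)" "y \<in> carrier (G k)" by (rule common2)
 interpret g: graded_module_loc R "G k" by (rule Gloc)
 show "a \<odot>\<^sub>U (x \<oplus>\<^sub>U y) = a \<odot>\<^sub>U x \<oplus>\<^sub>U a \<odot>\<^sub>U y"
  using a k by (simp add: U_smult[of _ k] U_add[of _ k] g.smult_r_distr)
next
 fix x assume "x \<in> carrier U"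
 then obtain k where k: "x \<in> carrier (G k)" by (auto simp: U_carrier)
 interpret g: graded_module_loc R "G k" by (rule Gloc)
 show "\<one>\<^sub>R \<odot>\<^sub>U x = x" using k by (simp add: U_smult[of _ k])
qed

definition Uc :: "int \<Rightarrow> 'g \<Rightarrow> 'g" where "Uc n x = hcomp (G (lev x)) (mdeg (G (lev x))) n x"

lemma Uc: "x \<in> carrier (G k) \<Longrightarrow> Uc n x = hcomp (G k) (mdeg (G k)) n x"
 unfolding Uc_def using ghom.comp[OF inc_ghom[OF lev(2)] lev(1)] .

lemma U_graded: "is_graded_module R U"
proof (rule graded_moduleI[OF U_module])
 show "proj_family U (mdeg U) Uc"
  unfolding proj_family_def
 proof (intro conjI allI ballI impI)
  fix x assume "x \<in> carrier U"
  then obtain k where k: "x \<in> carrier (G k)" by (auto simp: U_carrier)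
  interpret g: graded_module_loc R "G k" by (rule Gloc)
  show "Uc i x \<in> mdeg U i" for i unfolding Uc[OF k] U_deg using g.md.comp_in[OF k] by blast
  show "finite {i. Uc i x \<noteq> \<zero>\<^sub>U}" unfolding Uc[OF k] U_zero[of k] by (rule g.md.comp_finite[OF k])
  show "x = \<zero>\<^sub>U" if "\<forall>i. Uc i x = \<zero>\<^sub>U"
   using that g.md.comp_all_zero[OF k] unfolding Uc[OF k] U_zero[of k] by blast
 next
  fix i x y assume "x \<in> carrier U" "y \<in> carrier U"
  then obtain k where k: "x \<in> carrier (G k)" "y \<in> carrier (G k)" by (rule common2)
  interpret g: graded_module_loc R "G k" by (rule Gloc)
  show "Uc i (x \<oplus>\<^sub>U y) = Uc i x \<oplus>\<^sub>U Uc i y"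
   unfolding U_add[OF k] Uc[OF G_closed(1)[OF k]] Uc[OF k(1)] Uc[OF k(2)]
    U_add[OF g.md.comp_closed[OF k(1)] g.md.comp_closed[OF k(2)]] by (rule g.md.comp_add[OF k])
 next
  fix i x assume "x \<in> mdeg U i"
  then obtain k where k: "x \<in> mdeg (G k) i" by (auto simp: U_deg)
  interpret g: graded_module_loc R "G k" by (rule Gloc)
  show "Uc i x = x" unfolding Uc[OF g.md.piece_carrier[OF k]] by (rule g.md.comp_id[OF k])
 next
  fix i j x assume ij: "i \<noteq> j" and "x \<in> mdeg U j"
  then obtain k where k: "x \<in> mdeg (G k) j" by (auto simp: U_deg)
  interpret g: graded_module_loc R "G k" by (rule Gloc)
  show "Uc i x = \<zero>\<^sub>U" unfolding Uc[OF g.md.piece_carrier[OF k]] U_zero[of k] by (rule g.md.comp_other[OF ij k])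
 qed
next
 fix n
 show "additive_subgroup (mdeg U n) U"
 proof (rule abelian_group.add_subgroupI[OF U_abelian])
  show "mdeg U n \<subseteq> carrier U"
  proof
   fix x assume "x \<in> mdeg U n"
   then obtain k where k: "x \<in> mdeg (G k) n" by (auto simp: U_deg)
   interpret g: graded_module_loc R "G k" by (rule Gloc)
   show "x \<in> carrier U" unfolding U_carrier using g.md.piece_carrier[OF k] by blast
  qed
  interpret g: graded_module_loc R "G 0" by (rule Gloc)
  show "\<zero>\<^sub>U \<in> mdeg U n" unfolding U_zero[of 0] U_deg using g.md.piece_zero by blast
 next
  fix x y assume "x \<in> mdeg U n" "y \<in> mdeg U n"
  then obtain k l where "x \<in> mdeg (G k) n" "y \<in> mdeg (G l) n" by (auto simp: U_deg)
  then have k: "x \<in> mdeg (G (max k l)) n" "y \<in> mdeg (G (max k l)) n"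
   using deg_mono[of k "max k l" x n] deg_mono[of l "max k l" y n] by simp_all
  interpret g: graded_module_loc R "G (max k l)" by (rule Gloc)
  show "x \<oplus>\<^sub>U y \<in> mdeg U n"
   unfolding U_add[OF g.md.piece_carrier[OF k(1)] g.md.piece_carrier[OF k(2)]] U_deg
   using g.md.piece_add[OF k] by blast
 next
  fix x assume "x \<in> mdeg U n"
  then obtain k where k: "x \<in> mdeg (G k) n" by (auto simp: U_deg)
  interpret g: graded_module_loc R "G k" by (rule Gloc)
  have xc: "x \<in> carrier (G k)" using g.md.piece_carrier[OF k] .
  have "\<ominus>\<^sub>U x = \<ominus>\<^bsub>G k\<^esub> x"
   by (rule abelian_group.minus_equality[OF U_abelian])
    (use xc in \<open>auto simp: U_add[of _ k] U_zero[of k] g.M.l_neg U_carrier\<close>)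
  then show "\<ominus>\<^sub>U x \<in> mdeg U n" unfolding U_deg using g.md.piece_neg[OF k] by auto
 qed
next
 fix i j a x assume a: "a \<in> rdeg R i" and "x \<in> mdeg U j"
 then obtain k where k: "x \<in> mdeg (G k) j" by (auto simp: U_deg)
 interpret g: graded_module_loc R "G k" by (rule Gloc)
 show "a \<odot>\<^sub>U x \<in> mdeg U (int i + j)"
  unfolding U_smult[OF g.md.piece_carrier[OF k] g.rd.piece_carrier[OF a]] U_deg using g.smult_deg[OF a k] by blast
qed

lemma G_hom_U: "(\<lambda>x. x) \<in> graded_hom R (G k) U"
 unfolding graded_hom_def hom_def
 by (auto simp: U_carrier U_add U_smult U_deg)

text \<open>A finite system involves finitely many elements, so it lives at some stage
  \<open>k\<close>; the restriction of its graph to that stage is again a graph, and the next stage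
  contains a solution.\<close>

lemma U_solves:
 assumes sol: "\<And>k. solves R (G k) (G (Suc k))"
 shows "solves R U U"
 unfolding solves_def
proof (intro allI impI)
 fix s ps H assume H: "graph_ok R U s H" and ps: "set ps \<subseteq> H"
 note Hd = graph_okD[OF H]
 have "\<exists>k. \<forall>p\<in>set ps. snd p \<in> carrier (G k)"
  using ps
 proof (induction ps)
  case (Cons p ps)
  then obtain k where k: "\<forall>p\<in>set ps. snd p \<in> carrier (G k)" by auto
  have "snd p \<in> carrier U" using Hd(2)[of "fst p" "snd p"] Cons.prems by simp
  then obtain l where l: "snd p \<in> carrier (G l)" by (auto simp: U_carrier)
  have "\<forall>r\<in>set (p # ps). snd r \<in> carrier (G (max k l))"
   using k l carrier_mono[of k "max k l"] carrier_mono[of l "max k l"] by simp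
  then show ?case by (rule exI)
 qed simp
 then obtain k where k: "\<And>p. p \<in> set ps \<Longrightarrow> snd p \<in> carrier (G k)" by blast
 interpret g: graded_module_loc R "G k" by (rule Gloc)
 note icomp = ghom.comp[OF ghomI[OF gr gG U_graded G_hom_U], of _ k]
 let ?H = "H \<inter> (carrier R \<times> carrier (G k))"
 have "graph_ok R (G k) s ?H"
  unfolding graph_ok_def
 proof (intro conjI allI impI)
  show "(\<zero>\<^sub>R, \<zero>\<^bsub>G k\<^esub>) \<in> ?H" using Hd(3) U_zero[of k] by simp
  show "(a \<oplus>\<^sub>R b, y \<oplus>\<^bsub>G k\<^esub> w) \<in> ?H" if "(a, y) \<in> ?H" "(b, w) \<in> ?H" for a y b w
   using that Hd(4)[of a y b w] U_add[of y k w] by simp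
  show "(r \<otimes>\<^sub>R a, r \<odot>\<^bsub>G k\<^esub> y) \<in> ?H" if "r \<in> carrier R" "(a, y) \<in> ?H" for r a y
   using that Hd(5)[of r a y] U_smult[of y k r] by simp
  show "(rcomp R s n a, hcomp (G k) (mdeg (G k)) n y) \<in> ?H" if "(a, y) \<in> ?H" for n a y
   using that Hd(6)[of a y n] icomp[of y n] g.md.comp_closed[of y n] g.rcomp_facts(8)[of a s n] by simp
  show "y = \<zero>\<^bsub>G k\<^esub>" if "(\<zero>\<^sub>R, y) \<in> ?H" for y using that Hd(7)[of y] U_zero[of k] by simp
 qed simp
 moreover have "set ps \<subseteq> ?H"
 proof
  fix p assume p: "p \<in> set ps"
  then have "p \<in> H" using ps by blast
  moreover have "fst p \<in> carrier R" using Hd(1)[of "fst p" "snd p"] \<open>p \<in> H\<close> by simp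
  ultimately show "p \<in> ?H" using k[OF p] by (simp add: mem_Times_iff)
 qed
 ultimately obtain e where e: "e \<in> mdeg (G (Suc k)) s" "\<forall>(a, y)\<in>set ps. a \<odot>\<^bsub>G (Suc k)\<^esub> e = y"
  using sol[of k] unfolding solves_def by meson
 interpret g': graded_module_loc R "G (Suc k)" by (rule Gloc)
 have "\<forall>(a, y)\<in>set ps. a \<odot>\<^sub>U e = y"
 proof
  fix p assume p: "p \<in> set ps"
  obtain a y where ay: "p = (a, y)" by (rule prod.exhaust)
  have "a \<in> carrier R" using Hd(1)[of a y] p ps ay by auto
  then show "case p of (a, y) \<Rightarrow> a \<odot>\<^sub>U e = y"
   using bspec[OF e(2) p] U_smult[OF g'.md.piece_carrier[OF e(1)], of a] ay by simp
 qed
 then show "\<exists>e\<in>mdeg U s. \<forall>(a, y)\<in>set ps. a \<odot>\<^sub>U e = y" using e(1) U_deg by blast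
qed

end

text \<open>Countably many rounds of adjoining solutions suffice, because over a Noetherian ring
  only finite systems matter and each of them appears at some finite stage. The coding brings the
  tagged union back into the original carrier type.\<close>

lemma (in coding) injective_embedding:
 fixes R :: "'a graded_ring" and N :: "('a, 'c) graded_module"
 assumes gr: "is_graded_ring R" and acc: "acc (shifted_ring R 0) (carrier R) (carrier R)" and gN: "is_graded_module R N"
 shows "\<exists>(E :: ('a, 'c) graded_module) i. graded_injective R E \<and> i \<in> graded_hom R N E \<and> inj_on i (carrier N)"
proof -
 interpret N: graded_module_loc R N by (rule graded_module_locI[OF gr gN])
 \<comment> \<open>The given module sits at stage 0; stage \<open>k\<close> uses tags at most
   \<open>k\<close>.\<close>
 let ?h = "\<lambda>x :: 'c. (0::nat, x)"
 have inj0: "inj_on ?h (carrier N)" by (rule inj_onI) simp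
 let ?P = "\<lambda>k (G :: ('a, nat \<times> 'c) graded_module). is_graded_module R G \<and> carrier G \<subseteq> {..<Suc k} \<times> UNIV \<and> (k = 0 \<longrightarrow> G = transport ?h N)"
 let ?Q = "\<lambda>k G G'. (\<lambda>x. x) \<in> graded_hom R G G' \<and> solves R G G'"
 have "\<exists>G. \<forall>k. ?P k (G k) \<and> ?Q k (G k) (G (Suc k))"
 proof (rule dependent_nat_choice)
  show "\<exists>G. ?P 0 G" using N.transport_graded[OF inj0] N.transport_simps(1)[OF inj0] by auto
  show "\<exists>G'. ?P (Suc k) G' \<and> ?Q k G G'" if "?P k G" for G k
   using solution_step[OF gr, of G "Suc k"] that by blast
 qed
 then obtain G where G: "\<And>k. ?P k (G k)" "\<And>k. ?Q k (G k) (G (Suc k))" by blast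
 interpret ch: module_chain R G by unfold_locales (use gr G in blast)+
 interpret U: graded_module_loc R ch.U by (rule graded_module_locI[OF gr ch.U_graded])
 have sU: "solves R ch.U ch.U" by (rule ch.U_solves) (use G in blast)
 let ?r = "\<lambda>u :: nat \<times> 'c. pr [q (fst u), snd u]"
 have injr: "inj_on ?r (carrier ch.U)"
  by (rule inj_onI) (auto dest!: injD[OF inj_pr] injD[OF inj_q] intro: prod_eqI)
 let ?E = "transport ?r ch.U"
 have "graded_injective R ?E"
  unfolding graded_injective_def
 proof (intro conjI allI impI)
  show "is_graded_module R ?E" by (rule U.transport_graded[OF injr])
  fix A B :: "('a, 'c) graded_module" and u f
  assume as: "is_graded_module R A \<and> is_graded_module R B \<and> u \<in> graded_hom R A B \<and> inj_on u (carrier A) \<and> f \<in> graded_hom R A ?E"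
  then have AB: "is_graded_module R A" "is_graded_module R B" "u \<in> graded_hom R A B" "inj_on u (carrier A)" "f \<in> graded_hom R A ?E" by simp_all
  let ?v = "inv_into (carrier ch.U) ?r"
  have f': "(\<lambda>x. ?v (f x)) \<in> graded_hom R A ch.U"
   by (rule graded_hom_comp[OF AB(5) U.transport_inv_hom[OF injr]])
  obtain g where g: "g \<in> graded_hom R B ch.U" "\<And>x. x \<in> carrier A \<Longrightarrow> g (u x) = ?v (f x)"
   using baer[OF gr acc ch.U_graded sU AB(1-4) f'] by blast
  have "f x \<in> ?r ` carrier ch.U" if "x \<in> carrier A" for x
   using AB(5) that unfolding graded_hom_def hom_def by (auto simp: U.transport_simps(1)[OF injr])
  then have "?r (g (u x)) = f x" if "x \<in> carrier A" for x using g(2)[OF that] f_inv_into_f[of "f x" ?r "carrier ch.U"] that by simp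
  then show "\<exists>g\<in>graded_hom R B ?E. \<forall>x\<in>carrier A. g (u x) = f x"
   using graded_hom_comp[OF g(1) U.transport_hom[OF injr]] by (intro bexI[of _ "\<lambda>x. ?r (g x)"]) auto
 qed
 moreover have G0: "G 0 = transport ?h N" using G(1)[of 0] by simp
 have h0: "?h \<in> graded_hom R N (G 0)" unfolding G0 by (rule N.transport_hom[OF inj0])
 have "(\<lambda>x. ?r (?h x)) \<in> graded_hom R N ?E"
  by (rule graded_hom_comp[OF graded_hom_comp[OF h0 ch.G_hom_U] U.transport_hom[OF injr]])
 moreover have "inj_on (\<lambda>x. ?r (?h x)) (carrier N)" by (rule inj_onI) (auto dest!: injD[OF inj_pr])
 ultimately show ?thesis by blast
qed

text \<open>Dependent choice builds triples of a cosyzygy, an injective module and an embedding of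
  the former into the latter. The next cosyzygy is the quotient, transported back into the carrier
  type, which is possible because the image of a set is no larger than the set.\<close>

lemma (in coding) injective_resolution_exists:
 fixes R :: "'a graded_ring" and N :: "('a, 'n) graded_module" and h :: "'n \<Rightarrow> 'c"
 assumes gr: "is_graded_ring R" and acc: "acc (shifted_ring R 0) (carrier R) (carrier R)"
  and gN: "is_graded_module R N" and h: "inj h"
 shows "\<exists>(E :: nat \<Rightarrow> ('a, 'c) graded_module) d. graded_injective_resolution R N E d"
proof -
 interpret N: graded_module_loc R N by (rule graded_module_locI[OF gr gN])
 have injh: "inj_on h (carrier N)" using h inj_on_subset by blast
 let ?P = "\<lambda>(k :: nat) (T :: ('a, 'c) graded_module \<times> ('a, 'c) graded_module \<times> ('c \<Rightarrow> 'c)).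
  is_graded_module R (fst T) \<and> graded_injective R (fst (snd T)) \<and> snd (snd T) \<in> graded_hom R (fst T) (fst (snd T)) \<and>
  inj_on (snd (snd T)) (carrier (fst T)) \<and> (k = 0 \<longrightarrow> fst T = transport h N)"
 let ?Q = "\<lambda>(k :: nat) (T :: ('a, 'c) graded_module \<times> ('a, 'c) graded_module \<times> ('c \<Rightarrow> 'c)) (T' :: ('a, 'c) graded_module \<times> ('a, 'c) graded_module \<times> ('c \<Rightarrow> 'c)).
  \<exists>p\<in>graded_hom R (fst (snd T)) (fst T'). p ` carrier (fst (snd T)) = carrier (fst T') \<and>
   (\<forall>x\<in>carrier (fst (snd T)). p x = \<zero>\<^bsub>fst T'\<^esub> \<longleftrightarrow> x \<in> snd (snd T) ` carrier (fst T))"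
 have "\<exists>T. \<forall>k. ?P k (T k) \<and> ?Q k (T k) (T (Suc k))"
 proof (rule dependent_nat_choice)
  obtain E :: "('a, 'c) graded_module" and i where "graded_injective R E" "i \<in> graded_hom R (transport h N) E" "inj_on i (carrier (transport h N))"
   using injective_embedding[OF gr acc N.transport_graded[OF injh]] by blast
  then have "?P 0 (transport h N, E, i)" using N.transport_graded[OF injh] by simp
  then show "\<exists>T. ?P 0 T" by (rule exI[where x="(transport h N, E, i)"])
 next
  fix T :: "('a, 'c) graded_module \<times> ('a, 'c) graded_module \<times> ('c \<Rightarrow> 'c)" and k assume T: "?P k T"
  let ?C = "fst T" and ?E = "fst (snd T)" and ?i = "snd (snd T)"
  have gE: "is_graded_module R ?E" using T by (simp add: graded_injective_def)
  have gC: "is_graded_module R ?C" and ih: "?i \<in> graded_hom R ?C ?E" using T by simp_all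
  interpret i: ghom R ?C ?E ?i by (rule ghomI[OF gr gC gE ih])
  interpret q: quot R ?E "?i ` carrier ?C" by (rule quotI[OF gr gE i.image_hsub])
  let ?X = "graded_quotient ?E (?i ` carrier ?C)"
  interpret X: graded_module_loc R ?X by (rule graded_module_locI[OF gr q.Q_graded])
  have "small TYPE('c) (carrier ?X)" unfolding q.Q_carrier by (rule small_image[OF small_UNIV])
  then obtain j :: "'c set \<Rightarrow> 'c" where j: "inj_on j (carrier ?X)" by (auto simp: small_def)
  obtain E' :: "('a, 'c) graded_module" and i' where E': "graded_injective R E'" "i' \<in> graded_hom R (transport j ?X) E'" "inj_on i' (carrier (transport j ?X))"
   using injective_embedding[OF gr acc X.transport_graded[OF j]] by blast
  have "?P (Suc k) (transport j ?X, E', i')" using E' X.transport_graded[OF j] by simp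
  moreover have "?Q k T (transport j ?X, E', i')"
  proof (intro bexI conjI ballI)
   let ?p = "\<lambda>x. j (q.cl x)"
   show "?p \<in> graded_hom R ?E (fst (transport j ?X, E', i'))"
    using graded_hom_comp[OF q.cl_hom X.transport_hom[OF j]] by simp
   show "?p ` carrier ?E = carrier (fst (transport j ?X, E', i'))"
    by (simp add: X.transport_simps(1)[OF j] q.Q_carrier image_image)
   fix x assume x: "x \<in> carrier ?E"
   have cx: "q.cl x \<in> carrier ?X" unfolding q.Q_carrier using x by (rule imageI)
   have "?p x = j \<zero>\<^sub>?X \<longleftrightarrow> q.cl x = \<zero>\<^sub>?X" using inj_on_eq_iff[OF j cx X.M.zero_closed] .
   then show "?p x = \<zero>\<^bsub>fst (transport j ?X, E', i')\<^esub> \<longleftrightarrow> x \<in> ?i ` carrier ?C"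
    by (simp only: X.transport_simps(2)[OF j] q.cl_zero_iff[OF x] fst_conv)
  qed
  ultimately have "?P (Suc k) (transport j ?X, E', i') \<and> ?Q k T (transport j ?X, E', i')" by (rule conjI)
  then show "\<exists>T'. ?P (Suc k) T' \<and> ?Q k T T'" by (rule exI[where x="(transport j ?X, E', i')"])
 qed
 then obtain T where T': "\<forall>k. ?P k (T k) \<and> ?Q k (T k) (T (Suc k))" by (rule exE)
 have T: "?P k (T k)" "?Q k (T k) (T (Suc k))" for k
  by (rule conjunct1[OF spec[OF T', of k]], rule conjunct2[OF spec[OF T', of k]])
 define C E i where "C k = fst (T k)" "E k = fst (snd (T k))" "i k = snd (snd (T k))" for k
 have Ck: "is_graded_module R (C k)" "graded_injective R (E k)" "i k \<in> graded_hom R (C k) (E k)" "inj_on (i k) (carrier (C k))" for k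
  using T(1)[of k] by (simp_all add: C_E_i_def)
 have C0: "C 0 = transport h N" using T(1)[of 0] by (simp add: C_E_i_def)
 have "\<forall>k. \<exists>p. p \<in> graded_hom R (E k) (C (Suc k)) \<and> p ` carrier (E k) = carrier (C (Suc k)) \<and>
   (\<forall>x\<in>carrier (E k). p x = \<zero>\<^bsub>C (Suc k)\<^esub> \<longleftrightarrow> x \<in> i k ` carrier (C k))"
  using T(2) unfolding C_E_i_def Bex_def by (rule allI)
 from choice[OF this] obtain p where p': "\<forall>k. p k \<in> graded_hom R (E k) (C (Suc k)) \<and> p k ` carrier (E k) = carrier (C (Suc k)) \<and>
   (\<forall>x\<in>carrier (E k). p k x = \<zero>\<^bsub>C (Suc k)\<^esub> \<longleftrightarrow> x \<in> i k ` carrier (C k))" by (rule exE)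
 have p: "p k \<in> graded_hom R (E k) (C (Suc k))" "p k ` carrier (E k) = carrier (C (Suc k))"
   "x \<in> carrier (E k) \<Longrightarrow> p k x = \<zero>\<^bsub>C (Suc k)\<^esub> \<longleftrightarrow> x \<in> i k ` carrier (C k)" for k x
  using spec[OF p', of k] by simp_all
 have Ek: "is_graded_module R (E k)" for k using Ck(2) by (simp add: graded_injective_def)
 \<comment> \<open>Projection onto the next cosyzygy followed by its embedding; the kernel is the
   image of \<open>i k\<close>.\<close>
 define d where "d k x = i (Suc k) (p k x)" for k x
 have dh: "d k \<in> graded_hom R (E k) (E (Suc k))" for k
  using graded_hom_comp[OF p(1) Ck(3)] by (simp add: d_def[abs_def])
 have ker: "a_kernel (E k) (E (Suc k)) (d k) = i k ` carrier (C k)" for k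
 proof -
  interpret ih: ghom R "C k" "E k" "i k" by (rule ghomI[OF gr Ck(1) Ek Ck(3)])
  interpret ih': ghom R "C (Suc k)" "E (Suc k)" "i (Suc k)" by (rule ghomI[OF gr Ck(1) Ek Ck(3)])
  interpret ph: ghom R "E k" "C (Suc k)" "p k" by (rule ghomI[OF gr Ek Ck(1) p(1)])
  have "d k x = \<zero>\<^bsub>E (Suc k)\<^esub> \<longleftrightarrow> x \<in> i k ` carrier (C k)" if x: "x \<in> carrier (E k)" for x
  proof -
   have "d k x = \<zero>\<^bsub>E (Suc k)\<^esub> \<longleftrightarrow> i (Suc k) (p k x) = i (Suc k) \<zero>\<^bsub>C (Suc k)\<^esub>" by (simp add: d_def)
   also have "\<dots> \<longleftrightarrow> p k x = \<zero>\<^bsub>C (Suc k)\<^esub>" by (rule inj_on_eq_iff[OF Ck(4)]) (use x in simp_all)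
   finally show ?thesis using p(3)[OF x] by simp
  qed
  then show ?thesis unfolding a_kernel_def kernel_def using ih.closed by auto
 qed
 have "graded_injective_resolution R N E d"
  unfolding graded_injective_resolution_def
 proof (intro conjI allI)
  show "graded_injective R (E k)" "d k \<in> graded_hom R (E k) (E (Suc k))" for k using Ck dh by blast+
  show "d k ` carrier (E k) = a_kernel (E (Suc k)) (E (Suc (Suc k))) (d (Suc k))" for k
   unfolding ker using p(2)[of k] by (simp add: d_def[abs_def] image_image[symmetric])
  have hh: "h \<in> graded_hom R N (C 0)" unfolding C0 by (rule N.transport_hom[OF injh])
  have him: "h ` carrier N = carrier (C 0)" unfolding C0 by (simp add: N.transport_simps(1)[OF injh])
  show "\<exists>e\<in>graded_hom R N (E 0). inj_on e (carrier N) \<and> e ` carrier N = a_kernel (E 0) (E 1) (d 0)"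
  proof (intro bexI conjI)
   show "(\<lambda>x. i 0 (h x)) \<in> graded_hom R N (E 0)" by (rule graded_hom_comp[OF hh Ck(3)])
   show "inj_on (\<lambda>x. i 0 (h x)) (carrier N)"
    using comp_inj_on[OF injh, of "i 0"] Ck(4)[of 0] him by (simp add: comp_def)
   show "(\<lambda>x. i 0 (h x)) ` carrier N = a_kernel (E 0) (E 1) (d 0)"
    using ker[of 0] him by (simp add: image_image[symmetric])
  qed
 qed
 then show ?thesis by blast
qed

text \<open>Each block is preceded by its length, so the concatenation can be decoded from the
  left.\<close>

lemma list_code_inj: "inj (\<lambda>xss :: ('x + nat) list list. concat (map (\<lambda>l. Inr (length l) # l) xss))"
proof (rule injI)
 fix xss yss :: "('x + nat) list list"
 assume "concat (map (\<lambda>l. Inr (length l) # l) xss) = concat (map (\<lambda>l. Inr (length l) # l) yss)"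
 then show "xss = yss"
 proof (induction xss arbitrary: yss)
  case Nil then show ?case by (cases yss) auto
 next
  case (Cons l xss)
  then show ?case by (cases yss) auto
 qed
qed

text \<open>Shows that the choice in \<open>chosen_resolution\<close> is not vacuous. The carrier
  type consists of lists, so a list of its elements is coded by concatenation; the summand of
  natural numbers, moved to the outside of the sum type, provides the length marks.\<close>

lemma resolution_exists:
 fixes R :: "'a graded_ring" and N :: "('a, 'n) graded_module"
 assumes gr: "is_graded_ring R" and acc: "acc (shifted_ring R 0) (carrier R) (carrier R)" and gN: "is_graded_module R N"
 shows "graded_injective_resolution R N (fst (chosen_resolution R N)) (snd (chosen_resolution R N))"
proof -
 let ?s = "\<lambda>x :: 'a + 'n + nat. case x of Inl a \<Rightarrow> Inl (Inl a) | Inr y \<Rightarrow> (case y of Inl n \<Rightarrow> Inl (Inr n) | Inr k \<Rightarrow> Inr k)"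
 let ?s' = "\<lambda>x :: ('a + 'n) + nat. case x of Inl y \<Rightarrow> (case y of Inl a \<Rightarrow> Inl a | Inr n \<Rightarrow> Inr (Inl n)) | Inr k \<Rightarrow> Inr (Inr k)"
 have s: "inj ?s" by (rule injI) (auto split: sum.splits)
 have s': "inj ?s'" by (rule injI) (auto split: sum.splits)
 let ?pr = "\<lambda>xss :: ('a, 'n) univ list. map ?s' (concat (map (\<lambda>l. Inr (length l) # l) (map (map ?s) xss)))"
 have "inj ?pr"
  by (rule injI) (use inj_map_eq_map[OF s'] inj_eq[OF list_code_inj] inj_map_eq_map[OF inj_mapI[OF s]] in blast)
 moreover have "inj (\<lambda>a :: 'a. [Inl a] :: ('a, 'n) univ)" "inj (\<lambda>k :: nat. [Inr (Inr k)] :: ('a, 'n) univ)"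
  "inj (\<lambda>n :: 'n. [Inr (Inl n)] :: ('a, 'n) univ)" by (simp_all add: inj_def)
 ultimately interpret coding ?pr "\<lambda>a :: 'a. [Inl a] :: ('a, 'n) univ" "\<lambda>k :: nat. [Inr (Inr k)] :: ('a, 'n) univ"
  by unfold_locales
 obtain E :: "nat \<Rightarrow> ('a, ('a, 'n) univ) graded_module" and d where "graded_injective_resolution R N E d"
  using injective_resolution_exists[OF gr acc gN \<open>inj (\<lambda>n :: 'n. [Inr (Inl n)] :: ('a, 'n) univ)\<close>] by blast
 then have "(\<lambda>(E, d). graded_injective_resolution R N E d) (E, d)" by simp
 from someI[of "\<lambda>(E, d). graded_injective_resolution R N E d", OF this] show ?thesis
  unfolding chosen_resolution_def by (simp add: case_prod_beta)
qed

section \<open>Koszul exactness of injective modules modulo torsion\<close>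

context graded_module_loc
begin

lemma coch_add: assumes f: "coch M r (mdeg M) n q f" and g: "coch M r (mdeg M) n q g"
 shows "coch M r (mdeg M) n q (\<lambda>l. f l \<oplus>\<^sub>M g l)"
 unfolding coch_def
proof (intro allI impI)
 fix l :: "bool list" assume l: "length l = r"
 show "f l \<oplus>\<^sub>M g l \<in> (if ntrue l = q then mdeg M n else {\<zero>\<^sub>M})"
  using cochD[OF f l] cochD[OF g l] md.piece_add by (cases "ntrue l = q") simp_all
qed

lemma coch_minus: assumes f: "coch M r (mdeg M) n q f" and g: "coch M r (mdeg M) n q g"
 shows "coch M r (mdeg M) n q (\<lambda>l. f l \<ominus>\<^sub>M g l)"
 unfolding coch_def
proof (intro allI impI)
 fix l :: "bool list" assume l: "length l = r"
 show "f l \<ominus>\<^sub>M g l \<in> (if ntrue l = q then mdeg M n else {\<zero>\<^sub>M})"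
  using cochD[OF f l] cochD[OF g l] md.piece_minus by (cases "ntrue l = q") (simp_all add: M.minus_eq M.a_inv_zero)
qed

lemma coch_zero: "coch M r (mdeg M) n q (\<lambda>l. \<zero>\<^sub>M)"
 unfolding coch_def using md.piece_zero by auto

lemma coch_neg_zero: "coch M r (mdeg M) n q f \<Longrightarrow> q < 0 \<Longrightarrow> length l = r \<Longrightarrow> f l = \<zero>\<^sub>M"
 using cochD[of M r "mdeg M" n q f l] ntrue_nonneg[of l] by auto

lemma tors_asub: "asub M (carrier R) tors" by (rule hsub_asub[OF tors_hsub])

definition xt :: "'a \<Rightarrow> 'b set" where "xt x = {e \<in> carrier M. \<exists>k::nat. x [^] k \<odot>\<^sub>M e = \<zero>\<^sub>M}"

lemma pow_kill:
 assumes x: "x \<in> carrier R" and e: "e \<in> carrier M" and k: "x [^] (k::nat) \<odot>\<^sub>M e = \<zero>\<^sub>M"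
 shows "x [^] (j + k) \<odot>\<^sub>M e = \<zero>\<^sub>M"
 using x e k by (simp add: nat_pow_mult[symmetric] smult_assoc1)

lemma xt_asub: assumes x: "x \<in> carrier R" shows "asub M (carrier R) (xt x)"
proof (rule asubI)
 show "\<zero>\<^sub>M \<in> xt x" using x by (simp add: xt_def)
 fix e assume "e \<in> xt x"
 then obtain k where e: "e \<in> carrier M" "x [^] (k::nat) \<odot>\<^sub>M e = \<zero>\<^sub>M" by (auto simp: xt_def)
 have "x [^] k \<odot>\<^sub>M (\<ominus>\<^sub>M e) = \<zero>\<^sub>M" using e x by (simp add: smult_r_minus M.a_inv_zero)
 then show "\<ominus>\<^sub>M e \<in> xt x" using e unfolding xt_def by blast
 show "a \<odot>\<^sub>M e \<in> xt x" if a: "a \<in> carrier R" for a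
 proof -
  have "x [^] k \<odot>\<^sub>M (a \<odot>\<^sub>M e) = \<zero>\<^sub>M" using e x a smult_swap[of "x [^] k" a e] by simp
  then show ?thesis using e a unfolding xt_def by blast
 qed
 fix h assume "h \<in> xt x"
 then obtain j where h: "h \<in> carrier M" "x [^] (j::nat) \<odot>\<^sub>M h = \<zero>\<^sub>M" by (auto simp: xt_def)
 have "x [^] (j + k) \<odot>\<^sub>M (e \<oplus>\<^sub>M h) = \<zero>\<^sub>M"
  using pow_kill[OF x e, of j] pow_kill[OF x h, of k] e h x by (simp add: smult_r_distr add.commute)
 then show "e \<oplus>\<^sub>M h \<in> xt x" using e h unfolding xt_def by blast
qed (auto simp: xt_def)

lemma xt_divide: assumes "x \<in> carrier R" "e \<in> carrier M" "x \<odot>\<^sub>M e \<in> xt x" shows "e \<in> xt x"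
proof -
 obtain k where "x [^] (k::nat) \<odot>\<^sub>M (x \<odot>\<^sub>M e) = \<zero>\<^sub>M" using assms(3) by (auto simp: xt_def)
 then have "x [^] Suc k \<odot>\<^sub>M e = \<zero>\<^sub>M" using assms by (simp add: smult_assoc1)
 then show ?thesis using assms unfolding xt_def by blast
qed

lemma pow_deg: "x \<in> rdeg R 1 \<Longrightarrow> x [^] (k::nat) \<in> rdeg R k"
proof (induction k)
 case 0 then show ?case using one_deg by simp
next
 case (Suc k) then show ?case using mult_deg[of "x [^] k" k x 1] by simp
qed

lemma tors_xt: assumes x: "x \<in> rdeg R 1" shows "tors \<subseteq> xt x"
proof
 fix e assume "e \<in> tors"
 then obtain t where t: "e \<in> carrier M" "\<forall>k\<ge>t. \<forall>a\<in>rdeg R k. a \<odot>\<^sub>M e = \<zero>\<^sub>M" by (auto simp: torsion_part_def)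
 then have "x [^] t \<odot>\<^sub>M e = \<zero>\<^sub>M" using pow_deg[OF x, of t] by blast
 then show "e \<in> xt x" using t unfolding xt_def by blast
qed

lemma combo_kill:
 assumes "e \<in> carrier M" "set xs \<subseteq> carrier R" "P \<subseteq> carrier R" "\<And>x b. x \<in> set xs \<Longrightarrow> b \<in> P \<Longrightarrow> (x \<otimes> b) \<odot>\<^sub>M e \<in> S"
  and S: "asub M {} S"
 shows "a \<in> combo Rmod xs P \<Longrightarrow> a \<in> carrier R \<and> a \<odot>\<^sub>M e \<in> S"
 using assms(2,4)
proof (induction xs arbitrary: a)
 case Nil then show ?case using assms(1) asubD(2)[OF S] by simp
next
 case (Cons x xs)
 obtain b y where bY: "b \<in> P" "y \<in> combo Rmod xs P" "a = x \<otimes> b \<oplus> y" using Cons.prems(1) by auto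
 have IH: "y \<in> carrier R \<and> y \<odot>\<^sub>M e \<in> S" by (rule Cons.IH[OF bY(2)]) (use Cons.prems in auto)
 have c: "x \<in> carrier R" "b \<in> carrier R" using Cons.prems bY assms(3) by auto
 have "(x \<otimes> b) \<odot>\<^sub>M e \<in> S" using Cons.prems(3)[of x b] bY by simp
 then show ?case using IH c assms(1) asubD(3)[OF S] by (simp add: bY(3) smult_l_distr)
qed

end

section \<open>Rings with chosen linear generators\<close>

locale lin_gens = graded_ring_loc R for R :: "'a graded_ring" (structure) +
 fixes xs :: "'a list"
 assumes xs1: "set xs \<subseteq> rdeg R 1" and gens: "\<And>n. rdeg R (Suc n) \<subseteq> combo (shifted_ring R 0) xs (rdeg R n)"
begin

lemma xsc: "set xs \<subseteq> carrier R" using xs1 rd.piece_carrier by blast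

text \<open>A pigeonhole argument: a monomial of degree greater than the sum of the exponents
  contains one of the powers that kill \<open>e\<close>. The induction avoids monomials by
  multiplying with one variable at a time.\<close>

lemma pow_tors:
 assumes M: "graded_module_loc R M" and e: "e \<in> carrier M" and k: "\<And>x. x \<in> set xs \<Longrightarrow> \<exists>k::nat. x [^] k \<odot>\<^sub>M e = \<zero>\<^sub>M"
 shows "e \<in> torsion_part R M"
proof -
 interpret M: graded_module_loc R M by fact
 have bound: "\<forall>a\<in>rdeg R t. a \<odot>\<^sub>M e = \<zero>\<^sub>M"
  if "e \<in> carrier M" "\<And>x. x \<in> set xs \<Longrightarrow> x [^] (k x :: nat) \<odot>\<^sub>M e = \<zero>\<^sub>M" "t > sum k (set xs)" for t k e
  using that
 proof (induction t arbitrary: k e)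
  case (Suc t)
  have "a \<odot>\<^sub>M e \<in> {\<zero>\<^sub>M}" if a: "a \<in> rdeg R (Suc t)" for a
  proof (rule conjunct2[OF M.combo_kill[OF Suc.prems(1) xsc]])
   show "a \<in> combo Rmod xs (rdeg R t)" using gens a by blast
   show "rdeg R t \<subseteq> carrier R" using rd.piece_carrier by blast
   show "asub M {} {\<zero>\<^sub>M}" by (rule M.asub_zero) simp
   fix x b assume x: "x \<in> set xs" and b: "b \<in> rdeg R t"
   have xc: "x \<in> carrier R" "b \<in> carrier R" using xsc x b rd.piece_carrier by auto
   have "b \<odot>\<^sub>M (x \<odot>\<^sub>M e) = \<zero>\<^sub>M"
   proof (cases "k x = 0")
    case True
    then have "e = \<zero>\<^sub>M" using Suc.prems(2)[OF x] Suc.prems(1) by simp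
    then show ?thesis using xc by simp
   next
    case False
    \<comment> \<open>\<open>x\<close> times \<open>e\<close> is killed by one power of
      \<open>x\<close> less, so the sum of the exponents drops together with the degree.\<close>
    let ?k = "\<lambda>y. if y = x then k x - 1 else k y"
    have "sum k (set xs) = sum ?k (set xs) + 1"
    proof -
     have "sum k (set xs) = k x + sum k (set xs - {x})" using x by (simp add: sum.remove)
     moreover have "sum ?k (set xs) = ?k x + sum ?k (set xs - {x})" using x by (intro sum.remove) simp_all
     moreover have "sum ?k (set xs - {x}) = sum k (set xs - {x})" by (rule sum.cong) auto
     ultimately show ?thesis using False by simp
    qed
    then have t: "t > sum ?k (set xs)" using Suc.prems(3) by simp
    have "y [^] (?k y) \<odot>\<^sub>M (x \<odot>\<^sub>M e) = \<zero>\<^sub>M" if y: "y \<in> set xs" for y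
    proof (cases "y = x")
     case True
     have "x [^] (k x - 1) \<odot>\<^sub>M (x \<odot>\<^sub>M e) = x [^] Suc (k x - 1) \<odot>\<^sub>M e"
      using xc Suc.prems(1) by (simp add: M.smult_assoc1)
     then show ?thesis using True False Suc.prems(2)[OF x] by simp
    next
     case False
     have "y \<in> carrier R" using y xsc by blast
     then show ?thesis using False Suc.prems(1) Suc.prems(2)[OF y] M.smult_swap[of "y [^] k y" x e] xc by simp
    qed
    note kk = this
    have "x \<odot>\<^sub>M e \<in> carrier M" using xc Suc.prems(1) by simp
    then have "\<forall>a\<in>rdeg R t. a \<odot>\<^sub>M (x \<odot>\<^sub>M e) = \<zero>\<^sub>M" by (rule Suc.IH[of _ ?k, OF _ kk t])
    then show ?thesis by (rule bspec) (rule b)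
   qed
   then show "(x \<otimes> b) \<odot>\<^sub>M e \<in> {\<zero>\<^sub>M}" using xc Suc.prems(1) M.smult_swap[of x b e] by (simp add: M.smult_assoc1)
  qed
  then show ?case by simp
 qed simp
 obtain k where k': "\<And>x. x \<in> set xs \<Longrightarrow> x [^] (k x :: nat) \<odot>\<^sub>M e = \<zero>\<^sub>M" using k by metis
 have "\<forall>t\<ge>Suc (sum k (set xs)). \<forall>a\<in>rdeg R t. a \<odot>\<^sub>M e = \<zero>\<^sub>M"
  by (intro allI impI bound[OF e k']) simp_all
 then show ?thesis using e unfolding torsion_part_def by blast
qed

end

text \<open>Choose \<open>l\<close> such that x^l e and x^(l+1) e have the same annihilator. Then
  sending j + x^(l+1) a to a x^l e is well defined on the ideal Ann(e) + x^(l+1) R. Injectivity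
  extends the map to the ring, and \<open>y\<close> is the image of 1: whatever kills
  \<open>e\<close> kills \<open>y\<close>, and x^(l+1) y = x^l e.\<close>

lemma injective_division:
 fixes R :: "'a graded_ring" and E :: "('a, 'c) graded_module" and ia :: "'a \<Rightarrow> 'c"
 assumes gr: "is_graded_ring R" and acc: "acc (shifted_ring R 0) (carrier R) (carrier R)"
  and inj: "graded_injective R E" and ia: "inj ia" and e: "e \<in> mdeg E s" and x: "x \<in> rdeg R 1"
 shows "\<exists>y\<in>mdeg E (s - 1). (\<forall>a\<in>carrier R. a \<odot>\<^sub>E e = \<zero>\<^sub>E \<longrightarrow> a \<odot>\<^sub>E y = \<zero>\<^sub>E) \<and>
  (\<exists>l::nat. x [^]\<^bsub>R\<^esub> l \<odot>\<^sub>E (x \<odot>\<^sub>E y \<ominus>\<^sub>E e) = \<zero>\<^sub>E)"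
proof -
 have gE: "is_graded_module R E" using inj by (simp add: graded_injective_def)
 interpret E: graded_module_loc R E by (rule graded_module_locI[OF gr gE])
 interpret S: graded_module_loc R "shifted_ring R (s - 1)" by (rule graded_module_locI[OF gr E.shifted_ring_graded])
 let ?S = "shifted_ring R (s - 1)"
 have Sneg: "\<ominus>\<^sub>?S a = \<ominus>\<^sub>R a" for a using a_inv_cong[of ?S R] by simp
 have ec: "e \<in> carrier E" using E.md.piece_carrier[OF e] .
 have xc: "x \<in> carrier R" using E.rd.piece_carrier[OF x] .
 have xp: "x [^]\<^bsub>R\<^esub> (k::nat) \<in> carrier R" for k using xc by simp
 \<comment> \<open>The annihilators of x^l e increase with \<open>l\<close> and become stationary
   over a Noetherian ring.\<close>
 let ?A = "\<lambda>l::nat. {a \<in> carrier R. a \<odot>\<^sub>E (x [^]\<^bsub>R\<^esub> l \<odot>\<^sub>E e) = \<zero>\<^sub>E}"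
 interpret Rm: module R "shifted_ring R 0" by (rule E.shifted_ring_module)
 have A: "asub (shifted_ring R 0) (carrier R) (?A l)" for l
 proof (rule Rm.asubI)
  show "\<zero>\<^bsub>shifted_ring R 0\<^esub> \<in> ?A l" using ec xp by simp
  show "a \<oplus>\<^bsub>shifted_ring R 0\<^esub> b \<in> ?A l" if "a \<in> ?A l" "b \<in> ?A l" for a b using that ec xp by (simp add: E.smult_l_distr)
  show "\<ominus>\<^bsub>shifted_ring R 0\<^esub> a \<in> ?A l" if "a \<in> ?A l" for a using that ec xp by (simp add: E.Rmod_neg E.smult_l_minus E.M.a_inv_zero)
  show "b \<odot>\<^bsub>shifted_ring R 0\<^esub> a \<in> ?A l" if "b \<in> carrier R" "a \<in> ?A l" for a b using that ec xp by (simp add: E.smult_assoc1)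
 qed auto
 have Asub: "?A l \<subseteq> ?A (Suc l)" for l
 proof
  fix a assume a: "a \<in> ?A l"
  have "a \<odot>\<^sub>E (x [^]\<^bsub>R\<^esub> Suc l \<odot>\<^sub>E e) = x \<odot>\<^sub>E (a \<odot>\<^sub>E (x [^]\<^bsub>R\<^esub> l \<odot>\<^sub>E e))"
   using a xc ec E.pow_shift[OF xc ec, of l] E.smult_swap[of a x "x [^]\<^bsub>R\<^esub> l \<odot>\<^sub>E e"] by simp
  then show "a \<in> ?A (Suc l)" using a xc by simp
 qed
 have "\<exists>n0. \<forall>n\<ge>n0. ?A n = ?A n0"
  by (rule acc[unfolded acc_def, rule_format]) (use A Asub in blast)
 then obtain l where "\<forall>n\<ge>l. ?A n = ?A l" by (rule exE)
 then have l: "?A (Suc l) = ?A l" by (rule allE[of _ "Suc l"]) simp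
 let ?X = "x [^]\<^bsub>R\<^esub> Suc l"
 have Xc: "?X \<in> carrier R" by (rule xp)
 define Ann where "Ann = {a \<in> carrier R. a \<odot>\<^sub>E e = \<zero>\<^sub>E}"
 have AnnI: "a \<in> Ann \<longleftrightarrow> a \<in> carrier R \<and> a \<odot>\<^sub>E e = \<zero>\<^sub>E" for a by (simp add: Ann_def)
 \<comment> \<open>The domain of the map, placed in R(-(s-1)) so that the image of 1 gets degree
   \<open>s - 1\<close>.\<close>
 define J where "J = {j \<oplus>\<^sub>R ?X \<otimes>\<^sub>R a | j a. j \<in> Ann \<and> a \<in> carrier R}"
 have JI: "j \<oplus>\<^sub>R ?X \<otimes>\<^sub>R a \<in> J" if "j \<in> Ann" "a \<in> carrier R" for j a unfolding J_def using that by blast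
 have JE: "\<exists>j a. b = j \<oplus>\<^sub>R ?X \<otimes>\<^sub>R a \<and> j \<in> Ann \<and> j \<in> carrier R \<and> a \<in> carrier R" if "b \<in> J" for b
  using that unfolding J_def AnnI by blast
 have Ann0: "\<zero>\<^sub>R \<in> Ann" "a \<in> Ann \<Longrightarrow> b \<in> Ann \<Longrightarrow> a \<oplus>\<^sub>R b \<in> Ann" "r \<in> carrier R \<Longrightarrow> a \<in> Ann \<Longrightarrow> r \<otimes>\<^sub>R a \<in> Ann" for a b r
  using ec by (simp_all add: AnnI E.smult_l_distr E.smult_assoc1)
 \<comment> \<open>The annihilator of a homogeneous element is a homogeneous ideal; passing from
   R(-(s-1)) to R(-s) shifts the index of the components by one.\<close>
 have Annc: "S.mcomp n a \<in> Ann" if a: "a \<in> Ann" for a n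
 proof -
  have ac: "a \<in> carrier R" using a by (simp add: AnnI)
  have "S.mcomp n a = rcomp R (s - 1) n a"
   using S.md.comp_unique[of a "rcomp R (s - 1)" n] E.rcomp_family[of "s - 1"] ac
   by (simp add: proj_family_def)
  also have "\<dots> = rcomp R s (n + 1) a" by (simp add: rcomp_def algebra_simps)
  finally have eq: "S.mcomp n a = rcomp R s (n + 1) a" .
  have "rcomp R s (n + 1) a \<odot>\<^sub>E e = E.mcomp (n + 1) (a \<odot>\<^sub>E e)" using E.comp_smult_rcomp[OF ac e] by simp
  then show ?thesis using a E.md.comp_zero E.rcomp_facts(8)[OF ac] by (simp add: AnnI eq)
 qed
 have Xdeg: "?X \<in> rgr R (int (Suc l))" using E.pow_deg[OF x, of "Suc l"] E.rgr_of_nat[of "Suc l"] by simp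
 have compX: "S.mcomp n (?X \<otimes>\<^sub>R a) = ?X \<otimes>\<^sub>R S.mcomp (n - int (Suc l)) a" if "a \<in> carrier R" for a n
  using S.comp_smult[OF Xdeg, of a n] that by simp
 have scl: "S.mcomp n a \<in> carrier R" if "a \<in> carrier R" for a n using S.md.comp_closed[of a n] that by simp
 have J: "hsub R ?S J"
 proof (rule S.hsubI)
  show "J \<subseteq> carrier ?S" using JE Xc by fastforce
  have "\<zero>\<^sub>R \<oplus>\<^sub>R ?X \<otimes>\<^sub>R \<zero>\<^sub>R \<in> J" by (rule JI[OF Ann0(1)]) simp
  then show "\<zero>\<^sub>?S \<in> J" using Xc by (simp del: nat_pow_Suc E.nat_pow_Suc)
 next
  fix b c assume "b \<in> J" "c \<in> J"
  then obtain j a j' a' where b: "b = j \<oplus>\<^sub>R ?X \<otimes>\<^sub>R a" "j \<in> Ann" "j \<in> carrier R" "a \<in> carrier R"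
   and c: "c = j' \<oplus>\<^sub>R ?X \<otimes>\<^sub>R a'" "j' \<in> Ann" "j' \<in> carrier R" "a' \<in> carrier R" using JE by blast
  have "b \<oplus>\<^sub>R c = (j \<oplus>\<^sub>R j') \<oplus>\<^sub>R ?X \<otimes>\<^sub>R (a \<oplus>\<^sub>R a')"
   using S.swap4[of j "?X \<otimes>\<^sub>R a" j' "?X \<otimes>\<^sub>R a'"] b c Xc by (simp add: E.r_distr del: E.nat_pow_Suc)
  then show "b \<oplus>\<^sub>?S c \<in> J" using JI[OF Ann0(2)[OF b(2) c(2)], of "a \<oplus>\<^sub>R a'"] b c by simp
 next
  fix r b assume r: "r \<in> carrier R" and "b \<in> J"
  then obtain j a where b: "b = j \<oplus>\<^sub>R ?X \<otimes>\<^sub>R a" "j \<in> Ann" "j \<in> carrier R" "a \<in> carrier R" using JE by blast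
  have "r \<otimes>\<^sub>R b = r \<otimes>\<^sub>R j \<oplus>\<^sub>R ?X \<otimes>\<^sub>R (r \<otimes>\<^sub>R a)"
   using b r Xc E.m_lcomm[of r ?X a] by (simp add: E.r_distr del: E.nat_pow_Suc)
  then show "r \<odot>\<^sub>?S b \<in> J" using JI[OF Ann0(3)[OF r b(2)], of "r \<otimes>\<^sub>R a"] b r by simp
 next
  fix b n assume "b \<in> J"
  then obtain j a where b: "b = j \<oplus>\<^sub>R ?X \<otimes>\<^sub>R a" "j \<in> Ann" "j \<in> carrier R" "a \<in> carrier R" using JE by blast
  have "S.mcomp n b = S.mcomp n j \<oplus>\<^sub>R ?X \<otimes>\<^sub>R S.mcomp (n - int (Suc l)) a"
   using S.md.comp_add[of j "?X \<otimes>\<^sub>R a" n] compX[OF b(4)] b Xc by (simp del: E.nat_pow_Suc)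
  then show "S.mcomp n b \<in> J" using JI[OF Annc[OF b(2)] scl[OF b(4)]] by simp
 qed
 define f0 where "f0 b = (SOME v. \<exists>j a. b = j \<oplus>\<^sub>R ?X \<otimes>\<^sub>R a \<and> j \<in> Ann \<and> a \<in> carrier R \<and> v = a \<odot>\<^sub>E (x [^]\<^bsub>R\<^esub> l \<odot>\<^sub>E e))" for b
 let ?e = "x [^]\<^bsub>R\<^esub> l \<odot>\<^sub>E e"
 have ec': "?e \<in> carrier E" using ec xp by simp
 have welldef: "a \<odot>\<^sub>E ?e = a' \<odot>\<^sub>E ?e"
  if eq: "j \<oplus>\<^sub>R ?X \<otimes>\<^sub>R a = j' \<oplus>\<^sub>R ?X \<otimes>\<^sub>R a'" and j: "j \<in> Ann" "j' \<in> Ann" and a: "a \<in> carrier R" "a' \<in> carrier R" for j j' a a'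
 proof -
  have k: "(j \<oplus>\<^sub>R ?X \<otimes>\<^sub>R a) \<odot>\<^sub>E e = a \<odot>\<^sub>E (?X \<odot>\<^sub>E e)" if "j \<in> Ann" "a \<in> carrier R" for j a
   using that ec Xc E.m_comm[of ?X a] by (simp add: AnnI E.smult_l_distr E.smult_assoc1 del: E.nat_pow_Suc)
  have "a \<odot>\<^sub>E (?X \<odot>\<^sub>E e) = a' \<odot>\<^sub>E (?X \<odot>\<^sub>E e)" using k[OF j(1) a(1)] k[OF j(2) a(2)] eq by simp
  then have "(a \<ominus>\<^sub>R a') \<odot>\<^sub>E (?X \<odot>\<^sub>E e) = \<zero>\<^sub>E"
   using a ec Xc by (simp add: E.R.minus_eq E.smult_l_distr E.smult_l_minus E.M.r_neg del: E.nat_pow_Suc)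
  then have "a \<ominus>\<^sub>R a' \<in> ?A (Suc l)" using a by simp
  then have "a \<ominus>\<^sub>R a' \<in> ?A l" unfolding l .
  then have "a \<odot>\<^sub>E ?e \<ominus>\<^sub>E a' \<odot>\<^sub>E ?e = \<zero>\<^sub>E"
   using a ec' by (simp add: E.R.minus_eq E.M.minus_eq E.smult_l_distr E.smult_l_minus)
  then show ?thesis by (rule E.M.minus_zeroD[OF E.smult_closed[OF a(1) ec'] E.smult_closed[OF a(2) ec']])
 qed
 have f0: "f0 (j \<oplus>\<^sub>R ?X \<otimes>\<^sub>R a) = a \<odot>\<^sub>E ?e" if ja: "j \<in> Ann" "a \<in> carrier R" for j a
 proof -
  let ?b = "j \<oplus>\<^sub>R ?X \<otimes>\<^sub>R a"
  have "\<exists>v j' a'. ?b = j' \<oplus>\<^sub>R ?X \<otimes>\<^sub>R a' \<and> j' \<in> Ann \<and> a' \<in> carrier R \<and> v = a' \<odot>\<^sub>E ?e" using ja by blast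
  from someI_ex[OF this] obtain j' a' where "?b = j' \<oplus>\<^sub>R ?X \<otimes>\<^sub>R a'" "j' \<in> Ann" "a' \<in> carrier R" "f0 ?b = a' \<odot>\<^sub>E ?e"
   unfolding f0_def by blast
  then show ?thesis using welldef[of j a j' a'] ja by simp
 qed
 let ?J = "graded_submodule ?S J"
 interpret J: graded_module_loc R ?J by (rule graded_module_locI[OF gr S.hsub_module[OF J]])
 have f0h: "f0 \<in> graded_hom R ?J E"
  unfolding graded_hom_def hom_def
 proof (intro CollectI conjI ballI allI Pi_I)
  fix b assume "b \<in> carrier (add_monoid ?J)"
  then obtain j a where b: "b = j \<oplus>\<^sub>R ?X \<otimes>\<^sub>R a" "j \<in> Ann" "j \<in> carrier R" "a \<in> carrier R" using JE[of b] by auto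
  show "f0 b \<in> carrier (add_monoid E)" using f0[OF b(2,4)] b ec' by simp
  fix c assume "c \<in> carrier (add_monoid ?J)"
  then obtain j' a' where c: "c = j' \<oplus>\<^sub>R ?X \<otimes>\<^sub>R a'" "j' \<in> Ann" "j' \<in> carrier R" "a' \<in> carrier R" using JE[of c] by auto
  have "b \<oplus>\<^sub>R c = (j \<oplus>\<^sub>R j') \<oplus>\<^sub>R ?X \<otimes>\<^sub>R (a \<oplus>\<^sub>R a')"
   using S.swap4[of j "?X \<otimes>\<^sub>R a" j' "?X \<otimes>\<^sub>R a'"] b c Xc by (simp add: E.r_distr del: E.nat_pow_Suc)
  then have "f0 (b \<oplus>\<^sub>R c) = (a \<oplus>\<^sub>R a') \<odot>\<^sub>E ?e" using f0[OF Ann0(2)[OF b(2) c(2)], of "a \<oplus>\<^sub>R a'"] b c by simp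
  also have "\<dots> = f0 b \<oplus>\<^sub>E f0 c" unfolding b(1) c(1) f0[OF b(2,4)] f0[OF c(2,4)] by (rule E.smult_l_distr[OF b(4) c(4) ec'])
  finally show "f0 (b \<otimes>\<^bsub>add_monoid ?J\<^esub> c) = f0 b \<otimes>\<^bsub>add_monoid E\<^esub> f0 c" by simp
 next
  fix r b assume r: "r \<in> carrier R" and "b \<in> carrier ?J"
  then obtain j a where b: "b = j \<oplus>\<^sub>R ?X \<otimes>\<^sub>R a" "j \<in> Ann" "j \<in> carrier R" "a \<in> carrier R" using JE[of b] by auto
  have "r \<otimes>\<^sub>R b = r \<otimes>\<^sub>R j \<oplus>\<^sub>R ?X \<otimes>\<^sub>R (r \<otimes>\<^sub>R a)"
   using b r Xc E.m_lcomm[of r ?X a] by (simp add: E.r_distr del: E.nat_pow_Suc)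
  then have "f0 (r \<otimes>\<^sub>R b) = (r \<otimes>\<^sub>R a) \<odot>\<^sub>E ?e" using f0[OF Ann0(3)[OF r b(2)], of "r \<otimes>\<^sub>R a"] b r by simp
  also have "\<dots> = r \<odot>\<^sub>E f0 b" unfolding b(1) f0[OF b(2,4)] by (rule E.smult_assoc1[OF r b(4) ec'])
  finally show "f0 (r \<odot>\<^sub>?J b) = r \<odot>\<^sub>E f0 b" by simp
 next
  fix n show "f0 ` mdeg ?J n \<subseteq> mdeg E n"
  proof (rule image_subsetI)
   fix b assume "b \<in> mdeg ?J n"
   then have bn: "b \<in> mdeg ?S n" and bJ: "b \<in> J" by simp_all
   obtain j a where b: "b = j \<oplus>\<^sub>R ?X \<otimes>\<^sub>R a" "j \<in> Ann" "j \<in> carrier R" "a \<in> carrier R" using JE[OF bJ] by blast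
   let ?a = "S.mcomp (n - int (Suc l)) a"
   have "b = S.mcomp n b" using S.md.comp_id[OF bn] by simp
   also have "\<dots> = S.mcomp n j \<oplus>\<^sub>R ?X \<otimes>\<^sub>R ?a"
    using S.md.comp_add[of j "?X \<otimes>\<^sub>R a" n] compX[OF b(4)] b Xc by (simp del: E.nat_pow_Suc)
   finally have "f0 b = ?a \<odot>\<^sub>E ?e" using f0[OF Annc[OF b(2)] scl[OF b(4)], of n "n - int (Suc l)"] by simp
   moreover have "?a \<in> rgr R (n - int (Suc l) - (s - 1))" using S.md.comp_in[of a "n - int (Suc l)"] b(4) by simp
   moreover have "?e \<in> mdeg E (int l + s)" using E.smult_deg[OF E.pow_deg[OF x] e] .
   ultimately show "f0 b \<in> mdeg E n" using E.smult_rgr[of ?a "n - int (Suc l) - (s - 1)" ?e "int l + s"] by simp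
  qed
 qed
 have iaS: "inj_on ia (carrier ?S)" "inj_on ia (carrier ?J)" using ia inj_on_subset by blast+
 \<comment> \<open>Injectivity of \<open>E\<close> is tested against modules on its own carrier
   type, so the ring and the ideal are moved there along \<open>ia\<close>.\<close>
 let ?B = "transport ia ?S" and ?A' = "transport ia ?J"
 interpret A': graded_module_loc R ?A' by (rule graded_module_locI[OF gr J.transport_graded[OF iaS(2)]])
 have incl: "(\<lambda>b. b) \<in> graded_hom R ?J ?S" unfolding graded_hom_def hom_def using S.hsubD(1)[OF J] by auto
 have u: "(\<lambda>w. w) \<in> graded_hom R ?A' ?B"
 proof (rule A'.graded_hom_cong[OF graded_hom_comp[OF J.transport_inv_hom[OF iaS(2)] graded_hom_comp[OF incl S.transport_hom[OF iaS(1)]]]])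
  fix w assume "w \<in> carrier ?A'"
  then have "w \<in> ia ` carrier ?J" by (simp add: J.transport_simps[OF iaS(2)])
  then show "ia (inv_into (carrier ?J) ia w) = w" by (rule f_inv_into_f)
 qed
 have ff: "(\<lambda>w. f0 (inv_into (carrier ?J) ia w)) \<in> graded_hom R ?A' E"
  by (rule graded_hom_comp[OF J.transport_inv_hom[OF iaS(2)] f0h])
 have "\<exists>g\<in>graded_hom R ?B E. \<forall>w\<in>carrier ?A'. g w = f0 (inv_into (carrier ?J) ia w)"
  using inj[unfolded graded_injective_def, THEN conjunct2, rule_format, of ?A' ?B "\<lambda>w. w"]
   J.transport_graded[OF iaS(2)] S.transport_graded[OF iaS(1)] u ff by simp
 then obtain g where g: "g \<in> graded_hom R ?B E" "\<forall>w\<in>carrier ?A'. g w = f0 (inv_into (carrier ?J) ia w)" by (rule bexE)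
 interpret g: ghom R ?B E g by (rule ghomI[OF gr S.transport_graded[OF iaS(1)] gE g(1)])
 have gJ: "g (ia b) = f0 b" if "b \<in> J" for b
  using bspec[OF g(2), of "ia b"] that inv_into_f_f[OF iaS(2), of b] by (simp add: J.transport_simps[OF iaS(2)])
 define y where "y = g (ia \<one>\<^sub>R)"
 have one: "\<one>\<^sub>R \<in> carrier ?S" by simp
 have "ia \<one>\<^sub>R \<in> mdeg ?B (s - 1)"
  using E.one_deg E.rgr_of_nat[of 0] by (simp add: S.transport_simps[OF iaS(1)])
 then have y: "y \<in> mdeg E (s - 1)" unfolding y_def by (rule g.deg)
 have yc: "y \<in> carrier E" using E.md.piece_carrier[OF y] .
 have bY: "b \<odot>\<^sub>E y = f0 b" if "b \<in> J" for b
 proof -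
  have bc: "b \<in> carrier R" using S.hsubD(1)[OF J that] by simp
  have "b \<odot>\<^sub>E y = g (b \<odot>\<^sub>?B ia \<one>\<^sub>R)" unfolding y_def
   by (rule g.smult[symmetric, OF bc]) (simp add: S.transport_simps[OF iaS(1)])
  also have "b \<odot>\<^sub>?B ia \<one>\<^sub>R = ia b" using S.transport_simps(4)[OF iaS(1) one, of b] bc by simp
  finally show ?thesis using gJ[OF that] by simp
 qed
 have 1: "a \<odot>\<^sub>E y = \<zero>\<^sub>E" if "a \<in> carrier R" "a \<odot>\<^sub>E e = \<zero>\<^sub>E" for a
 proof -
  have a: "a \<in> Ann" using that by (simp add: AnnI)
  have "a \<oplus>\<^sub>R ?X \<otimes>\<^sub>R \<zero>\<^sub>R = a" using that Xc by (simp del: E.nat_pow_Suc)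
  then show ?thesis using bY[OF JI[OF a E.R.zero_closed]] f0[OF a E.R.zero_closed] ec' by simp
 qed
 have "\<zero>\<^sub>R \<oplus>\<^sub>R ?X \<otimes>\<^sub>R \<one>\<^sub>R = ?X" using Xc by (simp del: E.nat_pow_Suc)
 then have "?X \<odot>\<^sub>E y = ?e" using bY[OF JI[OF Ann0(1) E.R.one_closed]] f0[OF Ann0(1) E.R.one_closed] ec' by simp
 then have "x [^]\<^bsub>R\<^esub> l \<odot>\<^sub>E (x \<odot>\<^sub>E y \<ominus>\<^sub>E e) = \<zero>\<^sub>E"
  using xc xp yc ec ec' by (simp add: E.M.minus_eq E.smult_r_distr E.smult_r_minus E.smult_assoc1[symmetric] E.M.r_neg)
 then show ?thesis using y 1 by blast
qed

lemma dot_unit: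
 assumes "cring R"
 shows "set xs \<subseteq> carrier R \<Longrightarrow> j < length xs \<Longrightarrow> dot R ((replicate (length xs) \<zero>\<^sub>R)[j := \<one>\<^sub>R]) xs = xs ! j"
proof (induction xs arbitrary: j)
 case (Cons x xs)
 interpret cring R by fact
 have z: "set ys \<subseteq> carrier R \<Longrightarrow> dot R (replicate (length ys) \<zero>\<^sub>R) ys = \<zero>\<^sub>R" for ys
  by (induction ys) auto
 show ?case using Cons z[of xs] by (cases j) (auto simp: nth_mem subset_iff)
qed simp

text \<open>After \<open>j\<close> variables the error f - dg is killed by powers of each of them.
  Dividing the error by the next variable and contracting the result with the corresponding unit
  vector gives a correction of g that improves the error by one variable; in the end
  \<open>pow_tors\<close> applies.\<close>

lemma (in lin_gens) koszul_exact:
 fixes E :: "('a, 'c) graded_module" and ia :: "'a \<Rightarrow> 'c"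
 assumes acc: "acc (shifted_ring R 0) (carrier R) (carrier R)" and inj: "graded_injective R E" and ia: "inj ia"
  and f: "coch E (length xs) (mdeg E) n q f" and df: "kin (length xs) (kd E xs f) (torsion_part R E)"
 shows "\<exists>g. coch E (length xs) (mdeg E) (n - 1) (q - 1) g \<and> kin (length xs) (\<lambda>l. f l \<ominus>\<^sub>E kd E xs g l) (torsion_part R E)"
proof -
 have gE: "is_graded_module R E" using inj by (simp add: graded_injective_def)
 interpret E: graded_module_loc R E by (rule graded_module_locI[OF graded gE])
 let ?r = "length xs"
 define G where "G j = {e \<in> carrier E. \<forall>i<j. e \<in> E.xt (xs ! i)}" for j
 have xj: "xs ! j \<in> carrier R" "xs ! j \<in> rdeg R 1" if "j < ?r" for j using that xsc xs1 nth_mem by blast+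
 have G: "asub E (carrier R) (G j)" if "j \<le> ?r" for j
 proof (rule E.asubI)
  note a = E.asubD[OF E.xt_asub[OF xj(1)]]
  have lt: "i < ?r" if "i < j" for i using that \<open>j \<le> ?r\<close> by simp
  show "G j \<subseteq> carrier E" by (auto simp: G_def)
  show "\<zero>\<^sub>E \<in> G j" using a(2)[OF lt] by (simp add: G_def)
  show "u \<oplus>\<^sub>E v \<in> G j" if "u \<in> G j" "v \<in> G j" for u v using that a(3)[OF lt] by (simp add: G_def)
  show "\<ominus>\<^sub>E u \<in> G j" if "u \<in> G j" for u using that a(4)[OF lt] by (simp add: G_def)
  show "b \<odot>\<^sub>E u \<in> G j" if "b \<in> carrier R" "u \<in> G j" for b u using that a(6)[OF lt] by (simp add: G_def)
 qed
 have GSuc: "e \<in> G (Suc j) \<longleftrightarrow> e \<in> G j \<and> e \<in> E.xt (xs ! j)" for e j by (auto simp: G_def less_Suc_eq)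
 have fk: "kin ?r f (carrier E)" by (rule E.coch_kin[OF f])
 have "\<exists>g. coch E ?r (mdeg E) (n - 1) (q - 1) g \<and> kin ?r (\<lambda>l. f l \<ominus>\<^sub>E kd E xs g l) (G j)" if "j \<le> ?r" for j
  using that
 proof (induction j)
  case 0
  have kc: "kin ?r (kd E xs (\<lambda>l. \<zero>\<^sub>E)) (carrier E)" by (rule E.kd_carrier[OF xsc]) (simp add: kin_def)
  have "kin ?r (\<lambda>l. f l \<ominus>\<^sub>E kd E xs (\<lambda>l. \<zero>\<^sub>E) l) (G 0)"
   using fk kc by (simp add: kin_def G_def)
  then show ?case using E.coch_zero by blast
 next
  case (Suc j)
  then have jr: "j < ?r" "j \<le> ?r" by simp_all
  let ?x = "xs ! j"
  note x = xj[OF jr(1)]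
  obtain g where g: "coch E ?r (mdeg E) (n - 1) (q - 1) g" and gk: "kin ?r (\<lambda>l. f l \<ominus>\<^sub>E kd E xs g l) (G j)"
   using Suc.IH[OF jr(2)] by blast
  have gc: "kin ?r g (carrier E)" by (rule E.coch_kin[OF g])
  have dgc: "kin ?r (kd E xs g) (carrier E)" by (rule E.kd_carrier[OF xsc gc])
  define F where "F l = f l \<ominus>\<^sub>E kd E xs g l" for l
  have Fco: "coch E ?r (mdeg E) n q F"
   unfolding F_def using E.coch_minus[OF f] E.kd_coch[OF xs1 g] by simp
  have FG: "kin ?r F (G j)" using gk unfolding F_def .
  have Fc: "kin ?r F (carrier E)" by (rule E.coch_kin[OF Fco])
  have dF: "kd E xs F l = kd E xs f l" if l: "length l = ?r" for l
  proof -
   have "kd E xs F l = kd E xs f l \<ominus>\<^sub>E kd E xs (kd E xs g) l"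
    unfolding F_def by (rule E.kd_minus[OF xsc fk dgc l])
   then show ?thesis using E.kd_kd[OF xsc gc l] E.kd_carrierD[OF xsc fk l] by (simp add: E.M.minus_eq E.M.a_inv_zero)
  qed
  \<comment> \<open>The annihilator condition is what keeps the quotient in \<open>G j\<close>:
    powers of the earlier variables that kill the error also kill the quotient.\<close>
  have "\<exists>y. y \<in> (if ntrue l = q then mdeg E (n - 1) else {\<zero>\<^sub>E}) \<and>
    (\<forall>a\<in>carrier R. a \<odot>\<^sub>E F l = \<zero>\<^sub>E \<longrightarrow> a \<odot>\<^sub>E y = \<zero>\<^sub>E) \<and> ?x \<odot>\<^sub>E y \<ominus>\<^sub>E F l \<in> E.xt ?x" if l: "length l = ?r" for l
  proof (cases "ntrue l = q")
   case True
   then have "F l \<in> mdeg E n" using cochD[OF Fco l] by simp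
   from injective_division[OF graded acc inj ia this x(2)]
   obtain y k where y: "y \<in> mdeg E (n - 1)" "\<forall>a\<in>carrier R. a \<odot>\<^sub>E F l = \<zero>\<^sub>E \<longrightarrow> a \<odot>\<^sub>E y = \<zero>\<^sub>E"
    "?x [^] (k::nat) \<odot>\<^sub>E (?x \<odot>\<^sub>E y \<ominus>\<^sub>E F l) = \<zero>\<^sub>E" by blast
   have "?x \<odot>\<^sub>E y \<ominus>\<^sub>E F l \<in> carrier E" using x(1) E.md.piece_carrier[OF y(1)] kinD[OF Fc l] by simp
   then have "?x \<odot>\<^sub>E y \<ominus>\<^sub>E F l \<in> E.xt ?x" using y(3) unfolding E.xt_def by blast
   then show ?thesis using y(1,2) True by auto
  next
   case False
   then have "F l = \<zero>\<^sub>E" using cochD[OF Fco l] by simp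
   then show ?thesis using False x(1) E.asubD(2)[OF E.xt_asub[OF x(1)]] by (intro exI[of _ "\<zero>\<^sub>E"]) (simp add: E.M.minus_eq E.M.a_inv_zero)
  qed
  then obtain f' where f': "\<And>l. length l = ?r \<Longrightarrow> f' l \<in> (if ntrue l = q then mdeg E (n - 1) else {\<zero>\<^sub>E})"
   "\<And>l a. length l = ?r \<Longrightarrow> a \<in> carrier R \<Longrightarrow> a \<odot>\<^sub>E F l = \<zero>\<^sub>E \<Longrightarrow> a \<odot>\<^sub>E f' l = \<zero>\<^sub>E"
   "\<And>l. length l = ?r \<Longrightarrow> ?x \<odot>\<^sub>E f' l \<ominus>\<^sub>E F l \<in> E.xt ?x" by metis
  have f'co: "coch E ?r (mdeg E) (n - 1) q f'" using f'(1) unfolding coch_def by blast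
  have f'c: "kin ?r f' (carrier E)" by (rule E.coch_kin[OF f'co])
  have f'G: "kin ?r f' (G j)"
   proof (rule kinI)
   fix l :: "bool list" assume l: "length l = ?r"
   have "f' l \<in> E.xt (xs ! i)" if i: "i < j" for i
   proof -
    have "F l \<in> E.xt (xs ! i)" using kinD[OF FG l] i by (simp add: G_def)
    then obtain k where k: "(xs ! i) [^] (k::nat) \<odot>\<^sub>E F l = \<zero>\<^sub>E" by (auto simp: E.xt_def)
    have "(xs ! i) [^] k \<in> carrier R" using xj(1)[of i] i jr by simp
    from f'(2)[OF l this k] show ?thesis using kinD[OF f'c l] unfolding E.xt_def by blast
   qed
   then show "f' l \<in> G j" using kinD[OF f'c l] by (simp add: G_def)
  qed
  define D where "D l = ?x \<odot>\<^sub>E f' l \<ominus>\<^sub>E F l" for l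
  have Gj: "asub E (carrier R) (G j)" and xtx: "asub E (carrier R) (E.xt ?x)" using G[OF jr(2)] E.xt_asub[OF x(1)] .
  have DG: "kin ?r D (G (Suc j))"
   proof (rule kinI)
   fix l :: "bool list" assume l: "length l = ?r"
   have "D l \<in> G j" unfolding D_def using E.asubD(5)[OF Gj E.asubD(6)[OF Gj x(1) kinD[OF f'G l]] kinD[OF FG l]] .
   then show "D l \<in> G (Suc j)" using f'(3)[OF l] by (simp add: GSuc D_def)
  qed
  have GS: "asub E (carrier R) (G (Suc j))" by (rule G[OF Suc.prems])
  have asx: "asub E (set xs) S" if "asub E (carrier R) S" for S using E.asub_mono_ops[OF xsc that] .
  have Dc: "kin ?r D (carrier E)" by (rule kin_mono[OF DG]) (auto simp: G_def)
  have Dx: "kin ?r D (E.xt ?x)" by (rule kin_mono[OF DG]) (auto simp: GSuc)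
  have xf'c: "kin ?r (\<lambda>l. ?x \<odot>\<^sub>E f' l) (carrier E)" using f'c x by (simp add: kin_def)
  \<comment> \<open>The variable times the differential of \<open>f'\<close> is the differential of
    \<open>D + F\<close>. Both parts are power torsion for this variable, and power torsion is
    unaffected by removing the factor.\<close>
  have kf'G: "kin ?r (kd E xs f') (G (Suc j))"
   proof (rule kinI)
   fix l :: "bool list" assume l: "length l = ?r"
   have "kd E xs f' l \<in> G j" using kinD[OF E.kd_closed[OF xsc asx[OF Gj] f'G] l] .
   moreover have "kd E xs f' l \<in> E.xt ?x"
   proof (rule E.xt_divide[OF x(1) E.kd_carrierD[OF xsc f'c l]])
    have "?x \<odot>\<^sub>E kd E xs f' l = kd E xs (\<lambda>k. ?x \<odot>\<^sub>E f' k) l" using E.kd_smult[OF xsc x(1) f'c l] by simp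
    also have "\<dots> = kd E xs (\<lambda>k. D k \<oplus>\<^sub>E F k) l"
     by (rule kd_cong[OF _ l]) (use kinD[OF xf'c] kinD[OF Fc] in \<open>simp add: D_def E.M.minus_plus\<close>)
    also have "\<dots> = kd E xs D l \<oplus>\<^sub>E kd E xs F l" by (rule E.kd_add[OF xsc Dc Fc l])
    finally have e: "?x \<odot>\<^sub>E kd E xs f' l = kd E xs D l \<oplus>\<^sub>E kd E xs F l" .
    have "kd E xs F l \<in> E.xt ?x" using dF[OF l] kinD[OF df l] E.tors_xt[OF x(2)] by auto
    then show "?x \<odot>\<^sub>E kd E xs f' l \<in> E.xt ?x" unfolding e
     using E.asubD(3)[OF xtx kinD[OF E.kd_closed[OF xsc asx[OF xtx] Dx] l]] by blast
   qed
   ultimately show "kd E xs f' l \<in> G (Suc j)" by (simp add: GSuc)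
  qed
  \<comment> \<open>Contraction with the unit vector of index \<open>j\<close> is a homotopy for
    multiplication by the single variable \<open>?x\<close>.\<close>
  let ?cs = "(replicate ?r \<zero>)[j := \<one>]"
  have lcs: "length ?cs = ?r" by simp
  have cs: "set ?cs \<subseteq> R0" "set ?cs \<subseteq> carrier R"
   using set_update_subset_insert[of "replicate ?r \<zero>" j \<one>] one_deg rd.piece_zero R0_carrier by (auto split: if_splits)
  define w where "w = kw E ?cs f'"
  have wco: "coch E ?r (mdeg E) (n - 1) (q - 1) w"
   using E.kw_coch[OF cs(1), of "n - 1" q f'] f'co unfolding w_def by simp
  have wc: "kin ?r w (carrier E)" by (rule E.coch_kin[OF wco])
  have kwG: "kin ?r (kw E ?cs (kd E xs f')) (G (Suc j))"
   using E.kw_closed[OF cs(2) E.asub_mono_ops[OF cs(2) GS], of "kd E xs f'"] kf'G by simp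
  have "kin ?r (\<lambda>l. f l \<ominus>\<^sub>E kd E xs (\<lambda>k. g k \<oplus>\<^sub>E w k) l) (G (Suc j))"
   proof (rule kinI)
   fix l :: "bool list" assume l: "length l = ?r"
   have hom: "kd E xs w l \<oplus>\<^sub>E kw E ?cs (kd E xs f') l = ?x \<odot>\<^sub>E f' l"
    unfolding w_def using E.k_homotopy[OF xsc cs(2) lcs f'c l] dot_unit[OF is_cring xsc jr(1)] by simp
   let ?K = "kw E ?cs (kd E xs f') l"
   have c: "f l \<in> carrier E" "kd E xs g l \<in> carrier E" "kd E xs w l \<in> carrier E" "F l \<in> carrier E" "?x \<odot>\<^sub>E f' l \<in> carrier E"
    using kinD[OF fk l] kinD[OF dgc l] E.kd_carrierD[OF xsc wc l] kinD[OF Fc l] kinD[OF xf'c l] by auto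
   have Kc: "?K \<in> carrier E" using kinD[OF kwG l] by (simp add: G_def)
   \<comment> \<open>The new error is the contraction of the differential of \<open>f'\<close> minus
     \<open>D\<close>; both lie in \<open>G (Suc j)\<close>.\<close>
   have "f l \<ominus>\<^sub>E kd E xs (\<lambda>k. g k \<oplus>\<^sub>E w k) l = F l \<ominus>\<^sub>E kd E xs w l"
    unfolding E.kd_add[OF xsc gc wc l] F_def using c by (simp add: E.M.minus_eq E.M.minus_add E.M.a_assoc)
   also have "kd E xs w l = ?x \<odot>\<^sub>E f' l \<ominus>\<^sub>E ?K" using E.M.plus_minus_r[OF c(3) Kc] hom by simp
   also have "F l \<ominus>\<^sub>E (?x \<odot>\<^sub>E f' l \<ominus>\<^sub>E ?K) = ?K \<ominus>\<^sub>E D l"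
    unfolding D_def using c Kc by (simp add: E.M.minus_eq E.M.minus_add E.M.a_ac)
   finally show "f l \<ominus>\<^sub>E kd E xs (\<lambda>k. g k \<oplus>\<^sub>E w k) l \<in> G (Suc j)"
    using E.asubD(5)[OF GS kinD[OF kwG l] kinD[OF DG l]] by simp
  qed
  then show ?case using E.coch_add[OF g wco] by blast
 qed
 from this[of ?r] obtain g where g: "coch E ?r (mdeg E) (n - 1) (q - 1) g" "kin ?r (\<lambda>l. f l \<ominus>\<^sub>E kd E xs g l) (G ?r)" by blast
 have "G ?r \<subseteq> torsion_part R E"
 proof
  fix e assume e: "e \<in> G ?r"
  show "e \<in> torsion_part R E"
  proof (rule pow_tors[OF E.graded_module_loc_axioms])
   show "e \<in> carrier E" using e by (simp add: G_def)
   fix x assume "x \<in> set xs"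
   then obtain i where "i < ?r" "x = xs ! i" by (auto simp: in_set_conv_nth)
   then show "\<exists>k::nat. x [^] k \<odot>\<^sub>E e = \<zero>\<^sub>E" using e by (auto simp: G_def E.xt_def)
  qed
 qed
 then show ?thesis using g kin_mono by blast
qed

section \<open>Cohomology vanishing and the Koszul complex\<close>

lemma (in graded_module_loc) carrier_hsub: "hsub R M (carrier M)"
 by (rule hsubI) (auto simp: md.comp_closed)

text \<open>Only the products of the values with the variables are required to lie in
  \<open>S\<close>; this is used for a cochain whose values are yet to be shown to lie in
  \<open>S\<close>.\<close>

lemma (in graded_module_loc) kd_mult_closed:
 "set xs \<subseteq> carrier R \<Longrightarrow> asub M {} S \<Longrightarrow> (\<And>x l. x \<in> set xs \<Longrightarrow> length l = length xs \<Longrightarrow> x \<odot>\<^sub>M f l \<in> S) \<Longrightarrow> kin (length xs) (kd M xs f) S"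
proof (induction xs arbitrary: f)
 case Nil then show ?case using asubD(2) by (simp add: kin_def)
next
 case (Cons x xs)
 have k: "kin (length xs) (kd M xs (\<lambda>k. f (b # k))) S" for b
  by (rule Cons.IH) (use Cons.prems in auto)
 show ?case
 proof (rule kinI)
  fix l :: "bool list" assume "length l = length (x # xs)"
  then obtain b m where l: "l = b # m" "length m = length xs" by (cases l) auto
  have "x \<odot>\<^sub>M f (False # m) \<in> S" using Cons.prems(3)[of x "False # m"] l by simp
  then show "kd M (x # xs) f l \<in> S" using l kinD[OF k l(2)] asubD(5)[OF Cons.prems(2)] by simp
 qed
qed

context ghom
begin

lemma image_asub:
 assumes S: "asub M (carrier R) S" shows "asub N (carrier R) (f ` S)"
proof (rule cod.asubI)
 note TS = dom.asubD[OF S]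
 show "f ` S \<subseteq> carrier N" using TS(1) by blast
 show "\<zero>\<^sub>N \<in> f ` S" using zero[symmetric] TS(2) by blast
 fix u assume "u \<in> f ` S"
 then obtain u' where u: "u = f u'" "u' \<in> S" by auto
 show "\<ominus>\<^sub>N u \<in> f ` S" using u TS by (auto simp: neg[symmetric])
 show "a \<odot>\<^sub>N u \<in> f ` S" if "a \<in> carrier R" for a using u TS that by (auto simp: smult[symmetric])
 fix v assume "v \<in> f ` S"
 then obtain v' where v: "v = f v'" "v' \<in> S" by auto
 show "u \<oplus>\<^sub>N v \<in> f ` S" using u v TS by (auto simp: add[symmetric])
qed

lemma coch_image: "coch M r (mdeg M) n q g \<Longrightarrow> coch N r (mdeg N) n q (\<lambda>l. f (g l))"
 unfolding coch_def using deg by (auto split: if_splits)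

text \<open>Values are lifted one by one into \<open>S\<close> and then replaced by their
  homogeneous components.\<close>

lemma coch_lift:
 assumes S: "hsub R M S" and g: "coch N r (mdeg N) n q g" and gS: "kin r g (f ` S)"
 shows "\<exists>h. coch M r (mdeg M) n q h \<and> kin r h S \<and> (\<forall>l. length l = r \<longrightarrow> f (h l) = g l)"
proof -
 have "\<exists>s. s \<in> (if ntrue l = q then mdeg M n else {\<zero>\<^sub>M}) \<and> s \<in> S \<and> f s = g l" if l: "length l = r" for l
 proof (cases "ntrue l = q")
  case True
  obtain s where s: "s \<in> S" "g l = f s" using kinD[OF gS l] by auto
  have sc: "s \<in> carrier M" by (rule dom.hsubD(1)[OF S s(1)])
  have "f s \<in> mdeg N n" using cochD[OF g l] True s by simp
  from homogeneous_preimage[OF sc this] show ?thesis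
   using True s dom.hsub_comp[OF S s(1), of n] dom.md.comp_in[OF sc, of n] by (intro exI[of _ "dom.mcomp n s"]) simp
 next
  case False
  then have "g l = \<zero>\<^sub>N" using cochD[OF g l] by simp
  then show ?thesis using False dom.hsubD(2)[OF S] by (intro exI[of _ "\<zero>\<^sub>M"]) simp
 qed
 then obtain h where h: "\<And>l. length l = r \<Longrightarrow> h l \<in> (if ntrue l = q then mdeg M n else {\<zero>\<^sub>M}) \<and> h l \<in> S \<and> f (h l) = g l" by metis
 have "coch M r (mdeg M) n q h" unfolding coch_def using h by simp
 moreover have "kin r h S" unfolding kin_def using h by simp
 ultimately show ?thesis using h by blast
qed

end

section \<open>Cosyzygies of an injective resolution\<close>

locale resolution = lin_gens R xs for R :: "'a graded_ring" (structure) and xs +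
 fixes E :: "nat \<Rightarrow> ('a, 'c) graded_module" and d :: "nat \<Rightarrow> 'c \<Rightarrow> 'c" and ia :: "'a \<Rightarrow> 'c"
 assumes accR: "acc (shifted_ring R 0) (carrier R) (carrier R)" and inj_ia: "inj ia"
  and inj: "graded_injective R (E i)" and dhom: "d i \<in> graded_hom R (E i) (E (Suc i))"
  and exact: "d i ` carrier (E i) = {x \<in> carrier (E (Suc i)). d (Suc i) x = \<zero>\<^bsub>E (Suc (Suc i))\<^esub>}"
begin

abbreviation "T i \<equiv> torsion_part R (E i)"
definition Z where "Z i = {x \<in> carrier (E i). d i x = \<zero>\<^bsub>E (Suc i)\<^esub>}"
text \<open>Local cohomology of index i + 1 is zero in degree \<open>n\<close>: torsion cocycles are
  images of torsion elements. With this numbering index 0 does not occur.\<close>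

definition vanishing where "vanishing i n \<longleftrightarrow> mdeg (E (Suc i)) n \<inter> T (Suc i) \<inter> Z (Suc i) \<subseteq> d i ` T i"
text \<open>Exactness modulo torsion of the Koszul complex of the cosyzygy \<open>Z i\<close> in
  internal degree \<open>n\<close> and exterior degree \<open>q\<close>. For \<open>i = 0\<close> it
  is a condition on the resolved module, which is isomorphic to \<open>Z 0\<close>.\<close>

definition bounding where "bounding i n q \<longleftrightarrow> (\<forall>f. coch (E i) (length xs) (mdeg (E i)) n q f \<longrightarrow> kin (length xs) f (Z i) \<longrightarrow>
 kin (length xs) (kd (E i) xs f) (T i) \<longrightarrow> (\<exists>g. coch (E i) (length xs) (mdeg (E i)) (n - 1) (q - 1) g \<and> kin (length xs) g (Z i) \<and>
  kin (length xs) (\<lambda>l. f l \<ominus>\<^bsub>E i\<^esub> kd (E i) xs g l) (T i)))"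

lemma ghd: "ghom R (E i) (E (Suc i)) (d i)"
 using inj[of i] inj[of "Suc i"] by (intro ghomI graded dhom) (simp_all add: graded_injective_def)

lemma dZ: "d i ` carrier (E i) = Z (Suc i)" unfolding Z_def by (rule exact)

lemma Z_hsub: "hsub R (E i) (Z i)"
proof -
 interpret d: ghom R "E i" "E (Suc i)" "d i" by (rule ghd)
 show ?thesis using d.preimage_hsub[OF d.cod.zero_hsub] by (simp add: Z_def)
qed

lemma vanishingD: 
 assumes v: "vanishing i n" and g: "coch (E (Suc i)) (length xs) (mdeg (E (Suc i))) n q g" "kin (length xs) g (T (Suc i))" "kin (length xs) g (Z (Suc i))"
 shows "kin (length xs) g (d i ` T i)"
 proof (rule kinI)
 interpret d: ghom R "E i" "E (Suc i)" "d i" by (rule ghd)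
 fix l :: "bool list" assume l: "length l = length xs"
 have "g l \<in> mdeg (E (Suc i)) n" using cochD[OF g(1) l] d.cod.md.piece_zero[of n] by (auto split: if_splits)
 then show "g l \<in> d i ` T i" using v kinD[OF g(2) l] kinD[OF g(3) l] unfolding vanishing_def by blast
qed

text \<open>In the injective module \<open>f\<close> is the coboundary of some \<open>g\<close>
  modulo torsion, and \<open>d g\<close> is a cochain of the next cosyzygy with both degrees lowered
  by one, so that i + n is unchanged. Correcting \<open>g\<close> by a coboundary makes
  \<open>d g\<close> torsion, vanishing makes it the image of a torsion cochain, and subtracting
  that cochain moves \<open>g\<close> into \<open>Z i\<close>. The induction ends because cochains
  of negative exterior degree are zero.\<close>

lemma vanishing_imp_bounding:
 assumes v: "\<And>i n. int (Suc i) + n > t \<Longrightarrow> vanishing i n"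
 shows "q < int k \<Longrightarrow> n + int i > t \<Longrightarrow> bounding i n q"
proof (induction k arbitrary: i n q)
 case 0
 interpret d: ghom R "E i" "E (Suc i)" "d i" by (rule ghd)
 show ?case unfolding bounding_def
 proof (intro allI impI)
  fix f assume f: "coch (E i) (length xs) (mdeg (E i)) n q f" "kin (length xs) f (Z i)" "kin (length xs) (kd (E i) xs f) (T i)"
  have "f l \<ominus>\<^bsub>E i\<^esub> kd (E i) xs (\<lambda>l. \<zero>\<^bsub>E i\<^esub>) l \<in> T i" if l: "length l = length xs" for l
   using d.dom.coch_neg_zero[OF f(1) _ l] 0 d.dom.kd_zero[OF xsc l] d.dom.hsubD(2)[OF d.dom.tors_hsub]
   by (simp add: d.dom.M.minus_eq d.dom.M.a_inv_zero)
  then show "\<exists>g. coch (E i) (length xs) (mdeg (E i)) (n - 1) (q - 1) g \<and> kin (length xs) g (Z i) \<and>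
    kin (length xs) (\<lambda>l. f l \<ominus>\<^bsub>E i\<^esub> kd (E i) xs g l) (T i)"
   using d.dom.coch_zero d.dom.hsubD(2)[OF Z_hsub] by (intro exI[of _ "\<lambda>l. \<zero>\<^bsub>E i\<^esub>"]) (simp add: kin_def)
 qed
next
 case (Suc k)
 interpret d: ghom R "E i" "E (Suc i)" "d i" by (rule ghd)
 let ?r = "length xs" and ?E = "E i" and ?E' = "E (Suc i)"
 note TS = d.dom.hsubD[OF d.dom.tors_hsub] and TS' = d.cod.hsubD[OF d.cod.tors_hsub]
 show ?case unfolding bounding_def
 proof (intro allI impI)
  fix f assume f: "coch ?E ?r (mdeg ?E) n q f" "kin ?r f (Z i)" "kin ?r (kd ?E xs f) (T i)"
  have fc: "kin ?r f (carrier ?E)" by (rule d.dom.coch_kin[OF f(1)])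
  obtain g where g: "coch ?E ?r (mdeg ?E) (n - 1) (q - 1) g" "kin ?r (\<lambda>l. f l \<ominus>\<^sub>?E kd ?E xs g l) (T i)"
   using koszul_exact[OF accR inj inj_ia f(1,3)] by blast
  have gc: "kin ?r g (carrier ?E)" by (rule d.dom.coch_kin[OF g(1)])
  let ?g = "\<lambda>l. d i (g l)"
  have dg: "coch ?E' ?r (mdeg ?E') (n - 1) (q - 1) ?g" by (rule d.coch_image[OF g(1)])
  have dgZ: "kin ?r ?g (Z (Suc i))" unfolding kin_def dZ[symmetric] using gc by (simp add: kin_def)
  have dgT: "kin ?r (kd ?E' xs ?g) (T (Suc i))"
   proof (rule kinI)
   fix l :: "bool list" assume l: "length l = ?r"
   have c: "f l \<in> carrier ?E" "kd ?E xs g l \<in> carrier ?E" using kinD[OF fc l] d.dom.kd_carrierD[OF xsc gc l] .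
   have fz: "d i (f l) = \<zero>\<^sub>?E'" using kinD[OF f(2) l] by (simp add: Z_def)
   have "\<ominus>\<^sub>?E' d i (f l \<ominus>\<^sub>?E kd ?E xs g l) = kd ?E' xs ?g l"
    using d.minus[OF c] d.kd_hom[OF xsc gc l] c fz by (simp add: d.cod.M.minus_eq)
   then show "kd ?E' xs ?g l \<in> T (Suc i)" using TS'(4)[OF d.tors_image[OF kinD[OF g(2) l]]] by simp
  qed
  have "bounding (Suc i) (n - 1) (q - 1)" by (rule Suc.IH) (use Suc.prems in simp_all)
  from this[unfolded bounding_def, rule_format, OF dg dgZ dgT] obtain h where
   h: "coch ?E' ?r (mdeg ?E') (n - 1 - 1) (q - 1 - 1) h" "kin ?r h (Z (Suc i))" "kin ?r (\<lambda>l. ?g l \<ominus>\<^sub>?E' kd ?E' xs h l) (T (Suc i))" by blast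
  obtain h' where h': "coch ?E ?r (mdeg ?E) (n - 1 - 1) (q - 1 - 1) h'" "\<And>l. length l = ?r \<Longrightarrow> d i (h' l) = h l"
   using d.coch_lift[OF d.dom.carrier_hsub h(1)] h(2) unfolding dZ by blast
  have hc: "kin ?r h' (carrier ?E)" by (rule d.dom.coch_kin[OF h'(1)])
  have dhc: "kin ?r (kd ?E xs h') (carrier ?E)" by (rule d.dom.kd_carrier[OF xsc hc])
  define G where "G l = g l \<ominus>\<^sub>?E kd ?E xs h' l" for l
  have G: "coch ?E ?r (mdeg ?E) (n - 1) (q - 1) G"
   unfolding G_def using d.dom.coch_minus[OF g(1)] d.dom.kd_coch[OF xs1 h'(1)] by simp
  have Gc: "kin ?r G (carrier ?E)" by (rule d.dom.coch_kin[OF G])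
  have dG: "d i (G l) = ?g l \<ominus>\<^sub>?E' kd ?E' xs h l" if l: "length l = ?r" for l
  proof -
   have "kd ?E' xs h l = d i (kd ?E xs h' l)"
    using d.kd_hom[OF xsc hc l] kd_cong[of xs "\<lambda>k. d i (h' k)" h l ?E'] h'(2) l by simp
   then show ?thesis unfolding G_def using d.minus[OF kinD[OF gc l] kinD[OF dhc l]] by simp
  qed
  \<comment> \<open>The corrected \<open>d G\<close> has index i + 1 and internal degree n - 1, so
    their sum is again i + n, which exceeds \<open>t\<close>.\<close>
  have "kin ?r (\<lambda>l. d i (G l)) (d i ` T i)"
  proof (rule vanishingD[OF v d.coch_image[OF G]])
   show "int (Suc i) + (n - 1) > t" using Suc.prems by simp
   show "kin ?r (\<lambda>l. d i (G l)) (T (Suc i))" using h(3) dG by (simp add: kin_def)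
   show "kin ?r (\<lambda>l. d i (G l)) (Z (Suc i))" unfolding kin_def dZ[symmetric] using Gc by (simp add: kin_def)
  qed
  from d.coch_lift[OF d.dom.tors_hsub d.coch_image[OF G] this] obtain s where
   s: "coch ?E ?r (mdeg ?E) (n - 1) (q - 1) s" "kin ?r s (T i)" "\<And>l. length l = ?r \<Longrightarrow> d i (s l) = d i (G l)" by blast
  have sc: "kin ?r s (carrier ?E)" by (rule d.dom.coch_kin[OF s(1)])
  have dsT: "kin ?r (kd ?E xs s) (T i)"
   by (rule d.dom.kd_closed[OF xsc d.dom.asub_mono_ops[OF xsc d.dom.tors_asub] s(2)])
  let ?h = "\<lambda>l. G l \<ominus>\<^sub>?E s l"
  have hZ: "kin ?r ?h (Z i)"
   proof (rule kinI)
   fix l :: "bool list" assume l: "length l = ?r"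
   show "G l \<ominus>\<^sub>?E s l \<in> Z i"
    using kinD[OF Gc l] kinD[OF sc l] s(3)[OF l] by (simp add: Z_def d.minus d.cod.M.minus_eq d.cod.M.r_neg)
  qed
  have "kin ?r (\<lambda>l. f l \<ominus>\<^sub>?E kd ?E xs ?h l) (T i)"
   proof (rule kinI)
   fix l :: "bool list" assume l: "length l = ?r"
   have c: "f l \<in> carrier ?E" "kd ?E xs g l \<in> carrier ?E" "kd ?E xs s l \<in> carrier ?E"
    using kinD[OF fc l] d.dom.kd_carrierD[OF xsc gc l] d.dom.kd_carrierD[OF xsc sc l] .
   have "kd ?E xs G l = kd ?E xs g l"
    unfolding G_def using d.dom.kd_minus[OF xsc gc dhc l] d.dom.kd_kd[OF xsc hc l] c by (simp add: d.dom.M.minus_eq d.dom.M.a_inv_zero)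
   then have "f l \<ominus>\<^sub>?E kd ?E xs ?h l = (f l \<ominus>\<^sub>?E kd ?E xs g l) \<oplus>\<^sub>?E kd ?E xs s l"
    using d.dom.kd_minus[OF xsc Gc sc l] c by (simp add: d.dom.M.minus_eq d.dom.M.minus_add d.dom.M.a_assoc)
   then show "f l \<ominus>\<^sub>?E kd ?E xs ?h l \<in> T i" using TS(3)[OF kinD[OF g(2) l] kinD[OF dsT l]] by simp
  qed
  then show "\<exists>g. coch ?E ?r (mdeg ?E) (n - 1) (q - 1) g \<and> kin ?r g (Z i) \<and> kin ?r (\<lambda>l. f l \<ominus>\<^sub>?E kd ?E xs g l) (T i)"
   using d.dom.coch_minus[OF G s(1)] hZ by blast
 qed
qed

text \<open>Up to torsion the Koszul differential of \<open>f\<close> has values in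
  \<open>Z i\<close>, hence it agrees with that of some \<open>g\<close> over \<open>Z i\<close>.
  Then f - g is a Koszul cocycle modulo torsion in an injective module and therefore a coboundary
  modulo torsion.\<close>

lemma bounding_step:
 assumes b: "bounding i (n + 1) (q + 1)" and f: "coch (E i) (length xs) (mdeg (E i)) n q f"
  and df: "kin (length xs) (\<lambda>l. d i (kd (E i) xs f l)) (d i ` T i)"
 shows "\<exists>g u. coch (E i) (length xs) (mdeg (E i)) n q g \<and> kin (length xs) g (Z i) \<and>
  coch (E i) (length xs) (mdeg (E i)) (n - 1) (q - 1) u \<and>
  kin (length xs) (\<lambda>l. (f l \<ominus>\<^bsub>E i\<^esub> g l) \<ominus>\<^bsub>E i\<^esub> kd (E i) xs u l) (T i)"
proof -
 interpret d: ghom R "E i" "E (Suc i)" "d i" by (rule ghd)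
 let ?r = "length xs" and ?E = "E i" and ?E' = "E (Suc i)"
 note TS = d.dom.hsubD[OF d.dom.tors_hsub]
 have fc: "kin ?r f (carrier ?E)" by (rule d.dom.coch_kin[OF f])
 have dfco: "coch ?E ?r (mdeg ?E) (n + 1) (q + 1) (kd ?E xs f)" by (rule d.dom.kd_coch[OF xs1 f])
 have dfc: "kin ?r (kd ?E xs f) (carrier ?E)" by (rule d.dom.coch_kin[OF dfco])
 from d.coch_lift[OF d.dom.tors_hsub d.coch_image[OF dfco] df] obtain s where
  s: "coch ?E ?r (mdeg ?E) (n + 1) (q + 1) s" "kin ?r s (T i)" "\<And>l. length l = ?r \<Longrightarrow> d i (s l) = d i (kd ?E xs f l)" by blast
 have sc: "kin ?r s (carrier ?E)" by (rule d.dom.coch_kin[OF s(1)])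
 have dsT: "kin ?r (kd ?E xs s) (T i)"
  by (rule d.dom.kd_closed[OF xsc d.dom.asub_mono_ops[OF xsc d.dom.tors_asub] s(2)])
 define F where "F l = kd ?E xs f l \<ominus>\<^sub>?E s l" for l
 have F: "coch ?E ?r (mdeg ?E) (n + 1) (q + 1) F" unfolding F_def by (rule d.dom.coch_minus[OF dfco s(1)])
 have FZ: "kin ?r F (Z i)"
  proof (rule kinI)
  fix l :: "bool list" assume l: "length l = ?r"
  show "F l \<in> Z i"
   using kinD[OF dfc l] kinD[OF sc l] s(3)[OF l] by (simp add: F_def Z_def d.minus d.cod.M.minus_eq d.cod.M.r_neg)
 qed
 have dFT: "kin ?r (kd ?E xs F) (T i)"
  proof (rule kinI)
  fix l :: "bool list" assume l: "length l = ?r"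
  have "kd ?E xs F l = \<ominus>\<^sub>?E kd ?E xs s l"
   unfolding F_def using d.dom.kd_minus[OF xsc dfc sc l] d.dom.kd_kd[OF xsc fc l] d.dom.kd_carrierD[OF xsc sc l] by (simp add: d.dom.M.minus_eq)
  then show "kd ?E xs F l \<in> T i" using TS(4)[OF kinD[OF dsT l]] by simp
 qed
 from b[unfolded bounding_def, rule_format, OF F FZ dFT] obtain g where
  g: "coch ?E ?r (mdeg ?E) n q g" "kin ?r g (Z i)" "kin ?r (\<lambda>l. F l \<ominus>\<^sub>?E kd ?E xs g l) (T i)" by auto
 have gc: "kin ?r g (carrier ?E)" by (rule d.dom.coch_kin[OF g(1)])
 have fg: "coch ?E ?r (mdeg ?E) n q (\<lambda>l. f l \<ominus>\<^sub>?E g l)" by (rule d.dom.coch_minus[OF f g(1)])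
 have "kin ?r (kd ?E xs (\<lambda>l. f l \<ominus>\<^sub>?E g l)) (T i)"
  proof (rule kinI)
  fix l :: "bool list" assume l: "length l = ?r"
  have c: "kd ?E xs f l \<in> carrier ?E" "kd ?E xs g l \<in> carrier ?E" "s l \<in> carrier ?E"
   using kinD[OF dfc l] d.dom.kd_carrierD[OF xsc gc l] kinD[OF sc l] .
  have "kd ?E xs f l \<ominus>\<^sub>?E kd ?E xs g l = (F l \<ominus>\<^sub>?E kd ?E xs g l) \<oplus>\<^sub>?E s l"
   unfolding F_def using c by (simp add: d.dom.M.minus_eq d.dom.M.a_ac d.dom.M.r_neg2)
  then show "kd ?E xs (\<lambda>l. f l \<ominus>\<^sub>?E g l) l \<in> T i"
   using d.dom.kd_minus[OF xsc fc gc l] TS(3)[OF kinD[OF g(3) l] kinD[OF s(2) l]] by simp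
 qed
 from koszul_exact[OF accR inj inj_ia fg this] show ?thesis using g by blast
qed

text \<open>\<open>e\<close> is regarded as a cochain of exterior degree 0, whose differential
  consists of the products with the variables. Since there are no coboundaries in exterior degree 0,
  a preimage of \<open>e\<close> differs from an element of \<open>Z i\<close> by torsion.\<close>

lemma bounding_imp_vanishing:
 assumes b: "bounding i (n + 1) 1"
  and e: "e \<in> mdeg (E (Suc i)) n" "e \<in> Z (Suc i)" "\<And>x. x \<in> set xs \<Longrightarrow> x \<odot>\<^bsub>E (Suc i)\<^esub> e \<in> d i ` T i"
 shows "e \<in> d i ` T i"
proof -
 interpret d: ghom R "E i" "E (Suc i)" "d i" by (rule ghd)
 let ?r = "length xs" and ?E = "E i" and ?E' = "E (Suc i)"
 have S: "asub ?E' (carrier R) (d i ` T i)" by (rule d.image_asub[OF d.dom.tors_asub])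
 let ?F = "\<lambda>l. if ntrue l = 0 then e else \<zero>\<^sub>?E'"
 have F: "coch ?E' ?r (mdeg ?E') n 0 ?F" using e(1) by (simp add: coch_def)
 have FZ: "kin ?r ?F (d i ` carrier ?E)" unfolding dZ kin_def using e(2) d.cod.hsubD(2)[OF Z_hsub] by simp
 from d.coch_lift[OF d.dom.carrier_hsub F FZ] obtain f where
  f: "coch ?E ?r (mdeg ?E) n 0 f" "\<And>l. length l = ?r \<Longrightarrow> d i (f l) = ?F l" by blast
 have fc: "kin ?r f (carrier ?E)" by (rule d.dom.coch_kin[OF f(1)])
 have dF: "kin ?r (kd ?E' xs ?F) (d i ` T i)"
 proof (rule d.cod.kd_mult_closed[OF xsc d.cod.asub_mono_ops[OF _ S]])
  show "x \<odot>\<^sub>?E' ?F l \<in> d i ` T i" if "x \<in> set xs" for x l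
   using e(3)[OF that] d.cod.smult_r_null[OF subsetD[OF xsc that]] d.cod.asubD(2)[OF S] by (cases "ntrue l = 0") simp_all
 qed simp
 have "d i (kd ?E xs f l) = kd ?E' xs ?F l" if l: "length l = ?r" for l
  using d.kd_hom[OF xsc fc l] kd_cong[of xs "\<lambda>k. d i (f k)" ?F l ?E'] f(2) l by simp
 then have "kin ?r (\<lambda>l. d i (kd ?E xs f l)) (d i ` T i)" using dF by (simp add: kin_def)
 from bounding_step[OF _ f(1) this] b obtain g u where
  g: "coch ?E ?r (mdeg ?E) n 0 g" "kin ?r g (Z i)" "coch ?E ?r (mdeg ?E) (n - 1) (- 1) u"
  "kin ?r (\<lambda>l. (f l \<ominus>\<^sub>?E g l) \<ominus>\<^sub>?E kd ?E xs u l) (T i)" by auto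
 have gc: "kin ?r g (carrier ?E)" by (rule d.dom.coch_kin[OF g(1)])
 \<comment> \<open>The empty subset, the only index of exterior degree 0.\<close>
 let ?l = "replicate ?r False"
 have n0: "ntrue (replicate k False) = 0" for k by (induction k) auto
 have l: "length ?l = ?r" by simp
 have "kd ?E xs u ?l = kd ?E xs (\<lambda>l. \<zero>\<^sub>?E) ?l"
  by (rule kd_cong) (simp_all add: d.dom.coch_neg_zero[OF g(3)])
 then have "kd ?E xs u ?l = \<zero>\<^sub>?E" using d.dom.kd_zero[OF xsc l] by simp
 then have 1: "f ?l \<ominus>\<^sub>?E g ?l \<in> T i" using kinD[OF g(4) l] kinD[OF fc l] kinD[OF gc l] by (simp add: d.dom.M.minus_eq d.dom.M.a_inv_zero)
 have "d i (f ?l \<ominus>\<^sub>?E g ?l) = e"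
  using d.minus[OF kinD[OF fc l] kinD[OF gc l]] f(2)[OF l] kinD[OF g(2) l] d.cod.md.piece_carrier[OF e(1)]
  by (simp add: n0 Z_def d.cod.M.minus_eq d.cod.M.a_inv_zero)
 with 1 show ?thesis by blast
qed

text \<open>Induction on the degree from which on all scalars kill \<open>e\<close>: for the
  products with the variables this bound is smaller by one, and their degree is one higher, which
  stays in the admissible range.\<close>

lemma bounding_vanishing:
 assumes b: "\<And>n q. n + int i > t \<Longrightarrow> bounding i n q"
 shows "int (Suc i) + n > t \<Longrightarrow> vanishing i n"
proof -
 interpret d: ghom R "E i" "E (Suc i)" "d i" by (rule ghd)
 let ?E' = "E (Suc i)"
 have "e \<in> d i ` T i" if "int (Suc i) + n > t" "e \<in> mdeg ?E' n" "e \<in> Z (Suc i)" "\<forall>k\<ge>N. \<forall>a\<in>rdeg R k. a \<odot>\<^sub>?E' e = \<zero>\<^sub>?E'" for N n e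
  using that
 proof (induction N arbitrary: e n)
  case 0
  have "\<one> \<odot>\<^sub>?E' e = \<zero>\<^sub>?E'" using 0(4) one_deg by blast
  then have "e = d i \<zero>\<^bsub>E i\<^esub>" using d.cod.md.piece_carrier[OF 0(2)] by simp
  then show ?case using d.dom.hsubD(2)[OF d.dom.tors_hsub] by blast
 next
  case (Suc N)
  have ec: "e \<in> carrier ?E'" by (rule d.cod.md.piece_carrier[OF Suc.prems(2)])
  show ?case
  proof (rule bounding_imp_vanishing[OF b Suc.prems(2,3)])
   show "n + 1 + int i > t" using Suc.prems(1) by simp
   fix x assume x: "x \<in> set xs"
   then have x1: "x \<in> rdeg R 1" "x \<in> carrier R" using xs1 xsc by auto
   show "x \<odot>\<^sub>?E' e \<in> d i ` T i"
   proof (rule Suc.IH[of "n + 1"])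
    show "int (Suc i) + (n + 1) > t" using Suc.prems(1) by simp
    show "x \<odot>\<^sub>?E' e \<in> mdeg ?E' (n + 1)" using d.cod.smult_deg[OF x1(1) Suc.prems(2)] by (simp add: add.commute)
    show "x \<odot>\<^sub>?E' e \<in> Z (Suc i)" using d.cod.hsubD(6)[OF Z_hsub x1(2) Suc.prems(3)] .
    show "\<forall>k\<ge>N. \<forall>a\<in>rdeg R k. a \<odot>\<^sub>?E' (x \<odot>\<^sub>?E' e) = \<zero>\<^sub>?E'"
    proof (intro allI impI ballI)
     fix k a assume k: "N \<le> k" and a: "a \<in> rdeg R k"
     have "a \<otimes> x \<in> rdeg R (k + 1)" by (rule mult_deg[OF a x1(1)])
     moreover have "Suc N \<le> k + 1" using k by simp
     ultimately have "(a \<otimes> x) \<odot>\<^sub>?E' e = \<zero>\<^sub>?E'" using Suc.prems(4) by blast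
     then show "a \<odot>\<^sub>?E' (x \<odot>\<^sub>?E' e) = \<zero>\<^sub>?E'" using rd.piece_carrier[OF a] x1(2) ec by (simp add: d.cod.smult_assoc1)
    qed
   qed
  qed
 qed
 then show "int (Suc i) + n > t \<Longrightarrow> vanishing i n"
  unfolding vanishing_def torsion_part_def by blast
qed

text \<open>The Koszul differential of \<open>f\<close> consists of torsion cocycles, which by
  vanishing are images of torsion. So \<open>bounding_step\<close> splits a lift of \<open>f\<close>
  to \<open>E i\<close>, and applying \<open>d i\<close> removes the part in
  \<open>Z i\<close>.\<close>

lemma bounding_Suc:
 assumes b: "\<And>n q. n + int i > t \<Longrightarrow> bounding i n q" and n: "n + int (Suc i) > t"
 shows "bounding (Suc i) n q"
 unfolding bounding_def
proof (intro allI impI)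
 interpret d: ghom R "E i" "E (Suc i)" "d i" by (rule ghd)
 let ?r = "length xs" and ?E = "E i" and ?E' = "E (Suc i)"
 fix f assume f: "coch ?E' ?r (mdeg ?E') n q f" "kin ?r f (Z (Suc i))" "kin ?r (kd ?E' xs f) (T (Suc i))"
 from d.coch_lift[OF d.dom.carrier_hsub f(1) f(2)[folded dZ]] obtain f' where
  f': "coch ?E ?r (mdeg ?E) n q f'" "\<And>l. length l = ?r \<Longrightarrow> d i (f' l) = f l" by blast
 have fc: "kin ?r f' (carrier ?E)" by (rule d.dom.coch_kin[OF f'(1)])
 have eq: "d i (kd ?E xs f' l) = kd ?E' xs f l" if l: "length l = ?r" for l
  using d.kd_hom[OF xsc fc l] kd_cong[of xs "\<lambda>k. d i (f' k)" f l ?E'] f'(2) l by simp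
 have "kin ?r (kd ?E' xs f) (d i ` T i)"
 proof (rule vanishingD[OF bounding_vanishing[OF b]])
  show "coch ?E' ?r (mdeg ?E') (n + 1) (q + 1) (kd ?E' xs f)" by (rule d.cod.kd_coch[OF xs1 f(1)])
  show "kin ?r (kd ?E' xs f) (Z (Suc i))"
   by (rule d.cod.kd_closed[OF xsc d.cod.asub_mono_ops[OF xsc d.cod.hsub_asub[OF Z_hsub]] f(2)])
 qed (use n f(3) in auto)
 then have "kin ?r (\<lambda>l. d i (kd ?E xs f' l)) (d i ` T i)" using eq by (simp add: kin_def)
 from bounding_step[OF b f'(1) this] n obtain g u where
  g: "coch ?E ?r (mdeg ?E) n q g" "kin ?r g (Z i)" "coch ?E ?r (mdeg ?E) (n - 1) (q - 1) u"
  "kin ?r (\<lambda>l. (f' l \<ominus>\<^sub>?E g l) \<ominus>\<^sub>?E kd ?E xs u l) (T i)" by auto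
 have gc: "kin ?r g (carrier ?E)" by (rule d.dom.coch_kin[OF g(1)])
 have uc: "kin ?r u (carrier ?E)" by (rule d.dom.coch_kin[OF g(3)])
 let ?u = "\<lambda>l. d i (u l)"
 have "kin ?r (\<lambda>l. f l \<ominus>\<^sub>?E' kd ?E' xs ?u l) (T (Suc i))"
  proof (rule kinI)
  fix l :: "bool list" assume l: "length l = ?r"
  have c: "f' l \<in> carrier ?E" "g l \<in> carrier ?E" "kd ?E xs u l \<in> carrier ?E"
   using kinD[OF fc l] kinD[OF gc l] d.dom.kd_carrierD[OF xsc uc l] .
  have "d i (g l) = \<zero>\<^sub>?E'" using kinD[OF g(2) l] by (simp add: Z_def)
  then have "d i ((f' l \<ominus>\<^sub>?E g l) \<ominus>\<^sub>?E kd ?E xs u l) = f l \<ominus>\<^sub>?E' kd ?E' xs ?u l"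
   using c f'(2)[OF l, symmetric] d.kd_hom[OF xsc uc l] by (simp add: d.minus d.cod.M.minus_eq d.cod.M.a_inv_zero)
  then show "f l \<ominus>\<^sub>?E' kd ?E' xs ?u l \<in> T (Suc i)" using d.tors_image[OF kinD[OF g(4) l]] by simp
 qed
 moreover have "kin ?r ?u (Z (Suc i))" unfolding kin_def dZ[symmetric] using uc by (simp add: kin_def)
 ultimately show "\<exists>g. coch ?E' ?r (mdeg ?E') (n - 1) (q - 1) g \<and> kin ?r g (Z (Suc i)) \<and>
   kin ?r (\<lambda>l. f l \<ominus>\<^sub>?E' kd ?E' xs g l) (T (Suc i))" using d.coch_image[OF g(3)] by blast
qed

text \<open>The sum of resolution index and internal degree controls both sides: every passage to
  the next cosyzygy raises the one and lowers the bound on the other.\<close>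

theorem vanishing_iff:
 "(\<forall>i n. int (Suc i) + n > t \<longrightarrow> vanishing i n) \<longleftrightarrow> (\<forall>n q. n > t \<longrightarrow> bounding 0 n q)"
proof
 assume v: "\<forall>i n. int (Suc i) + n > t \<longrightarrow> vanishing i n"
 show "\<forall>n q. n > t \<longrightarrow> bounding 0 n q"
 proof (intro allI impI)
  fix n q assume n: "n > t"
  show "bounding 0 n q"
   by (rule vanishing_imp_bounding[of t q "nat (q + 1)"]) (use v n in simp_all)
 qed
next
 assume b: "\<forall>n q. n > t \<longrightarrow> bounding 0 n q"
 have "n + int i > t \<Longrightarrow> bounding i n q" for i n q
 proof (induction i arbitrary: n q)
  case (Suc i) show ?case by (rule bounding_Suc[OF Suc.IH Suc.prems])
 qed (use b in simp)
 then show "\<forall>i n. int (Suc i) + n > t \<longrightarrow> vanishing i n" using bounding_vanishing by blast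
qed

end

section \<open>The Koszul criterion for geometric regularity\<close>

definition koszul_regular :: "'a graded_ring \<Rightarrow> ('a, 'b) graded_module \<Rightarrow> 'a list \<Rightarrow> 'b set \<Rightarrow> int \<Rightarrow> bool" where
 "koszul_regular R M xs S t \<longleftrightarrow> (\<forall>n q f. n > t \<longrightarrow> coch M (length xs) (mdeg M) n q f \<longrightarrow> kin (length xs) (kd M xs f) S \<longrightarrow>
   (\<exists>g. coch M (length xs) (mdeg M) (n - 1) (q - 1) g \<and> kin (length xs) (\<lambda>l. f l \<ominus>\<^sub>M kd M xs g l) S))"

text \<open>The map \<theta> identifies M/H with \<open>Z 0\<close> and matches the torsion of the
  target with the saturation of \<open>H\<close>. Cochains are lifted to M, so that the conditions
  for different \<open>H\<close> can be compared inside one module.\<close>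

lemma (in resolution) koszul_regular_iff:
 fixes M :: "('a, 'b) graded_module"
 assumes M: "is_graded_module R M" and H: "\<theta> \<in> graded_hom R M (E 0)" "\<theta> ` carrier M = Z 0"
  "\<And>x. x \<in> carrier M \<Longrightarrow> \<theta> x = \<zero>\<^bsub>E 0\<^esub> \<longleftrightarrow> x \<in> H"
 shows "koszul_regular R M xs (graded_module_loc.sat R M H) t \<longleftrightarrow> (\<forall>n q. n > t \<longrightarrow> bounding 0 n q)"
proof -
 interpret h: ghom R M "E 0" \<theta>
  using inj[of 0] by (intro ghomI graded M H(1)) (simp add: graded_injective_def)
 let ?r = "length xs" and ?E = "E 0"
 have sat: "\<theta> x \<in> T 0 \<longleftrightarrow> x \<in> h.dom.sat H" if x: "x \<in> carrier M" for x
 proof -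
  have "a \<odot>\<^sub>?E \<theta> x = \<zero>\<^sub>?E \<longleftrightarrow> a \<odot>\<^sub>M x \<in> H" if "a \<in> rdeg R k" for a k
   using h.smult[of a x] H(3)[of "a \<odot>\<^sub>M x"] rd.piece_carrier[OF that] x by simp
  then show ?thesis using x unfolding h.cod.torsion_part_sat h.dom.sat_def h.cod.sat_def by simp
 qed
 have dif: "\<theta> (f l \<ominus>\<^sub>M kd M xs g l) = \<theta> (f l) \<ominus>\<^sub>?E kd ?E xs (\<lambda>l. \<theta> (g l)) l \<and> f l \<ominus>\<^sub>M kd M xs g l \<in> carrier M"
  if "kin ?r f (carrier M)" "kin ?r g (carrier M)" "length l = ?r" for f g l
  using h.minus[OF kinD[OF that(1,3)] h.dom.kd_carrierD[OF xsc that(2,3)]] h.kd_hom[OF xsc that(2,3)] kinD[OF that(1,3)] h.dom.kd_carrierD[OF xsc that(2,3)] by simp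
 show ?thesis
 proof (intro iffI allI impI)
  fix n q assume k: "koszul_regular R M xs (h.dom.sat H) t" and n: "n > t"
  show "bounding 0 n q" unfolding bounding_def
  proof (intro allI impI)
   fix f assume f: "coch ?E ?r (mdeg ?E) n q f" "kin ?r f (Z 0)" "kin ?r (kd ?E xs f) (T 0)"
   from h.coch_lift[OF h.dom.carrier_hsub f(1) f(2)[folded H(2)]] obtain f' where
    f': "coch M ?r (mdeg M) n q f'" "\<And>l. length l = ?r \<Longrightarrow> \<theta> (f' l) = f l" by blast
   have fc: "kin ?r f' (carrier M)" by (rule h.dom.coch_kin[OF f'(1)])
   have eq: "\<theta> (kd M xs f' l) = kd ?E xs f l" if l: "length l = ?r" for l
    using h.kd_hom[OF xsc fc l] kd_cong[of xs "\<lambda>k. \<theta> (f' k)" f l ?E] f'(2) l by simp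
   have "kin ?r (kd M xs f') (h.dom.sat H)"
    proof (rule kinI)
    fix l :: "bool list" assume l: "length l = ?r"
    show "kd M xs f' l \<in> h.dom.sat H" using kinD[OF f(3) l] eq[OF l] sat[OF h.dom.kd_carrierD[OF xsc fc l]] by simp
   qed
   from k[unfolded koszul_regular_def, rule_format, OF n f'(1) this] obtain g where
    g: "coch M ?r (mdeg M) (n - 1) (q - 1) g" "kin ?r (\<lambda>l. f' l \<ominus>\<^sub>M kd M xs g l) (h.dom.sat H)" by blast
   have gc: "kin ?r g (carrier M)" by (rule h.dom.coch_kin[OF g(1)])
   have "kin ?r (\<lambda>l. f l \<ominus>\<^sub>?E kd ?E xs (\<lambda>l. \<theta> (g l)) l) (T 0)"
    proof (rule kinI)
    fix l :: "bool list" assume l: "length l = ?r"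
    show "f l \<ominus>\<^sub>?E kd ?E xs (\<lambda>l. \<theta> (g l)) l \<in> T 0"
     using kinD[OF g(2) l] dif[OF fc gc l] sat[of "f' l \<ominus>\<^sub>M kd M xs g l"] f'(2)[OF l] by simp
   qed
   moreover have "kin ?r (\<lambda>l. \<theta> (g l)) (Z 0)" unfolding kin_def H(2)[symmetric] using gc by (simp add: kin_def)
   ultimately show "\<exists>g. coch ?E ?r (mdeg ?E) (n - 1) (q - 1) g \<and> kin ?r g (Z 0) \<and>
     kin ?r (\<lambda>l. f l \<ominus>\<^sub>?E kd ?E xs g l) (T 0)" using h.coch_image[OF g(1)] by blast
  qed
 next
  assume b: "\<forall>n q. n > t \<longrightarrow> bounding 0 n q"
  show "koszul_regular R M xs (h.dom.sat H) t" unfolding koszul_regular_def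
  proof (intro allI impI)
   fix n q f assume n: "n > t" and f: "coch M ?r (mdeg M) n q f" "kin ?r (kd M xs f) (h.dom.sat H)"
   have fc: "kin ?r f (carrier M)" by (rule h.dom.coch_kin[OF f(1)])
   have fZ: "kin ?r (\<lambda>l. \<theta> (f l)) (Z 0)" unfolding kin_def H(2)[symmetric] using fc by (simp add: kin_def)
   have fT: "kin ?r (kd ?E xs (\<lambda>l. \<theta> (f l))) (T 0)"
    unfolding kin_def using f(2) sat h.dom.kd_carrierD[OF xsc fc] h.kd_hom[OF xsc fc] by (simp add: kin_def)
   have "bounding 0 n q" using b n by blast
   from this[unfolded bounding_def, rule_format, OF h.coch_image[OF f(1)] fZ fT] obtain g where
    g: "coch ?E ?r (mdeg ?E) (n - 1) (q - 1) g" "kin ?r g (Z 0)" "kin ?r (\<lambda>l. \<theta> (f l) \<ominus>\<^sub>?E kd ?E xs g l) (T 0)" by blast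
   from h.coch_lift[OF h.dom.carrier_hsub g(1) g(2)[folded H(2)]] obtain g' where
    g': "coch M ?r (mdeg M) (n - 1) (q - 1) g'" "\<And>l. length l = ?r \<Longrightarrow> \<theta> (g' l) = g l" by blast
   have gc: "kin ?r g' (carrier M)" by (rule h.dom.coch_kin[OF g'(1)])
   have "kin ?r (\<lambda>l. f l \<ominus>\<^sub>M kd M xs g' l) (h.dom.sat H)"
    proof (rule kinI)
    fix l :: "bool list" assume l: "length l = ?r"
    have "kd ?E xs (\<lambda>l. \<theta> (g' l)) l = kd ?E xs g l" by (rule kd_cong) (use g'(2) l in auto)
    then show "f l \<ominus>\<^sub>M kd M xs g' l \<in> h.dom.sat H" using dif[OF fc gc l] sat[of "f l \<ominus>\<^sub>M kd M xs g' l"] kinD[OF g(3) l] by simp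
   qed
   then show "\<exists>g. coch M ?r (mdeg M) (n - 1) (q - 1) g \<and> kin ?r (\<lambda>l. f l \<ominus>\<^sub>M kd M xs g l) (h.dom.sat H)" using g'(1) by blast
  qed
 qed
qed

lemma a_kernel_eq: "a_kernel A B h = {x \<in> carrier A. h x = \<zero>\<^sub>B}"
 by (simp add: a_kernel_def kernel_def)

text \<open>The cosets in \<open>local_cohomology\<close> are formed in a restricted record
  \<open>G\<close>, of which only the addition enters a coset.\<close>

lemma (in module) coset_eq_iff:
 assumes B: "asub M (carrier R) B" and x: "x \<in> carrier M" and G: "add G = add M" "carrier G \<subseteq> carrier M"
 shows "B +>\<^bsub>G\<^esub> x = B \<longleftrightarrow> x \<in> B"
proof -
 have eq: "B +>\<^bsub>G\<^esub> x = {b \<oplus>\<^sub>M x | b. b \<in> B}" unfolding a_r_coset_def r_coset_def by (auto simp: G)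
 note B = asubD[OF B]
 show ?thesis
 proof
  assume "B +>\<^bsub>G\<^esub> x = B"
  moreover have "\<zero>\<^sub>M \<oplus>\<^sub>M x \<in> B +>\<^bsub>G\<^esub> x" unfolding eq using B(2) by blast
  ultimately show "x \<in> B" using x by simp
 next
  assume xB: "x \<in> B"
  have "b = (b \<ominus>\<^sub>M x) \<oplus>\<^sub>M x" if "b \<in> B" for b
   using B(1)[OF that] x by (simp add: M.minus_eq M.a_assoc M.l_neg)
  then have "B \<subseteq> B +>\<^bsub>G\<^esub> x" unfolding eq using B(5)[OF _ xB] by blast
  moreover have "B +>\<^bsub>G\<^esub> x \<subseteq> B" unfolding eq using B(3)[OF _ xB] by blast
  ultimately show "B +>\<^bsub>G\<^esub> x = B" by blast
 qed
qed

text \<open>The form with a surjection and its kernel \<open>H\<close> serves both for M/zM, with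
  the class map, and for M, with the identity and \<open>H\<close> zero. The ranges agree: index
  \<open>i\<close> and degree \<open>n - i + 1\<close> have sum n + 1, and n + 1 > t means n \<ge>
  t.\<close>

theorem (in lin_gens) geometrically_regular_iff:
 fixes M :: "('a, 'b) graded_module" and N :: "('a, 'n) graded_module"
 assumes acc: "acc (shifted_ring R 0) (carrier R) (carrier R)" and M: "is_graded_module R M" and N: "is_graded_module R N"
  and \<pi>: "\<pi> \<in> graded_hom R M N" "\<pi> ` carrier M = carrier N" "\<And>x. x \<in> carrier M \<Longrightarrow> \<pi> x = \<zero>\<^sub>N \<longleftrightarrow> x \<in> H"
 shows "geometrically_regular R N t \<longleftrightarrow> koszul_regular R M xs (graded_module_loc.sat R M H) t"
proof -
 define E where "E = fst (chosen_resolution R N)"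
 define d where "d = snd (chosen_resolution R N)"
 have ch: "chosen_resolution R N = (E, d)" by (simp add: E_def d_def)
 have res: "graded_injective_resolution R N E d" using resolution_exists[OF graded acc N] by (simp add: E_def d_def)
 let ?ia = "\<lambda>a. [Inl a] :: ('a, 'n) univ"
 interpret resolution R xs E d ?ia
 proof unfold_locales
  show "acc (shifted_ring R 0) (carrier R) (carrier R)" by (rule acc)
  show "inj ?ia" by (simp add: inj_def)
  show "graded_injective R (E i)" "d i \<in> graded_hom R (E i) (E (Suc i))"
   "d i ` carrier (E i) = {x \<in> carrier (E (Suc i)). d (Suc i) x = \<zero>\<^bsub>E (Suc (Suc i))\<^esub>}" for i
   using res unfolding graded_injective_resolution_def by (simp_all add: a_kernel_eq)
 qed
 obtain \<epsilon> where e: "\<epsilon> \<in> graded_hom R N (E 0)" "inj_on \<epsilon> (carrier N)" "\<epsilon> ` carrier N = Z 0"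
  using res unfolding graded_injective_resolution_def by (auto simp: a_kernel_eq Z_def)
 interpret e: ghom R N "E 0" \<epsilon> using inj[of 0] by (intro ghomI graded N e(1)) (simp add: graded_injective_def)
 interpret p: ghom R M N \<pi> by (rule ghomI[OF graded M N \<pi>(1)])
 have k: "koszul_regular R M xs (p.dom.sat H) t \<longleftrightarrow> (\<forall>n q. n > t \<longrightarrow> bounding 0 n q)"
 proof (rule koszul_regular_iff[OF M graded_hom_comp[OF \<pi>(1) e(1)]])
  show "(\<lambda>x. \<epsilon> (\<pi> x)) ` carrier M = Z 0" unfolding e(3)[symmetric] \<pi>(2)[symmetric] by (simp add: image_image)
  fix x assume x: "x \<in> carrier M"
  have "\<epsilon> (\<pi> x) = \<epsilon> \<zero>\<^sub>N \<longleftrightarrow> \<pi> x = \<zero>\<^sub>N" by (rule inj_on_eq_iff[OF e(2)]) (use x in auto)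
  then show "\<epsilon> (\<pi> x) = \<zero>\<^bsub>E 0\<^esub> \<longleftrightarrow> x \<in> H" using \<pi>(3)[OF x] by simp
 qed
 \<comment> \<open>A component of the cohomology is zero if and only if all torsion cocycles of that
   degree are boundaries of torsion elements.\<close>
 have v: "mdeg (local_cohomology R N (Suc j)) n = {\<zero>\<^bsub>local_cohomology R N (Suc j)\<^esub>} \<longleftrightarrow> vanishing j n" for j n
 proof -
  interpret d: ghom R "E j" "E (Suc j)" "d j" by (rule ghd)
  let ?G = "graded_submodule (graded_submodule (E (Suc j)) (T (Suc j))) {x \<in> T (Suc j). d (Suc j) x = \<zero>\<^bsub>E (Suc (Suc j))\<^esub>}"
  let ?B = "d j ` T j"
  have Tc: "T (Suc j) \<subseteq> carrier (E (Suc j))" using d.cod.hsubD(1)[OF d.cod.tors_hsub] by blast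
  have cong: "?B +>\<^bsub>?G\<^esub> x = ?B \<longleftrightarrow> x \<in> ?B" if "x \<in> carrier (E (Suc j))" for x
   by (rule d.cod.coset_eq_iff[OF d.image_asub[OF d.dom.tors_asub] that]) (use Tc in auto)
  have "mdeg (local_cohomology R N (Suc j)) n = (\<lambda>x. ?B +>\<^bsub>?G\<^esub> x) ` (mdeg (E (Suc j)) n \<inter> T (Suc j) \<inter> Z (Suc j))"
  proof -
   have "{x \<in> T (Suc j). d (Suc j) x = \<zero>\<^bsub>E (Suc (Suc j))\<^esub>} = T (Suc j) \<inter> Z (Suc j)" using Tc by (auto simp: Z_def)
   then show ?thesis by (simp add: local_cohomology_def ch Let_def a_kernel_eq graded_quotient_def Int_assoc)
  qed
  moreover have "\<zero>\<^bsub>local_cohomology R N (Suc j)\<^esub> = ?B" by (simp add: local_cohomology_def ch Let_def graded_quotient_def)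
  moreover
  have "(\<lambda>x. ?B +>\<^bsub>?G\<^esub> x) ` S = {?B} \<longleftrightarrow> S \<subseteq> ?B" if S: "S \<subseteq> carrier (E (Suc j))" "S \<noteq> {}" for S
  proof
   assume "(\<lambda>x. ?B +>\<^bsub>?G\<^esub> x) ` S = {?B}"
   note im = this
   show "S \<subseteq> ?B"
   proof
    fix x assume x: "x \<in> S"
    have "?B +>\<^bsub>?G\<^esub> x \<in> (\<lambda>x. ?B +>\<^bsub>?G\<^esub> x) ` S" using x by (rule imageI)
    then have "?B +>\<^bsub>?G\<^esub> x = ?B" unfolding im by (rule singletonD)
    then show "x \<in> ?B" by (rule iffD1[OF cong[OF subsetD[OF S(1) x]]])
   qed
  next
   assume SB: "S \<subseteq> ?B"
   have "?B +>\<^bsub>?G\<^esub> x = ?B" if x: "x \<in> S" for x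
    by (rule iffD2[OF cong[OF subsetD[OF S(1) x]] subsetD[OF SB x]])
   then have "(\<lambda>x. ?B +>\<^bsub>?G\<^esub> x) ` S = (\<lambda>x. ?B) ` S" by (rule image_cong[OF refl])
   then show "(\<lambda>x. ?B +>\<^bsub>?G\<^esub> x) ` S = {?B}" using S(2) by (simp only: image_constant_conv if_False)
  qed
  note im = this[of "mdeg (E (Suc j)) n \<inter> T (Suc j) \<inter> Z (Suc j)"]
  have ne: "mdeg (E (Suc j)) n \<inter> T (Suc j) \<inter> Z (Suc j) \<noteq> {}"
   using d.cod.md.piece_zero[of n] d.cod.hsubD(2)[OF d.cod.tors_hsub] d.cod.hsubD(2)[OF Z_hsub] by blast
  have "mdeg (E (Suc j)) n \<inter> T (Suc j) \<inter> Z (Suc j) \<subseteq> carrier (E (Suc j))" using Tc by blast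
  note im = im[OF this ne]
  ultimately show ?thesis unfolding vanishing_def im[symmetric] by (simp only: )
 qed
 have "geometrically_regular R N t \<longleftrightarrow> (\<forall>i n. int (Suc i) + n > t \<longrightarrow> vanishing i n)"
 proof
  assume g: "geometrically_regular R N t"
  show "\<forall>i n. int (Suc i) + n > t \<longrightarrow> vanishing i n"
  proof (intro allI impI)
   fix i n assume "int (Suc i) + n > t"
   then show "vanishing i n"
    using g[unfolded geometrically_regular_def, rule_format, of "n + int i" "Suc i"] v[of i n] by simp
  qed
 next
  assume a: "\<forall>i n. int (Suc i) + n > t \<longrightarrow> vanishing i n"
  show "geometrically_regular R N t" unfolding geometrically_regular_def
  proof (intro allI impI)
   fix n i assume n: "t \<le> n" and i: "1 \<le> (i::nat)"
   obtain j where j: "i = Suc j" using i by (cases i) auto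
   have "vanishing j (n - int i + 1)" using a n j by simp
   then show "mdeg (local_cohomology R N i) (n - int i + 1) = {\<zero>\<^bsub>local_cohomology R N i\<^esub>}" unfolding j v by simp
  qed
 qed
 then show ?thesis using k vanishing_iff by simp
qed

section \<open>From the quotient by the linear form back to the module\<close>

context lin_gens
begin

text \<open>Generation in degree \<open>j\<close> writes an element e of degree j + 1 as a top
  Koszul differential of a cochain f of degree \<open>j\<close>. If e lies in \<open>T\<close>, then
  f agrees with a coboundary modulo \<open>T\<close>, which in degree \<open>j\<close> means modulo
  \<open>W\<close>; applying the differential once more puts e into \<open>W\<close>.\<close>

lemma koszul_regular_quotient_step:
 fixes M :: "('a, 'b) graded_module"
 assumes M: "graded_module_loc R M" and T: "hsub R M T" and W: "hsub R M W" and WT: "W \<subseteq> T"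
  and k: "koszul_regular R M xs T t" and j: "j > t" and gen: "mdeg M (j + 1) \<subseteq> combo M xs (mdeg M j)"
  and eq: "mdeg M j \<inter> T \<subseteq> W" 
 shows "mdeg M (j + 1) \<inter> T \<subseteq> W"
proof
 interpret M: graded_module_loc R M by fact
 let ?r = "length xs"
 fix e assume e: "e \<in> mdeg M (j + 1) \<inter> T"
 have P: "asub M {} (mdeg M j)" using M.md.piece_carrier M.md.piece_zero M.md.piece_add M.md.piece_neg by (intro M.asubI) auto
 obtain f where f: "\<And>l. length l = ?r \<Longrightarrow> f l \<in> (if ntrue l = int ?r - 1 then mdeg M j else {\<zero>\<^sub>M})"
  "kd M xs f (replicate ?r True) = e"
  using M.combo_kd[OF P xsc, of e] gen e by blast
 have fco: "coch M ?r (mdeg M) j (int ?r - 1) f" unfolding coch_def using f(1) by blast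
 have fc: "kin ?r f (carrier M)" by (rule M.coch_kin[OF fco])
 have dco: "coch M ?r (mdeg M) (j + 1) (int ?r) (kd M xs f)" using M.kd_coch[OF xs1 fco] by simp
 have "kin ?r (kd M xs f) T"
  proof (rule kinI)
  fix l :: "bool list" assume l: "length l = ?r"
  show "kd M xs f l \<in> T"
  proof (cases "ntrue l = int ?r")
   case True
   then have "l = replicate ?r True" using ntrue_max[of l] l by simp
   then show ?thesis using f(2) e by simp
  next
   case False then show ?thesis using cochD[OF dco l] M.hsubD(2)[OF T] by simp
  qed
 qed
 from k[unfolded koszul_regular_def, rule_format, OF j fco this] obtain g where
  g: "coch M ?r (mdeg M) (j - 1) (int ?r - 1 - 1) g" "kin ?r (\<lambda>l. f l \<ominus>\<^sub>M kd M xs g l) T" by blast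
 have gc: "kin ?r g (carrier M)" by (rule M.coch_kin[OF g(1)])
 have dgco: "coch M ?r (mdeg M) j (int ?r - 1) (kd M xs g)" using M.kd_coch[OF xs1 g(1)] by simp
 have dgc: "kin ?r (kd M xs g) (carrier M)" by (rule M.coch_kin[OF dgco])
 have hco: "coch M ?r (mdeg M) j (int ?r - 1) (\<lambda>l. f l \<ominus>\<^sub>M kd M xs g l)" by (rule M.coch_minus[OF fco dgco])
 have hW: "kin ?r (\<lambda>l. f l \<ominus>\<^sub>M kd M xs g l) W"
  proof (rule kinI)
  fix l :: "bool list" assume l: "length l = ?r"
  show "f l \<ominus>\<^sub>M kd M xs g l \<in> W"
   using cochD[OF hco l] kinD[OF g(2) l] eq M.hsubD(2)[OF W] by (auto split: if_splits)
 qed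
 have l: "length (replicate ?r True) = ?r" by simp
 have "kin ?r (kd M xs (\<lambda>l. f l \<ominus>\<^sub>M kd M xs g l)) W"
  by (rule M.kd_closed[OF xsc M.asub_mono_ops[OF xsc M.hsub_asub[OF W]] hW])
 from kinD[OF this l] show "e \<in> W"
  using M.kd_minus[OF xsc fc dgc l] M.kd_kd[OF xsc gc l] f(2) M.md.piece_carrier[of e "j + 1"] e by (simp add: M.M.minus_eq M.M.a_inv_zero)
qed

text \<open>The hypothesis \<open>W\<close> says that in degrees above \<open>m\<close> the elements
  of \<open>T\<close> are multiples of \<open>z\<close> modulo \<open>L\<close>. The final
  cancellation rests on z (f - dv) = dD + w(df), where w is the contraction and \<open>D\<close> the
  error in the division by \<open>z\<close>; both terms on the right lie in
  \<open>L\<close>.\<close>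

lemma koszul_regular_lift:
 fixes M :: "('a, 'b) graded_module"
 assumes M: "graded_module_loc R M" and T: "hsub R M T" and L: "hsub R M L" 
  and cs: "set cs \<subseteq> rdeg R 0" "length cs = length xs" and z: "dot R cs xs = z"
  and W: "\<And>n x. x \<in> T \<Longrightarrow> x \<in> mdeg M n \<Longrightarrow> n > m \<Longrightarrow> \<exists>y\<in>mdeg M (n - 1). x \<ominus>\<^sub>M z \<odot>\<^sub>M y \<in> L"
  and reg: "\<And>x. x \<in> carrier M \<Longrightarrow> z \<odot>\<^sub>M x \<in> L \<Longrightarrow> x \<in> L" and LT: "L \<subseteq> T" and zT: "\<And>x. x \<in> carrier M \<Longrightarrow> z \<odot>\<^sub>M x \<in> T"
  and k: "koszul_regular R M xs T t" and m: "m \<ge> t"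
 shows "koszul_regular R M xs L m"
 unfolding koszul_regular_def
proof (intro allI impI)
 interpret M: graded_module_loc R M by fact
 let ?r = "length xs"
 fix n q f assume n: "n > m" and f: "coch M ?r (mdeg M) n q f" and df: "kin ?r (kd M xs f) L"
 have csc: "set cs \<subseteq> carrier R" using cs(1) rd.piece_carrier by blast
 have zc: "z \<in> carrier R" using M.dot_closed[OF csc xsc cs(2)] z by simp
 note LD = M.hsubD[OF L] and TD = M.hsubD[OF T]
 note mono = M.asub_mono_ops[OF xsc M.hsub_asub[OF L]]
 have fc: "kin ?r f (carrier M)" by (rule M.coch_kin[OF f])
 have dfc: "kin ?r (kd M xs f) (carrier M)" by (rule M.kd_carrier[OF xsc fc])
 let ?w = "kw M cs f"
 have wco: "coch M ?r (mdeg M) n (q - 1) ?w" using M.kw_coch[of cs n q f] cs f by simp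
 have wc: "kin ?r ?w (carrier M)" by (rule M.coch_kin[OF wco])
 \<comment> \<open>The homotopy read backwards: the differential of the contraction of
   \<open>f\<close> is z f up to the contraction of df, which lies in \<open>L\<close>.\<close>
 have hom: "kd M xs ?w l = z \<odot>\<^sub>M f l \<ominus>\<^sub>M kw M cs (kd M xs f) l" and kwL: "kw M cs (kd M xs f) l \<in> L"
  if l: "length l = ?r" for l
 proof -
  have "kin (length cs) (kw M cs (kd M xs f)) L"
   by (rule M.kw_closed[OF csc M.asub_mono_ops[OF csc M.hsub_asub[OF L]]]) (use df cs in simp)
  then show kw: "kw M cs (kd M xs f) l \<in> L" using kinD l cs(2) by metis
  show "kd M xs ?w l = z \<odot>\<^sub>M f l \<ominus>\<^sub>M kw M cs (kd M xs f) l"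
   using M.k_homotopy[OF xsc csc cs(2) fc l] z LD(1)[OF kw] M.kd_carrierD[OF xsc wc l] M.M.plus_minus_r by metis
 qed
 have "kin ?r (kd M xs ?w) T"
  proof (rule kinI)
  fix l :: "bool list" assume l: "length l = ?r"
  show "kd M xs ?w l \<in> T" unfolding hom[OF l] using zT[OF kinD[OF fc l]] kwL[OF l] LT TD(5) by blast
 qed
 from k[unfolded koszul_regular_def, rule_format, OF _ wco this] n m obtain u where
  u: "coch M ?r (mdeg M) (n - 1) (q - 1 - 1) u" "kin ?r (\<lambda>l. ?w l \<ominus>\<^sub>M kd M xs u l) T" by auto
 have uc: "kin ?r u (carrier M)" by (rule M.coch_kin[OF u(1)])
 have duco: "coch M ?r (mdeg M) n (q - 1) (kd M xs u)" using M.kd_coch[OF xs1 u(1)] by simp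
 have duc: "kin ?r (kd M xs u) (carrier M)" by (rule M.coch_kin[OF duco])
 let ?F = "\<lambda>l. ?w l \<ominus>\<^sub>M kd M xs u l"
 have Fco: "coch M ?r (mdeg M) n (q - 1) ?F" by (rule M.coch_minus[OF wco duco])
 have "\<exists>y. y \<in> (if ntrue l = q - 1 then mdeg M (n - 1) else {\<zero>\<^sub>M}) \<and> ?F l \<ominus>\<^sub>M z \<odot>\<^sub>M y \<in> L" if l: "length l = ?r" for l
 proof (cases "ntrue l = q - 1")
  case True
  then have "?F l \<in> mdeg M n" using cochD[OF Fco l] by simp
  from W[OF kinD[OF u(2) l] this n] show ?thesis using True by auto
 next
  case False
  then have "?F l = \<zero>\<^sub>M" using cochD[OF Fco l] by simp
  then show ?thesis using False zc LD(2) by (intro exI[of _ "\<zero>\<^sub>M"]) (simp add: M.M.minus_eq M.M.a_inv_zero)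
 qed
 then obtain v where v: "\<And>l. length l = ?r \<Longrightarrow> v l \<in> (if ntrue l = q - 1 then mdeg M (n - 1) else {\<zero>\<^sub>M})"
  "\<And>l. length l = ?r \<Longrightarrow> ?F l \<ominus>\<^sub>M z \<odot>\<^sub>M v l \<in> L" by metis
 have vco: "coch M ?r (mdeg M) (n - 1) (q - 1) v" unfolding coch_def using v(1) by blast
 have vc: "kin ?r v (carrier M)" by (rule M.coch_kin[OF vco])
 have zvc: "kin ?r (\<lambda>l. z \<odot>\<^sub>M v l) (carrier M)" using vc zc by (simp add: kin_def)
 let ?D = "\<lambda>l. ?F l \<ominus>\<^sub>M z \<odot>\<^sub>M v l"
 have "kin ?r ?D L" using v(2) by (simp add: kin_def)
 then have dDL: "kin ?r (kd M xs ?D) L" by (rule M.kd_closed[OF xsc mono])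
 have "kin ?r (\<lambda>l. f l \<ominus>\<^sub>M kd M xs v l) L"
  proof (rule kinI)
  fix l :: "bool list" assume l: "length l = ?r"
  have c: "f l \<in> carrier M" "kd M xs v l \<in> carrier M" "kw M cs (kd M xs f) l \<in> carrier M" "kd M xs ?w l \<in> carrier M"
   using kinD[OF fc l] M.kd_carrierD[OF xsc vc l] LD(1)[OF kwL[OF l]] M.kd_carrierD[OF xsc wc l] .
  have "kd M xs ?D l = kd M xs ?w l \<ominus>\<^sub>M z \<odot>\<^sub>M kd M xs v l"
   using M.kd_minus[OF xsc M.coch_kin[OF Fco] zvc l] M.kd_minus[OF xsc wc duc l] M.kd_kd[OF xsc uc l]
    M.kd_smult[OF xsc zc vc l] c zc by (simp add: M.M.minus_eq M.M.a_inv_zero)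
  also have "\<dots> = (z \<odot>\<^sub>M f l \<ominus>\<^sub>M z \<odot>\<^sub>M kd M xs v l) \<ominus>\<^sub>M kw M cs (kd M xs f) l"
   unfolding hom[OF l] using c zc by (simp add: M.M.minus_eq M.M.a_ac)
  finally have "z \<odot>\<^sub>M (f l \<ominus>\<^sub>M kd M xs v l) = kd M xs ?D l \<oplus>\<^sub>M kw M cs (kd M xs f) l"
   using c zc by (simp add: M.M.minus_eq M.smult_r_distr M.smult_r_minus M.M.a_assoc M.M.l_neg)
  then have "z \<odot>\<^sub>M (f l \<ominus>\<^sub>M kd M xs v l) \<in> L" using LD(3)[OF kinD[OF dDL l] kwL[OF l]] by simp
  then show "f l \<ominus>\<^sub>M kd M xs v l \<in> L" using reg c by simp
 qed
 then show "\<exists>g. coch M ?r (mdeg M) (n - 1) (q - 1) g \<and> kin ?r (\<lambda>l. f l \<ominus>\<^sub>M kd M xs g l) L" using vco by blast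
qed

end

section \<open>Euler characteristic of the Koszul complex\<close>

text \<open>The product of copies of M over an index type. Cochains of all exterior degrees form
  subproducts of it, so one ambient module serves for measuring all their lengths.\<close>

definition fun_module :: "('a, 'b, 'm) module_scheme \<Rightarrow> ('a, 'i \<Rightarrow> 'b) module" where
 "fun_module M = \<lparr>carrier = {f. \<forall>i. f i \<in> carrier M}, monoid.mult = undefined, one = undefined, zero = (\<lambda>i. \<zero>\<^sub>M),
   add = (\<lambda>f g i. f i \<oplus>\<^sub>M g i), module.smult = (\<lambda>a f i. a \<odot>\<^sub>M f i)\<rparr>"

definition pset :: "('i \<Rightarrow> 'b set) \<Rightarrow> ('i \<Rightarrow> 'b) set" where "pset S = {f. \<forall>i. f i \<in> S i}"

lemma fun_module_simps [simp]:
 "carrier (fun_module M) = {f. \<forall>i. f i \<in> carrier M}" "zero (fun_module M) = (\<lambda>i. \<zero>\<^sub>M)"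
 "add (fun_module M) f g = (\<lambda>i. f i \<oplus>\<^sub>M g i)" "module.smult (fun_module M) a f = (\<lambda>i. a \<odot>\<^sub>M f i)"
 by (simp_all add: fun_module_def)

context module
begin

lemma fun_module: "module R (fun_module M)"
proof (rule moduleI[OF R.is_cring])
 show "abelian_group (fun_module M)"
 proof (rule abelian_groupI)
  fix f assume f: "f \<in> carrier (fun_module M)"
  show "\<exists>g\<in>carrier (fun_module M). g \<oplus>\<^bsub>fun_module M\<^esub> f = \<zero>\<^bsub>fun_module M\<^esub>"
   using f by (intro bexI[of _ "\<lambda>i. \<ominus>\<^sub>M f i"]) (simp_all add: M.l_neg)
 qed (auto simp: M.a_ac)
qed (auto simp: smult_l_distr smult_r_distr smult_assoc1)

lemma fun_module_neg: 
 assumes f: "f \<in> carrier (fun_module M)" shows "\<ominus>\<^bsub>fun_module M\<^esub> f = (\<lambda>i. \<ominus>\<^sub>M f i)"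
proof -
 interpret F: module R "fun_module M" by (rule fun_module)
 show ?thesis by (rule F.M.minus_equality) (use f in \<open>simp_all add: M.l_neg\<close>)
qed

lemma pset_asub:
 assumes S: "\<And>i. asub M A (S i)"
 shows "asub (fun_module M) A (pset S)"
proof -
 interpret F: module R "fun_module M" by (rule fun_module)
 note D = asubD[OF S]
 have c: "pset S \<subseteq> carrier (fun_module M)" unfolding pset_def using D(1) by auto
 show ?thesis
 proof (rule F.asubI[OF c])
  show "\<zero>\<^bsub>fun_module M\<^esub> \<in> pset S" by (simp add: pset_def D(2))
  fix f assume f: "f \<in> pset S"
  show "\<ominus>\<^bsub>fun_module M\<^esub> f \<in> pset S" unfolding fun_module_neg[OF subsetD[OF c f]] using f D(4) by (simp add: pset_def)
  show "a \<odot>\<^bsub>fun_module M\<^esub> f \<in> pset S" if "a \<in> A" for a using f that D(6) by (simp add: pset_def)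
  fix g assume g: "g \<in> pset S"
  show "f \<oplus>\<^bsub>fun_module M\<^esub> g \<in> pset S" using f g D(3) by (simp add: pset_def)
 qed
qed

text \<open>The factors are enlarged from \<open>S i\<close> to \<open>V i\<close> one at a time,
  and evaluation at the enlarged index identifies each step with a quotient of one factor.\<close>

lemma len_pset:
 assumes A: "A \<subseteq> carrier R" and V: "\<And>i. asub M A (V i)" and I: "finite I"
 shows "(\<And>i. asub M A (S i)) \<Longrightarrow> (\<And>i. S i \<subseteq> V i) \<Longrightarrow> (\<And>i. i \<notin> I \<Longrightarrow> S i = V i) \<Longrightarrow>
  len (fun_module M) A (pset S) (pset V) = (\<Sum>i\<in>I. len M A (S i) (V i))"
 using I
proof (induction I arbitrary: S rule: finite_induct)
 interpret F: module R "fun_module M" by (rule fun_module)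
 case empty
 have "S = V" using empty by auto
 then show ?case using F.len_zero_iff[OF pset_asub[of A V, OF V] pset_asub[of A V, OF V] order_refl] by simp
next
 interpret F: module R "fun_module M" by (rule fun_module)
 case (insert k I)
 let ?S = "S(k := V k)"
 have S: "asub M A (?S i)" for i using insert.prems(1) V by simp
 have "S i \<subseteq> ?S i" "?S i \<subseteq> V i" for i using insert.prems(2) by simp_all
 then have sub: "pset S \<subseteq> pset ?S" "pset ?S \<subseteq> pset V" unfolding pset_def by blast+
 have 1: "len (fun_module M) A (pset S) (pset ?S) = len M A (S k) (V k)"
 proof (rule len_iso[where f="\<lambda>f. f k", OF fun_module module_axioms A pset_asub[OF S] insert.prems(1)])
  show "y k \<in> carrier M" if "y \<in> pset ?S" for y 
  proof -
   have "y k \<in> ?S k" using that unfolding pset_def by blast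
   then show ?thesis using asubD(1)[OF V[of k]] by simp
  qed
  show "pset S = {y \<in> pset ?S. y k \<in> S k}"
  proof (intro subset_antisym subsetI)
   fix y assume "y \<in> pset S"
   then have "y \<in> pset ?S" "y k \<in> S k" using sub(1) unfolding pset_def by blast+
   then show "y \<in> {y \<in> pset ?S. y k \<in> S k}" by simp
  next
   fix y assume y: "y \<in> {y \<in> pset ?S. y k \<in> S k}"
   have "y i \<in> S i" for i
   proof (cases "i = k")
    case False
    have "y i \<in> ?S i" using y unfolding pset_def by blast
    then show ?thesis using False by simp
   qed (use y in simp)
   then show "y \<in> pset S" by (simp add: pset_def)
  qed
  show "V k = {y k \<oplus>\<^sub>M x |y x. y \<in> pset ?S \<and> x \<in> S k}"
  proof (intro subset_antisym subsetI)
   fix v assume v: "v \<in> V k"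
   let ?y = "\<lambda>i. if i = k then v else \<zero>\<^sub>M"
   have "?y \<in> pset ?S" using v asubD(2)[OF insert.prems(1)] by (simp add: pset_def)
   moreover have "v = ?y k \<oplus>\<^sub>M \<zero>\<^sub>M" using asubD(1)[OF V v] by simp
   moreover note asubD(2)[OF insert.prems(1), of k]
   ultimately show "v \<in> {y k \<oplus>\<^sub>M x |y x. y \<in> pset ?S \<and> x \<in> S k}"
    by (intro CollectI exI[of _ ?y] exI[of _ "\<zero>\<^sub>M"] conjI)
  next
   fix v assume "v \<in> {y k \<oplus>\<^sub>M x |y x. y \<in> pset ?S \<and> x \<in> S k}"
   then obtain y x where yx: "v = y k \<oplus>\<^sub>M x" "y \<in> pset ?S" "x \<in> S k" by blast
   have "y k \<in> ?S k" using yx(2) unfolding pset_def by blast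
   then have "y k \<in> V k" by simp
   then show "v \<in> V k" unfolding yx(1) by (rule asubD(3)[OF V]) (rule subsetD[OF insert.prems(2) yx(3)])
  qed
 qed simp_all
 have 2: "len (fun_module M) A (pset ?S) (pset V) = (\<Sum>i\<in>I. len M A (?S i) (V i))"
  by (rule insert.IH[OF S]) (use insert.prems in auto)
 have 3: "(\<Sum>i\<in>I. len M A (?S i) (V i)) = (\<Sum>i\<in>I. len M A (S i) (V i))"
  by (rule sum.cong) (use insert.hyps in auto)
 show ?case
  unfolding F.len_add[OF A sub pset_asub[OF insert.prems(1)] pset_asub[OF S] pset_asub[OF V]] 1 2 3 sum.insert[OF insert.hyps]
  by (rule refl)
qed

end

lemma alternating_telescope:
 fixes b c :: "nat \<Rightarrow> int"
 shows "(\<And>q. q \<le> r \<Longrightarrow> c q = b q + b (Suc q)) \<Longrightarrow> (\<Sum>q\<le>r. (- 1) ^ q * c q) = b 0 + (- 1) ^ r * b (Suc r)"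
 by (induction r) (simp_all add: algebra_simps)

lemma finite_lists_r: "finite {l :: bool list. length l = r}"
 using finite_lists_length_eq[of "UNIV :: bool set" r] by simp

text \<open>Grouping the lists by their number of true entries gives the sum of (-1)^q binom(r, q)
  h(D + q) over q, which is the r-th finite difference of \<open>h\<close> at \<open>D\<close> up to
  sign.\<close>

definition euler :: "nat \<Rightarrow> (int \<Rightarrow> rat) \<Rightarrow> int \<Rightarrow> rat" where
 "euler r h D = (\<Sum>l | length l = r. (- 1) ^ nat (ntrue l) * h (D + ntrue l))"

context lin_gens
begin

text \<open>In the strand of internal degrees D + q the Koszul complex modulo \<open>T\<close> is
  exact at every q \<ge> 0, because D + q > t. So the length of the q-cochains is b(q) + b(q + 1),
  where b measures the boundaries, and the alternating sum telescopes to outer terms that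
  vanish.\<close>

lemma koszul_euler:
 fixes M :: "('a, 'b) graded_module"
 assumes M: "graded_module_loc R M" and T: "hsub R M T" and k: "koszul_regular R M xs T t" and D: "D > t"
  and fin: "\<And>n. len M (rdeg R 0) (mdeg M n \<inter> T) (mdeg M n) = enat (lam n)"
 shows "euler (length xs) (\<lambda>n. rat_of_nat (lam n)) D = 0"
proof -
 interpret M: graded_module_loc R M by fact
 interpret F: module R "fun_module M :: ('a, bool list \<Rightarrow> 'b) module" by (rule M.fun_module)
 let ?r = "length xs" and ?F = "fun_module M :: ('a, bool list \<Rightarrow> 'b) module" and ?A = "rdeg R 0"
 note TD = M.hsubD[OF T]
 have A: "?A \<subseteq> carrier R" by (rule R0_carrier)
 \<comment> \<open>Functions on lists of every length, zero off the relevant ones, so that these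
   products differ in finitely many factors only.\<close>
 define C where "C q l = (if length l = ?r \<and> ntrue l = q then mdeg M (D + q) else {\<zero>\<^sub>M})" for q l
 define S where "S q l = C q l \<inter> T" for q l
 define \<delta> where "\<delta> f l = (if length l = ?r then kd M xs f l else \<zero>\<^sub>M)" for f l
 have T0: "asub M ?A T" by (rule M.asub_mono_ops[OF A M.hsub_asub[OF T]])
 have Tx: "asub M (set xs) T" by (rule M.asub_mono_ops[OF xsc M.hsub_asub[OF T]])
 have Int: "asub M ?A (U \<inter> T)" if "asub M ?A U" for U
  by (rule M.asubI) (use M.asubD[OF that] TD A in auto)
 have C: "asub M ?A (C q l)" for q l
  using M.piece_asub[of "D + q"] M.asub_zero[OF A] by (simp add: C_def)
 have S: "asub M ?A (S q l)" for q l unfolding S_def by (rule Int[OF C])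
 have SC: "S q l \<subseteq> C q l" for q l by (auto simp: S_def)
 have Sz: "S q l = {\<zero>\<^sub>M}" if "\<not> (length l = ?r \<and> ntrue l = q)" for q l
  using that TD(2) by (auto simp: S_def C_def)
 let ?C = "\<lambda>q. pset (C q)" and ?S = "\<lambda>q. pset (S q)"
 have pC: "asub ?F ?A (?C q)" and pS: "asub ?F ?A (?S q)" for q by (rule M.pset_asub[OF C], rule M.pset_asub[OF S])
 have pSC: "?S q \<subseteq> ?C q" for q using SC unfolding pset_def by blast
 have coch: "coch M ?r (mdeg M) (D + q) q f" if "f \<in> ?C q" for f q
  unfolding coch_def
 proof (intro allI impI)
  fix l :: "bool list" assume l: "length l = ?r"
  have "f l \<in> C q l" using that by (simp add: pset_def)
  then show "f l \<in> (if ntrue l = q then mdeg M (D + q) else {\<zero>\<^sub>M})" using l by (simp add: C_def)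
 qed
 have off: "f l = \<zero>\<^sub>M" if "f \<in> ?C q" "length l \<noteq> ?r" for f q l
 proof -
  have "f l \<in> C q l" using that(1) by (simp add: pset_def)
  then show ?thesis using that(2) by (simp add: C_def)
 qed
 have toC: "(\<lambda>l. if length l = ?r then f l else \<zero>\<^sub>M) \<in> ?C q" if f: "coch M ?r (mdeg M) (D + q) q f" for f q
  unfolding pset_def
 proof (intro CollectI allI)
  fix l show "(if length l = ?r then f l else \<zero>\<^sub>M) \<in> C q l"
   using cochD[OF f, of l] by (cases "length l = ?r") (simp_all add: C_def)
 qed
 have Cc: "kin ?r f (carrier M)" if "f \<in> ?C q" for f q by (rule M.coch_kin[OF coch[OF that]])
 have dC: "\<delta> f \<in> ?C (q + 1)" if "f \<in> ?C q" for f q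
  using toC[of "q + 1" "kd M xs f"] M.kd_coch[OF xs1 coch[OF that]] by (simp add: \<delta>_def[abs_def] add.assoc)
 have dc: "\<delta> f l \<in> carrier M" if "f \<in> ?C q" for f q l
  using M.kd_carrierD[OF xsc Cc[OF that]] by (simp add: \<delta>_def)
 have dadd: "\<delta> (\<lambda>i. f i \<oplus>\<^sub>M g i) = (\<lambda>l. \<delta> f l \<oplus>\<^sub>M \<delta> g l)" if "f \<in> ?C q" "g \<in> ?C q" for f g q
  by (rule ext) (simp add: \<delta>_def M.kd_add[OF xsc Cc[OF that(1)] Cc[OF that(2)]])
 have dsm: "\<delta> (\<lambda>i. a \<odot>\<^sub>M f i) = (\<lambda>l. a \<odot>\<^sub>M \<delta> f l)" if "a \<in> ?A" "f \<in> ?C q" for a f q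
  using subsetD[OF A that(1)] by (intro ext) (simp add: \<delta>_def M.kd_smult[OF xsc subsetD[OF A that(1)] Cc[OF that(2)]])
 have dneg: "\<delta> (\<lambda>i. \<ominus>\<^sub>M f i) = (\<lambda>l. \<ominus>\<^sub>M \<delta> f l)" if "f \<in> ?C q" for f q
  by (rule ext) (simp add: \<delta>_def M.kd_neg[OF xsc Cc[OF that]] M.M.a_inv_zero)
 have dd: "\<delta> (\<delta> f) = (\<lambda>l. \<zero>\<^sub>M)" if "f \<in> ?C q" for f q
 proof
  fix l show "\<delta> (\<delta> f) l = \<zero>\<^sub>M"
   using kd_cong[of xs "\<delta> f" "kd M xs f" l M] M.kd_kd[OF xsc Cc[OF that], of l] by (simp add: \<delta>_def)
 qed
 have dS: "\<delta> f \<in> ?S (q + 1)" if "f \<in> ?S q" for f q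
 proof -
  have fC: "f \<in> ?C q" using that pSC by blast
  have "kin ?r f T" using that by (simp add: kin_def pset_def S_def)
  then have "kin ?r (kd M xs f) T" by (rule M.kd_closed[OF xsc Tx])
  then have "\<delta> f l \<in> T" for l using TD(2) by (simp add: \<delta>_def kin_def)
  then show ?thesis using dC[OF fC] by (simp add: pset_def S_def)
 qed
 \<comment> \<open>\<open>X\<close> consists of the cocycles modulo \<open>T\<close>, and
   \<open>B\<close> of the boundaries enlarged by the cochains with values in
   \<open>T\<close>.\<close>
 define X where "X q = {y \<in> ?C q. \<delta> y \<in> ?S (q + 1)}" for q
 define B where "B q = {\<delta> y \<oplus>\<^sub>?F x | y x. y \<in> ?C (q - 1) \<and> x \<in> ?S q}" for q
 have SX: "?S q \<subseteq> X q" "X q \<subseteq> ?C q" for q using dS pSC unfolding X_def by blast+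
 have Xa: "asub ?F ?A (X q)" for q
 proof (rule F.asubI)
  note D1 = F.asubD[OF pC] and D2 = F.asubD[OF pS]
  note c = D1(1) and s = D2(1)
  show "X q \<subseteq> carrier ?F" using SX(2) D1(1) by blast
  show "\<zero>\<^sub>?F \<in> X q" using subsetD[OF SX(1) F.asubD(2)[OF pS]] .
  fix f assume f: "f \<in> X q"
  then have f': "f \<in> ?C q" "\<delta> f \<in> ?S (q + 1)" by (simp_all add: X_def)
  have "\<ominus>\<^sub>?F (\<delta> f) = \<delta> (\<ominus>\<^sub>?F f)"
   unfolding M.fun_module_neg[OF c[OF f'(1)]] M.fun_module_neg[OF s[OF f'(2)]] dneg[OF f'(1)] by (rule refl)
  then show "\<ominus>\<^sub>?F f \<in> X q" using D1(4)[OF f'(1)] D2(4)[OF f'(2)] by (simp add: X_def)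
  show "a \<odot>\<^sub>?F f \<in> X q" if a: "a \<in> ?A" for a
   using D1(6)[OF a f'(1)] D2(6)[OF a f'(2)] dsm[OF a f'(1)] by (simp add: X_def)
  fix g assume g: "g \<in> X q"
  then have g': "g \<in> ?C q" "\<delta> g \<in> ?S (q + 1)" by (simp_all add: X_def)
  show "f \<oplus>\<^sub>?F g \<in> X q" using D1(3)[OF f'(1) g'(1)] D2(3)[OF f'(2) g'(2)] dadd[OF f'(1) g'(1)] by (simp add: X_def)
 qed
 \<comment> \<open>The differential identifies cochains modulo cocycles with the boundaries of the
   next degree.\<close>
 have 1: "len ?F ?A (X q) (?C q) = len ?F ?A (?S (q + 1)) (B (q + 1))" for q
 proof (rule len_iso[where f=\<delta>, OF M.fun_module M.fun_module A pC pS])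
  show "\<delta> y \<in> carrier ?F" if "y \<in> ?C q" for y using dc[OF that] by simp
  show "\<delta> (y \<oplus>\<^sub>?F z) = \<delta> y \<oplus>\<^sub>?F \<delta> z" if "y \<in> ?C q" "z \<in> ?C q" for y z using dadd[OF that] by simp
  show "\<delta> (a \<odot>\<^sub>?F y) = a \<odot>\<^sub>?F \<delta> y" if "a \<in> ?A" "y \<in> ?C q" for a y using dsm[OF that] by simp
  show "X q = {y \<in> ?C q. \<delta> y \<in> ?S (q + 1)}" by (rule X_def)
  show "B (q + 1) = {\<delta> y \<oplus>\<^sub>?F x |y x. y \<in> ?C q \<and> x \<in> ?S (q + 1)}" unfolding B_def by simp
 qed
 have 2: "X q = B q" if q: "0 \<le> q" for q
 proof (intro subset_antisym subsetI)
  fix y assume y: "y \<in> X q"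
  then have yC: "y \<in> ?C q" and dy: "\<delta> y \<in> ?S (q + 1)" by (simp_all add: X_def)
  have "kin ?r (kd M xs y) T"
   proof (rule kinI)
   fix l :: "bool list" assume l: "length l = ?r"
   have "\<delta> y l \<in> S (q + 1) l" using dy by (simp add: pset_def)
   then show "kd M xs y l \<in> T" using l by (simp add: \<delta>_def S_def)
  qed
  from k[unfolded koszul_regular_def, rule_format, OF _ coch[OF yC] this] D q obtain g where
   g: "coch M ?r (mdeg M) (D + q - 1) (q - 1) g" "kin ?r (\<lambda>l. y l \<ominus>\<^sub>M kd M xs g l) T" by auto
  let ?g = "\<lambda>l. if length l = ?r then g l else \<zero>\<^sub>M"
  have gC: "?g \<in> ?C (q - 1)" by (rule toC) (use g(1) in \<open>simp add: algebra_simps\<close>)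
  have dg: "\<delta> ?g \<in> ?C q" using dC[OF gC] by simp
  let ?x = "y \<ominus>\<^sub>?F \<delta> ?g"
  have xC: "?x \<in> ?C q" by (rule F.asubD(5)[OF pC yC dg])
  have dgc: "\<delta> ?g \<in> carrier ?F" "y \<in> carrier ?F" using F.asubD(1)[OF pC dg] F.asubD(1)[OF pC yC] .
  have xl: "?x l = y l \<ominus>\<^sub>M \<delta> ?g l" for l by (simp add: F.M.minus_eq M.fun_module_neg[OF dgc(1)] M.M.minus_eq)
  have "?x l \<in> T" for l
  proof (cases "length l = ?r")
   case True
   have "kd M xs ?g l = kd M xs g l" by (rule kd_cong) (use True in simp_all)
   then show ?thesis unfolding xl using kinD[OF g(2) True] True by (simp add: \<delta>_def)
  next
   case False then show ?thesis using off[OF xC] TD(2) by simp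
  qed
  then have "?x \<in> ?S q" using xC by (simp add: pset_def S_def)
  moreover have "y = \<delta> ?g \<oplus>\<^sub>?F ?x"
   using F.M.plus_minus_r[of "?x" "\<delta> ?g"] dgc by (simp only: F.M.minus_eq F.M.a_ac F.M.r_neg2 F.M.a_inv_closed F.M.a_closed F.M.r_neg F.M.r_zero F.M.l_zero)
  ultimately show "y \<in> B q" unfolding B_def using gC by blast
 next
  fix y assume "y \<in> B q"
  then obtain u x where ux: "y = \<delta> u \<oplus>\<^sub>?F x" "u \<in> ?C (q - 1)" "x \<in> ?S q" unfolding B_def by blast
  have du: "\<delta> u \<in> ?C q" using dC[OF ux(2)] by simp
  have "\<delta> (\<delta> u) \<in> ?S (q + 1)" unfolding dd[OF ux(2)] using F.asubD(2)[OF pS] by simp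
  then have "\<delta> u \<in> X q" using du by (simp add: X_def)
  then show "y \<in> X q" unfolding ux(1) by (rule F.asubD(3)[OF Xa]) (use SX(1) ux(3) in blast)
 qed
 define b where "b q = len ?F ?A (?S q) (B q)" for q
 define c where "c q = len ?F ?A (?S q) (?C q)" for q
 have 3: "c q = b q + b (q + 1)" if q: "0 \<le> q" for q
  unfolding c_def b_def 1[symmetric] 2[OF q, symmetric] by (rule F.len_add[OF A SX pS Xa pC])
 let ?I = "{l :: bool list. length l = ?r}"
 have 4: "c q = (\<Sum>l\<in>?I. if ntrue l = q then enat (lam (D + q)) else 0)" for q
 proof -
  have "c q = (\<Sum>l\<in>?I. len M ?A (S q l) (C q l))"
   unfolding c_def by (rule M.len_pset[OF A C finite_lists_r S SC]) (simp add: Sz C_def)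
  also have "\<dots> = (\<Sum>l\<in>?I. if ntrue l = q then enat (lam (D + q)) else 0)"
  proof (rule sum.cong[OF refl])
   fix l assume l: "l \<in> ?I"
   show "len M ?A (S q l) (C q l) = (if ntrue l = q then enat (lam (D + q)) else 0)"
   proof (cases "ntrue l = q")
    case True then show ?thesis using l fin[of "D + q"] by (simp add: S_def C_def)
   next
    case False then show ?thesis using M.len_zero_iff[OF M.asub_zero[OF A] M.asub_zero[OF A]] Sz[of l q] by (simp add: C_def)
   qed
  qed
  finally show ?thesis .
 qed
 have c5: "c q = enat (\<Sum>l\<in>?I. if ntrue l = q then lam (D + q) else 0)" for q
 proof -
  have "c q = (\<Sum>l\<in>?I. of_nat (if ntrue l = q then lam (D + q) else 0))"
   unfolding 4 by (rule sum.cong) (simp_all add: of_nat_eq_enat zero_enat_def)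
  also have "\<dots> = of_nat (\<Sum>l\<in>?I. if ntrue l = q then lam (D + q) else 0)" by (rule of_nat_sum[symmetric])
  finally show ?thesis unfolding of_nat_eq_enat .
 qed
 \<comment> \<open>There are no cochains of exterior degree -1, hence no boundaries in degree
   0.\<close>
 have b0: "b 0 = 0"
 proof -
  have "c (- 1) = 0" unfolding 4 using ntrue_nonneg by (intro sum.neutral) (metis (no_types, lifting) le_minus_one_simps(3))
  then have "len ?F ?A (X (- 1)) (?C (- 1)) \<le> 0" unfolding c_def using F.len_anti[OF SX(1)] by metis
  then show ?thesis unfolding b_def using 1[of "- 1"] by simp
 qed
 have br: "b (int ?r + 1) = 0"
 proof -
  have "c (int ?r + 1) = 0" unfolding 4
  proof (rule sum.neutral, rule ballI)
   fix l :: "bool list" assume "l \<in> ?I"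
   then show "(if ntrue l = int ?r + 1 then enat (lam (D + (int ?r + 1))) else 0) = 0" using ntrue_le[of l] by simp
  qed
  then show ?thesis using 3[of "int ?r + 1"] by simp
 qed
 define b' where "b' q = int (the_enat (b (int q)))" for q
 define c' where "c' q = (\<Sum>l\<in>?I. if ntrue l = int q then int (lam (D + int q)) else 0)" for q :: nat
 have 5: "c' q = b' q + b' (Suc q)" for q
 proof -
  have e: "enat (\<Sum>l\<in>?I. if ntrue l = int q then lam (D + int q) else 0) = b (int q) + b (int (Suc q))"
   using 3[of "int q"] c5[of "int q"] by (simp add: add.commute)
  then obtain u v where uv: "b (int q) = enat u" "b (int (Suc q)) = enat v" by (cases "b (int q)"; cases "b (int (Suc q))") auto
  have "(\<Sum>l\<in>?I. if ntrue l = int q then lam (D + int q) else 0) = u + v" using e uv by simp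
  then have "int (\<Sum>l\<in>?I. if ntrue l = int q then lam (D + int q) else 0) = int u + int v" by simp
  then show ?thesis using uv by (simp add: b'_def c'_def if_distrib[of int] of_nat_sum cong: if_cong)
 qed
 have "(\<Sum>q\<le>?r. (- 1) ^ q * c' q) = 0"
  using alternating_telescope[of ?r c' b'] 5 b0 br by (simp add: b'_def add.commute zero_enat_def)
 moreover have "(\<Sum>q\<le>?r. (- 1) ^ q * c' q) = (\<Sum>l\<in>?I. (- 1) ^ nat (ntrue l) * int (lam (D + ntrue l)))"
 proof -
  have "(\<Sum>q\<le>?r. (- 1) ^ q * c' q) = (\<Sum>q\<le>?r. \<Sum>l\<in>?I. if ntrue l = int q then (- 1) ^ q * int (lam (D + int q)) else 0)"
   unfolding c'_def sum_distrib_left by (intro sum.cong refl) simp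
  also have "\<dots> = (\<Sum>l\<in>?I. \<Sum>q\<le>?r. if ntrue l = int q then (- 1) ^ q * int (lam (D + int q)) else 0)" by (rule sum.swap)
  also have "\<dots> = (\<Sum>l\<in>?I. (- 1) ^ nat (ntrue l) * int (lam (D + ntrue l)))"
  proof (rule sum.cong[OF refl])
   fix l :: "bool list" assume l: "l \<in> ?I"
   have n: "nat (ntrue l) \<le> ?r" "int (nat (ntrue l)) = ntrue l" using ntrue_le[of l] ntrue_nonneg[of l] l by simp_all
   have "(\<Sum>q\<le>?r. if ntrue l = int q then (- 1) ^ q * int (lam (D + int q)) else 0) =
    (\<Sum>q\<le>?r. if q = nat (ntrue l) then (- 1) ^ q * int (lam (D + int q)) else 0)"
    using n(2) by (intro sum.cong refl if_cong) auto
   also have "\<dots> = (- 1) ^ nat (ntrue l) * int (lam (D + ntrue l))"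
    using n by simp
   finally show "(\<Sum>q\<le>?r. if ntrue l = int q then (- 1) ^ q * int (lam (D + int q)) else 0) = (- 1) ^ nat (ntrue l) * int (lam (D + ntrue l))" .
  qed
  finally show ?thesis .
 qed
 ultimately have z: "(\<Sum>l\<in>?I. (- 1) ^ nat (ntrue l) * int (lam (D + ntrue l))) = 0" by simp
 have "euler ?r (\<lambda>n. rat_of_nat (lam n)) D = of_int (\<Sum>l\<in>?I. (- 1) ^ nat (ntrue l) * int (lam (D + ntrue l)))"
  by (simp add: euler_def)
 then show ?thesis unfolding z by simp
qed

end

section \<open>Finite differences and polynomials\<close>

lemma euler_Suc: "euler (Suc r) h D = euler r (\<lambda>j. h j - h (j + 1)) D"
proof -
 let ?g = "\<lambda>l. (- 1) ^ nat (ntrue l) * h (D + ntrue l)"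
 have "{l :: bool list. length l = Suc r} = (#) False ` {l. length l = r} \<union> (#) True ` {l. length l = r}"
  by (auto simp: length_Suc_conv image_iff)
 then have "euler (Suc r) h D = sum ?g ((#) False ` {l. length l = r} \<union> (#) True ` {l. length l = r})" by (simp add: euler_def)
 also have "\<dots> = sum ?g ((#) False ` {l. length l = r}) + sum ?g ((#) True ` {l. length l = r})"
  by (rule sum.union_disjoint) (auto simp: finite_lists_r)
 also have "\<dots> = (\<Sum>l | length l = r. ?g (False # l)) + (\<Sum>l | length l = r. ?g (True # l))"
  by (simp add: sum.reindex inj_on_def)
 also have "\<dots> = (\<Sum>l | length l = r. ?g (False # l) + ?g (True # l))" by (simp add: sum.distrib)
 also have "\<dots> = euler r (\<lambda>j. h j - h (j + 1)) D"
  unfolding euler_def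
 proof (rule sum.cong[OF refl])
  fix l :: "bool list"
  have "nat (1 + ntrue l) = Suc (nat (ntrue l))" using ntrue_nonneg[of l] by simp
  then show "?g (False # l) + ?g (True # l) = (- 1) ^ nat (ntrue l) * (h (D + ntrue l) - h (D + ntrue l + 1))"
   by (simp add: algebra_simps)
 qed
 finally show ?thesis .
qed

lemma gchoose_poly: "\<exists>p :: rat poly. \<forall>x. poly p x = x gchoose k"
proof (induction k)
 case 0 show ?case by (intro exI[of _ 1]) simp
next
 case (Suc k)
 then obtain p :: "rat poly" where p: "\<And>x. poly p x = x gchoose k" by blast
 have "poly (smult (1 / of_nat (Suc k)) (p * [:- of_nat k, 1:])) x = x gchoose Suc k" for x
 proof -
  have "x gchoose Suc k = (x gchoose k) * (x - of_nat k) / of_nat (Suc k)"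
   by (simp add: gbinomial_prod_rev mult.commute)
  then show ?thesis by (simp add: p algebra_simps diff_divide_distrib)
 qed
 then show ?case by blast
qed

text \<open>If the first difference is a combination of the binomials j over k, then by Pascal's
  rule adding the same combination of the binomials j over k + 1 to \<open>h\<close> gives a
  constant. No degrees are lost in this step, which matters because the polynomial will be evaluated
  at \<open>t\<close> itself.\<close>

lemma newton_form:
 assumes "\<And>D. D \<ge> t \<Longrightarrow> euler r h D = 0"
 shows "\<exists>a. \<forall>j\<ge>t. h j = (\<Sum>k<r. a k * (rat_of_int j gchoose k))"
 using assms
proof (induction r arbitrary: h)
 case 0
 have "h j = 0" if "j \<ge> t" for j using 0[OF that] by (simp add: euler_def)
 then show ?case by simp
next
 case (Suc r)
 obtain a where a: "\<And>j. j \<ge> t \<Longrightarrow> h j - h (j + 1) = (\<Sum>k<r. a k * (rat_of_int j gchoose k))"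
  using Suc.IH[of "\<lambda>j. h j - h (j + 1)"] Suc.prems by (auto simp: euler_Suc)
 let ?P = "\<lambda>j. \<Sum>k<r. a k * (rat_of_int j gchoose Suc k)"
 have nxt: "h (j + 1) + ?P (j + 1) = h j + ?P j" if "j \<ge> t" for j
 proof -
  have "?P (j + 1) = ?P j + (\<Sum>k<r. a k * (rat_of_int j gchoose k))"
  proof -
   have "rat_of_int (j + 1) gchoose Suc k = (rat_of_int j gchoose k) + (rat_of_int j gchoose Suc k)" for k
    using gbinomial_Suc_Suc[of "rat_of_int j" k] by simp
   then show ?thesis by (simp add: algebra_simps sum.distrib)
  qed
  then show ?thesis using a[OF that] by simp
 qed
 define c where "c = h t + ?P t"
 have "h j + ?P j = c" if "j \<ge> t" for j
  using that
 proof (induction j rule: int_ge_induct)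
  case base show ?case by (simp add: c_def)
 next
  case (step i) then show ?case using nxt[of i] by simp
 qed
 then have eq: "h j = c - ?P j" if "j \<ge> t" for j using that by (simp add: eq_diff_eq)
 \<comment> \<open>The constant becomes the coefficient at index 0, and the other coefficients move
   up by one with a change of sign.\<close>
 have "h j = (\<Sum>k<Suc r. (if k = 0 then c else - a (k - 1)) * (rat_of_int j gchoose k))" if "j \<ge> t" for j
  unfolding eq[OF that] sum.lessThan_Suc_shift by (simp add: sum_negf)
 then show ?case by (intro exI[of _ "\<lambda>k. if k = 0 then c else - a (k - 1)"] allI impI)
qed

lemma eventually_polynomial:
 assumes "\<And>D. D \<ge> t \<Longrightarrow> euler r h D = 0"
 shows "\<exists>p. \<forall>j\<ge>t. h j = poly p (rat_of_int j)"
proof -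
 obtain a where a: "\<And>j. j \<ge> t \<Longrightarrow> h j = (\<Sum>k<r. a k * (rat_of_int j gchoose k))" using newton_form[OF assms] by blast
 obtain p :: "nat \<Rightarrow> rat poly" where p: "\<And>k x. poly (p k) x = x gchoose k" using gchoose_poly by metis
 have "h j = poly (\<Sum>k<r. smult (a k) (p k)) (rat_of_int j)" if "j \<ge> t" for j
  using a[OF that] by (simp add: poly_sum p)
 then show ?thesis by (intro exI[of _ "\<Sum>k<r. smult (a k) (p k)"] allI impI)
qed

section \<open>Hilbert functions\<close>

context graded_module_loc
begin

lemma piece_submodule_iff:
 "submodule H (degree_zero_ring R) (M\<lparr>carrier := mdeg M n\<rparr>) \<longleftrightarrow> asub M R0 H \<and> H \<subseteq> mdeg M n"
proof -
 have g: "group (add_monoid M)" by (rule M.a_group)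
 have P: "subgroup (mdeg M n) (add_monoid M)" using md.piece_subgroup by (simp add: additive_subgroup_def)
 have eq: "add_monoid (M\<lparr>carrier := mdeg M n\<rparr>) = (add_monoid M)\<lparr>carrier := mdeg M n\<rparr>" by simp
 have "subgroup H (add_monoid (M\<lparr>carrier := mdeg M n\<rparr>)) \<longleftrightarrow> subgroup H (add_monoid M) \<and> H \<subseteq> mdeg M n"
  unfolding eq using group.incl_subgroup[OF g P] group.subgroup_incl[OF g _ P] subgroup.subset[of H "(add_monoid M)\<lparr>carrier := mdeg M n\<rparr>"]
  by auto
 then show ?thesis
  unfolding submodule_def submodule_axioms_def asub_def additive_subgroup_def by (auto simp: degree_zero_ring_def)
qed

lemma hilbert_function_len: "hilbert_function R M n = the_enat (len M R0 {\<zero>\<^sub>M} (mdeg M n))"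
proof -
 have "(\<exists>N. (\<forall>i\<le>k. submodule (N i) (degree_zero_ring R) (M\<lparr>carrier := mdeg M n\<rparr>)) \<and> (\<forall>i<k. N i \<subset> N (Suc i))) \<longleftrightarrow>
  (\<exists>N. asub_chain M R0 {\<zero>\<^sub>M} (mdeg M n) k N)" for k
  unfolding piece_submodule_iff asub_chain_def using asubD(2) by (intro iff_exI) auto
 then show ?thesis by (simp add: hilbert_function_def module_length_def len_def)
qed

lemma msum_hsub:
 assumes H: "hsub R M H" and K: "hsub R M K" shows "hsub R M (msum H K)"
proof -
 have "asub M (carrier R) (msum H K)" by (rule asub_msum[OF subset_refl hsub_asub[OF H] hsub_asub[OF K]])
 moreover have "mcomp n x \<in> msum H K" if mx: "x \<in> msum H K" for x n
 proof -
  obtain h k where hk: "h \<in> H" "k \<in> K" "x = h \<oplus>\<^sub>M k" using msumE[OF mx] by blast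
  have "mcomp n x = mcomp n h \<oplus>\<^sub>M mcomp n k" unfolding hk(3) by (rule md.comp_add[OF hsubD(1)[OF H hk(1)] hsubD(1)[OF K hk(2)]])
  then show ?thesis using msumI[OF hsub_comp[OF H hk(1)] hsub_comp[OF K hk(2)]] by simp
 qed
 ultimately show ?thesis by (simp add: hsub_def submodule_asub)
qed

lemma element_smult_hsub: assumes z: "z \<in> rdeg R 1" shows "hsub R M (element_smult M z)"
proof -
 have zc: "z \<in> carrier R" by (rule rd.piece_carrier[OF z])
 have eq: "element_smult M z = (\<lambda>x. z \<odot>\<^sub>M x) ` carrier M" by (auto simp: element_smult_def)
 have "asub M (carrier R) (element_smult M z)"
  unfolding eq by (rule asub_image_smult[OF subset_refl zc carrier_asub[OF subset_refl]])
 moreover have "mcomp n x \<in> element_smult M z" if mx: "x \<in> element_smult M z" for x n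
 proof -
  obtain y where y: "x = z \<odot>\<^sub>M y" "y \<in> carrier M" using mx unfolding eq by blast
  have "mcomp n x = z \<odot>\<^sub>M mcomp (n - 1) y"
   unfolding y(1) using comp_smult[of z 1 y n] z rgr_of_nat[of 1] y(2) by simp
  then show ?thesis unfolding eq using md.comp_closed[OF y(2)] by blast
 qed
 ultimately show ?thesis by (simp add: hsub_def submodule_asub)
qed

lemma sat_incl: assumes "hsub R M H" shows "H \<subseteq> sat H"
 unfolding sat_def using hsubD(1,6)[OF assms] rd.piece_carrier by blast

lemma sat_mono: "H \<subseteq> K \<Longrightarrow> sat H \<subseteq> sat K" unfolding sat_def by blast

text \<open>Multiplying a component of \<open>y\<close> by a scalar of large degree leads into
  degrees where \<open>z\<close> is injective, and \<open>z\<close> kills the product because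
  \<open>z\<close> times \<open>y\<close> is torsion. Thus injectivity of \<open>z\<close> in large
  degrees becomes injectivity modulo torsion in all degrees.\<close>

lemma filter_regular_torsion:
 assumes fr: "filter_regular M z" and z: "z \<in> rdeg R 1" and y: "y \<in> carrier M" "z \<odot>\<^sub>M y \<in> tors"
 shows "y \<in> tors"
proof -
 have zc: "z \<in> carrier R" by (rule rd.piece_carrier[OF z])
 note tD = hsubD[OF tors_hsub]
 obtain n0 where n0: "\<And>n e. n \<ge> n0 \<Longrightarrow> e \<in> mdeg M n \<Longrightarrow> z \<odot>\<^sub>M e = \<zero>\<^sub>M \<Longrightarrow> e = \<zero>\<^sub>M"
  using fr unfolding filter_regular_def by blast
 have "mcomp i y \<in> tors" for i
 proof -
  have yi: "mcomp i y \<in> mdeg M i" "mcomp i y \<in> carrier M" using md.comp_in[OF y(1)] md.comp_closed[OF y(1)] .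
  have "mcomp (i + 1) (z \<odot>\<^sub>M y) = z \<odot>\<^sub>M mcomp i y" using comp_smult[of z 1 y "i + 1"] z rgr_of_nat[of 1] y(1) by simp
  then have "z \<odot>\<^sub>M mcomp i y \<in> tors" using hsub_comp[OF tors_hsub y(2), of "i + 1"] by simp
  then obtain k0 where k0: "\<And>k a. k \<ge> k0 \<Longrightarrow> a \<in> rdeg R k \<Longrightarrow> a \<odot>\<^sub>M (z \<odot>\<^sub>M mcomp i y) = \<zero>\<^sub>M"
   unfolding torsion_part_def by blast
  have "a \<odot>\<^sub>M mcomp i y = \<zero>\<^sub>M" if k: "k \<ge> max k0 (nat (n0 - i))" and a: "a \<in> rdeg R k" for k a
  proof (rule n0)
   show "n0 \<le> int k + i" using k by (simp add: nat_le_iff)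
   show "a \<odot>\<^sub>M mcomp i y \<in> mdeg M (int k + i)" by (rule smult_deg[OF a yi(1)])
   show "z \<odot>\<^sub>M (a \<odot>\<^sub>M mcomp i y) = \<zero>\<^sub>M"
    using k0[OF _ a] k smult_swap[OF zc rd.piece_carrier[OF a] yi(2)] by simp
  qed
  then show ?thesis unfolding torsion_part_def using yi(2) by blast
 qed
 then show ?thesis using md.homogeneous_sum_induct[OF y(1), of "\<lambda>x. x \<in> tors"] tD(2,3) by blast
qed

end

text \<open>Converts Hilbert functions of quotients into lengths of subquotients of M.\<close>

lemma (in quot) Q_len: "len Q R0 {\<zero>\<^sub>Q} (mdeg Q n) = len M R0 (mdeg M n \<inter> H) (mdeg M n)"
proof -
 interpret QQ: graded_module_loc R Q by (rule graded_module_locI[OF graded Q_graded])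
 have c: "x \<in> carrier M" if "x \<in> mdeg M n" for x by (rule md.piece_carrier[OF that])
 have clc: "cl x \<in> carrier Q" if "x \<in> carrier M" for x using that by (simp add: Q_carrier)
 show ?thesis
 proof (rule sym, rule len_iso[where f="\<lambda>x. cl x", OF module_axioms QQ.module_axioms R0_carrier piece_asub QQ.asub_zero[OF R0_carrier]])
  show "cl y \<in> carrier Q" if "y \<in> mdeg M n" for y by (rule clc[OF c[OF that]])
  show "cl (y \<oplus>\<^sub>M z) = cl y \<oplus>\<^sub>Q cl z" if "y \<in> mdeg M n" "z \<in> mdeg M n" for y z by (rule Q_add[symmetric]) (rule c[OF that(1)], rule c[OF that(2)])
  show "cl (a \<odot>\<^sub>M y) = a \<odot>\<^sub>Q cl y" if "a \<in> R0" "y \<in> mdeg M n" for a y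
   by (rule Q_smult[symmetric, OF subsetD[OF R0_carrier that(1)] c[OF that(2)]])
  show "mdeg M n \<inter> H = {y \<in> mdeg M n. cl y \<in> {\<zero>\<^sub>Q}}" using cl_zero_iff[OF c] by blast
  have z: "cl y \<oplus>\<^sub>Q \<zero>\<^sub>Q = cl y" if "y \<in> mdeg M n" for y using clc[OF c[OF that]] by (rule QQ.M.r_zero)
  show "mdeg Q n = {cl y \<oplus>\<^sub>Q x |y x. y \<in> mdeg M n \<and> x \<in> {\<zero>\<^sub>Q}}"
  proof (intro subset_antisym subsetI)
   fix X assume "X \<in> mdeg Q n"
   then obtain y where y: "y \<in> mdeg M n" "X = cl y" by (auto simp: Q_deg)
   then show "X \<in> {cl y \<oplus>\<^sub>Q x |y x. y \<in> mdeg M n \<and> x \<in> {\<zero>\<^sub>Q}}" using z[OF y(1)] by (intro CollectI exI[of _ y] exI[of _ "\<zero>\<^sub>Q"]) simp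
  next
   fix X assume "X \<in> {cl y \<oplus>\<^sub>Q x |y x. y \<in> mdeg M n \<and> x \<in> {\<zero>\<^sub>Q}}"
   then obtain y where y: "y \<in> mdeg M n" "X = cl y \<oplus>\<^sub>Q \<zero>\<^sub>Q" by blast
   then show "X \<in> mdeg Q n" using z[OF y(1)] by (simp add: Q_deg)
  qed
 qed
qed

section \<open>Linear generators of standard graded rings\<close>

lemma (in module) combo_transfer:
 assumes y: "y \<in> carrier M" and P: "P \<subseteq> carrier R" "\<And>b. b \<in> P \<Longrightarrow> b \<odot>\<^sub>M y \<in> P'" and S: "add S = add R" "zero S = zero R" "module.smult S = monoid.mult R"
 shows "set xs \<subseteq> carrier R \<Longrightarrow> a \<in> combo S xs P \<Longrightarrow> a \<in> carrier R \<and> a \<odot>\<^sub>M y \<in> combo M xs P'"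
proof (induction xs arbitrary: a)
 case Nil then show ?case using y S by simp
next
 case (Cons x xs)
 obtain b u where bu: "b \<in> P" "u \<in> combo S xs P" "a = x \<otimes>\<^sub>R b \<oplus>\<^sub>R u" using Cons.prems(2) by (auto simp: S)
 have IH: "u \<in> carrier R" "u \<odot>\<^sub>M y \<in> combo M xs P'" using Cons.IH[OF _ bu(2)] Cons.prems(1) by auto
 have c: "x \<in> carrier R" "b \<in> carrier R" using Cons.prems(1) P(1) bu(1) by auto
 have "a \<odot>\<^sub>M y = x \<odot>\<^sub>M (b \<odot>\<^sub>M y) \<oplus>\<^sub>M u \<odot>\<^sub>M y" unfolding bu(3) using c IH(1) y by (simp add: smult_l_distr smult_assoc1)
 then show ?case using IH P(2)[OF bu(1)] c bu(3) by auto
qed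

lemma (in graded_ring_loc) combo_dot:
 assumes P: "P \<subseteq> carrier R"
 shows "set xs \<subseteq> carrier R \<Longrightarrow> e \<in> combo Rmod xs P \<Longrightarrow> \<exists>cs. set cs \<subseteq> P \<and> length cs = length xs \<and> dot R cs xs = e"
proof (induction xs arbitrary: e)
 case Nil then show ?case by simp
next
 case (Cons x xs)
 obtain b u where bu: "b \<in> P" "u \<in> combo Rmod xs P" "e = x \<otimes> b \<oplus> u" using Cons.prems(2) by auto
 obtain cs where cs: "set cs \<subseteq> P" "length cs = length xs" "dot R cs xs = u" using Cons.IH[OF _ bu(2)] Cons.prems(1) by auto
 have "x \<in> carrier R" "b \<in> carrier R" using Cons.prems(1) P bu(1) by auto
 then have "dot R (b # cs) (x # xs) = e" using cs(3) bu(3) by (simp add: m_comm)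
 then show ?case using cs bu(1) by (intro exI[of _ "b # cs"]) simp
qed

text \<open>The generators of R_1 over R_0 are taken. The ring elements whose components of each
  degree n + 1 lie in x_1 R_n + ... + x_r R_n contain 1 and are stable under R_0 and R_1; as these
  generate the ring, they are everything.\<close>

lemma (in graded_ring_loc) linear_generators:
 assumes gen: "generate_ring R (rdeg R 0 \<union> rdeg R 1) = carrier R" and acc: "acc Rmod (carrier R) (carrier R)"
 obtains xs where "lin_gens R xs"
proof -
 interpret S: graded_module_loc R Rmod by (rule graded_module_locI[OF graded shifted_ring_graded])
 have deg: "mdeg Rmod (int n) = rdeg R n" for n using rgr_of_nat[of n] by simp
 obtain X where X: "finite X" "X \<subseteq> mdeg Rmod 1" "aspan Rmod R0 X = mdeg Rmod 1"
  by (rule S.piece_finite_gen[of 1]) (use acc in simp)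
 have d1: "mdeg Rmod 1 = rdeg R 1" using deg[of 1] by simp
 obtain xs where xs: "set xs = X" using finite_list[OF X(1)] by blast
 have xs1: "set xs \<subseteq> rdeg R 1" using X(2) xs d1 by simp
 have xsc: "set xs \<subseteq> carrier R" using xs1 rd.piece_carrier by blast
 have P: "asub Rmod R0 (rdeg R n)" for n using S.piece_asub[of "int n"] deg by simp
 have C: "asub Rmod R0 (combo Rmod xs (rdeg R n))" for n by (rule S.combo_asub[OF R0_carrier P xsc])
 have "aspan Rmod R0 X \<subseteq> combo Rmod xs R0"
 proof (rule S.aspan_least[OF C])
  show "X \<subseteq> combo Rmod xs R0"
  proof
   fix x assume x: "x \<in> X"
   have "x \<odot>\<^sub>Rmod \<one> \<in> combo Rmod xs R0"
    by (rule S.combo_incl[OF S.asub_mono_ops[OF _ P] xsc]) (use x xs one_deg in auto)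
   then show "x \<in> combo Rmod xs R0" using x xs xsc by auto
  qed
 qed
 then have R1: "rdeg R 1 \<subseteq> combo Rmod xs R0" using X(3) d1 by simp
 define U where "U = {a \<in> carrier R. \<forall>n. S.mcomp (int (Suc n)) a \<in> combo Rmod xs (rdeg R n)}"
 have R1c: "a \<otimes> c \<in> combo Rmod xs (rdeg R n)" if a: "a \<in> rdeg R 1" and c: "c \<in> rdeg R n" for a c n
 proof -
  have "c \<odot>\<^sub>Rmod a \<in> combo Rmod xs (rdeg R n)"
  proof (rule conjunct2[OF S.combo_smult[OF rd.piece_carrier[OF c] _ _ xsc]])
   show "a \<in> combo Rmod xs R0" using R1 a by blast
   show "R0 \<subseteq> carrier Rmod" using R0_carrier by simp
   show "c \<odot>\<^sub>Rmod b \<in> rdeg R n" if "b \<in> R0" for b using mult_deg[OF c that] by simp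
  qed
  then show ?thesis using rd.piece_carrier[OF a] rd.piece_carrier[OF c] by (simp add: m_comm)
 qed
 have U: "asub Rmod (rdeg R 0 \<union> rdeg R 1) U"
 proof (rule S.asubI)
  show "U \<subseteq> carrier Rmod" by (auto simp: U_def)
  show "\<zero>\<^sub>Rmod \<in> U" using S.md.comp_zero S.asubD(2)[OF C] by (simp add: U_def)
  show "a \<oplus>\<^sub>Rmod b \<in> U" if "a \<in> U" "b \<in> U" for a b
   using that S.md.comp_add[of a b] S.asubD(3)[OF C] by (simp add: U_def)
  show "\<ominus>\<^sub>Rmod a \<in> U" if "a \<in> U" for a
   using that S.md.comp_neg[of a] S.asubD(4)[OF C] by (simp add: U_def Rmod_neg)
  show "a \<odot>\<^sub>Rmod b \<in> U" if a: "a \<in> rdeg R 0 \<union> rdeg R 1" and b: "b \<in> U" for a b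
  proof -
   have bc: "b \<in> carrier R" using b by (simp add: U_def)
   have ac: "a \<in> carrier R" using a rd.piece_carrier by blast
   have "S.mcomp (int (Suc n)) (a \<otimes> b) \<in> combo Rmod xs (rdeg R n)" for n
   proof (cases "a \<in> rdeg R 0")
    case True
    have "S.mcomp (int (Suc n)) (a \<otimes> b) = a \<otimes> S.mcomp (int (Suc n)) b"
     using S.comp_smult[of a 0 b "int (Suc n)"] True rgr_of_nat[of 0] bc by simp
    then show ?thesis using S.asubD(6)[OF C True, of "S.mcomp (int (Suc n)) b"] b by (simp add: U_def)
   next
    case False
    then have a1: "a \<in> rdeg R 1" using a by simp
    have "S.mcomp (int (Suc n)) (a \<otimes> b) = a \<otimes> S.mcomp (int n) b"
     using S.comp_smult[of a 1 b "int (Suc n)"] a1 rgr_of_nat[of 1] bc by simp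
    moreover have "S.mcomp (int n) b \<in> rdeg R n" using S.md.comp_in[of b "int n"] bc unfolding deg by simp
    ultimately show ?thesis using R1c[OF a1] by simp
   qed
   then show ?thesis using ac bc by (simp add: U_def)
  qed
 qed
 have U': "asub Rmod (carrier R) U"
  by (rule S.asub_generate_ring[OF _ gen U]) (use rd.piece_carrier in blast)
 have one: "\<one> \<in> U"
 proof -
  have "S.mcomp (int (Suc n)) \<one> = \<zero>" for n
   using S.md.comp_other[of "int (Suc n)" 0 \<one>] one_deg deg[of 0] by simp
  then show ?thesis using S.asubD(2)[OF C] by (simp add: U_def)
 qed
 have "lin_gens R xs"
 proof unfold_locales
  show "set xs \<subseteq> rdeg R 1" by (rule xs1)
  fix n
  show "rdeg R (Suc n) \<subseteq> combo Rmod xs (rdeg R n)"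
  proof
   fix a assume a: "a \<in> rdeg R (Suc n)"
   have ac: "a \<in> carrier R" by (rule rd.piece_carrier[OF a])
   have "a \<odot>\<^sub>Rmod \<one> \<in> U" by (rule S.asubD(6)[OF U' ac one])
   then have "a \<in> U" using ac by simp
   then have "S.mcomp (int (Suc n)) a \<in> combo Rmod xs (rdeg R n)" unfolding U_def by blast
   moreover have "S.mcomp (int (Suc n)) a = a" using S.md.comp_id[of a "int (Suc n)"] a unfolding deg by simp
   ultimately show "a \<in> combo Rmod xs (rdeg R n)" by simp
  qed
 qed
 then show thesis by (rule that)
qed

text \<open>The elements all of whose components are combinations of the variables with coefficients
  of one degree less form a submodule that contains R_+ M. Above the maximal generator degree the
  components of M lie in R_+ M.\<close>

lemma (in lin_gens) generated_below:
 fixes M :: "('a, 'b) graded_module"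
 assumes M: "graded_module_loc R M" and gen: "generate_ring R (rdeg R 0 \<union> rdeg R 1) = carrier R"
  and d: "max_generator_degree R M \<le> ereal (real_of_int t)" and n: "n > t"
 shows "mdeg M n \<subseteq> combo M xs (mdeg M (n - 1))"
proof -
 interpret M: graded_module_loc R M by fact
 let ?I = "ideal_smult R M (irrelevant_ideal R)"
 define V where "V = {x \<in> carrier M. \<forall>n. M.mcomp n x \<in> combo M xs (mdeg M (n - 1))}"
 have C: "asub M R0 (combo M xs (mdeg M n))" for n by (rule M.combo_asub[OF R0_carrier M.piece_asub xsc])
 have high: "a \<odot>\<^sub>M x \<in> V" if a: "a \<in> rdeg R (Suc k)" and x: "x \<in> carrier M" for a x k
 proof -
  have ac: "a \<in> carrier R" by (rule rd.piece_carrier[OF a])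
  have "M.mcomp n (a \<odot>\<^sub>M x) \<in> combo M xs (mdeg M (n - 1))" for n
  proof -
   let ?y = "M.mcomp (n - int (Suc k)) x"
   have y: "?y \<in> mdeg M (n - int (Suc k))" by (rule M.md.comp_in[OF x])
   have "a \<odot>\<^sub>M ?y \<in> combo M xs (mdeg M (n - 1))"
   proof (rule conjunct2[OF M.combo_transfer[OF M.md.piece_carrier[OF y] _ _ _ _ _ xsc]])
    show "a \<in> combo Rmod xs (rdeg R k)" using gens a by blast
    show "rdeg R k \<subseteq> carrier R" using rd.piece_carrier by blast
    show "b \<odot>\<^sub>M ?y \<in> mdeg M (n - 1)" if "b \<in> rdeg R k" for b
     using M.smult_deg[OF that y] by (simp add: algebra_simps)
   qed simp_all
   then show ?thesis using M.comp_smult[of a "int (Suc k)" x n] a rgr_of_nat[of "Suc k"] x by simp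
  qed
  then show ?thesis using ac x by (simp add: V_def)
 qed
 have "rdeg R 0 \<union> rdeg R 1 \<subseteq> carrier R" using rd.piece_carrier by blast
 moreover have "asub M (rdeg R 0 \<union> rdeg R 1) V"
 proof (rule M.asubI)
  show "V \<subseteq> carrier M" by (auto simp: V_def)
  show "\<zero>\<^sub>M \<in> V" using M.md.comp_zero M.asubD(2)[OF C] by (simp add: V_def)
  show "a \<oplus>\<^sub>M b \<in> V" if "a \<in> V" "b \<in> V" for a b
   using that M.md.comp_add[of a b] M.asubD(3)[OF C] by (simp add: V_def)
  show "\<ominus>\<^sub>M a \<in> V" if "a \<in> V" for a
   using that M.md.comp_neg[of a] M.asubD(4)[OF C] by (simp add: V_def)
  show "a \<odot>\<^sub>M b \<in> V" if a: "a \<in> rdeg R 0 \<union> rdeg R 1" and b: "b \<in> V" for a b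
  proof (cases "a \<in> rdeg R 0")
   case True
   have bc: "b \<in> carrier M" using b by (simp add: V_def)
   have "M.mcomp n (a \<odot>\<^sub>M b) \<in> combo M xs (mdeg M (n - 1))" for n
    using M.comp_smult[of a 0 b n] True rgr_of_nat[of 0] bc M.asubD(6)[OF C True, of "M.mcomp n b"] b by (simp add: V_def)
   then show ?thesis using subsetD[OF R0_carrier True] bc by (simp add: V_def)
  next
   case False then show ?thesis using high[of a 0 b] a b by (simp add: V_def)
  qed
 qed
 ultimately have V: "asub M (carrier R) V" by (rule M.asub_generate_ring[OF _ gen])
 have "?I \<subseteq> V"
  unfolding ideal_smult_def submodule_span_def
 proof (rule Inter_lower, rule CollectI, rule conjI)
  show "submodule V R M" using V by (simp add: M.submodule_asub)
  show "{a \<odot>\<^sub>M x |a x. a \<in> irrelevant_ideal R \<and> x \<in> carrier M} \<subseteq> V"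
  proof
   fix v assume "v \<in> {a \<odot>\<^sub>M x |a x. a \<in> irrelevant_ideal R \<and> x \<in> carrier M}"
   then obtain a x where ax: "v = a \<odot>\<^sub>M x" "a \<in> irrelevant_ideal R" "x \<in> carrier M" by blast
   obtain F c where F: "finite F" "F \<subseteq> {1..}" "\<And>n. n \<in> F \<Longrightarrow> c n \<in> rdeg R n" "a = (\<Oplus>n\<in>F. c n)"
    using ax(2) unfolding irrelevant_ideal_def by blast
   have "(\<Oplus>n\<in>F. c n) \<odot>\<^sub>M x \<in> V"
    using F(1-3)
   proof (induction F rule: finite_induct)
    case empty then show ?case using ax(3) M.asubD(2)[OF V] by simp
   next
    case (insert k F)
    have cf: "c \<in> F \<rightarrow> carrier R" "c k \<in> carrier R" using insert.prems(2) rd.piece_carrier by blast+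
    obtain j where j: "k = Suc j" using insert.prems(1) by (cases k) auto
    have "c k \<odot>\<^sub>M x \<in> V" using high[of "c k" j x] insert.prems(2)[of k] ax(3) j by simp
    moreover have "(\<Oplus>n\<in>F. c n) \<odot>\<^sub>M x \<in> V" using insert by simp
    moreover have "(\<Oplus>n\<in>insert k F. c n) \<odot>\<^sub>M x = c k \<odot>\<^sub>M x \<oplus>\<^sub>M (\<Oplus>n\<in>F. c n) \<odot>\<^sub>M x"
     using insert.hyps cf ax(3) by (simp add: M.smult_l_distr)
    ultimately show ?case using M.asubD(3)[OF V] by simp
   qed
   then show "v \<in> V" using ax(1) F(4) by simp
  qed
 qed
 moreover have "mdeg M n \<subseteq> ?I"
 proof
  fix x assume x: "x \<in> mdeg M n"
  have xc: "x \<in> carrier M" by (rule M.md.piece_carrier[OF x])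
  let ?Q = "graded_quotient M ?I"
  have "mdeg ?Q n = {\<zero>\<^sub>?Q}"
  proof (rule ccontr)
   assume "mdeg ?Q n \<noteq> {\<zero>\<^sub>?Q}"
   then have "ereal (real_of_int n) \<le> max_generator_degree R M"
    unfolding max_generator_degree_def Let_def by (intro Sup_upper imageI) simp
   then have "ereal (real_of_int n) \<le> ereal (real_of_int t)" using d by (rule order_trans)
   then show False using n by simp
  qed
  moreover have "?I +>\<^bsub>M\<^esub> x \<in> mdeg ?Q n" using x by (simp add: graded_quotient_def)
  ultimately have "?I +>\<^bsub>M\<^esub> x = ?I" by (simp add: graded_quotient_def)
  moreover have "\<zero>\<^sub>M \<in> ?I"
   unfolding ideal_smult_def submodule_span_def using M.submoduleD(2) by blast
  then have "\<zero>\<^sub>M \<oplus>\<^sub>M x \<in> ?I +>\<^bsub>M\<^esub> x" by (auto simp: a_r_coset_def')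
  ultimately show "x \<in> ?I" using xc by simp
 qed
 moreover have "x \<in> combo M xs (mdeg M (n - 1))" if "x \<in> V" "x \<in> mdeg M n" for x
 proof -
  have "M.mcomp n x \<in> combo M xs (mdeg M (n - 1))" using that(1) by (simp add: V_def)
  then show ?thesis using M.md.comp_id[OF that(2)] by simp
 qed
 ultimately show ?thesis by blast
qed

section \<open>Numerical invariants and conclusion\<close>

lemma poly_eq_eventually:
 fixes p q :: "rat poly"
 assumes "\<And>n. n \<ge> n0 \<Longrightarrow> poly p (of_int n) = poly q (of_int n)"
 shows "p = q"
proof (rule ccontr)
 assume "p \<noteq> q"
 then have "finite {x. poly (p - q) x = 0}" by (intro poly_roots_finite) simp
 moreover have "rat_of_int ` {n0..} \<subseteq> {x. poly (p - q) x = 0}" using assms by auto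
 ultimately have "finite (rat_of_int ` {n0..})" by (rule finite_subset[rotated])
 then have "finite {n0..}" by (rule finite_imageD) (simp add: inj_on_def)
 then show False by (simp add: infinite_Ici)
qed

text \<open>The span of finitely many generators over the Artinian degree zero part has finite
  length, hence satisfies the chain condition, which survives adjoining the ring generators. It
  makes the homogeneous components finitely generated over degree zero, and so of finite
  length.\<close>

lemma finite_dimension_setup:
 fixes R :: "'a graded_ring" and M :: "('a, 'b) graded_module"
 assumes sg: "standard_graded R" and fg: "finitely_generated_algebra R" and art: "artinian_ring (degree_zero_ring R)"
  and M: "is_graded_module R M" and fM: "finitely_generated_module R M"
 shows "acc M (carrier R) (carrier M) \<and> len M (rdeg R 0) {\<zero>\<^sub>M} (mdeg M n) \<noteq> \<infinity>"
proof -
 have gr: "is_graded_ring R" using sg by (simp add: standard_graded_def)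
 interpret M: graded_module_loc R M by (rule graded_module_locI[OF gr M])
 have fl: "len M.Rmod (rdeg R 0) {\<zero>\<^sub>R} (rdeg R 0) \<noteq> \<infinity>" by (rule M.artinian_finite_length[OF art])
 obtain X where X: "X \<subseteq> carrier R" "finite X" "generate_ring R (rdeg R 0 \<union> X) = carrier R"
  using fg unfolding finitely_generated_algebra_def by blast
 obtain S where S: "S \<subseteq> carrier M" "finite S" "submodule_span R M S = carrier M"
  using fM unfolding finitely_generated_module_def by blast
 have span: "aspan M (carrier R) S = carrier M"
  using S(3) unfolding submodule_span_def aspan_def M.submodule_asub .
 have acc: "acc M (carrier R) (carrier M)"
  by (rule M.noetherian_module[OF M.R0_carrier X(2,1,3) S(1) span M.acc_if_finite_len[OF M.R0_carrier M.finite_length_span[OF fl S(2,1)]]])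
 obtain S' where S': "finite S'" "S' \<subseteq> mdeg M n" "aspan M (rdeg R 0) S' = mdeg M n" by (rule M.piece_finite_gen[OF acc])
 have "S' \<subseteq> carrier M" using S'(2) M.md.piece_carrier by blast
 from M.finite_length_span[OF fl S'(1) this] show ?thesis using acc S'(3) by simp
qed

text \<open>As a module over itself the ring is generated by 1, so the result for modules
  applies.\<close>

lemma ring_noetherian:
 fixes R :: "'a graded_ring"
 assumes sg: "standard_graded R" and fg: "finitely_generated_algebra R" and art: "artinian_ring (degree_zero_ring R)"
 shows "acc (shifted_ring R 0) (carrier R) (carrier R)"
proof -
 have gr: "is_graded_ring R" using sg by (simp add: standard_graded_def)
 interpret R: graded_ring_loc R by (rule graded_ring_locI[OF gr])
 interpret S: graded_module_loc R "shifted_ring R 0" by (rule graded_module_locI[OF gr R.shifted_ring_graded])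
 have "finitely_generated_module R (shifted_ring R 0)"
  unfolding finitely_generated_module_def
 proof (intro exI[of _ "{\<one>\<^sub>R}"] conjI)
  have "carrier R \<subseteq> H" if "submodule H R (shifted_ring R 0)" "\<one>\<^sub>R \<in> H" for H
  proof
   fix a assume a: "a \<in> carrier R"
   have "a \<odot>\<^bsub>shifted_ring R 0\<^esub> \<one>\<^sub>R \<in> H" by (rule S.submoduleD(6)[OF that(1) a that(2)])
   then show "a \<in> H" using a by simp
  qed
  moreover have "submodule (carrier R) R (shifted_ring R 0)"
   using S.carrier_asub[OF subset_refl] by (simp add: S.submodule_asub)
  ultimately show "submodule_span R (shifted_ring R 0) {\<one>\<^sub>R} = carrier (shifted_ring R 0)"
   unfolding submodule_span_def by auto
 qed simp_all
 from finite_dimension_setup[OF sg fg art R.shifted_ring_graded this] show ?thesis by simp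
qed

text \<open>Above \<open>t\<close> the support of \<open>tau\<close> is an initial segment of
  consecutive degrees, each contributing at least 1 to the sum, so it has at most as many degrees as
  the sum. This is the origin of the regularity bound.\<close>

lemma initial_segment_zero:
 fixes tau :: "int \<Rightarrow> nat"
 assumes step: "\<And>j. j > t \<Longrightarrow> tau j = 0 \<Longrightarrow> tau (j + 1) = 0" and N: "\<And>j. j > N \<Longrightarrow> tau j = 0"
  and n: "n > t + int (\<Sum>j\<in>{t<..N}. tau j)"
 shows "tau n = 0"
proof (rule ccontr)
 assume nz: "tau n \<noteq> 0"
 have nN: "n \<le> N" using N[of n] nz by (meson not_le_imp_less)
 \<comment> \<open>A zero at an earlier degree would propagate up to \<open>n\<close>.\<close>
 have pos: "tau i \<ge> 1" if i: "i \<in> {t<..n}" for i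
 proof (rule ccontr)
  assume "\<not> 1 \<le> tau i"
  then have i0: "tau i = 0" by simp
  have "tau j = 0" if "i \<le> j" for j
   using that
  proof (induction j rule: int_ge_induct)
   case base show ?case by (rule i0)
  next
   case (step j) then show ?case using assms(1)[of j] i by simp
  qed
  then show False using i nz by simp
 qed
 have "nat (n - t) = (\<Sum>j\<in>{t<..n}. 1)" by simp
 also have "\<dots> \<le> (\<Sum>j\<in>{t<..n}. tau j)" by (rule sum_mono[OF pos])
 also have "\<dots> \<le> (\<Sum>j\<in>{t<..N}. tau j)" by (rule sum_mono2) (use nN in auto)
 finally show False using n by linarith
qed

text \<open>Subtracting the partial sums of \<open>tau\<close> from \<open>hb\<close> leaves a
  function whose increments are values of \<open>lam\<close>, so it is polynomial from
  \<open>t\<close> on. At \<open>t\<close> it equals \<open>hb\<close>, and in high degrees it is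
  \<open>hM\<close> minus the total of \<open>tau\<close>; comparing the two gives the value of the
  Hilbert polynomial at \<open>t\<close>.\<close>

lemma hilbert_polynomial_value:
 fixes hb lam tau :: "int \<Rightarrow> nat" and hM :: "int \<Rightarrow> nat"
 assumes rel: "\<And>j. hb (j + 1) = hb j + tau (j + 1) + lam (j + 1)"
  and eul: "\<And>D. D > t \<Longrightarrow> euler r (\<lambda>n. rat_of_nat (lam n)) D = 0"
  and N: "N \<ge> t" "\<And>j. j > N \<Longrightarrow> tau j = 0" "\<And>j. j \<ge> N \<Longrightarrow> hM j = hb j"
 shows "poly (THE p. \<exists>n0. \<forall>n\<ge>n0. poly p (of_int n) = of_nat (hM n)) (rat_of_int t)
  = of_nat (hb t) + of_nat (\<Sum>j\<in>{t<..N}. tau j)"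
proof -
 define h where "h j = rat_of_nat (hb j) - rat_of_nat (\<Sum>i\<in>{t<..j}. tau i)" for j
 have dh: "h j - h (j + 1) = - rat_of_nat (lam (j + 1))" if "j \<ge> t" for j
 proof -
  have "{t<..j + 1} = insert (j + 1) {t<..j}" using that by auto
  then show ?thesis by (simp add: h_def rel)
 qed
 \<comment> \<open>Taking one difference moves the argument to D + 1, so D = t is covered although
   \<open>lam\<close> is controlled above \<open>t\<close> only.\<close>
 have "euler (Suc r) h D = 0" if D: "D \<ge> t" for D
 proof -
  have "euler (Suc r) h D = (\<Sum>l | length l = r. (- 1) ^ nat (ntrue l) * (h (D + ntrue l) - h (D + ntrue l + 1)))"
   unfolding euler_Suc by (simp add: euler_def)
  also have "\<dots> = (\<Sum>l | length l = r. - ((- 1) ^ nat (ntrue l) * rat_of_nat (lam (D + 1 + ntrue l))))"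
  proof (rule sum.cong[OF refl])
   fix l :: "bool list"
   have e: "D + ntrue l + 1 = D + 1 + ntrue l" by simp
   have "h (D + ntrue l) - h (D + ntrue l + 1) = - rat_of_nat (lam (D + ntrue l + 1))"
    by (rule dh) (use D ntrue_nonneg[of l] in simp)
   then show "(- 1) ^ nat (ntrue l) * (h (D + ntrue l) - h (D + ntrue l + 1)) = - ((- 1) ^ nat (ntrue l) * rat_of_nat (lam (D + 1 + ntrue l)))"
    unfolding e by simp
  qed
  also have "\<dots> = - euler r (\<lambda>n. rat_of_nat (lam n)) (D + 1)" by (simp add: euler_def sum_negf)
  finally show ?thesis using eul[of "D + 1"] D by simp
 qed
 then obtain p where p: "\<And>j. j \<ge> t \<Longrightarrow> h j = poly p (rat_of_int j)" using eventually_polynomial[of t "Suc r" h] by blast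
 let ?s = "rat_of_nat (\<Sum>j\<in>{t<..N}. tau j)"
 let ?p = "p + [:?s:]"
 have val: "poly ?p (of_int n) = of_nat (hM n)" if n: "n \<ge> N" for n
 proof -
  have "(\<Sum>i\<in>{t<..n}. tau i) = (\<Sum>j\<in>{t<..N}. tau j)"
   by (rule sum.mono_neutral_right) (use n N(2) in auto)
  then have "h n = of_nat (hM n) - ?s" using N(3)[OF n] by (simp add: h_def)
  moreover have "h n = poly p (of_int n)" using p n N(1) by simp
  ultimately show ?thesis by simp
 qed
 have "(THE p. \<exists>n0. \<forall>n\<ge>n0. poly p (of_int n) = of_nat (hM n)) = ?p"
 proof (rule the_equality)
  show "\<exists>n0. \<forall>n\<ge>n0. poly ?p (of_int n) = of_nat (hM n)" using val by blast
  fix q :: "rat poly" assume "\<exists>n0. \<forall>n\<ge>n0. poly q (of_int n) = of_nat (hM n)"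
  then obtain n0 where q: "\<And>n. n \<ge> n0 \<Longrightarrow> poly q (of_int n) = of_nat (hM n)" by blast
  show "q = ?p" by (rule poly_eq_eventually[of "max n0 N"]) (use q val in simp)
 qed
 moreover have "poly p (of_int t) = of_nat (hb t)" using p[of t] by (simp add: h_def)
 ultimately show ?thesis by simp
qed

theorem theorem3p7:
 fixes R :: "'a graded_ring" and M :: "('a, 'b) graded_module" and z :: 'a and t :: int
 assumes "standard_graded R"
  and "finitely_generated_algebra R"
  and "artinian_ring (degree_zero_ring R)"
  and "local_ring (degree_zero_ring R)"
  and "is_graded_module R M"
  and "finitely_generated_module R M"
  and "z \<in> rdeg R 1"
  and "filter_regular M z"
  and "max_generator_degree R M \<le> ereal (real_of_int t)"
  and "geometrically_regular R (graded_quotient M (element_smult M z)) t"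
 shows "\<exists>m :: int.
  (of_int m :: rat) = of_int t + poly (hilbert_polynomial R M) (of_int t)
   - of_nat (hilbert_function R (graded_quotient M (torsion_part R M)) t) \<and>
  geometrically_regular R M m"
proof -
 note z1 = \<open>z \<in> rdeg R 1\<close> and gM = \<open>is_graded_module R M\<close>
 have gr: "is_graded_ring R" and gen: "generate_ring R (rdeg R 0 \<union> rdeg R 1) = carrier R"
  using assms(1) by (simp_all add: standard_graded_def)
 have accR: "acc (shifted_ring R 0) (carrier R) (carrier R)" by (rule ring_noetherian[OF assms(1-3)])
 interpret R: graded_ring_loc R by (rule graded_ring_locI[OF gr])
 obtain xs where "lin_gens R xs" by (rule R.linear_generators[OF gen accR])
 then interpret lin_gens R xs .
 interpret M: graded_module_loc R M by (rule graded_module_locI[OF gr gM])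
 note Ml = M.graded_module_loc_axioms
 have zc: "z \<in> carrier R" by (rule R.rd.piece_carrier[OF z1])
 have acc: "acc M (carrier R) (carrier M)" and fin: "len M (rdeg R 0) {\<zero>\<^sub>M} (mdeg M n) \<noteq> \<infinity>" for n
  using finite_dimension_setup[OF assms(1-3,5,6)] by auto
 let ?H = "element_smult M z" and ?L = "torsion_part R M" and ?A = "rdeg R 0"
 let ?T = "M.sat ?H" and ?W = "M.msum ?H ?L"
 have H: "hsub R M ?H" and L: "hsub R M ?L" by (rule M.element_smult_hsub[OF z1], rule M.tors_hsub)
 have T: "hsub R M ?T" and W: "hsub R M ?W" by (rule M.sat_hsub[OF H], rule M.msum_hsub[OF H L])
 note LD = M.hsubD[OF L] and TD = M.hsubD[OF T] and HD = M.hsubD[OF H]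
 have HT: "?H \<subseteq> ?T" by (rule M.sat_incl[OF H])
 have LT: "?L \<subseteq> ?T" unfolding M.torsion_part_sat by (rule M.sat_mono) (use HD(2) in simp)
 have LW: "?L \<subseteq> ?W" 
 proof
  fix x assume x: "x \<in> ?L"
  have "\<zero>\<^sub>M \<oplus>\<^sub>M x \<in> ?W" by (rule M.msumI[OF HD(2) x])
  then show "x \<in> ?W" using LD(1)[OF x] by simp
 qed
 have WT: "?W \<subseteq> ?T"
 proof
  fix x assume "x \<in> ?W"
  then show "x \<in> ?T" using HT LT TD(3) by (elim M.msumE) blast
 qed
 have reg: "x \<in> ?L" if "x \<in> carrier M" "z \<odot>\<^sub>M x \<in> ?L" for x
  by (rule M.filter_regular_torsion[OF assms(8) z1 that])
 have zT: "z \<odot>\<^sub>M x \<in> ?T" if "x \<in> carrier M" for x using HT that by (auto simp: element_smult_def)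
 interpret q: quot R M ?H by (rule quotI[OF gr gM H])
 have kT: "koszul_regular R M xs ?T t"
  using geometrically_regular_iff[OF accR gM q.Q_graded q.cl_hom q.Q_carrier[symmetric] q.cl_zero_iff, of t] assms(10) by simp
 \<comment> \<open>In a homogeneous element of zM + L both summands may be replaced by their
   components, so the cofactor of \<open>z\<close> has degree n - 1.\<close>
 have Wpiece: "\<exists>y\<in>mdeg M (n - 1). x \<ominus>\<^sub>M z \<odot>\<^sub>M y \<in> ?L" if x: "x \<in> ?W" "x \<in> mdeg M n" for x n
 proof -
  obtain h e where he: "h \<in> ?H" "e \<in> ?L" "x = h \<oplus>\<^sub>M e" using M.msumE[OF x(1)] by blast
  obtain y where y: "y \<in> carrier M" "h = z \<odot>\<^sub>M y" using he(1) unfolding element_smult_def by blast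
  have ec: "e \<in> carrier M" by (rule LD(1)[OF he(2)])
  have yn: "M.mcomp (n - 1) y \<in> mdeg M (n - 1)" "M.mcomp (n - 1) y \<in> carrier M"
   using M.md.comp_in[OF y(1)] M.md.comp_closed[OF y(1)] .
  have "x = M.mcomp n (z \<odot>\<^sub>M y \<oplus>\<^sub>M e)" using M.md.comp_id[OF x(2)] he(3) y(2) by simp
  also have "\<dots> = z \<odot>\<^sub>M M.mcomp (n - 1) y \<oplus>\<^sub>M M.mcomp n e"
   using M.md.comp_add[of "z \<odot>\<^sub>M y" e n] zc y(1) ec M.comp_smult[of z 1 y n] R.rgr_of_nat[of 1] z1 by simp
  finally have "x = z \<odot>\<^sub>M M.mcomp (n - 1) y \<oplus>\<^sub>M M.mcomp n e" .
  then have "x \<ominus>\<^sub>M z \<odot>\<^sub>M M.mcomp (n - 1) y = M.mcomp n e"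
   using zc yn(2) M.md.comp_closed[OF ec, of n] by (simp add: M.M.minus_eq M.M.a_ac M.M.r_neg2 M.M.r_neg)
  then show ?thesis using yn(1) M.hsub_comp[OF L he(2), of n] by (intro bexI[of _ "M.mcomp (n - 1) y"]) simp_all
 qed
 have A: "?A \<subseteq> carrier R" by (rule R.R0_carrier)
 have a: "asub M ?A (mdeg M n \<inter> U)" if "hsub R M U" for U n
  by (rule M.asubI) (use M.asubD[OF M.piece_asub] M.hsubD[OF that] A in auto)
 have finU: "len M ?A (mdeg M n \<inter> U) Y \<noteq> \<infinity>" if "hsub R M U" "Y \<subseteq> mdeg M n" for U n Y
 proof -
  have "len M ?A (mdeg M n \<inter> U) Y \<le> len M ?A {\<zero>\<^sub>M} Y" by (rule M.len_anti) (use M.asubD(2)[OF a[OF that(1)]] in blast)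
  also have "\<dots> \<le> len M ?A {\<zero>\<^sub>M} (mdeg M n)" by (rule M.len_mono[OF that(2)])
  finally show ?thesis using fin[of n] enat_le_finite by blast
 qed
 \<comment> \<open>\<open>lam\<close>, \<open>tau\<close> and \<open>hb\<close> are the Hilbert
   functions of M/T, T/W and M/L. All these lengths are finite, so \<open>the_enat\<close> loses
   nothing.\<close>
 define lam where "lam n = the_enat (len M ?A (mdeg M n \<inter> ?T) (mdeg M n))" for n
 define tau where "tau n = the_enat (len M ?A (mdeg M n \<inter> ?W) (mdeg M n \<inter> ?T))" for n
 define hb where "hb n = the_enat (len M ?A (mdeg M n \<inter> ?L) (mdeg M n))" for n
 have en: "len M ?A (mdeg M n \<inter> ?T) (mdeg M n) = enat (lam n)" "len M ?A (mdeg M n \<inter> ?W) (mdeg M n \<inter> ?T) = enat (tau n)"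
  "len M ?A (mdeg M n \<inter> ?L) (mdeg M n) = enat (hb n)" for n
 proof -
  have e: "x = enat (the_enat x)" if "x \<noteq> \<infinity>" for x using that by (cases x) auto
  show "len M ?A (mdeg M n \<inter> ?T) (mdeg M n) = enat (lam n)" unfolding lam_def by (rule e[OF finU[OF T subset_refl]])
  show "len M ?A (mdeg M n \<inter> ?W) (mdeg M n \<inter> ?T) = enat (tau n)" unfolding tau_def by (rule e[OF finU[OF W Int_lower1]])
  show "len M ?A (mdeg M n \<inter> ?L) (mdeg M n) = enat (hb n)" unfolding hb_def by (rule e[OF finU[OF L subset_refl]])
 qed
 have sub: "mdeg M n \<inter> ?L \<subseteq> mdeg M n \<inter> ?W" "mdeg M n \<inter> ?W \<subseteq> mdeg M n \<inter> ?T" "mdeg M n \<inter> ?T \<subseteq> mdeg M n" "mdeg M n \<inter> ?W \<subseteq> mdeg M n" for n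
  using LW WT by auto
 \<comment> \<open>Multiplication by \<open>z\<close> is injective on M/L and identifies its
   component of degree n with that of W/L in degree n + 1.\<close>
 have shift: "len M ?A (mdeg M n \<inter> ?L) (mdeg M n) = len M ?A (mdeg M (n + 1) \<inter> ?L) (mdeg M (n + 1) \<inter> ?W)" for n
 proof (rule len_iso[where f="\<lambda>x. z \<odot>\<^sub>M x", OF M.module_axioms M.module_axioms A M.piece_asub a[OF L]])
  have c: "y \<in> carrier M" if "y \<in> mdeg M n" for y by (rule M.md.piece_carrier[OF that])
  have zd: "z \<odot>\<^sub>M y \<in> mdeg M (n + 1)" if "y \<in> mdeg M n" for y using M.smult_deg[OF z1 that] by (simp add: add.commute)
  show "z \<odot>\<^sub>M y \<in> carrier M" if "y \<in> mdeg M n" for y using zc c[OF that] by simp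
  show "z \<odot>\<^sub>M (y \<oplus>\<^sub>M w) = z \<odot>\<^sub>M y \<oplus>\<^sub>M z \<odot>\<^sub>M w" if "y \<in> mdeg M n" "w \<in> mdeg M n" for y w
   using zc c[OF that(1)] c[OF that(2)] by (simp add: M.smult_r_distr)
  show "z \<odot>\<^sub>M (b \<odot>\<^sub>M y) = b \<odot>\<^sub>M (z \<odot>\<^sub>M y)" if "b \<in> ?A" "y \<in> mdeg M n" for b y
   by (rule M.smult_swap[OF zc subsetD[OF A that(1)] c[OF that(2)]])
  show "mdeg M n \<inter> ?L = {y \<in> mdeg M n. z \<odot>\<^sub>M y \<in> mdeg M (n + 1) \<inter> ?L}"
  proof (intro subset_antisym subsetI)
   fix y assume "y \<in> mdeg M n \<inter> ?L"
   then show "y \<in> {y \<in> mdeg M n. z \<odot>\<^sub>M y \<in> mdeg M (n + 1) \<inter> ?L}" using zd[of y] LD(6)[OF zc, of y] by simp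
  next
   fix y assume "y \<in> {y \<in> mdeg M n. z \<odot>\<^sub>M y \<in> mdeg M (n + 1) \<inter> ?L}"
   then show "y \<in> mdeg M n \<inter> ?L" using reg[OF c, of y] by simp
  qed
  show "mdeg M (n + 1) \<inter> ?W = {z \<odot>\<^sub>M y \<oplus>\<^sub>M x |y x. y \<in> mdeg M n \<and> x \<in> mdeg M (n + 1) \<inter> ?L}"
  proof (intro subset_antisym subsetI)
   fix x assume "x \<in> mdeg M (n + 1) \<inter> ?W"
   then have xW: "x \<in> ?W" "x \<in> mdeg M (n + 1)" by simp_all
   from Wpiece[OF xW] obtain y where y: "y \<in> mdeg M n" "x \<ominus>\<^sub>M z \<odot>\<^sub>M y \<in> ?L" by auto
   have "x = z \<odot>\<^sub>M y \<oplus>\<^sub>M (x \<ominus>\<^sub>M z \<odot>\<^sub>M y)"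
    using M.md.piece_carrier[OF xW(2)] zc c[OF y(1)] by (simp add: M.M.minus_eq M.M.a_ac M.M.r_neg2 M.M.r_neg)
   moreover have "x \<ominus>\<^sub>M z \<odot>\<^sub>M y \<in> mdeg M (n + 1)" by (rule M.md.piece_minus[OF xW(2) zd[OF y(1)]])
   ultimately show "x \<in> {z \<odot>\<^sub>M y \<oplus>\<^sub>M x |y x. y \<in> mdeg M n \<and> x \<in> mdeg M (n + 1) \<inter> ?L}" using y by blast
  next
   fix x assume "x \<in> {z \<odot>\<^sub>M y \<oplus>\<^sub>M x |y x. y \<in> mdeg M n \<and> x \<in> mdeg M (n + 1) \<inter> ?L}"
   then obtain y e where ye: "x = z \<odot>\<^sub>M y \<oplus>\<^sub>M e" "y \<in> mdeg M n" "e \<in> mdeg M (n + 1)" "e \<in> ?L" by blast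
   have "z \<odot>\<^sub>M y \<in> ?H" using c[OF ye(2)] unfolding element_smult_def by blast
   then show "x \<in> mdeg M (n + 1) \<inter> ?W" unfolding ye(1)
    using M.msumI[OF _ ye(4)] M.md.piece_add[OF zd[OF ye(2)] ye(3)] by blast
  qed
 qed
 \<comment> \<open>Additivity of length along L \<subseteq> W \<subseteq> T \<subseteq> M in degree
   n + 1, with the first step measured by \<open>shift\<close>.\<close>
 have rel: "hb (n + 1) = hb n + tau (n + 1) + lam (n + 1)" for n
 proof -
  let ?n = "n + 1"
  have "enat (hb ?n) = len M ?A (mdeg M ?n \<inter> ?L) (mdeg M ?n \<inter> ?W) + len M ?A (mdeg M ?n \<inter> ?W) (mdeg M ?n)"
   unfolding en(3)[symmetric] by (rule M.len_add[OF A sub(1,4) a[OF L] a[OF W] M.piece_asub])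
  also have "len M ?A (mdeg M ?n \<inter> ?W) (mdeg M ?n) = enat (tau ?n) + enat (lam ?n)"
   unfolding en(1,2)[symmetric] by (rule M.len_add[OF A sub(2,3) a[OF W] a[OF T] M.piece_asub])
  also have "len M ?A (mdeg M ?n \<inter> ?L) (mdeg M ?n \<inter> ?W) = enat (hb n)" using shift[of n] en(3)[of n] by simp
  finally show ?thesis by simp
 qed
 have tau0: "tau n = 0 \<longleftrightarrow> mdeg M n \<inter> ?T \<subseteq> ?W" for n
 proof -
  have "tau n = 0 \<longleftrightarrow> mdeg M n \<inter> ?W = mdeg M n \<inter> ?T"
   using M.len_zero_iff[OF a[OF W] a[OF T] sub(2), of n] en(2)[of n] by (simp add: zero_enat_def)
  then show ?thesis using WT by blast
 qed
 have step: "tau (j + 1) = 0" if j: "j > t" "tau j = 0" for j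
 proof -
  have "mdeg M (j + 1) \<subseteq> combo M xs (mdeg M j)" using generated_below[OF Ml gen assms(9), of "j + 1"] j(1) by simp
  from koszul_regular_quotient_step[OF Ml T W WT kT j(1) this iffD1[OF tau0 j(2)]] show ?thesis by (rule iffD2[OF tau0])
 qed
 obtain n0 where n0: "\<And>n. n \<ge> n0 \<Longrightarrow> ?T \<inter> mdeg M n \<subseteq> ?H" using M.sat_bounded[OF acc H] by blast
 obtain n1 where n1: "\<And>n. n \<ge> n1 \<Longrightarrow> ?L \<inter> mdeg M n \<subseteq> {\<zero>\<^sub>M}"
  using M.sat_bounded[OF acc M.zero_hsub] unfolding M.torsion_part_sat by blast
 have HW: "?H \<subseteq> ?W"
 proof
  fix x assume x: "x \<in> ?H"
  have "x \<oplus>\<^sub>M \<zero>\<^sub>M \<in> ?W" by (rule M.msumI[OF x LD(2)])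
  then show "x \<in> ?W" using HD(1)[OF x] by simp
 qed
 \<comment> \<open>Beyond \<open>N\<close> the saturation of zM lies in zM, so \<open>tau\<close> is
   zero, and the torsion vanishes, so M and M/L have the same Hilbert function.\<close>
 define N where "N = max t (max n0 n1)"
 have N: "N \<ge> t" by (simp add: N_def)
 have N1: "tau j = 0" if "j > N" for j
  unfolding tau0 using n0[of j] HW that by (auto simp: N_def)
 have N2: "hilbert_function R M j = hb j" if "j \<ge> N" for j
 proof -
  have "mdeg M j \<inter> ?L = {\<zero>\<^sub>M}" using n1[of j] that M.asubD(2)[OF a[OF L], of j] by (auto simp: N_def)
  then show ?thesis by (simp add: M.hilbert_function_len hb_def)
 qed
 define s where "s = (\<Sum>j\<in>{t<..N}. tau j)"
 have "poly (hilbert_polynomial R M) (rat_of_int t) = of_nat (hb t) + of_nat s"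
  unfolding hilbert_polynomial_def s_def
  by (rule hilbert_polynomial_value[where tau=tau and lam=lam, OF rel koszul_euler[OF Ml T kT _ en(1)] N N1 N2])
 moreover have "hilbert_function R (graded_quotient M ?L) t = hb t"
 proof -
  interpret l: quot R M ?L by (rule quotI[OF gr gM L])
  interpret ql: graded_module_loc R "graded_quotient M ?L" by (rule graded_module_locI[OF gr l.Q_graded])
  show ?thesis unfolding ql.hilbert_function_len l.Q_len hb_def by (rule refl)
 qed
 \<comment> \<open>The witness is \<open>t + s\<close>; in particular the rational expression is an
   integer and at least \<open>t\<close>.\<close>
 ultimately have m: "of_int (t + int s) = of_int t + poly (hilbert_polynomial R M) (of_int t)
   - rat_of_nat (hilbert_function R (graded_quotient M ?L) t)" by simp
 \<comment> \<open>The coefficients of \<open>z\<close> in terms of the variables have degree zero,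
   so contraction with them preserves internal degrees.\<close>
 have "z \<in> combo (shifted_ring R 0) xs ?A" using gens[of 0] z1 by auto
 then obtain cs where cs: "set cs \<subseteq> ?A" "length cs = length xs" "dot R cs xs = z" using R.combo_dot[OF A xsc] by blast
 have "koszul_regular R M xs ?L (t + int s)"
 proof (rule koszul_regular_lift[OF Ml T L cs _ reg LT zT kT])
  fix n x assume x: "x \<in> ?T" "x \<in> mdeg M n" and n: "n > t + int s"
  have "tau n = 0" by (rule initial_segment_zero[where tau=tau and t=t and N=N, OF step N1]) (use n in \<open>simp_all add: s_def\<close>)
  then have "x \<in> ?W" using x unfolding tau0 by blast
  then show "\<exists>y\<in>mdeg M (n - 1). x \<ominus>\<^sub>M z \<odot>\<^sub>M y \<in> ?L" using x(2) by (rule Wpiece)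
 next
  have "0 \<le> int s" by (rule of_nat_0_le_iff)
  then show "t \<le> t + int s" by linarith
 qed
 moreover have "(\<lambda>x. x) \<in> graded_hom R M M" by (simp add: graded_hom_def hom_def)
 ultimately have "geometrically_regular R M (t + int s)"
  using geometrically_regular_iff[OF accR gM gM, of "\<lambda>x. x" "{\<zero>\<^sub>M}" "t + int s"] by (simp add: M.torsion_part_sat)
 with m show ?thesis by blast
qed

end
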